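(* Let $\ell\ge 2$ and $1\le m\le \ell$ be integers, let $g=Y_\ell^m$, and let $B_\varepsilon$ be the homogeneous body with radial boundary $r(u)=1+\varepsilon g(u)$, $u\in S^2$. For $m\ge 2$ and every $\varepsilon$ in the convex range, and for $m=1$ and all sufficiently small $\varepsilon>0$, the body $B_\varepsilon$ has exactly $$S=U=m(\ell-m+1)$$ stable and unstable equilibria (that is, exactly $m(\ell-m+1)$ stable ones and exactly $m(\ell-m+1)$ unstable ones). Its remaining critical points (the remaining critical points of the squared centroid-to-surface distance $\rho$) are exactly $2m(\ell-m)$ ordinary saddles together with, when $m\ge2$, the two poles, which are (unsplit) critical points of index $1-m$: ordinary saddles if $m=2$ and monkey saddles if $m\ge 3$. When $m=1$ the two poles are regular, non-critical points. The Poincaré–Hopf balance holds in the index form $$2m(\ell-m+1)-2m(\ell-m)+2(1-m)=2=\chi(S^2),$$ the three terms being the contributions of the extrema, the ordinary saddles and the poles respectively.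
   Context: Notation. $(\theta,\phi)$ are spherical coordinates on $S^2\subset\mathbb{R}^3$, with colatitude $\theta\in[0,\pi]$ and longitude $\phi$; the poles are $\theta=0$ and $\theta=\pi$. For $1\le m\le\ell$, the real spherical harmonic is $Y_\ell^m(\theta,\phi)=P_\ell^m(\cos\theta)\cos(m\phi)$, where $P_\ell^m(x)=(1-x^2)^{m/2}\,\frac{d^m}{dx^m}P_\ell(x)$ and $P_\ell$ is the Legendre polynomial of degree $\ell$. Body. For smooth $g:S^2\to\mathbb{R}$ and $\varepsilon$ with $r(u)=1+\varepsilon g(u)>0$ on $S^2$, $B_\varepsilon=\{t\,u: u\in S^2,\ 0\le t\le r(u)\}$, taken with uniform mass density. Its boundary point in direction $u$ is $x(u)=r(u)u$, and $\mathbf{c}=\mathbf{c}(\varepsilon)$ is its centroid. The convex range is the set of $\varepsilon>0$ such that $1+\varepsilon g>0$ on $S^2$ and $B_\varepsilon$ is convex. Equilibria. Let $\rho(u)=|x(u)-\mathbf{c}|^2$ for $u\in S^2$. The static equilibria of $B_\varepsilon$ are the critical points $u\in S^2$ of $\rho$; local minima of $\rho$ are stable equilibria, local maxima are unstable equilibria, and the other ones are of saddle type. $S$ and $U$ denote the numbers of stable and unstable equilibria. Critical points. The index of an isolated critical point is the Poincaré–Hopf index of the gradient vector field there. An ordinary saddle is a nondegenerate critical point of index $-1$. A monkey saddle (of order $m\ge3$) is a degenerate critical point at which, in a suitable local complex chart $z$ centred at the point, the function minus its value there equals a nonzero constant times $\mathrm{Re}(z^m)$ plus terms of order $O(|z|^{m+1})$.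 *)

theory Defs
  imports
    "HOL-Analysis.Analysis"
    "HOL-Computational_Algebra.Polynomial"
    "HOL-Complex_Analysis.Winding_Numbers"
    "HOL-Homology.Homology"
begin

abbreviation S2 :: "(real^3) set"
  where "S2 \<equiv> sphere 0 1"

definition north_pole :: "real^3"
  where "north_pole = axis 3 1"

definition south_pole :: "real^3"
  where "south_pole = - axis 3 1"

definition poles :: "(real^3) set"
  where "poles = {north_pole, south_pole}"


subsection \<open>Real spherical harmonics\<close>

text \<open>Rodrigues' formula.\<close>

definition legendre_poly :: "nat \<Rightarrow> real poly"
  where "legendre_poly l = Polynomial.smult (1 / (2 ^ l * fact l)) ((pderiv ^^ l) ([:-1, 0, 1:] ^ l))"

text \<open>For \<open>x \<in> [-1, 1]\<close> the first factor is \<open>(1 - x\<^sup>2)\<close> to the power \<open>m/2\<close>. No Condon--Shortley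
  sign, no normalisation.\<close>

definition assoc_legendre :: "nat \<Rightarrow> nat \<Rightarrow> real \<Rightarrow> real"
  where "assoc_legendre l m x = sqrt (1 - x\<^sup>2) ^ m * poly ((pderiv ^^ m) (legendre_poly l)) x"

definition sph_point :: "real \<Rightarrow> real \<Rightarrow> real^3"
  where "sph_point \<theta> \<phi> = vector [sin \<theta> * cos \<phi>, sin \<theta> * sin \<phi>, cos \<theta>]"

definition colatitude :: "real^3 \<Rightarrow> real"
  where "colatitude u = arccos (u $ 3)"

text \<open>The longitude in \<open>(-\<pi>, \<pi>]\<close>; it gets the arbitrary value 0 at the poles, where
  the functions below do not depend on it.\<close>

definition longitude :: "real^3 \<Rightarrow> real"
  where "longitude u = Arg (Complex (u $ 1) (u $ 2))"

definition real_harmonic :: "nat \<Rightarrow> nat \<Rightarrow> real^3 \<Rightarrow> real"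
  where "real_harmonic l m u =
    assoc_legendre l m (cos (colatitude u)) * cos (real m * longitude u)"

lemma real_harmonic_sph_point:
  assumes "1 \<le> m" "0 \<le> \<theta>" "\<theta> \<le> pi"
  shows "real_harmonic l m (sph_point \<theta> \<phi>) = assoc_legendre l m (cos \<theta>) * cos (real m * \<phi>)"
proof (cases "sin \<theta> = 0")
  case True
  then have "(cos \<theta>)\<^sup>2 = 1"
    using sin_cos_squared_add[of \<theta>] by simp
  moreover have "colatitude (sph_point \<theta> \<phi>) = \<theta>"
    using assms by (simp add: colatitude_def sph_point_def vector_3 arccos_cos)
  ultimately show ?thesis
    using assms by (simp add: real_harmonic_def assoc_legendre_def)
next
  case False
  then have pos: "sin \<theta> > 0"
    using assms sin_ge_zero[of \<theta>] by linarith
  define a where "a = longitude (sph_point \<theta> \<phi>)"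
  have col: "colatitude (sph_point \<theta> \<phi>) = \<theta>"
    using assms by (simp add: colatitude_def sph_point_def vector_3 arccos_cos)
  have z: "Complex (sin \<theta> * cos \<phi>) (sin \<theta> * sin \<phi>) = of_real (sin \<theta>) * cis \<phi>"
    by (simp add: complex_eq_iff)
  have "cis a = cis \<phi>"
    using pos cis_Arg[of "of_real (sin \<theta>) * cis \<phi>"]
    by (simp add: a_def longitude_def sph_point_def vector_3 z sgn_mult sgn_of_real sgn_eq norm_mult)
  then have "cis (real m * a) = cis (real m * \<phi>)"
    by (simp flip: Complex.DeMoivre)
  then have "cos (real m * a) = cos (real m * \<phi>)"
    by (simp add: complex_eq_iff)
  then show ?thesis
    by (simp add: real_harmonic_def col a_def)
qed


subsection \<open>Radial bodies\<close>

definition radial_body :: "(real^3 \<Rightarrow> real) \<Rightarrow> real \<Rightarrow> (real^3) set"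
  where "radial_body g \<epsilon> = {t *\<^sub>R u | t u. u \<in> S2 \<and> 0 \<le> t \<and> t \<le> 1 + \<epsilon> * g u}"

definition centroid :: "(real^3) set \<Rightarrow> real^3"
  where "centroid B = integral B (\<lambda>x. x) /\<^sub>R measure lebesgue B"

definition convex_range :: "(real^3 \<Rightarrow> real) \<Rightarrow> real set"
  where "convex_range g =
    {\<epsilon>. 0 < \<epsilon> \<and> (\<forall>u\<in>S2. 0 < 1 + \<epsilon> * g u) \<and> convex (radial_body g \<epsilon>)}"

definition centroid_dist2 :: "(real^3 \<Rightarrow> real) \<Rightarrow> real \<Rightarrow> real^3 \<Rightarrow> real"
  where "centroid_dist2 g \<epsilon> u =
    (norm ((1 + \<epsilon> * g u) *\<^sub>R u - centroid (radial_body g \<epsilon>)))\<^sup>2"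


subsection \<open>Critical points of functions on the sphere\<close>

text \<open>A function \<open>f\<close> on the sphere is extended to be constant along rays. At a point of the sphere
  the Euclidean gradient of the extension is tangential and is the Riemannian gradient of \<open>f\<close>.
  Only the values of \<open>f\<close> on the sphere matter.\<close>

definition sphere_grad :: "(real^3 \<Rightarrow> real) \<Rightarrow> real^3 \<Rightarrow> real^3"
  where "sphere_grad f u = (THE D. GDERIV (\<lambda>x. f (x /\<^sub>R norm x)) u :> D)"

definition critical_points :: "(real^3 \<Rightarrow> real) \<Rightarrow> (real^3) set"
  where "critical_points f = {u \<in> S2. GDERIV (\<lambda>x. f (x /\<^sub>R norm x)) u :> 0}"

definition stable_points :: "(real^3 \<Rightarrow> real) \<Rightarrow> (real^3) set"
  where "stable_points f = {u \<in> critical_points f. \<forall>\<^sub>F v in at u within S2. f u \<le> f v}"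

definition unstable_points :: "(real^3 \<Rightarrow> real) \<Rightarrow> (real^3) set"
  where "unstable_points f = {u \<in> critical_points f. \<forall>\<^sub>F v in at u within S2. f v \<le> f u}"

definition saddle_type_points :: "(real^3 \<Rightarrow> real) \<Rightarrow> (real^3) set"
  where "saddle_type_points f = critical_points f - (stable_points f \<union> unstable_points f)"

text \<open>The Hessian at a critical point is the derivative of the gradient field along the sphere; it is
  determined by the derivative below on the tangent plane \<open>{v. v \<bullet> p = 0}\<close> only, so only its
  values on tangent vectors are used.\<close>

definition nondegenerate_critical :: "(real^3 \<Rightarrow> real) \<Rightarrow> real^3 \<Rightarrow> bool"
  where "nondegenerate_critical f p \<longleftrightarrow> p \<in> critical_points f \<and>
    (\<exists>H. (sphere_grad f has_derivative H) (at p within S2) \<and>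
      (\<forall>v. v \<bullet> p = 0 \<and> v \<noteq> 0 \<longrightarrow> H v \<noteq> 0))"

definition degenerate_critical :: "(real^3 \<Rightarrow> real) \<Rightarrow> real^3 \<Rightarrow> bool"
  where "degenerate_critical f p \<longleftrightarrow> p \<in> critical_points f \<and>
    (\<exists>H. (sphere_grad f has_derivative H) (at p within S2) \<and>
      (\<exists>v. v \<bullet> p = 0 \<and> v \<noteq> 0 \<and> H v = 0))"

text \<open>The Poincare--Hopf index at \<open>p\<close> of a tangent field \<open>V\<close> with no zeros near \<open>p\<close> except possibly
  at \<open>p\<close>. In the chart of the sphere given by orthogonal projection to the tangent plane with
  orthonormal basis \<open>e1, e2\<close>, the field has components \<open>V \<bullet> e1\<close> and \<open>V \<bullet> e2\<close>; the index is its
  winding number along small coordinate circles. Reversing the orientation of the basis reverses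
  both the circle and the target plane, so both orientations give the same number.\<close>

definition tangent_circle :: "real^3 \<Rightarrow> real^3 \<Rightarrow> real^3 \<Rightarrow> real \<Rightarrow> real \<Rightarrow> real^3"
  where "tangent_circle p e1 e2 r t =
    sqrt (1 - r\<^sup>2) *\<^sub>R p + (r * cos (2 * pi * t)) *\<^sub>R e1 + (r * sin (2 * pi * t)) *\<^sub>R e2"

definition has_ph_index :: "(real^3 \<Rightarrow> real^3) \<Rightarrow> real^3 \<Rightarrow> int \<Rightarrow> bool"
  where "has_ph_index V p k \<longleftrightarrow> p \<in> S2 \<and> (\<forall>\<^sub>F u in at p within S2. V u \<noteq> 0) \<and>
    (\<forall>e1 e2. norm e1 = 1 \<and> norm e2 = 1 \<and> e1 \<bullet> e2 = 0 \<and> e1 \<bullet> p = 0 \<and> e2 \<bullet> p = 0 \<longrightarrow>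
      (\<forall>\<^sub>F r in at_right 0.
        winding_number
          (\<lambda>t. Complex (V (tangent_circle p e1 e2 r t) \<bullet> e1) (V (tangent_circle p e1 e2 r t) \<bullet> e2)) 0
        = of_int k))"

definition ph_index :: "(real^3 \<Rightarrow> real^3) \<Rightarrow> real^3 \<Rightarrow> int"
  where "ph_index V p = (THE k. has_ph_index V p k)"

definition ordinary_saddle :: "(real^3 \<Rightarrow> real) \<Rightarrow> real^3 \<Rightarrow> bool"
  where "ordinary_saddle f p \<longleftrightarrow>
    nondegenerate_critical f p \<and> has_ph_index (sphere_grad f) p (- 1)"

text \<open>On an open subset \<open>W\<close> of a finite-dimensional space, \<open>Ck_on k W f\<close> says that \<open>f\<close> is
  \<open>k\<close> times continuously differentiable on \<open>W\<close>.\<close>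

primrec Ck_on :: "nat \<Rightarrow> 'a::real_normed_vector set \<Rightarrow> ('a \<Rightarrow> 'b::real_normed_vector) \<Rightarrow> bool"
  where
    "Ck_on 0 W f \<longleftrightarrow> continuous_on W f"
  | "Ck_on (Suc k) W f \<longleftrightarrow> (\<forall>x\<in>W. f differentiable (at x)) \<and>
      (\<forall>v. Ck_on k W (\<lambda>x. frechet_derivative f (at x) v))"

definition smooth_on :: "'a::real_normed_vector set \<Rightarrow> ('a \<Rightarrow> 'b::real_normed_vector) \<Rightarrow> bool"
  where "smooth_on W f \<longleftrightarrow> (\<forall>k. Ck_on k W f)"

text \<open>A smooth complex-valued chart: a diffeomorphism from a relatively open subset \<open>V\<close> of the
  sphere to an open subset of the plane. A map on \<open>V\<close> is smooth when it extends smoothly to an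
  open set of the ambient space.\<close>

definition complex_chart :: "(real^3) set \<Rightarrow> (real^3 \<Rightarrow> complex) \<Rightarrow> bool"
  where "complex_chart V \<psi> \<longleftrightarrow> openin (top_of_set S2) V \<and>
    (\<exists>N. open N \<and> V \<subseteq> N \<and> smooth_on N \<psi>) \<and>
    (\<exists>W \<sigma>. open W \<and> homeomorphism V W \<psi> \<sigma> \<and> smooth_on W \<sigma>)"

definition monkey_saddle :: "nat \<Rightarrow> (real^3 \<Rightarrow> real) \<Rightarrow> real^3 \<Rightarrow> bool"
  where "monkey_saddle m f p \<longleftrightarrow> 3 \<le> m \<and> degenerate_critical f p \<and>
    (\<exists>V \<psi> a. complex_chart V \<psi> \<and> p \<in> V \<and> \<psi> p = 0 \<and> a \<noteq> 0 \<and>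
      (\<lambda>u. f u - f p - a * Re (\<psi> u ^ m)) \<in> O[at p within S2](\<lambda>u. norm (\<psi> u) ^ (m + 1)))"


subsection \<open>Euler characteristic\<close>

text \<open>The rank of an abelian group of finite rank (the supremum is junk otherwise): the largest size
  of a finite set that is linearly independent over the integers. Groups are multiplicative.\<close>

definition abelian_rank :: "('a, 'b) monoid_scheme \<Rightarrow> nat"
  where "abelian_rank G = Sup {card B | B. finite B \<and> B \<subseteq> carrier G \<and>
    (\<forall>c :: 'a \<Rightarrow> int. finprod G (\<lambda>b. b [^]\<^bsub>G\<^esub> c b) B = \<one>\<^bsub>G\<^esub> \<longrightarrow> (\<forall>b\<in>B. c b = 0))}"

definition betti :: "nat \<Rightarrow> 'a topology \<Rightarrow> nat"
  where "betti k X = abelian_rank (homology_group (int k) X)"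

definition euler_characteristic :: "'a topology \<Rightarrow> int"
  where "euler_characteristic X = (\<Sum>k | betti k X \<noteq> 0. (- 1) ^ k * int (betti k X))"

end

theory Submission
  imports Defs
begin

text \<open>
  Write \<open>w = u\<^sub>1 + \<i> u\<^sub>2\<close> and \<open>z = u\<^sub>3\<close>. On the sphere the harmonic is \<open>s q(z)\<close> with
  \<open>s = Re (w^m)\<close> and \<open>q\<close> the \<open>m\<close>-th derivative of the Legendre polynomial
  (\<open>real_harmonic_eq\<close>). For \<open>m \<ge> 2\<close> the symmetries of the body put its centroid at the origin
  (\<open>centroid_symmetry\<close>), so \<open>\<rho> = (1 + \<epsilon> s q)\<^sup>2\<close>. For \<open>m = 1\<close> they only put it on the first axis,
  at a position \<open>c\<close>, and completing the square gives
  \<open>\<rho> = (1 + \<epsilon> s (q - c/\<epsilon>))\<^sup>2 - c\<^sup>2 s\<^sup>2 + c\<^sup>2\<close>. Both cases have the form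
  \<open>(1 + \<epsilon> s q)\<^sup>2 - \<kappa> s\<^sup>2 + C\<close>, a function of \<open>s\<close> and \<open>z\<close> alone, whose critical points can be listed.

  Let \<open>\<kappa> = 0\<close>. Away from the poles there are two kinds of critical points. On the \<open>2m\<close> nodal
  meridians, where \<open>s = 0\<close>, they sit at the zeros of \<open>q\<close>; there are \<open>2m (l - m)\<close> of them, and since
  \<open>s q\<close> vanishes to first order in two independent directions they are saddles. On the \<open>2m\<close>
  meridians where \<open>w^m\<close> is real they sit at the zeros of \<open>N = (1 - z\<^sup>2) q' - m z q\<close>, which is
  \<open>(1 - z\<^sup>2) (1 - z\<^sup>2)^(-m/2)\<close> times the derivative of \<open>(1 - z\<^sup>2)^(m/2) q\<close>. All \<open>l - m\<close> roots of \<open>q\<close>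
  are real and lie in \<open>(-1, 1)\<close>, so Rolle's theorem and the degree give exactly \<open>l - m + 1\<close> zeros of
  \<open>N\<close>; Laguerre's inequality \<open>q q'' \<le> q'\<^sup>2\<close> gives \<open>N' q < 0\<close> there (\<open>crit_poly_roots\<close>). In the frame
  of the meridian and the parallel the Hessian is diagonal, and \<open>N' q < 0\<close> says exactly that both
  entries have the same sign. The sign changes with that of \<open>w^m\<close>, so \<open>m\<close> of the \<open>2m\<close> points at each
  height are minima and \<open>m\<close> are maxima (\<open>extremum_point\<close>, \<open>saddle_point\<close>,
  \<open>critical_nonpole_classified\<close>). At the poles \<open>q \<noteq> 0\<close>, so \<open>\<rho>\<close> is a constant plus a nonzero multiple
  of \<open>Re (w^m)\<close> to leading order: a saddle of index \<open>1 - m\<close> if \<open>m \<ge> 2\<close>, a regular point if \<open>m = 1\<close>.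

  For \<open>m = 1\<close> the centroid moves. The harmonic has degree at least 2, so it is orthogonal to the
  linear functions and \<open>c = O(\<epsilon>\<^sup>2)\<close> (\<open>first_moment_of_harmonic\<close>,
  \<open>centroid_shift_second_order\<close>). Hence \<open>c/\<epsilon>\<close> and \<open>\<kappa>/\<epsilon> = c\<^sup>2/\<epsilon>\<close> tend to 0 with \<open>\<epsilon>\<close>, and because all
  roots of \<open>q\<close> and \<open>N\<close> are simple, their number and the signs of the slopes persist for small \<open>\<epsilon>\<close>
  (\<open>simple_roots_stable\<close>). The locale \<open>zonal_body_roots\<close> collects what is common to both cases.

  Indices are winding numbers, found by comparing the gradient along a small circle with the
  leading power of the coordinate (\<open>has_ph_index_near_power\<close>). The Euler characteristic comes from
  the singular homology of the sphere.
\<close>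

section \<open>Roots of derivatives of Legendre polynomials\<close>

lemma poly_rolle_finite:
  fixes p :: "real poly"
  assumes "finite Z" "card Z = Suc n" "\<And>x. x \<in> Z \<Longrightarrow> poly p x = 0"
  shows "\<exists>Z'. finite Z' \<and> card Z' = n \<and> Z' \<subseteq> {Min Z<..<Max Z} \<and> Z' \<inter> Z = {} \<and>
    (\<forall>x\<in>Z'. poly (pderiv p) x = 0)"
  using assms
proof (induction n arbitrary: Z)
  case 0
  show ?case by (rule exI[of _ "{}"]) auto
next
  case (Suc n)
  have ne: "Z \<noteq> {}" using Suc.prems by auto
  define M where "M = Max Z"
  have M: "M \<in> Z" using ne Suc.prems M_def by simp
  define Y where "Y = Z - {M}"
  have Y: "finite Y" "card Y = Suc n"
    using Suc.prems M unfolding Y_def by (auto simp: card_Diff_singleton)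
  then have "Y \<noteq> {}" by auto
  note Y = Y this
  have Ysub: "Y \<subseteq> Z" by (auto simp: Y_def)
  define K where "K = Max Y"
  have K: "K \<in> Y" using Y K_def by simp
  have "K \<le> M" using K Ysub Suc.prems M_def by auto
  moreover have "K \<noteq> M" using K Y_def by auto
  ultimately have KM: "K < M" by simp
  obtain Y' where Y': "finite Y'" "card Y' = n" "Y' \<subseteq> {Min Y<..<Max Y}" "Y' \<inter> Y = {}"
    "\<forall>x\<in>Y'. poly (pderiv p) x = 0"
    using Suc.IH[OF Y(1,2)] Suc.prems(3) Ysub by blast
  obtain t where t: "K < t" "t < M" "poly p M - poly p K = (M - K) * poly (pderiv p) t"
    using poly_MVT[OF KM] by blast
  have "poly p M = 0" "poly p K = 0" using Suc.prems(3) M K Ysub by auto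
  with t KM have t0: "poly (pderiv p) t = 0" by simp
  have tY: "t \<notin> Y" using t(1) K_def Y by (metis Max_ge leD)
  have tY': "t \<notin> Y'" using Y'(3) t(1) K_def by auto
  have MY': "M \<notin> Y'" using Y'(3) KM K_def by auto
  have min: "Min Z \<le> Min Y" using Ysub Y Suc.prems by (intro Min_antimono)
  have mint: "Min Z < t"
  proof -
    have "Min Z \<le> K" using K Ysub Suc.prems by auto
    then show ?thesis using t by simp
  qed
  show ?case
  proof (rule exI[of _ "insert t Y'"], intro conjI)
    show "finite (insert t Y')" using Y' by simp
    show "card (insert t Y') = Suc n" using Y' tY' by simp
    show "insert t Y' \<subseteq> {Min Z<..<Max Z}"
      using Y'(3) min mint t KM unfolding M_def K_def by force
    show "insert t Y' \<inter> Z = {}" using tY Y'(4) MY' t unfolding Y_def by auto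
    show "\<forall>x\<in>insert t Y'. poly (pderiv p) x = 0" using Y' t0 by auto
  qed
qed

lemma power_dvd_pderiv:
  fixes f p :: "real poly"
  assumes "p ^ Suc n dvd f"
  shows "p ^ n dvd pderiv f"
proof -
  obtain g where g: "f = p ^ Suc n * g" using assms by (auto simp: dvd_def)
  have "pderiv f = p ^ n * (p * pderiv g + Polynomial.smult (of_nat (Suc n)) (pderiv p) * g)"
    unfolding g pderiv_mult pderiv_power_Suc
    by (simp add: algebra_simps)
  then show ?thesis by (simp add: dvd_def)
qed

lemma power_dvd_pderiv_iter:
  fixes f p :: "real poly"
  assumes "p ^ (n + k) dvd f"
  shows "p ^ n dvd (pderiv ^^ k) f"
  using assms
proof (induction k arbitrary: n)
  case 0 then show ?case by simp
next
  case (Suc k)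
  have "p ^ Suc n dvd (pderiv ^^ k) f" using Suc.IH[of "Suc n"] Suc.prems by simp
  then show ?case by (simp add: power_dvd_pderiv del: power_Suc)
qed

lemma pderiv_iter_smult: "(pderiv ^^ k) (Polynomial.smult (c::real) p) = Polynomial.smult c ((pderiv ^^ k) p)"
  by (induction k) (auto simp: pderiv_smult)

lemma degree_pderiv_iter: "degree ((pderiv ^^ k) (p::real poly)) = degree p - k"
  by (induction k) (auto simp: degree_pderiv)

text \<open>The polynomial \<open>(x\<^sup>2 - 1)^l\<close> has roots of order \<open>l\<close> at \<open>\<plusminus>1\<close>. Up to the \<open>l\<close>-th derivative the
  endpoints stay roots, and Rolle's theorem adds one interior root per differentiation.\<close>

lemma rodrigues_roots:
  assumes "k \<le> l"
  shows "\<exists>Z. finite Z \<and> card Z = k \<and> Z \<subseteq> {-1<..<1::real} \<and>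
    (\<forall>x\<in>Z. poly ((pderiv ^^ k) ([:-1, 0, 1:] ^ l)) x = 0)"
  using assms
proof (induction k)
  case 0
  show ?case by (rule exI[of _ "{}"]) auto
next
  case (Suc k)
  let ?f = "[:-1, 0, 1:] ^ l :: real poly"
  obtain Z where Z: "finite Z" "card Z = k" "Z \<subseteq> {-1<..<1::real}"
    "\<forall>x\<in>Z. poly ((pderiv ^^ k) ?f) x = 0" using Suc by auto
  have "[:-1,0,1:] ^ (1 + k) dvd ?f" using Suc.prems by (intro le_imp_power_dvd) simp
  then have dv: "[:-1,0,1:] ^ 1 dvd (pderiv ^^ k) ?f" by (rule power_dvd_pderiv_iter)
  then obtain h where h: "(pderiv ^^ k) ?f = [:-1,0,1:] * h" by (auto simp: dvd_def)
  have e: "poly ((pderiv ^^ k) ?f) 1 = 0" "poly ((pderiv ^^ k) ?f) (-1) = 0"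
    unfolding h by simp_all
  let ?Y = "insert 1 (insert (-1) Z)"
  have "1 \<notin> Z" "-1 \<notin> Z" using Z(3) by auto
  then have Y: "finite ?Y" "card ?Y = Suc (Suc k)" using Z by auto
  have mm: "Min ?Y = -1" "Max ?Y = 1"
    using Z by (intro Min_eqI Max_eqI; force)+
  show ?case using poly_rolle_finite[OF Y, of "(pderiv ^^ k) ?f"] e Z mm by auto
qed

text \<open>From the \<open>l\<close>-th derivative on the endpoints are no longer roots, so that each further
  differentiation loses one root.\<close>

lemma rodrigues_deriv_roots:
  assumes "k \<le> l"
  shows "\<exists>Z. finite Z \<and> card Z = l - k \<and> Z \<subseteq> {-1<..<1::real} \<and>
    (\<forall>x\<in>Z. poly ((pderiv ^^ (k + l)) ([:-1, 0, 1:] ^ l)) x = 0)"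
  using assms
proof (induction k)
  case 0
  show ?case using rodrigues_roots[of l l] by simp
next
  case (Suc k)
  then obtain Z where Z: "finite Z" "card Z = Suc (l - Suc k)" "Z \<subseteq> {-1<..<1::real}"
    "\<forall>x\<in>Z. poly ((pderiv ^^ (k + l)) ([:-1, 0, 1:] ^ l)) x = 0"
    by (metis Suc_diff_le Suc_leD diff_Suc_Suc)
  have "Z \<noteq> {}" using Z by auto
  then have mm: "Min Z \<in> Z" "Max Z \<in> Z" using Z by simp_all
  then have "{Min Z<..<Max Z} \<subseteq> {-1<..<1}" using Z(3) by force
  with poly_rolle_finite[OF Z(1,2), of "(pderiv ^^ (k + l)) ([:-1, 0, 1:] ^ l)"] Z(4)
  show ?case by (auto; blast)
qed

lemma poly_eq_prod_roots:
  fixes p :: "real poly"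
  assumes "finite Z" "card Z = degree p" "\<And>x. x \<in> Z \<Longrightarrow> poly p x = 0"
  shows "p = Polynomial.smult (lead_coeff p) (\<Prod>r\<in>Z. [:-r, 1:])"
  using assms
proof (induction Z arbitrary: p rule: finite_induct)
  case empty
  then show ?case by (auto elim!: degree_eq_zeroE)
next
  case (insert r Z)
  obtain g where g: "p = [:-r, 1:] * g"
    using insert.prems(2)[of r] by (auto simp: poly_eq_0_iff_dvd dvd_def)
  have p0: "p \<noteq> 0" using insert by auto
  then have g0: "g \<noteq> 0" using g by auto
  have dg: "card Z = degree g" using insert g g0 by (simp add: degree_mult_eq del: mult_pCons_left)
  have "poly g x = 0" if "x \<in> Z" for x
    using insert.prems(2)[of x] that insert.hyps unfolding g by (auto simp del: mult_pCons_left)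
  then have "g = Polynomial.smult (lead_coeff g) (\<Prod>r\<in>Z. [:-r, 1:])"
    using insert.IH dg by blast
  moreover have "lead_coeff p = lead_coeff g" unfolding g by (simp add: lead_coeff_mult del: mult_pCons_left)
  ultimately have "p = [:-r, 1:] * Polynomial.smult (lead_coeff p) (\<Prod>r\<in>Z. [:-r, 1:])"
    using g by metis
  then show ?case using insert.hyps by (simp del: mult_pCons_left)
qed

text \<open>With \<open>p = (x - r) p\<^sub>0\<close> one has \<open>p'\<^sup>2 - p p'' = p\<^sub>0\<^sup>2 + (x - r)\<^sup>2 (p\<^sub>0'\<^sup>2 - p\<^sub>0 p\<^sub>0'')\<close>, so the inequality
  follows by adding one root at a time.\<close>

lemma laguerre_inequality_prod:
  assumes "finite Z"
  shows "poly (\<Prod>r\<in>Z. [:-r, 1:]) x * poly (pderiv (pderiv (\<Prod>r\<in>Z. [:-r, 1:]))) x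
    \<le> (poly (pderiv (\<Prod>r\<in>Z. [:-r, 1::real:])) x)\<^sup>2"
  using assms
proof (induction Z rule: finite_induct)
  case empty
  then show ?case by (simp add: pderiv_1)
next
  case (insert a Z)
  let ?g = "\<Prod>r\<in>Z. [:-r, 1::real:]"
  have d1: "pderiv ([:-a,1:] * ?g) = ?g + [:-a,1:] * pderiv ?g"
    by (simp add: pderiv_mult pderiv_pCons del: mult_pCons_left)
  have d2: "pderiv (pderiv ([:-a,1:] * ?g)) = 2 * pderiv ?g + [:-a,1:] * pderiv (pderiv ?g)"
    unfolding d1 by (simp add: pderiv_mult pderiv_add pderiv_pCons del: mult_pCons_left)
  have "(poly (pderiv ([:-a,1:] * ?g)) x)\<^sup>2 - poly ([:-a,1:] * ?g) x * poly (pderiv (pderiv ([:-a,1:] * ?g))) x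
    = (poly ?g x)\<^sup>2 + (x - a)\<^sup>2 * ((poly (pderiv ?g) x)\<^sup>2 - poly ?g x * poly (pderiv (pderiv ?g)) x)"
  proof -
    have e: "(u + (x - a) * v)\<^sup>2 - (x - a) * u * (2 * v + (x - a) * w) = u\<^sup>2 + (x - a)\<^sup>2 * (v\<^sup>2 - u * w)"
      for u v w :: real by (simp add: power2_eq_square algebra_simps)
    show ?thesis
      unfolding d2 unfolding d1 poly_mult poly_add
      using e[of "poly ?g x" "poly (pderiv ?g) x" "poly (pderiv (pderiv ?g)) x"] by simp
  qed
  moreover have "0 \<le> (poly ?g x)\<^sup>2 + (x - a)\<^sup>2 * ((poly (pderiv ?g) x)\<^sup>2 - poly ?g x * poly (pderiv (pderiv ?g)) x)"
    using insert.IH by (intro add_nonneg_nonneg mult_nonneg_nonneg) auto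
  ultimately have "0 \<le> (poly (pderiv ([:-a,1:] * ?g)) x)\<^sup>2 - poly ([:-a,1:] * ?g) x * poly (pderiv (pderiv ([:-a,1:] * ?g))) x"
    by linarith
  then show ?case unfolding prod.insert[OF insert.hyps] by linarith
qed

lemma laguerre_inequality:
  fixes p :: "real poly"
  assumes "finite Z" "card Z = degree p" "\<And>x. x \<in> Z \<Longrightarrow> poly p x = 0"
  shows "poly p x * poly (pderiv (pderiv p)) x \<le> (poly (pderiv p) x)\<^sup>2"
proof -
  let ?g = "\<Prod>r\<in>Z. [:-r, 1::real:]"
  define c where "c = lead_coeff p"
  have p: "p = Polynomial.smult c ?g" unfolding c_def by (rule poly_eq_prod_roots[OF assms])
  have "c\<^sup>2 * (poly ?g x * poly (pderiv (pderiv ?g)) x) \<le> c\<^sup>2 * (poly (pderiv ?g) x)\<^sup>2"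
    by (rule mult_left_mono[OF laguerre_inequality_prod[OF assms(1)]]) simp
  then show ?thesis unfolding p by (simp add: pderiv_smult power2_eq_square algebra_simps)
qed

lemma simple_root_if_card_roots_eq_degree:
  fixes p :: "real poly"
  assumes "finite Z" "card Z = degree p" "\<And>x. x \<in> Z \<Longrightarrow> poly p x = 0" "a \<in> Z" "p \<noteq> 0"
  shows "poly (pderiv p) a \<noteq> 0"
proof -
  obtain g where g: "p = [:-a, 1:] * g"
    using assms(3)[OF assms(4)] by (auto simp: poly_eq_0_iff_dvd dvd_def)
  have g0: "g \<noteq> 0" using g assms by auto
  have dg: "degree p = Suc (degree g)" using g g0 by (simp add: degree_mult_eq del: mult_pCons_left)
  have "poly g a \<noteq> 0"
  proof
    assume "poly g a = 0"
    then have "\<forall>x\<in>Z. poly g x = 0"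
    proof (intro ballI)
      fix x assume "x \<in> Z"
      then have "(x - a) * poly g x = 0" using assms(3)[of x] unfolding g by (simp add: algebra_simps)
      then show "poly g x = 0" using \<open>poly g a = 0\<close> by auto
    qed
    then have "Z \<subseteq> {x. poly g x = 0}" by auto
    then have "card Z \<le> degree g"
      using card_mono[OF poly_roots_finite[OF g0]] card_poly_roots_bound[OF g0] by (meson le_trans)
    then show False using dg assms by simp
  qed
  then show ?thesis unfolding g by (simp add: pderiv_mult pderiv_pCons del: mult_pCons_left)
qed

text \<open>On the meridians where \<open>w^m\<close> is real the harmonic is \<open>\<plusminus>(1 - z\<^sup>2)^(m/2) q(z)\<close>; this polynomial is
  its derivative, multiplied by the power \<open>(1 - z\<^sup>2)^(1 - m/2)\<close> that makes it polynomial.\<close>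

definition crit_poly :: "nat \<Rightarrow> real poly \<Rightarrow> real poly"
  where "crit_poly m q = [:1, 0, -1:] * pderiv q - Polynomial.smult (real m) ([:0, 1:] * q)"

lemma poly_crit_poly: "poly (crit_poly m q) z = (1 - z\<^sup>2) * poly (pderiv q) z - real m * z * poly q z"
  by (simp add: crit_poly_def power2_eq_square algebra_simps)

lemma poly_pderiv_crit_poly:
  "poly (pderiv (crit_poly m q)) z =
    (1 - z\<^sup>2) * poly (pderiv (pderiv q)) z - (real m + 2) * z * poly (pderiv q) z - real m * poly q z"
  unfolding crit_poly_def pderiv_diff pderiv_mult pderiv_smult
  by (simp add: pderiv_pCons power2_eq_square algebra_simps)

text \<open>Rolle's theorem applies to \<open>(1 - z\<^sup>2)^m q\<^sup>2\<close>, which vanishes at \<open>\<plusminus>1\<close> and at the roots of \<open>q\<close>, and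
  gives enough zeros; the degree forbids more. The sign is Laguerre's inequality, after \<open>q'\<close> has
  been eliminated with the equation \<open>(1 - z\<^sup>2) q' = m z q\<close> that holds at such a zero.\<close>

lemma crit_poly_roots:
  fixes q :: "real poly"
  assumes m: "1 \<le> m" and Z: "finite Z" "card Z = degree q" "\<And>x. x \<in> Z \<Longrightarrow> poly q x = 0"
    and Zi: "Z \<subseteq> {-1<..<1}" and q0: "q \<noteq> 0"
  shows "card {z \<in> {-1<..<1}. poly (crit_poly m q) z = 0} = degree q + 1" (is ?A)
    and "\<And>z. z \<in> {-1<..<1} \<Longrightarrow> poly (crit_poly m q) z = 0 \<Longrightarrow>
      poly (pderiv (crit_poly m q)) z * poly q z < 0"
proof -
  have "Z = {x. poly q x = 0}"
    using Z q0 by (intro card_seteq) (auto simp: poly_roots_finite intro: card_poly_roots_bound)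
  then have Zeq: "\<And>x. poly q x = 0 \<longleftrightarrow> x \<in> Z" by auto
  obtain k where k: "m = Suc k" using m by (cases m) auto
  show B: "poly (pderiv (crit_poly m q)) z * poly q z < 0"
    if z: "z \<in> {-1<..<1}" and N: "poly (crit_poly m q) z = 0" for z
  proof -
    define u where "u = 1 - z\<^sup>2"
    have u: "u > 0" using z by (simp add: u_def power2_less_1_iff abs_less_iff abs_square_less_1)
    have e: "u * poly (pderiv q) z = real m * z * poly q z"
      using N by (simp add: poly_crit_poly u_def)
    have qn: "poly q z \<noteq> 0"
    proof
      assume "poly q z = 0"
      then have "poly (pderiv q) z = 0" using e u by simp
      then show False
        using simple_root_if_card_roots_eq_degree[OF Z _ q0, of z] Zeq \<open>poly q z = 0\<close> by auto
    qed
    have "u * (poly (pderiv (crit_poly m q)) z * poly q z) =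
       u^2 * (poly q z * poly (pderiv (pderiv q)) z) - (real m + 2) * z * (u * poly (pderiv q) z) * poly q z
        - real m * u * (poly q z)\<^sup>2"
      unfolding poly_pderiv_crit_poly u_def[symmetric] by (simp add: algebra_simps power2_eq_square)
    also have "\<dots> \<le> u^2 * (poly (pderiv q) z)\<^sup>2 - (real m + 2) * z * (u * poly (pderiv q) z) * poly q z
        - real m * u * (poly q z)\<^sup>2"
      using laguerre_inequality[OF Z, of z] by (simp add: mult_left_mono)
    also have "\<dots> = (u * poly (pderiv q) z)\<^sup>2 - (real m + 2) * z * (u * poly (pderiv q) z) * poly q z
        - real m * u * (poly q z)\<^sup>2" by (simp add: power_mult_distrib)
    also have "\<dots> = - (real m * (1 + z\<^sup>2) * (poly q z)\<^sup>2)"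
      unfolding e unfolding u_def by (simp add: algebra_simps power2_eq_square)
    also have "\<dots> < 0"
      using m qn by (simp add: zero_less_mult_iff add_pos_nonneg)
    finally show ?thesis using u by (simp add: mult_less_0_iff zero_less_mult_iff)
  qed
  let ?N = "crit_poly m q"
  \<comment> \<open>The square of \<open>(1 - z\<^sup>2)^(m/2) q\<close>, which unlike its root is a polynomial for odd \<open>m\<close>.\<close>
  let ?P = "[:1, 0, -1:] ^ m * q ^ 2"
  let ?Y = "insert 1 (insert (-1) Z)"
  have "1 \<notin> Z" "-1 \<notin> Z" using Zi by auto
  then have Y: "finite ?Y" "card ?Y = Suc (Suc (degree q))" using Z by auto
  have mm: "Min ?Y = -1" "Max ?Y = 1"
    using Z Zi by (intro Min_eqI Max_eqI; force)+
  have P0: "poly ?P x = 0" if "x \<in> ?Y" for x using that Z(3) m by auto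
  obtain Y' where Y': "finite Y'" "card Y' = Suc (degree q)" "Y' \<subseteq> {-1<..<1}" "Y' \<inter> ?Y = {}"
     "\<forall>x\<in>Y'. poly (pderiv ?P) x = 0"
    using poly_rolle_finite[OF Y P0] mm by auto
  have dP: "poly (pderiv ?P) x = 2 * (1 - x\<^sup>2) ^ k * poly q x * poly ?N x" for x
    unfolding k pderiv_mult pderiv_power_Suc poly_crit_poly power2_eq_square
    by (simp add: pderiv_mult pderiv_pCons algebra_simps power2_eq_square)
  have sub: "Y' \<subseteq> {z \<in> {-1<..<1}. poly ?N z = 0}"
  proof
    fix x assume x: "x \<in> Y'"
    have "1 - x\<^sup>2 \<noteq> 0" "poly q x \<noteq> 0" using x Y' Zeq by (auto simp: power2_eq_1_iff)
    then show "x \<in> {z \<in> {-1<..<1}. poly ?N z = 0}" using x Y' dP[of x] by auto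
  qed
  have "poly q 1 \<noteq> 0" using Zeq Zi by auto
  then have N0: "?N \<noteq> 0" using m poly_crit_poly[of m q 1] by auto
  have "degree ?N \<le> Suc (degree q)"
    unfolding crit_poly_def
  proof (rule degree_diff_le)
    show "degree ([:1, 0, - 1:] * pderiv q) \<le> Suc (degree q)"
    proof (cases "pderiv q = 0")
      case False
      then have "degree q \<noteq> 0" by (auto simp: pderiv_eq_0_iff)
      then show ?thesis using False by (subst degree_mult_eq) (auto simp: degree_pderiv)
    qed simp
    show "degree (Polynomial.smult (real m) ([:0, 1:] * q)) \<le> Suc (degree q)"
      by (simp add: degree_pCons_le)
  qed
  have fin: "finite {z \<in> {-1<..<1}. poly ?N z = 0}"
    by (rule finite_subset[OF _ poly_roots_finite[OF N0]]) auto
  have "card {z \<in> {-1<..<1}. poly ?N z = 0} \<le> card {z. poly ?N z = 0}"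
    by (rule card_mono[OF poly_roots_finite[OF N0]]) auto
  also have "\<dots> \<le> Suc (degree q)" using card_poly_roots_bound[OF N0] \<open>degree ?N \<le> Suc (degree q)\<close> by simp
  finally have "card {z \<in> {-1<..<1}. poly ?N z = 0} \<le> Suc (degree q)" .
  moreover have "Suc (degree q) \<le> card {z \<in> {-1<..<1}. poly ?N z = 0}"
    using card_mono[OF fin sub] Y' by simp
  ultimately show ?A by simp
qed

lemma legendre_deriv_roots:
  assumes "m \<le> l"
  defines "q \<equiv> (pderiv ^^ m) (legendre_poly l)"
  shows "q \<noteq> 0" "degree q = l - m" "card {z. poly q z = 0} = l - m" "{z. poly q z = 0} \<subseteq> {-1<..<1}"
proof -
  let ?c = "1 / (2 ^ l * fact l) :: real"
  define f :: "real poly" where "f = [:-1, 0, 1:] ^ l"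
  have q: "q = Polynomial.smult ?c ((pderiv ^^ (m + l)) f)"
    unfolding q_def f_def legendre_poly_def pderiv_iter_smult funpow_add by simp
  have df: "degree f = 2 * l" unfolding f_def by (simp add: degree_power_eq)
  then show d: "degree q = l - m" unfolding q by (simp add: degree_pderiv_iter)
  show q0: "q \<noteq> 0"
  proof (cases "m = l")
    case False
    then show ?thesis using d assms by auto
  next
    case True
    have "f \<noteq> 0" unfolding f_def by simp
    have "(pderiv ^^ (m + l)) f \<noteq> 0"
    proof (cases l)
      case 0 then show ?thesis using True \<open>f \<noteq> 0\<close> by simp
    next
      case (Suc n)
      have "degree ((pderiv ^^ (m + n)) f) \<noteq> 0" using Suc True df
        by (subst degree_pderiv_iter) simp
      then have "pderiv ((pderiv ^^ (m + n)) f) \<noteq> 0" by (simp add: pderiv_eq_0_iff)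
      then show ?thesis using Suc by simp
    qed
    then show ?thesis unfolding q by simp
  qed
  obtain Z where Z: "finite Z" "card Z = l - m" "Z \<subseteq> {-1<..<1::real}"
    "\<forall>x\<in>Z. poly ((pderiv ^^ (m + l)) f) x = 0" using rodrigues_deriv_roots[OF assms(1)] unfolding f_def by blast
  have "Z = {x. poly q x = 0}"
  proof (rule card_seteq[OF poly_roots_finite[OF q0]])
    show "Z \<subseteq> {x. poly q x = 0}" using Z(4) unfolding q by auto
    show "card {x. poly q x = 0} \<le> card Z" using card_poly_roots_bound[OF q0] Z(2) d by simp
  qed
  then show "card {z. poly q z = 0} = l - m" "{z. poly q z = 0} \<subseteq> {-1<..<1}" using Z by auto
qed

lemma poly_ext: "(\<And>x. poly p x = poly q x) \<Longrightarrow> p = (q :: real poly)"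
  by (simp add: poly_eq_poly_eq_iff[symmetric] fun_eq_iff)

text \<open>Leibniz' rule for a quadratic factor \<open>A\<close> with \<open>A' = 2 B\<close> and \<open>B' = 1\<close>; only three terms are left.\<close>

lemma pderiv_iter_mult_quadratic:
  fixes p A B :: "real poly"
  assumes A: "pderiv A = Polynomial.smult 2 B" and B: "pderiv B = 1"
  shows "(pderiv ^^ Suc (Suc n)) (A * p) = A * (pderiv ^^ Suc (Suc n)) p
    + Polynomial.smult (2 * real (Suc (Suc n))) (B * (pderiv ^^ Suc n) p)
    + Polynomial.smult (real (Suc (Suc n)) * real (Suc n)) ((pderiv ^^ n) p)"
proof (induction n)
  case 0
  show ?case
    by (rule poly_ext) (simp add: pderiv_mult pderiv_add pderiv_smult A B numeral_2_eq_2 algebra_simps)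
next
  case (Suc n)
  have "(pderiv ^^ Suc (Suc (Suc n))) (A * p) = pderiv ((pderiv ^^ Suc (Suc n)) (A * p))"
    by simp
  also have "\<dots> = A * (pderiv ^^ Suc (Suc (Suc n))) p
    + Polynomial.smult (2 * real (Suc (Suc (Suc n)))) (B * (pderiv ^^ Suc (Suc n)) p)
    + Polynomial.smult (real (Suc (Suc (Suc n))) * real (Suc (Suc n))) ((pderiv ^^ Suc n) p)"
    unfolding Suc
    by (rule poly_ext) (simp add: pderiv_mult pderiv_add pderiv_smult A B algebra_simps)
  finally show ?case .
qed

text \<open>Differentiate the relation \<open>(x\<^sup>2 - 1) f' = 2 l x f\<close>, valid for \<open>f = (x\<^sup>2 - 1)^l\<close>, another \<open>l + 1\<close> times.\<close>

lemma legendre_ode: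
  assumes l: "1 \<le> l"
  shows "(1 - x\<^sup>2) * poly (pderiv (pderiv (legendre_poly l))) x - 2 * x * poly (pderiv (legendre_poly l)) x
    + real l * (real l + 1) * poly (legendre_poly l) x = 0"
proof -
  define A :: "real poly" where "A = [:-1, 0, 1:]"
  define B :: "real poly" where "B = [:0, 1:]"
  have dA: "pderiv A = Polynomial.smult 2 B" and dB: "pderiv B = 1"
    by (simp_all add: A_def B_def pderiv_pCons)
  have pA: "poly A x = x\<^sup>2 - 1" and pB: "poly B x = x"
    by (simp_all add: A_def B_def power2_eq_square)
  obtain k where k: "l = Suc k" using l by (cases l) auto
  define f where "f = A ^ l"
  define y where "y = (pderiv ^^ l) f"
  have "A * pderiv f = Polynomial.smult (2 * real l) (B * f)"
    unfolding f_def k pderiv_power_Suc dA by (rule poly_ext) (simp add: algebra_simps)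
  then have "(pderiv ^^ Suc (Suc k)) (A * pderiv f) = (pderiv ^^ Suc (Suc k)) (Polynomial.smult (2 * real l) (B * f))"
    by simp
  moreover have Bf: "(pderiv ^^ Suc n) (B * f) = B * (pderiv ^^ Suc n) f + Polynomial.smult (real (Suc n)) ((pderiv ^^ n) f)" for n
  proof (induction n)
    case (Suc n)
    have "(pderiv ^^ Suc (Suc n)) (B * f) = pderiv ((pderiv ^^ Suc n) (B * f))" by simp
    then show ?case unfolding Suc by (intro poly_ext) (simp add: pderiv_mult pderiv_add pderiv_smult dB algebra_simps)
  qed (simp add: pderiv_mult dB)
  ultimately have "A * pderiv (pderiv y) + Polynomial.smult (2 * real (Suc l)) (B * pderiv y)
      + Polynomial.smult (real (Suc l) * real l) y
      = Polynomial.smult (2 * real l) (B * pderiv y + Polynomial.smult (real (Suc l)) y)"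
    unfolding pderiv_iter_mult_quadratic[OF dA dB] pderiv_iter_smult y_def k Bf
    by (simp add: funpow_swap1[symmetric])
  then have "poly (A * pderiv (pderiv y) + Polynomial.smult (2 * real (Suc l)) (B * pderiv y)
      + Polynomial.smult (real (Suc l) * real l) y) x
      = poly (Polynomial.smult (2 * real l) (B * pderiv y + Polynomial.smult (real (Suc l)) y)) x" by simp
  then have e: "(1 - x\<^sup>2) * poly (pderiv (pderiv y)) x - 2 * x * poly (pderiv y) x
    + real l * (real l + 1) * poly y x = 0"
    by (simp add: pA pB algebra_simps)
  have L: "legendre_poly l = Polynomial.smult (1 / (2 ^ l * fact l)) y"
    unfolding legendre_poly_def y_def f_def A_def ..
  define c :: real where "c = 1 / (2 ^ l * fact l)"
  have "c * ((1 - x\<^sup>2) * poly (pderiv (pderiv y)) x - 2 * x * poly (pderiv y) x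
    + real l * (real l + 1) * poly y x) = 0" using e by simp
  then show ?thesis unfolding L c_def[symmetric] by (simp add: pderiv_smult algebra_simps)
qed

section \<open>Stability of simple roots\<close>

text \<open>Outside small disjoint intervals around the roots \<open>|N|\<close> is bounded below, so a uniformly close
  \<open>F\<close> has no zeros there. Inside such an interval \<open>N'\<close> has a constant sign, which \<open>F'\<close> inherits, so
  that \<open>F\<close> is strictly monotone and has exactly one zero. Derivatives are only compared at distance
  \<open>a\<close> from the endpoints, because \<open>sqrt (1 - z\<^sup>2)\<close>, whose derivative is unbounded, will occur in \<open>F\<close>.\<close>

lemma simple_roots_stable:
  fixes N N' :: "real \<Rightarrow> real"
  assumes contN: "continuous_on {-1..1} N" and contN': "continuous_on {-1..1} N'"
    and fin: "finite {z \<in> {-1<..<1}. N z = 0}"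
    and ends: "N 1 \<noteq> 0" "N (-1) \<noteq> 0"
    and der: "\<And>z. z \<in> {-1<..<1} \<Longrightarrow> (N has_real_derivative N' z) (at z)"
    and simple: "\<And>z. z \<in> {-1<..<1} \<Longrightarrow> N z = 0 \<Longrightarrow> N' z \<noteq> 0"
    and eta: "0 < \<eta>"
  shows "\<exists>\<delta>>0. \<exists>a>0. a < 1 \<and> (\<forall>F F'. continuous_on {-1..1} F \<and> (\<forall>z\<in>{-1..1}. \<bar>F z - N z\<bar> < \<delta>) \<and>
      (\<forall>z. \<bar>z\<bar> \<le> 1 - a \<longrightarrow> (F has_real_derivative F' z) (at z) \<and> \<bar>F' z - N' z\<bar> < \<delta>) \<longrightarrow>
      (\<exists>\<phi>. bij_betw \<phi> {z \<in> {-1<..<1}. N z = 0} {z \<in> {-1..1}. F z = 0} \<and>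
        (\<forall>r\<in>{z \<in> {-1<..<1}. N z = 0}. \<bar>\<phi> r\<bar> < 1 \<and> \<bar>\<phi> r - r\<bar> < \<eta> \<and> sgn (F' (\<phi> r)) = sgn (N' r))))"
proof -
  define Z where "Z = {z \<in> {-1<..<1}. N z = 0}"
  have finZ: "finite Z" using fin Z_def by simp
  have small: "\<exists>d>0. \<forall>r\<in>Z. P r d" if "\<And>r. r \<in> Z \<Longrightarrow> \<exists>d>0. P r d"
    and "\<And>r d d'. P r d \<Longrightarrow> 0 < d' \<Longrightarrow> d' \<le> d \<Longrightarrow> P r d'" for P :: "real \<Rightarrow> real \<Rightarrow> bool"
  proof -
    have "\<forall>r\<in>Z. \<exists>d. d > 0 \<and> P r d" using that(1) by blast
    from bchoice[OF this] obtain D where D: "\<forall>r\<in>Z. D r > 0 \<and> P r (D r)" ..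
    define d where "d = Min (insert 1 (D ` Z))"
    have "d > 0" unfolding d_def using finZ D by (subst Min_gr_iff) auto
    moreover have "d \<le> D r" if "r \<in> Z" for r unfolding d_def using finZ that by simp
    ultimately show ?thesis using D that(2) by blast
  qed
  obtain a where a: "a > 0" "\<And>r. r \<in> Z \<Longrightarrow> \<bar>r\<bar> \<le> 1 - 2 * a"
  proof -
    have "\<exists>a>0. \<forall>r\<in>Z. \<bar>r\<bar> \<le> 1 - 2 * a"
    proof (rule small)
      fix r assume "r \<in> Z"
      then show "\<exists>d>0. \<bar>r\<bar> \<le> 1 - 2 * d" by (intro exI[of _ "(1 - \<bar>r\<bar>) / 2"]) (auto simp: Z_def diff_divide_distrib)
    qed auto
    then show ?thesis using that by blast
  qed
  define b where "b = min a (1/2)"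
  have b: "b > 0" "b < 1" "b \<le> a" using a b_def by auto
  obtain d1 where d1: "d1 > 0" "\<And>r s. r \<in> Z \<Longrightarrow> s \<in> Z \<Longrightarrow> r \<noteq> s \<Longrightarrow> 2 * d1 < \<bar>r - s\<bar>"
  proof -
    have "\<exists>d>0. \<forall>r\<in>Z. \<forall>s\<in>Z. r \<noteq> s \<longrightarrow> 2 * d < \<bar>r - s\<bar>"
    proof (rule small)
      fix r assume r: "r \<in> Z"
      show "\<exists>d>0. \<forall>s\<in>Z. r \<noteq> s \<longrightarrow> 2 * d < \<bar>r - s\<bar>"
      proof (rule small)
        fix s assume "s \<in> Z"
        show "\<exists>d>0. r \<noteq> s \<longrightarrow> 2 * d < \<bar>r - s\<bar>"
        proof (cases "r = s")
          case False
          then show ?thesis by (intro exI[of _ "\<bar>r - s\<bar> / 3"]) auto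
        qed (auto intro: exI[of _ 1])
      qed auto
    next
      fix r d d' :: real
      assume A: "\<forall>s\<in>Z. r \<noteq> s \<longrightarrow> 2 * d < \<bar>r - s\<bar>" "d' \<le> d"
      show "\<forall>s\<in>Z. r \<noteq> s \<longrightarrow> 2 * d' < \<bar>r - s\<bar>"
      proof (intro ballI impI)
        fix s assume "s \<in> Z" "r \<noteq> s"
        then have "2 * d < \<bar>r - s\<bar>" using A(1) by blast
        then show "2 * d' < \<bar>r - s\<bar>" using A(2) by linarith
      qed
    qed
    then show ?thesis using that by blast
  qed
  obtain d2 where d2: "d2 > 0" "\<And>r z. r \<in> Z \<Longrightarrow> z \<in> {-1..1} \<Longrightarrow> \<bar>z - r\<bar> \<le> d2 \<Longrightarrow> \<bar>N' z - N' r\<bar> \<le> \<bar>N' r\<bar> / 2"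
  proof -
    have "\<exists>d>0. \<forall>r\<in>Z. \<forall>z\<in>{-1..1}. \<bar>z - r\<bar> \<le> d \<longrightarrow> \<bar>N' z - N' r\<bar> \<le> \<bar>N' r\<bar> / 2"
    proof (rule small)
      fix r assume r: "r \<in> Z"
      then have "\<bar>N' r\<bar> / 2 > 0" "r \<in> {-1..1}" using simple by (auto simp: Z_def)
      then obtain d where "d > 0" "\<And>z. z \<in> {-1..1} \<Longrightarrow> dist z r < d \<Longrightarrow> dist (N' z) (N' r) < \<bar>N' r\<bar> / 2"
        using contN' unfolding continuous_on_iff by blast
      then show "\<exists>d>0. \<forall>z\<in>{-1..1}. \<bar>z - r\<bar> \<le> d \<longrightarrow> \<bar>N' z - N' r\<bar> \<le> \<bar>N' r\<bar> / 2"
        by (intro exI[of _ "d/2"]) (force simp: dist_real_def)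
    qed auto
    then show ?thesis using that by blast
  qed
  \<comment> \<open>The intervals of radius \<open>e\<close> around the roots are disjoint, stay away from the endpoints, and \<open>N'\<close>
    keeps its sign on them.\<close>
  define e where "e = Min {\<eta> / 2, d1, d2, b / 2}"
  have e: "e > 0" "e < \<eta>" "e \<le> d1" "e \<le> d2" "e < b" using eta d1 d2 b by (auto simp: e_def min_def)
  obtain c where c: "c > 0" "\<And>r. r \<in> Z \<Longrightarrow> 2 * c \<le> \<bar>N' r\<bar> / 2"
  proof -
    have "\<exists>d>0. \<forall>r\<in>Z. 2 * d \<le> \<bar>N' r\<bar> / 2"
    proof (rule small)
      fix r assume "r \<in> Z"
      then have "\<bar>N' r\<bar> > 0" using simple by (auto simp: Z_def)
      then show "\<exists>d>0. 2 * d \<le> \<bar>N' r\<bar> / 2" by (intro exI[of _ "\<bar>N' r\<bar> / 4"]) auto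
    qed auto
    then show ?thesis using that by blast
  qed
  \<comment> \<open>The compact complement of the intervals, where \<open>N\<close> is bounded away from 0.\<close>
  define C where "C = {-1..1} - (\<Union>r\<in>Z. ball r e)"
  have "compact C" unfolding C_def by (intro compact_diff) auto
  have N0: "N z \<noteq> 0" if "z \<in> C" for z
  proof
    assume "N z = 0"
    with that ends have "z \<in> Z" unfolding C_def Z_def
      by (auto simp: less_le)
    then show False using that e(1) unfolding C_def by auto
  qed
  obtain \<mu> where mu: "\<mu> > 0" "\<And>z. z \<in> C \<Longrightarrow> \<mu> \<le> \<bar>N z\<bar>"
  proof (cases "C = {}")
    case True then show ?thesis using that[of 1] by auto
  next
    case False
    have "continuous_on C (\<lambda>z. \<bar>N z\<bar>)"
      by (intro continuous_on_rabs continuous_on_subset[OF contN]) (auto simp: C_def)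
    then obtain z0 where "z0 \<in> C" "\<And>z. z \<in> C \<Longrightarrow> \<bar>N z0\<bar> \<le> \<bar>N z\<bar>"
      using continuous_attains_inf[OF \<open>compact C\<close> False] by blast
    then show ?thesis using that[of "\<bar>N z0\<bar>"] N0 by auto
  qed
  define \<delta> where "\<delta> = min c \<mu>"
  have delta: "\<delta> > 0" "\<delta> \<le> c" "\<delta> \<le> \<mu>" using c mu by (auto simp: \<delta>_def)
  show ?thesis
  proof (rule exI[of _ \<delta>], intro conjI, rule delta, rule exI[of _ b], intro conjI allI impI)
    show "b > 0" "b < 1" using b by auto
    fix F F' :: "real \<Rightarrow> real"
    assume F: "continuous_on {-1..1} F \<and> (\<forall>z\<in>{-1..1}. \<bar>F z - N z\<bar> < \<delta>) \<and>
      (\<forall>z. \<bar>z\<bar> \<le> 1 - b \<longrightarrow> (F has_real_derivative F' z) (at z) \<and> \<bar>F' z - N' z\<bar> < \<delta>)"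
    have FC: "F z \<noteq> 0" if "z \<in> C" for z
    proof -
      have "\<bar>F z - N z\<bar> < \<mu>" "\<mu> \<le> \<bar>N z\<bar>" using F that mu delta unfolding C_def by (auto intro: less_le_trans)
      then show ?thesis by auto
    qed
    have inb: "\<bar>z\<bar> \<le> 1 - b" if "r \<in> Z" "\<bar>z - r\<bar> \<le> e" for r z
      using a(2)[OF that(1)] that(2) e(5) b(3) by linarith
    have sg: "c \<le> sgn (N' r) * F' z \<and> c \<le> sgn (N' r) * N' z" if r: "r \<in> Z" and z: "\<bar>z - r\<bar> \<le> e" for r z
    proof -
      have z1: "\<bar>z\<bar> \<le> 1 - b" using inb that by blast
      then have "\<bar>N' z - N' r\<bar> \<le> \<bar>N' r\<bar> / 2" using d2(2)[OF r, of z] z e b by (simp add: abs_le_iff)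
      moreover have "\<bar>F' z - N' z\<bar> < c" using F z1 delta by (meson less_le_trans)
      moreover have "N' r \<noteq> 0" using c(1) c(2)[OF r] by auto
      ultimately have "N' r > 0 \<and> c \<le> F' z \<and> c \<le> N' z \<or> N' r < 0 \<and> c \<le> - F' z \<and> c \<le> - N' z"
        using c(2)[OF r] c(1) by linarith
      then show ?thesis by (elim disjE) simp_all
    qed
    have ex: "\<exists>!z. \<bar>z - r\<bar> \<le> e \<and> F z = 0" if r: "r \<in> Z" for r
    proof -
      define s where "s = sgn (N' r)"
      define G where "G = (\<lambda>z. s * F z)"
      have dG: "(G has_real_derivative s * F' z) (at z)" if "\<bar>z - r\<bar> \<le> e" for z
        unfolding G_def using F inb[OF r that] by (intro DERIV_cmult) blast
      have pos: "s * F' z > 0" if "\<bar>z - r\<bar> \<le> e" for z using sg[OF r that] c s_def by auto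
      have mono: "G x < G y" if "\<bar>x - r\<bar> \<le> e" "\<bar>y - r\<bar> \<le> e" "x < y" for x y
      proof (rule DERIV_pos_imp_increasing[OF that(3)])
        fix z assume "x \<le> z" "z \<le> y"
        then have "\<bar>z - r\<bar> \<le> e" using that by auto
        then show "\<exists>u. (G has_real_derivative u) (at z) \<and> u > 0" using dG pos by blast
      qed
      have s: "s = 1 \<or> s = -1" using simple r unfolding s_def Z_def by (auto simp: sgn_if)
      have monoN: "s * N x < s * N y" if "\<bar>x - r\<bar> \<le> e" "\<bar>y - r\<bar> \<le> e" "x < y" for x y
      proof (rule DERIV_pos_imp_increasing[OF that(3), where f = "\<lambda>x. s * N x"])
        fix z assume "x \<le> z" "z \<le> y"
        then have z: "\<bar>z - r\<bar> \<le> e" using that by auto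
        then have "z \<in> {-1<..<1}" using inb[OF r] b by fastforce
        then have "((\<lambda>x. s * N x) has_real_derivative s * N' z) (at z)" using der by (intro DERIV_cmult) blast
        moreover have "s * N' z > 0" using sg[OF r z] c s_def by auto
        ultimately show "\<exists>u. ((\<lambda>x. s * N x) has_real_derivative u) (at z) \<and> u > 0" by blast
      qed
      have CE: "t \<in> C" if "t = r + e \<or> t = r - e" for t
      proof -
        have "\<bar>t - r\<bar> \<le> e" using that e by auto
        then have "\<bar>t\<bar> \<le> 1" using inb[OF r] b by force
        moreover have "t \<notin> ball x e" if "x \<in> Z" for x
        proof (cases "x = r")
          case True then show ?thesis using \<open>t = r + e \<or> t = r - e\<close> by (auto simp: dist_real_def)
        next
          case False
          then have "2 * d1 < \<bar>x - r\<bar>" using d1 r \<open>x \<in> Z\<close> by auto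
          then show ?thesis using e(3) \<open>\<bar>t - r\<bar> \<le> e\<close> by (auto simp: dist_real_def)
        qed
        ultimately show ?thesis unfolding C_def by auto
      qed
      have Nr: "N r = 0" using r Z_def by auto
      have close: "\<bar>F t - N t\<bar> < \<bar>N t\<bar>" if "t = r + e \<or> t = r - e" for t
      proof -
        have "\<mu> \<le> \<bar>N t\<bar>" using mu CE that by blast
        moreover have "\<bar>F t - N t\<bar> < \<delta>" using F CE[OF that] unfolding C_def by blast
        ultimately show ?thesis using delta by linarith
      qed
      have "s * N (r - e) < 0" using monoN[of "r - e" r] e(1) Nr by simp
      moreover have "\<bar>F (r - e) - N (r - e)\<bar> < \<bar>N (r - e)\<bar>" using close by blast
      ultimately have "G (r - e) < 0" using s unfolding G_def by (elim disjE; simp; linarith)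
      have "s * N (r + e) > 0" using monoN[of r "r + e"] e(1) Nr by simp
      moreover have "\<bar>F (r + e) - N (r + e)\<bar> < \<bar>N (r + e)\<bar>" using close by blast
      ultimately have "G (r + e) > 0" using s unfolding G_def by (elim disjE; simp; linarith)
      moreover note \<open>G (r - e) < 0\<close>
      moreover have "continuous_on {r - e..r + e} G"
        by (intro continuous_at_imp_continuous_on ballI DERIV_isCont[OF dG]) auto
      ultimately obtain z where z: "r - e \<le> z" "z \<le> r + e" "G z = 0"
        using IVT'[of G "r - e" 0 "r + e"] e(1) by force
      show ?thesis
      proof (rule ex1I[of _ z])
        show "\<bar>z - r\<bar> \<le> e \<and> F z = 0" using z s unfolding G_def by auto
        fix y assume y: "\<bar>y - r\<bar> \<le> e \<and> F y = 0"
        have ze: "\<bar>z - r\<bar> \<le> e" using z by linarith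
        then show "y = z"
          using mono[of y z] mono[of z y] z(3) ze y unfolding G_def
          by (cases y z rule: linorder_cases) simp_all
      qed
    qed
    define \<phi> where "\<phi> r = (THE z. \<bar>z - r\<bar> \<le> e \<and> F z = 0)" for r
    have phi: "\<bar>\<phi> r - r\<bar> \<le> e" "F (\<phi> r) = 0" if "r \<in> Z" for r
      using theI'[OF ex[OF that]] unfolding \<phi>_def by auto
    have "bij_betw \<phi> Z {z \<in> {-1..1}. F z = 0}"
    proof (rule bij_betw_imageI)
      show "inj_on \<phi> Z"
      proof (rule inj_onI, rule ccontr)
        fix r s assume A: "r \<in> Z" "s \<in> Z" "\<phi> r = \<phi> s" "r \<noteq> s"
        then show False using d1(2)[OF A(1,2,4)] phi(1)[OF A(1)] phi(1)[OF A(2)] e(3) by linarith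
      qed
      show "\<phi> ` Z = {z \<in> {-1..1}. F z = 0}"
      proof (intro equalityI subsetI)
        fix z assume "z \<in> \<phi> ` Z"
        then obtain r where r: "r \<in> Z" "z = \<phi> r" by auto
        then show "z \<in> {z \<in> {-1..1}. F z = 0}" using phi[OF r(1)] inb[OF r(1), of z] b by auto
      next
        fix z assume z: "z \<in> {z \<in> {-1..1}. F z = 0}"
        then have "z \<notin> C" using FC by auto
        then obtain r where r: "r \<in> Z" "z \<in> ball r e" using z unfolding C_def by auto
        then have "\<bar>z - r\<bar> \<le> e" by (auto simp: dist_real_def)
        then have "z = \<phi> r" using ex[OF r(1)] phi[OF r(1)] z by auto
        then show "z \<in> \<phi> ` Z" using r by auto
      qed
    qed
    moreover have "\<bar>\<phi> r\<bar> < 1 \<and> \<bar>\<phi> r - r\<bar> < \<eta> \<and> sgn (F' (\<phi> r)) = sgn (N' r)" if r: "r \<in> Z" for r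
    proof (intro conjI)
      show "\<bar>\<phi> r\<bar> < 1" using inb[OF r phi(1)[OF r]] b by linarith
      show "\<bar>\<phi> r - r\<bar> < \<eta>" using phi(1)[OF r] e by linarith
      show "sgn (F' (\<phi> r)) = sgn (N' r)"
      proof -
        have "c \<le> sgn (N' r) * F' (\<phi> r)" using sg[OF r phi(1)[OF r]] by blast
        then have "0 < sgn (N' r) * F' (\<phi> r)" using c(1) by linarith
        then show ?thesis by (cases "N' r" "0::real" rule: linorder_cases) (simp_all add: zero_less_mult_iff)
      qed
    qed
    ultimately show "\<exists>\<phi>. bij_betw \<phi> {z \<in> {-1<..<1}. N z = 0} {z \<in> {-1..1}. F z = 0} \<and>
        (\<forall>r\<in>{z \<in> {-1<..<1}. N z = 0}. \<bar>\<phi> r\<bar> < 1 \<and> \<bar>\<phi> r - r\<bar> < \<eta> \<and> sgn (F' (\<phi> r)) = sgn (N' r))"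
      unfolding Z_def[symmetric] by blast
  qed
qed

section \<open>The Euler characteristic of the sphere\<close>

lemma hom_integer_finprod:
  assumes G: "comm_group G" and h: "h \<in> hom G integer_group" and fin: "finite B"
    and f: "f \<in> B \<rightarrow> carrier G"
  shows "h (finprod G f B) = (\<Sum>b\<in>B. h (f b))"
proof -
  interpret comm_group G by (rule G)
  have h1: "h \<one>\<^bsub>G\<^esub> = 0"
    using hom_one[OF h is_group group_integer_group] by simp
  show ?thesis
    using fin f
  proof (induction B rule: finite_induct)
    case empty
    then show ?case by (simp add: h1)
  next
    case (insert x B)
    then have "finprod G f (insert x B) = f x \<otimes>\<^bsub>G\<^esub> finprod G f B"
      by (intro finprod_insert) auto
    moreover have "h (f x \<otimes>\<^bsub>G\<^esub> finprod G f B) = h (f x) + h (finprod G f B)"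
      using hom_mult[OF h, of "f x" "finprod G f B"] insert.prems by auto
    ultimately show ?case using insert by simp
  qed
qed

lemma abelian_rank_trivial:
  assumes G: "comm_group G" and t: "trivial_group G"
  shows "abelian_rank G = 0"
proof -
  interpret comm_group G by (rule G)
  have c: "carrier G = {\<one>\<^bsub>G\<^esub>}" using t by (simp add: trivial_group_def)
  have "{card B |B. finite B \<and> B \<subseteq> carrier G \<and>
      (\<forall>c :: 'a \<Rightarrow> int. finprod G (\<lambda>b. b [^]\<^bsub>G\<^esub> c b) B = \<one>\<^bsub>G\<^esub> \<longrightarrow> (\<forall>b\<in>B. c b = 0))} = {0}"
  proof (intro equalityI subsetI)
    fix n assume "n \<in> {card B |B. finite B \<and> B \<subseteq> carrier G \<and>
      (\<forall>c :: 'a \<Rightarrow> int. finprod G (\<lambda>b. b [^]\<^bsub>G\<^esub> c b) B = \<one>\<^bsub>G\<^esub> \<longrightarrow> (\<forall>b\<in>B. c b = 0))}"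
    then obtain B where B: "n = card B" "B \<subseteq> carrier G"
      "\<forall>c :: 'a \<Rightarrow> int. finprod G (\<lambda>b. b [^]\<^bsub>G\<^esub> c b) B = \<one>\<^bsub>G\<^esub> \<longrightarrow> (\<forall>b\<in>B. c b = 0)" by auto
    have "finprod G (\<lambda>b. b [^]\<^bsub>G\<^esub> (1::int)) B \<in> carrier G" using B(2) by (intro finprod_closed) auto
    then have "finprod G (\<lambda>b. b [^]\<^bsub>G\<^esub> (1::int)) B = \<one>\<^bsub>G\<^esub>" using c by auto
    then have "\<forall>b\<in>B. (1::int) = 0" using B(3)[rule_format, of "\<lambda>_. 1"] by blast
    then have "B = {}" by auto
    then show "n \<in> {0}" using B by simp
  next
    fix n :: nat assume "n \<in> {0}"
    then show "n \<in> {card B |B. finite B \<and> B \<subseteq> carrier G \<and>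
      (\<forall>c :: 'a \<Rightarrow> int. finprod G (\<lambda>b. b [^]\<^bsub>G\<^esub> c b) B = \<one>\<^bsub>G\<^esub> \<longrightarrow> (\<forall>b\<in>B. c b = 0))}"
      by (auto intro!: exI[of _ "{}"])
  qed
  then show ?thesis unfolding abelian_rank_def by simp
qed

text \<open>An isomorphism to the integers turns independence into linear independence over the integers
  of a set of integers. A single nonzero integer is independent; two integers \<open>a\<close>, \<open>b\<close> satisfy the
  relation \<open>b a - a b = 0\<close>.\<close>

lemma abelian_rank_infinite_cyclic:
  assumes G: "comm_group G" and iso: "G \<cong> integer_group"
  shows "abelian_rank G = 1"
proof -
  interpret comm_group G by (rule G)
  obtain h where h: "h \<in> iso G integer_group" using iso unfolding is_iso_def by blast
  then have hh: "h \<in> hom G integer_group" and bij: "bij_betw h (carrier G) UNIV"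
    by (auto simp: iso_def)
  have h1: "h \<one>\<^bsub>G\<^esub> = 0"
    using hom_one[OF hh is_group group_integer_group] by simp
  have inj: "x = y" if "x \<in> carrier G" "y \<in> carrier G" "h x = h y" for x y
    using bij that by (auto simp: bij_betw_def inj_on_def)
  have pow: "h (x [^]\<^bsub>G\<^esub> (n::int)) = n * h x" if "x \<in> carrier G" for x n
    using group_hom.hom_int_pow[of G integer_group h x n] that hh
    by (simp add: group_hom_def group_hom_axioms_def is_group)
  have fp: "finprod G (\<lambda>b. b [^]\<^bsub>G\<^esub> (c b)) B = \<one>\<^bsub>G\<^esub> \<longleftrightarrow> (\<Sum>b\<in>B. c b * h b) = 0"
    if "finite B" "B \<subseteq> carrier G" for B and c :: "'a \<Rightarrow> int"
  proof -
    have P: "(\<lambda>b. b [^]\<^bsub>G\<^esub> (c b)) \<in> B \<rightarrow> carrier G" using that by auto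
    have "h (finprod G (\<lambda>b. b [^]\<^bsub>G\<^esub> (c b)) B) = (\<Sum>b\<in>B. c b * h b)"
      unfolding hom_integer_finprod[OF G hh that(1) P] using that pow by (intro sum.cong) auto
    then show ?thesis using inj[OF finprod_closed[OF P] one_closed] h1 by auto
  qed
  let ?S = "{card B |B. finite B \<and> B \<subseteq> carrier G \<and>
      (\<forall>c :: 'a \<Rightarrow> int. finprod G (\<lambda>b. b [^]\<^bsub>G\<^esub> c b) B = \<one>\<^bsub>G\<^esub> \<longrightarrow> (\<forall>b\<in>B. c b = 0))}"
  have "Sup ?S = 1"
  proof (rule cSup_eq_maximum)
    have "1 \<in> h ` carrier G" using bij by (simp add: bij_betw_def)
    then obtain e where e: "e \<in> carrier G" "h e = 1" by (auto simp: image_iff)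
    have "\<forall>c :: 'a \<Rightarrow> int. finprod G (\<lambda>b. b [^]\<^bsub>G\<^esub> c b) {e} = \<one>\<^bsub>G\<^esub> \<longrightarrow> (\<forall>b\<in>{e}. c b = 0)"
    proof (intro allI impI)
      fix c :: "'a \<Rightarrow> int" assume "finprod G (\<lambda>b. b [^]\<^bsub>G\<^esub> c b) {e} = \<one>\<^bsub>G\<^esub>"
      then show "\<forall>b\<in>{e}. c b = 0" using fp[of "{e}" c] e by simp
    qed
    then show "1 \<in> ?S" using e by (intro CollectI exI[of _ "{e}"]) auto
  next
    fix n assume "n \<in> ?S"
    then obtain B where B: "n = card B" "finite B" "B \<subseteq> carrier G"
      "\<forall>c :: 'a \<Rightarrow> int. finprod G (\<lambda>b. b [^]\<^bsub>G\<^esub> c b) B = \<one>\<^bsub>G\<^esub> \<longrightarrow> (\<forall>b\<in>B. c b = 0)" by auto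
    have "x = y" if xy: "x \<in> B" "y \<in> B" for x y
    proof (rule ccontr)
      assume ne: "x \<noteq> y"
      define c where "c = (\<lambda>b. if b = x then h y else if b = y then - h x else 0)"
      have "(\<Sum>b\<in>B. c b * h b) = (\<Sum>b\<in>{x, y}. c b * h b)"
        using xy B(2) by (intro sum.mono_neutral_right) (auto simp: c_def)
      also have "\<dots> = 0" using ne by (simp add: c_def)
      finally have "(\<Sum>b\<in>B. c b * h b) = 0" .
      then have "finprod G (\<lambda>b. b [^]\<^bsub>G\<^esub> c b) B = \<one>\<^bsub>G\<^esub>" using fp[OF B(2,3)] by blast
      then have "\<forall>b\<in>B. c b = 0" using B(4) by blast
      then have "c x = 0" "c y = 0" using xy by auto
      then have "h x = h y" using ne by (simp_all add: c_def split: if_splits)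
      then show False using inj B(3) xy ne by blast
    qed
    then have "card B \<le> 1" using card_le_Suc0_iff_eq[OF B(2)] by simp
    then show "n \<le> 1" using B by simp
  qed
  then show ?thesis unfolding abelian_rank_def .
qed

lemma S2_homeomorphic_nsphere: "top_of_set S2 homeomorphic_space nsphere 2"
proof -
  have c: "card (Basis :: (real^3) set) = 3" by simp
  have "\<exists>(f :: (nat \<Rightarrow> real) \<Rightarrow> real^3) g.
    homeomorphic_maps (nsphere (3 - 1)) (top_of_set (sphere 0 1 \<inter> span (Basis :: (real^3) set))) f g"
    by (rule homeomorphic_maps_nsphere_euclidean_sphere[OF independent_Basis orthogonal_Basis c])
      (simp, erule norm_Basis, (rule exI)+, assumption)
  then have "nsphere (3 - 1) homeomorphic_space top_of_set (sphere 0 1 \<inter> span (Basis :: (real^3) set))"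
    unfolding homeomorphic_space_def .
  then have "nsphere 2 homeomorphic_space top_of_set S2"
    by (simp add: span_Basis)
  then show ?thesis by (subst homeomorphic_space_sym)
qed

lemma betti_S2: "betti k (top_of_set S2) = (if k = 0 \<or> k = 2 then 1 else 0)"
proof (cases "k = 0")
  case True
  have "path_connected S2" by (rule path_connected_sphere) simp
  then have "path_connectedin euclidean S2" by simp
  then have "path_connected_space (top_of_set S2)" by (simp add: path_connectedin_def)
  then have "homology_group 0 (top_of_set S2) \<cong> integer_group"
    by (intro isomorphic_integer_zeroth_homology_group) auto
  then show ?thesis using True abelian_rank_infinite_cyclic[OF abelian_homology_group] by (simp add: betti_def)
next
  case False
  have "homology_group (int k) (top_of_set S2) \<cong> homology_group (int k) (nsphere 2)"
    by (rule homeomorphic_space_imp_isomorphic_homology_groups[OF S2_homeomorphic_nsphere])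
  also have "homology_group (int k) (nsphere 2) = reduced_homology_group (int k) (nsphere 2)"
    using False by (simp add: un_reduced_homology_group)
  finally have iso: "homology_group (int k) (top_of_set S2) \<cong> reduced_homology_group (int k) (nsphere 2)" .
  show ?thesis
  proof (cases "k = 2")
    case True
    then have "homology_group (int k) (top_of_set S2) \<cong> integer_group"
      using iso_trans[OF iso] reduced_homology_group_nsphere(1)[of 2] by simp
    then show ?thesis using True abelian_rank_infinite_cyclic[OF abelian_homology_group]
      by (simp add: betti_def)
  next
    case False2: False
    then have "trivial_group (reduced_homology_group (int k) (nsphere 2))"
      by (intro reduced_homology_group_nsphere(2)) auto
    then have "trivial_group (homology_group (int k) (top_of_set S2))"
      using isomorphic_group_triviality[OF iso] by simp
    then show ?thesis using False False2 abelian_rank_trivial[OF abelian_homology_group]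
      by (simp add: betti_def)
  qed
qed

lemma euler_characteristic_S2: "euler_characteristic (top_of_set S2) = 2"
proof -
  have "{k. betti k (top_of_set S2) \<noteq> 0} = {0, 2}" by (auto simp: betti_S2)
  then show ?thesis unfolding euler_characteristic_def by (simp add: betti_S2)
qed

section \<open>Planar linear algebra and winding numbers\<close>

text \<open>The bases that occur in the definition of the Poincare--Hopf index.\<close>

definition tangent_basis :: "real^3 \<Rightarrow> real^3 \<Rightarrow> real^3 \<Rightarrow> bool"
  where "tangent_basis p e1 e2 \<longleftrightarrow>
    norm e1 = 1 \<and> norm e2 = 1 \<and> e1 \<bullet> e2 = 0 \<and> e1 \<bullet> p = 0 \<and> e2 \<bullet> p = 0"

lemma tangent_basis_exists:
  assumes "norm p = 1"
  obtains e1 e2 where "tangent_basis p e1 e2"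
proof -
  obtain T :: "real^3 \<Rightarrow> real^3" where T: "orthogonal_transformation T" "T (axis 3 1) = p"
    using orthogonal_transformation_exists[of "axis 3 1" p] assms by (auto simp: norm_axis_1)
  have "T x \<bullet> T y = x \<bullet> y" "norm (T x) = norm x" for x y
    using T(1) by (auto simp: orthogonal_transformation_def orthogonal_transformation_norm)
  then have "tangent_basis p (T (axis 1 1)) (T (axis 2 1))"
    unfolding tangent_basis_def T(2)[symmetric] by (simp add: inner_axis_axis norm_axis_1)
  then show ?thesis using that by blast
qed

lemma tangent_decompose:
  assumes b: "tangent_basis p e1 e2" and p: "norm p = 1" and v: "v \<bullet> p = 0"
  shows "v = (v \<bullet> e1) *\<^sub>R e1 + (v \<bullet> e2) *\<^sub>R e2"
proof -
  let ?B = "{p, e1, e2}"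
  have n: "p \<noteq> 0" "e1 \<noteq> 0" "e2 \<noteq> 0" using b p by (auto simp: tangent_basis_def)
  have sq: "p \<bullet> p = 1" "e1 \<bullet> e1 = 1" "e2 \<bullet> e2 = 1"
    using b p by (simp_all add: tangent_basis_def norm_eq_1)
  have d: "p \<noteq> e1" "p \<noteq> e2" "e1 \<noteq> e2" using sq b by (auto simp: tangent_basis_def)
  have o: "pairwise orthogonal ?B"
    using b by (auto simp: pairwise_def orthogonal_def tangent_basis_def inner_commute)
  have "independent ?B" using pairwise_orthogonal_independent[OF o] n by auto
  then have "span ?B = UNIV"
    using card_ge_dim_independent[of ?B UNIV] d by auto
  then have "(\<Sum>i\<in>?B. (v \<bullet> i) *\<^sub>R i) = v"
    using b p by (intro orthonormal_basis_expand[OF o]) (auto simp: tangent_basis_def)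
  then show ?thesis using d v by simp
qed

text \<open>The loop \<open>g\<close> stays closer to the circle run through \<open>k\<close> times than that circle is to 0, so both
  have the same winding number.\<close>

lemma winding_number_near_power:
  fixes k :: int
  assumes g: "path g" "pathfinish g = pathstart g"
    and near: "\<And>t. t \<in> {0..1} \<Longrightarrow> cmod (g t - \<alpha> * cis (2 * pi * k * t)) < cmod \<alpha>"
  shows "winding_number g 0 = k"
proof -
  have a0: "\<alpha> \<noteq> 0" using near[of 0] by force
  define q where "q = (\<lambda>t::real. Ln \<alpha> + 2 * pi * k * t * \<i>)"
  have eq: "exp \<circ> q = (\<lambda>t. \<alpha> * cis (2 * pi * k * t))"
    using a0 by (auto simp: q_def exp_add cis_conv_exp fun_eq_iff mult_ac)
  have "path q" unfolding path_def q_def by (intro continuous_intros)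
  from winding_number_compose_exp[OF this]
  have w: "winding_number (\<lambda>t. \<alpha> * cis (2 * pi * k * t)) 0 = k"
    unfolding eq by (simp add: pathfinish_def pathstart_def q_def field_simps)
  have "winding_number g 0 = winding_number (\<lambda>t. \<alpha> * cis (2 * pi * k * t)) 0"
  proof (rule winding_number_nearby_loops_eq)
    show "path (\<lambda>t. \<alpha> * cis (2 * pi * k * t))"
      unfolding path_def by (intro continuous_intros)
    show "pathfinish (\<lambda>t. \<alpha> * cis (2 * pi * k * t)) = pathstart (\<lambda>t. \<alpha> * cis (2 * pi * k * t))"
      by (simp add: pathfinish_def pathstart_def cis_multiple_2pi)
    show "cmod (g t - \<alpha> * cis (2 * pi * k * t)) < cmod (\<alpha> * cis (2 * pi * k * t) - 0)" if "t \<in> {0..1}" for t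
      using near[OF that] by (simp add: norm_mult)
  qed (use g in auto)
  then show ?thesis using w by simp
qed

lemma tangent_circle_in_sphere:
  assumes "norm p = 1" "tangent_basis p e1 e2" "0 \<le> r" "r \<le> 1"
  shows "tangent_circle p e1 e2 r t \<in> S2"
proof -
  have sq: "p \<bullet> p = 1" "e1 \<bullet> e1 = 1" "e2 \<bullet> e2 = 1" "e1 \<bullet> e2 = 0" "e1 \<bullet> p = 0" "e2 \<bullet> p = 0"
    "e2 \<bullet> e1 = 0" "p \<bullet> e1 = 0" "p \<bullet> e2 = 0"
    using assms by (auto simp: tangent_basis_def norm_eq_1 inner_commute)
  have "r\<^sup>2 \<le> 1" using assms by (simp add: power_le_one)
  then have s: "sqrt (1 - r\<^sup>2) * sqrt (1 - r\<^sup>2) = 1 - r\<^sup>2" by simp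
  have cs: "r * cos x * (r * cos x) + r * sin x * (r * sin x) = r\<^sup>2" for x
    by (metis (no_types) distrib_left mult.assoc mult.left_commute mult.right_neutral power2_eq_square sin_cos_squared_add2)
  have "tangent_circle p e1 e2 r t \<bullet> tangent_circle p e1 e2 r t = 1"
    using s cs[of "2 * pi * t"] unfolding tangent_circle_def
    by (simp add: inner_add_left inner_add_right sq)
  then show ?thesis by (simp add: norm_eq_1)
qed

text \<open>The off-diagonal entries \<open>B\<close>, \<open>C\<close> need not agree: the determinant only gains
  \<open>(B - C)\<^sup>2 / 4\<close> over that of the symmetric part.\<close>

lemma definite_det_pos:
  fixes A B C E :: real
  assumes "\<And>a b. (a, b) \<noteq> (0, 0) \<Longrightarrow> A * a^2 + (B + C) * a * b + E * b^2 > 0"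
  shows "A * E - B * C > 0"
proof -
  have A: "A > 0" using assms[of 1 0] by simp
  have "4 * A^2 * E - A * (B + C)^2 > 0"
    using assms[of "B + C" "- 2 * A"] A by (simp add: power2_eq_square algebra_simps)
  then have "A * (4 * A * E - (B + C)^2) > 0" by (simp add: power2_eq_square algebra_simps)
  then have "4 * A * E - (B + C)^2 > 0" using A by (simp add: zero_less_mult_iff)
  moreover have "(B + C)^2 - 4 * (B * C) = (B - C)^2" by (simp add: power2_eq_square algebra_simps)
  moreover have "(B - C)^2 \<ge> 0" by simp
  ultimately show ?thesis by linarith
qed

lemma indefinite_det_neg:
  fixes A B E :: real
  assumes "A * a^2 + 2 * B * a * b + E * b^2 > 0" "A * c^2 + 2 * B * c * d + E * d^2 < 0"
  shows "A * E - B * B < 0"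
proof (rule ccontr)
  assume "\<not> ?thesis"
  then have n: "A * E - B * B \<ge> 0" by simp
  have id: "A * (A * x^2 + 2 * B * x * y + E * y^2) = (A * x + B * y)^2 + (A * E - B * B) * y^2" for x y
    by (simp add: power2_eq_square algebra_simps)
  have A: "A * (A * x^2 + 2 * B * x * y + E * y^2) \<ge> 0" for x y unfolding id using n by simp
  show False
  proof (cases "A = 0")
    case True
    then have "B = 0" using n by (simp add: not_le[symmetric] zero_le_mult_iff) (metis linorder_neqE_linordered_idom mult_pos_pos mult_neg_neg not_le)
    then have "E * b^2 > 0" "E * d^2 < 0" using assms True by auto
    then show False by (metis mult_less_0_iff not_less_iff_gr_or_eq zero_less_mult_iff zero_le_power2 not_le)
  next
    case False
    then show False using A[of a b] A[of c d] assms by (simp add: zero_le_mult_iff)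
  qed
qed

section \<open>Critical points of functions on the sphere\<close>

text \<open>A function on the sphere is studied through a twice differentiable extension \<open>F\<close> to the whole
  space, with gradient \<open>D\<close> and derivative \<open>J\<close> of the gradient.\<close>

locale sphere_fun =
  fixes f F :: "real^3 \<Rightarrow> real" and D :: "real^3 \<Rightarrow> real^3" and J :: "real^3 \<Rightarrow> real^3 \<Rightarrow> real^3"
  assumes f_eq: "\<And>u. u \<in> S2 \<Longrightarrow> f u = F u"
    and dF: "\<And>x. (F has_derivative (\<lambda>h. h \<bullet> D x)) (at x)"
    and dD: "\<And>x. (D has_derivative J x) (at x)"
begin

text \<open>The tangential part of the gradient, defined on all of space so that it can be differentiated
  there; on the sphere it is the gradient field (\<open>sphere_grad_eq\<close>).\<close>

definition W :: "real^3 \<Rightarrow> real^3"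
  where "W u = D u - (D u \<bullet> u) *\<^sub>R u"

lemma gderiv_radial:
  assumes u: "u \<in> S2"
  shows "GDERIV (\<lambda>x. f (x /\<^sub>R norm x)) u :> W u"
proof -
  have u1: "norm u = 1" "u \<noteq> 0" using u by auto
  have n: "((\<lambda>x. x /\<^sub>R norm x) has_derivative (\<lambda>h. h - (h \<bullet> u) *\<^sub>R u)) (at u)"
  proof -
    have "((\<lambda>x. inverse (norm x)) has_derivative
       (\<lambda>h. - (inverse (norm u) * (h \<bullet> sgn u) * inverse (norm u)))) (at u)"
      by (rule Deriv.has_derivative_inverse[OF _ has_derivative_norm]) (use u1 in auto)
    from has_derivative_scaleR[OF this has_derivative_ident]
    show ?thesis using u1 by (simp add: sgn_div_norm)
  qed
  have "(F has_derivative (\<lambda>h. h \<bullet> D u)) (at (u /\<^sub>R norm u))" using dF[of u] u1 by simp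
  from diff_chain_at[OF n this]
  have "((\<lambda>x. F (x /\<^sub>R norm x)) has_derivative (\<lambda>h. (h - (h \<bullet> u) *\<^sub>R u) \<bullet> D u)) (at u)"
    by (simp add: o_def)
  then have "((\<lambda>x. f (x /\<^sub>R norm x)) has_derivative (\<lambda>h. (h - (h \<bullet> u) *\<^sub>R u) \<bullet> D u)) (at u)"
    by (rule has_derivative_transform_within_open[OF _ open_Compl[OF closed_singleton[of 0]]])
      (use u1 in \<open>auto simp: f_eq\<close>)
  moreover have "(\<lambda>h. (h - (h \<bullet> u) *\<^sub>R u) \<bullet> D u) = (\<lambda>h. h \<bullet> W u)"
    by (auto simp: W_def inner_diff_left inner_diff_right inner_commute fun_eq_iff)
  ultimately show ?thesis unfolding gderiv_def by simp
qed

lemma gderiv_unique: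
  assumes "GDERIV (g :: real^3 \<Rightarrow> real) u :> a" "GDERIV g u :> b"
  shows "a = b"
proof -
  have "(\<lambda>h. h \<bullet> a) = (\<lambda>h. h \<bullet> b)"
    using assms has_derivative_unique unfolding gderiv_def by blast
  then have "(a - b) \<bullet> a = (a - b) \<bullet> b" by metis
  then have "(a - b) \<bullet> (a - b) = 0" by (simp add: inner_diff_right)
  then show ?thesis by simp
qed

lemma sphere_grad_eq: "u \<in> S2 \<Longrightarrow> sphere_grad f u = W u"
  unfolding sphere_grad_def using gderiv_radial gderiv_unique by (intro the_equality) blast+

lemma critical_iff: "u \<in> critical_points f \<longleftrightarrow> u \<in> S2 \<and> W u = 0"
proof
  assume u: "u \<in> critical_points f"
  then have uS: "u \<in> S2" "GDERIV (\<lambda>x. f (x /\<^sub>R norm x)) u :> 0" by (auto simp: critical_points_def)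
  then show "u \<in> S2 \<and> W u = 0" using gderiv_unique[OF gderiv_radial[OF uS(1)] uS(2)] by simp
next
  assume u: "u \<in> S2 \<and> W u = 0"
  then show "u \<in> critical_points f" using gderiv_radial[of u] by (auto simp: critical_points_def)
qed

lemma sphere_grad_eq_0_iff: "u \<in> S2 \<Longrightarrow> sphere_grad f u = 0 \<longleftrightarrow> u \<in> critical_points f"
  by (simp add: sphere_grad_eq critical_iff)

lemma eventually_sphere_grad_nonzero:
  assumes "finite (critical_points f)" "p \<in> S2"
  shows "\<forall>\<^sub>F u in at p within S2. sphere_grad f u \<noteq> 0"
proof -
  have "\<not> p islimpt critical_points f" using assms by (simp add: islimpt_finite)
  then have "\<forall>\<^sub>F u in at p. u \<notin> critical_points f"
    unfolding islimpt_iff_eventually by simp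
  then have "\<forall>\<^sub>F u in at p within S2. u \<notin> critical_points f"
    using at_le[of S2 UNIV p] by (auto simp: le_filter_def)
  moreover have "\<forall>\<^sub>F u in at p within S2. u \<in> S2" by (simp add: eventually_at_filter)
  ultimately show ?thesis
    by eventually_elim (simp add: sphere_grad_eq_0_iff)
qed

text \<open>The derivative of the field \<open>W\<close>. At a critical point it is the Hessian on tangent vectors.\<close>

definition H :: "real^3 \<Rightarrow> real^3 \<Rightarrow> real^3"
  where "H p v = J p v - (J p v \<bullet> p + D p \<bullet> v) *\<^sub>R p - (D p \<bullet> p) *\<^sub>R v"

text \<open>The quadratic form of the Hessian on tangent vectors. The second term is the curvature of the
  sphere: moving along a geodesic bends towards the centre.\<close>

definition Q :: "real^3 \<Rightarrow> real^3 \<Rightarrow> real"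
  where "Q p v = J p v \<bullet> v - (D p \<bullet> p) * (v \<bullet> v)"

lemma W_deriv: "(W has_derivative H p) (at p)"
proof -
  have "((\<lambda>u. D u - (D u \<bullet> u) *\<^sub>R u) has_derivative
     (\<lambda>v. J p v - ((D p \<bullet> p) *\<^sub>R v + (D p \<bullet> v + J p v \<bullet> p) *\<^sub>R p))) (at p)"
    by (intro has_derivative_diff has_derivative_scaleR has_derivative_inner has_derivative_ident dD)
  moreover have "W = (\<lambda>u. D u - (D u \<bullet> u) *\<^sub>R u)" by (auto simp: W_def)
  moreover have "H p = (\<lambda>v. J p v - ((D p \<bullet> p) *\<^sub>R v + (D p \<bullet> v + J p v \<bullet> p) *\<^sub>R p))"
    by (auto simp: H_def fun_eq_iff algebra_simps)
  ultimately show ?thesis by simp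
qed

lemma sphere_grad_deriv:
  assumes "p \<in> S2"
  shows "(sphere_grad f has_derivative H p) (at p within S2)"
  by (rule has_derivative_transform[OF assms _ has_derivative_at_withinI[OF W_deriv]])
    (simp add: sphere_grad_eq)

lemma linear_H: "linear (H p)" using W_deriv has_derivative_linear by blast

lemma linear_J: "linear (J p)" using dD has_derivative_linear by blast

lemma critical_normal:
  assumes "p \<in> critical_points f" "v \<bullet> p = 0"
  shows "D p \<bullet> v = 0" "H p v \<bullet> p = 0" "H p v \<bullet> v = Q p v"
proof -
  have p: "p \<bullet> p = 1" "W p = 0" using assms by (auto simp: critical_iff norm_eq_1)
  then have "D p = (D p \<bullet> p) *\<^sub>R p" by (simp add: W_def)
  then show d: "D p \<bullet> v = 0" using assms(2) by (metis inner_commute inner_scaleR_left mult_zero_right)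
  show "H p v \<bullet> p = 0" using p assms(2) d by (simp add: H_def inner_diff_left)
  show "H p v \<bullet> v = Q p v" using assms(2) d
    by (simp add: H_def Q_def inner_diff_left) (simp add: inner_commute)
qed

lemma W_expansion:
  assumes "W p = 0" "0 < \<epsilon>"
  obtains d where "d > 0" "\<And>u. norm (u - p) < d \<Longrightarrow> norm (W u - H p (u - p)) \<le> \<epsilon> * norm (u - p)"
proof -
  have "\<exists>d>0. \<forall>u. norm (u - p) < d \<longrightarrow> norm (W u - W p - H p (u - p)) \<le> \<epsilon> * norm (u - p)"
    using W_deriv[of p] assms(2) unfolding has_derivative_at_alt by blast
  then obtain d where "d > 0" "\<And>u. norm (u - p) < d \<Longrightarrow> norm (W u - W p - H p (u - p)) \<le> \<epsilon> * norm (u - p)"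
    by blast
  then show ?thesis using that[of d] assms(1) by simp
qed

lemma curve_bound:
  assumes p: "p \<in> S2" and v: "v \<bullet> p = 0" "norm v = 1"
  shows "norm (cos t *\<^sub>R p + sin t *\<^sub>R v - p) \<le> \<bar>t\<bar>"
proof -
  have pv: "p \<bullet> p = 1" "v \<bullet> v = 1" "p \<bullet> v = 0" using assms by (auto simp: norm_eq_1 inner_commute)
  have "(norm (cos t *\<^sub>R p + sin t *\<^sub>R v - p))\<^sup>2 = (cos t - 1)^2 + (sin t)^2"
    unfolding power2_norm_eq_inner using v pv
    by (simp add: inner_diff_left inner_diff_right inner_add_left inner_add_right power2_eq_square algebra_simps)
  also have "\<dots> = 2 - 2 * cos t" using sin_cos_squared_add[of t] by (simp add: power2_eq_square algebra_simps)
  also have "\<dots> = (2 * sin (t/2))^2" using cos_double_sin[of "t/2"] by (simp add: power2_eq_square)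
  also have "\<dots> \<le> t^2"
  proof -
    have "\<bar>2 * sin (t/2)\<bar> \<le> \<bar>t\<bar>" using abs_sin_x_le_abs_x[of "t/2"] by simp
    then show ?thesis by (rule abs_le_square_iff[THEN iffD1])
  qed
  finally show ?thesis by (metis abs_le_square_iff abs_norm_cancel)
qed

text \<open>Along the geodesic with initial velocity \<open>v\<close> the derivative of \<open>F\<close> at time \<open>t\<close> is
  \<open>t Q p v + o(t)\<close>, uniformly in \<open>v\<close>. Uniformity is what makes the result usable for all nearby points
  at once.\<close>

lemma increasing_along_geodesics:
  assumes p: "p \<in> critical_points f" and c: "c > 0" and sg: "\<sigma> = 1 \<or> \<sigma> = (-1::real)"
  shows "\<exists>t0>0. t0 < pi \<and> (\<forall>v t. v \<bullet> p = 0 \<and> norm v = 1 \<and> c \<le> \<sigma> * Q p v \<and> 0 < t \<and> t < t0 \<longrightarrow>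
    \<sigma> * (F (cos t *\<^sub>R p + sin t *\<^sub>R v) - F p) > 0)"
proof -
  have pS: "p \<in> S2" "W p = 0" using p by (auto simp: critical_iff)
  then have pp: "p \<bullet> p = 1" by (simp add: norm_eq_1)
  obtain d where d: "d > 0" "\<And>u. norm (u - p) < d \<Longrightarrow> norm (W u - H p (u - p)) \<le> c/8 * norm (u - p)"
    using W_expansion[OF pS(2), of "c/8"] c by auto
  define K where "K = norm (H p p) + 1"
  have K: "K > 0" unfolding K_def by (smt (verit) norm_ge_zero)
  define t0 where "t0 = Min {d, 1, c / (8 * K)}"
  have t0: "t0 > 0" "t0 \<le> d" "t0 \<le> 1" "t0 \<le> c / (8 * K)" using d c K by (auto simp: t0_def)
  show ?thesis
  proof (intro exI[of _ t0] conjI allI impI)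
    show "t0 > 0" by (rule t0(1))
    show "t0 < pi" using t0(3) pi_gt3 by linarith
    fix v t assume "v \<bullet> p = 0 \<and> norm v = 1 \<and> c \<le> \<sigma> * Q p v \<and> 0 < t \<and> t < t0"
    then have v: "v \<bullet> p = 0" "norm v = 1" and Qv: "c \<le> \<sigma> * Q p v" and t: "0 < t" "t < t0" by auto
    have vv: "v \<bullet> v = 1" using v by (simp add: norm_eq_1)
    define cc where "cc = (\<lambda>s. cos s *\<^sub>R p + sin s *\<^sub>R v)"
    define c' where "c' = (\<lambda>s. (- sin s) *\<^sub>R p + cos s *\<^sub>R v)"
    have dc: "(cc has_derivative (\<lambda>h. h *\<^sub>R c' s)) (at s)" for s
      unfolding cc_def c'_def
      by (auto intro!: derivative_eq_intros simp: algebra_simps)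
    define h where "h = (\<lambda>s. \<sigma> * F (cc s))"
    have dh: "(h has_real_derivative \<sigma> * (W (cc s) \<bullet> c' s)) (at s)" for s
    proof -
      have "(F \<circ> cc has_derivative (\<lambda>h. h \<bullet> D (cc s)) \<circ> (\<lambda>h. h *\<^sub>R c' s)) (at s)"
        by (rule diff_chain_at[OF dc dF])
      then have "((\<lambda>s. F (cc s)) has_real_derivative (D (cc s) \<bullet> c' s)) (at s)"
        unfolding has_field_derivative_def by (simp add: o_def inner_commute mult_commute_abs)
      moreover have "cc s \<bullet> c' s = 0"
        unfolding cc_def c'_def using v pp vv
        by (simp add: inner_add_left inner_add_right inner_commute algebra_simps)
      then have "D (cc s) \<bullet> c' s = W (cc s) \<bullet> c' s" by (simp add: W_def inner_diff_left)
      ultimately show ?thesis unfolding h_def by (auto intro!: DERIV_cmult)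
    qed
    have pos: "\<sigma> * (W (cc s) \<bullet> c' s) > 0" if s: "0 < s" "s \<le> t" for s
    proof -
      have s1: "s < d" "s < 1" "s < c / (8 * K)" using s t t0 by linarith+
      have nb: "norm (cc s - p) \<le> s" using curve_bound[OF pS(1) v, of s] s unfolding cc_def by simp
      then have "norm (W (cc s) - H p (cc s - p)) \<le> c/8 * norm (cc s - p)" using d(2) s1 by simp
      also have "\<dots> \<le> c/8 * s" using nb c by simp
      finally have e: "norm (W (cc s) - H p (cc s - p)) \<le> c/8 * s" .
      have nc: "norm (c' s) = 1"
      proof -
        have "c' s \<bullet> c' s = 1" unfolding c'_def using v pp vv sin_cos_squared_add[of s]
          by (simp add: inner_add_left inner_add_right inner_commute algebra_simps power2_eq_square)
        then show ?thesis by (simp add: norm_eq_1)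
      qed
      have "\<bar>(W (cc s) - H p (cc s - p)) \<bullet> c' s\<bar> \<le> c/8 * s"
        using Cauchy_Schwarz_ineq2[of "W (cc s) - H p (cc s - p)" "c' s"] e nc by simp
      then have A: "\<bar>W (cc s) \<bullet> c' s - H p (cc s - p) \<bullet> c' s\<bar> \<le> c/8 * s" by (simp add: inner_diff_left)
      have "cc s - p = (cos s - 1) *\<^sub>R p + sin s *\<^sub>R v" by (simp add: cc_def algebra_simps)
      then have Hc: "H p (cc s - p) = (cos s - 1) *\<^sub>R H p p + sin s *\<^sub>R H p v"
        by (simp add: linear_add[OF linear_H] linear_cmul[OF linear_H])
      have B: "H p (cc s - p) \<bullet> c' s = (cos s - 1) * (H p p \<bullet> c' s) + sin s * cos s * Q p v"
        unfolding Hc using critical_normal[OF p v(1)]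
        by (simp add: inner_add_left c'_def inner_diff_right algebra_simps)
      have c1: "\<bar>cos s - 1\<bar> \<le> s * s / 2"
      proof -
        have "\<bar>sin (s/2)\<bar> \<le> \<bar>s/2\<bar>" by (rule abs_sin_x_le_abs_x)
        then have "(sin (s/2))^2 \<le> (s/2)^2" by (rule abs_le_square_iff[THEN iffD1])
        moreover have "cos s = 1 - 2 * (sin (s/2))^2" using cos_double_sin[of "s/2"] by simp
        ultimately show ?thesis by (simp add: power2_eq_square)
      qed
      have "\<bar>(cos s - 1) * (H p p \<bullet> c' s)\<bar> \<le> (s * s / 2) * K"
      proof -
        have "\<bar>H p p \<bullet> c' s\<bar> \<le> K" using Cauchy_Schwarz_ineq2[of "H p p" "c' s"] nc by (simp add: K_def)
        then show ?thesis unfolding abs_mult using c1 by (intro mult_mono) auto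
      qed
      also have "\<dots> \<le> s * (c / 16)"
      proof -
        have "s * K \<le> c / 8" using s1(3) K by (simp add: field_simps)
        then have "s * (s * K) \<le> s * (c / 8)" using s by (intro mult_left_mono) auto
        then show ?thesis by (simp add: mult_ac)
      qed
      finally have C: "\<bar>(cos s - 1) * (H p p \<bullet> c' s)\<bar> \<le> s * (c / 16)" .
      have "sin s * cos s \<ge> s / 4"
      proof -
        have "cos s \<ge> 1/2" using c1 s s1 mult_strict_mono[of s 1 s 1] by auto
        moreover have "sin s \<ge> s / 2"
        proof -
          obtain z where z: "0 < z" "z < s" "sin s - sin 0 = (s - 0) * cos z"
            using MVT2[of 0 s sin cos] s by (auto intro: DERIV_sin)
          have "cos s \<le> cos z" using z s1 pi_gt3 by (intro cos_monotone_0_pi_le) auto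
          then have "1/2 \<le> cos z" using \<open>cos s \<ge> 1/2\<close> by linarith
          then have "s * (1/2) \<le> s * cos z" using s by (intro mult_left_mono) auto
          then show ?thesis using z(3) by simp
        qed
        ultimately have "s/2 * (1/2) \<le> sin s * cos s" using s by (intro mult_mono) auto
        then show ?thesis by simp
      qed
      then have "s/4 * c \<le> sin s * cos s * (\<sigma> * Q p v)" using Qv s c by (intro mult_mono) auto
      then have E: "s/4 * c \<le> \<sigma> * (sin s * cos s * Q p v)" by (simp add: mult_ac)
      have "\<sigma> * (W (cc s) \<bullet> c' s) \<ge> \<sigma> * (sin s * cos s * Q p v) - c/8 * s - s * (c/16)"
        using sg A[unfolded B] C by (elim disjE) (simp_all only: mult_1 mult_minus1 abs_le_iff; linarith)+
      moreover have "s * c > 0" using s c by simp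
      ultimately show ?thesis using E by (simp add: mult.commute)
    qed
    have "h 0 < h t"
    proof (rule DERIV_pos_imp_increasing_open[OF t(1)])
      show "\<exists>y. (h has_real_derivative y) (at x) \<and> 0 < y" if "0 < x" "x < t" for x
        using dh pos that by (meson less_imp_le)
      show "continuous_on {0..t} h"
        by (intro continuous_at_imp_continuous_on ballI DERIV_isCont[OF dh])
    qed
    then show "\<sigma> * (F (cos t *\<^sub>R p + sin t *\<^sub>R v) - F p) > 0"
      by (simp add: h_def cc_def algebra_simps)
  qed
qed
end

context sphere_fun begin

lemma near_point_geodesic:
  assumes p: "norm p = 1" and u: "u \<in> S2" "u \<noteq> p" and t0: "0 < t0" "t0 < pi" "cos t0 < u \<bullet> p"
  obtains v t where "v \<bullet> p = 0" "norm v = 1" "0 < t" "t < t0" "u = cos t *\<^sub>R p + sin t *\<^sub>R v"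
proof -
  have pp: "p \<bullet> p = 1" "u \<bullet> u = 1" using p u by (auto simp: norm_eq_1)
  have "(u - p) \<bullet> (u - p) > 0" using u by simp
  then have x1: "u \<bullet> p < 1" using pp by (simp add: inner_diff_left inner_diff_right inner_commute)
  have x2: "-1 < u \<bullet> p" using t0 cos_ge_minus_one[of t0] by linarith
  define t where "t = arccos (u \<bullet> p)"
  have ct: "cos t = u \<bullet> p" using x1 x2 by (simp add: t_def)
  have tb: "0 < t" "t < pi" using arccos_lt_bounded[of "u \<bullet> p"] x1 x2 by (auto simp: t_def)
  have tt0: "t < t0"
  proof (rule ccontr)
    assume "\<not> t < t0"
    then have "cos t \<le> cos t0" using t0 tb by (intro cos_monotone_0_pi_le) auto
    then show False using ct t0 by simp
  qed
  have st: "sin t > 0" using tb by (rule sin_gt_zero)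
  define v where "v = (1 / sin t) *\<^sub>R (u - (u \<bullet> p) *\<^sub>R p)"
  have "v \<bullet> p = 0" using pp by (simp add: v_def inner_diff_left)
  moreover have "norm v = 1"
  proof -
    have s2: "(sin t)^2 = 1 - (u \<bullet> p)^2" using sin_cos_squared_add[of t] ct by simp
    have "(u - (u \<bullet> p) *\<^sub>R p) \<bullet> (u - (u \<bullet> p) *\<^sub>R p) = (sin t)^2"
      unfolding s2 using pp by (simp add: inner_diff_left inner_diff_right inner_commute power2_eq_square)
    then have "v \<bullet> v = 1" using st by (simp add: v_def power2_eq_square)
    then show ?thesis by (simp add: norm_eq_1)
  qed
  moreover have "u = cos t *\<^sub>R p + sin t *\<^sub>R v" using st by (simp add: v_def ct)
  ultimately show ?thesis using that tb(1) tt0 by blast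
qed

lemma continuous_on_Q: "continuous_on S (Q p)"
proof -
  have "continuous_on S (J p)" using linear_J by (intro linear_continuous_on) (simp add: linear_conv_bounded_linear)
  then show ?thesis unfolding Q_def by (intro continuous_intros)
qed

text \<open>By compactness of the unit tangent circle the form \<open>\<sigma> Q p\<close> has a positive lower bound, and every
  nearby point lies on a short geodesic from \<open>p\<close>.\<close>

lemma definite_critical_strict:
  assumes p: "p \<in> critical_points f" and sg: "\<sigma> = 1 \<or> \<sigma> = (-1::real)"
    and def: "\<And>v. v \<bullet> p = 0 \<Longrightarrow> v \<noteq> 0 \<Longrightarrow> \<sigma> * Q p v > 0"
  shows "\<forall>\<^sub>F u in at p within S2. \<sigma> * (f u - f p) > 0"
proof -
  have pS: "p \<in> S2" "norm p = 1" using p by (auto simp: critical_iff)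
  let ?T = "sphere 0 1 \<inter> {v. v \<bullet> p = 0}"
  have "closed {v. v \<bullet> p = 0}" by (intro closed_Collect_eq continuous_intros)
  then have cT: "compact ?T" by (intro compact_Int_closed) auto
  obtain e1 e2 where "tangent_basis p e1 e2" using tangent_basis_exists pS by blast
  then have "e1 \<in> ?T" by (auto simp: tangent_basis_def)
  then have nT: "?T \<noteq> {}" by blast
  have "continuous_on ?T (\<lambda>v. \<sigma> * Q p v)" by (intro continuous_intros continuous_on_Q)
  from continuous_attains_inf[OF cT nT this]
  obtain v0 where v0: "v0 \<in> ?T" "\<forall>v\<in>?T. \<sigma> * Q p v0 \<le> \<sigma> * Q p v" by blast
  define c where "c = \<sigma> * Q p v0"
  have c: "c > 0" unfolding c_def using v0(1) by (intro def) auto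
  obtain t0 where t0: "t0 > 0" "t0 < pi" "\<forall>v t. v \<bullet> p = 0 \<and> norm v = 1 \<and> c \<le> \<sigma> * Q p v \<and> 0 < t \<and> t < t0 \<longrightarrow>
    \<sigma> * (F (cos t *\<^sub>R p + sin t *\<^sub>R v) - F p) > 0"
    using increasing_along_geodesics[OF p c sg] by blast
  have "cos t0 < 1" using cos_monotone_0_pi[of 0 t0] t0 by simp
  then have "cos t0 < p \<bullet> p" using pS by (simp add: norm_eq_1)
  then have "\<forall>\<^sub>F u in at p within S2. cos t0 < u \<bullet> p"
    by (intro order_tendstoD(1)[of "\<lambda>u. u \<bullet> p" "p \<bullet> p"] tendsto_intros)
  moreover have "\<forall>\<^sub>F u in at p within S2. u \<in> S2 \<and> u \<noteq> p" by (simp add: eventually_at_filter)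
  ultimately show ?thesis
  proof eventually_elim
    case (elim u)
    then have u: "u \<in> S2" "u \<noteq> p" "cos t0 < u \<bullet> p" by auto
    obtain v t where vt: "v \<bullet> p = 0" "norm v = 1" "0 < t" "t < t0" "u = cos t *\<^sub>R p + sin t *\<^sub>R v"
      by (rule near_point_geodesic[OF pS(2) u(1,2) t0(1,2) u(3)])
    have "c \<le> \<sigma> * Q p v" unfolding c_def using v0(2) vt by auto
    then show "\<sigma> * (f u - f p) > 0"
      using t0(3) vt(1-4) u(1) pS(1) by (simp add: f_eq vt(5))
  qed
qed

lemma at_within_S2_nontrivial: "p \<in> S2 \<Longrightarrow> at p within S2 \<noteq> bot"
proof -
  assume "p \<in> S2"
  then have "- p \<in> S2" by simp
  have "- p \<noteq> p"
  proof
    assume "- p = p"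
    then have "2 *\<^sub>R p = 0" by (metis add.right_inverse scaleR_2)
    then show False using \<open>p \<in> S2\<close> by auto
  qed
  have "connected S2" by (rule connected_sphere) simp
  then have "p islimpt S2"
  proof (rule connected_imp_perfect[OF _ \<open>p \<in> S2\<close>])
    show "S2 \<noteq> {x}" for x
      using \<open>p \<in> S2\<close> \<open>- p \<in> S2\<close> \<open>- p \<noteq> p\<close> by (metis singletonD)
  qed
  then show ?thesis by (simp add: trivial_limit_within)
qed

lemma critical_not_extremum_if:
  assumes p: "p \<in> critical_points f" and sg: "\<sigma> = 1 \<or> \<sigma> = (-1::real)"
    and v: "v \<bullet> p = 0" "\<sigma> * Q p v > 0"
  shows "\<not> (\<forall>\<^sub>F u in at p within S2. \<sigma> * (f u - f p) \<le> 0)"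
proof
  assume ev: "\<forall>\<^sub>F u in at p within S2. \<sigma> * (f u - f p) \<le> 0"
  have pS: "p \<in> S2" "norm p = 1" using p by (auto simp: critical_iff)
  have "v \<noteq> 0" using v by (auto simp: Q_def)
  define w where "w = v /\<^sub>R norm v"
  have w: "w \<bullet> p = 0" "norm w = 1" using v \<open>v \<noteq> 0\<close> by (auto simp: w_def)
  have "Q p w = Q p v / (norm v)^2"
    by (simp add: Q_def w_def linear_cmul[OF linear_J] power2_eq_square divide_inverse algebra_simps)
  then have c: "\<sigma> * Q p w > 0" using v \<open>v \<noteq> 0\<close> by (simp add: zero_less_divide_iff)
  obtain t0 where t0: "t0 > 0" "t0 < pi" "\<forall>v t. v \<bullet> p = 0 \<and> norm v = 1 \<and> \<sigma> * Q p w \<le> \<sigma> * Q p v \<and> 0 < t \<and> t < t0 \<longrightarrow>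
    \<sigma> * (F (cos t *\<^sub>R p + sin t *\<^sub>R v) - F p) > 0"
    using increasing_along_geodesics[OF p c sg] by blast
  then have inc: "\<And>t. 0 < t \<Longrightarrow> t < t0 \<Longrightarrow> \<sigma> * (F (cos t *\<^sub>R p + sin t *\<^sub>R w) - F p) > 0"
    using w by blast
  define cc where "cc = (\<lambda>t. cos t *\<^sub>R p + sin t *\<^sub>R w)"
  have ccS: "cc t \<in> S2" for t
  proof -
    have "p \<bullet> p = 1" "w \<bullet> w = 1" using pS w by (auto simp: norm_eq_1)
    then have "cc t \<bullet> cc t = 1" using w(1) sin_cos_squared_add[of t]
      by (simp add: cc_def inner_add_left inner_add_right inner_commute power2_eq_square add.commute)
    then show ?thesis by (simp add: norm_eq_1)
  qed
  have pos: "\<forall>\<^sub>F t in at_right 0. \<sigma> * (f (cc t) - f p) > 0"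
    using eventually_at_right_real[OF t0(1)]
  proof eventually_elim
    case (elim t)
    then show ?case using inc[of t] ccS[of t] pS by (simp add: f_eq cc_def)
  qed
  have "filterlim cc (at p within S2) (at_right 0)"
    unfolding filterlim_at
  proof
    show "\<forall>\<^sub>F t in at_right 0. cc t \<in> S2 \<and> cc t \<noteq> p" using pos by eventually_elim (use ccS in auto)
    have "(cc \<longlongrightarrow> cos 0 *\<^sub>R p + sin 0 *\<^sub>R w) (at_right 0)" unfolding cc_def by (intro tendsto_intros)
    then show "(cc \<longlongrightarrow> p) (at_right 0)" by simp
  qed
  then have "\<forall>\<^sub>F t in at_right 0. \<sigma> * (f (cc t) - f p) \<le> 0"
    by (rule eventually_compose_filterlim[OF ev])
  with pos have "\<forall>\<^sub>F t in at_right (0::real). False" by eventually_elim simp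
  then show False by simp
qed

text \<open>The index is the winding number of the field along a small circle, and a field close to
  \<open>\<alpha> r^n e^(i k \<tau>)\<close> has winding number \<open>k\<close>. Allowing an arbitrary order \<open>n\<close> of vanishing covers
  degenerate critical points.\<close>

lemma has_ph_index_near_power:
  fixes k :: int
  assumes p: "p \<in> S2" and nz: "\<forall>\<^sub>F u in at p within S2. sphere_grad f u \<noteq> 0"
    and near: "\<And>e1 e2. tangent_basis p e1 e2 \<Longrightarrow> \<exists>\<alpha> n. \<forall>\<^sub>F r in at_right 0. \<forall>t.
      cmod (Complex (W (tangent_circle p e1 e2 r t) \<bullet> e1) (W (tangent_circle p e1 e2 r t) \<bullet> e2)
        - of_real (r ^ n) * \<alpha> * cis (2 * pi * k * t)) < r ^ n * cmod \<alpha>"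
  shows "has_ph_index (sphere_grad f) p k"
  unfolding has_ph_index_def
proof (intro conjI allI impI)
  fix e1 e2
  assume "norm e1 = 1 \<and> norm e2 = 1 \<and> e1 \<bullet> e2 = 0 \<and> e1 \<bullet> p = 0 \<and> e2 \<bullet> p = 0"
  then have b: "tangent_basis p e1 e2" by (simp add: tangent_basis_def)
  obtain \<alpha> n where an: "\<forall>\<^sub>F r in at_right 0. \<forall>t.
      cmod (Complex (W (tangent_circle p e1 e2 r t) \<bullet> e1) (W (tangent_circle p e1 e2 r t) \<bullet> e2)
        - of_real (r ^ n) * \<alpha> * cis (2 * pi * k * t)) < r ^ n * cmod \<alpha>" using near[OF b] by blast
  have "\<forall>\<^sub>F r in at_right (0::real). 0 < r \<and> r < 1"
    using eventually_at_right_real[of 0 1] by simp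
  with an show "\<forall>\<^sub>F r in at_right 0.
        winding_number
          (\<lambda>t. Complex (sphere_grad f (tangent_circle p e1 e2 r t) \<bullet> e1)
            (sphere_grad f (tangent_circle p e1 e2 r t) \<bullet> e2)) 0 = of_int k"
  proof eventually_elim
    case (elim r)
    have c: "tangent_circle p e1 e2 r t \<in> S2" for t
      using tangent_circle_in_sphere[OF _ b] p elim by simp
    let ?g = "\<lambda>t. Complex (W (tangent_circle p e1 e2 r t) \<bullet> e1) (W (tangent_circle p e1 e2 r t) \<bullet> e2)"
    have contW: "continuous_on UNIV W"
      by (intro continuous_at_imp_continuous_on ballI has_derivative_continuous[OF W_deriv])
    have "continuous_on {0..1} (tangent_circle p e1 e2 r)"
      unfolding tangent_circle_def by (intro continuous_intros)
    then have cW: "continuous_on {0..1} (\<lambda>t. W (tangent_circle p e1 e2 r t))"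
      using continuous_on_compose2[OF contW] by blast
    have "winding_number ?g 0 = of_int k"
    proof (rule winding_number_near_power)
      show "path ?g" unfolding path_def Complex_eq by (intro continuous_intros cW)
      show "pathfinish ?g = pathstart ?g"
        by (simp add: pathfinish_def pathstart_def tangent_circle_def)
      show "cmod (?g t - (of_real (r ^ n) * \<alpha>) * cis (2 * pi * k * t)) < cmod (of_real (r ^ n) * \<alpha>)" for t
        using elim by (simp add: norm_mult norm_power)
    qed
    then show ?case using c by (simp add: sphere_grad_eq)
  qed
qed (use p nz in auto)

text \<open>A real linear map of the plane is \<open>\<zeta> \<mapsto> \<alpha> \<zeta> + \<beta> cnj \<zeta>\<close> with determinant \<open>|\<alpha>|\<^sup>2 - |\<beta>|\<^sup>2\<close>. The larger
  of the two terms dominates along the circle, where it turns once, forwards or backwards.\<close>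

lemma has_ph_index_det:
  fixes s :: int
  assumes p: "p \<in> critical_points f" and nz: "\<forall>\<^sub>F u in at p within S2. sphere_grad f u \<noteq> 0"
    and s: "s = 1 \<or> s = -1"
    and det: "\<And>e1 e2. tangent_basis p e1 e2 \<Longrightarrow>
      s * ((H p e1 \<bullet> e1) * (H p e2 \<bullet> e2) - (H p e2 \<bullet> e1) * (H p e1 \<bullet> e2)) > 0"
  shows "has_ph_index (sphere_grad f) p s"
proof (rule has_ph_index_near_power[OF _ nz])
  show pS: "p \<in> S2" using p by (simp add: critical_iff)
  have pn: "norm p = 1" using pS by simp
  fix e1 e2 assume b: "tangent_basis p e1 e2"
  define A11 A22 A12 A21 where "A11 = H p e1 \<bullet> e1" and "A22 = H p e2 \<bullet> e2"
    and "A12 = H p e2 \<bullet> e1" and "A21 = H p e1 \<bullet> e2"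
  define \<alpha> \<beta> where "\<alpha> = Complex ((A11 + A22) / 2) ((A21 - A12) / 2)"
    and "\<beta> = Complex ((A11 - A22) / 2) ((A21 + A12) / 2)"
  have ab: "(cmod \<alpha>)\<^sup>2 - (cmod \<beta>)\<^sup>2 = A11 * A22 - A12 * A21"
    unfolding \<alpha>_def \<beta>_def cmod_power2 by (simp add: power2_eq_square field_simps)
  \<comment> \<open>The dominant coefficient is \<open>a\<close>: that of \<open>\<zeta>\<close> for positive determinant, that of \<open>cnj \<zeta>\<close> for
    negative determinant.\<close>
  define a b' where "a = (if s = 1 then \<alpha> else \<beta>)" and "b' = (if s = 1 then \<beta> else \<alpha>)"
  have "(cmod a)\<^sup>2 > (cmod b')\<^sup>2"
    using s ab det[OF b] unfolding a_def b'_def A11_def A22_def A12_def A21_def by auto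
  then have gap: "cmod a > cmod b'" by (rule power_less_imp_less_base) simp
  define g where "g = cmod a - cmod b'"
  have g: "g > 0" using gap g_def by simp
  define E where "E = (\<lambda>t. cos (2 * pi * t) *\<^sub>R e1 + sin (2 * pi * t) *\<^sub>R e2)"
  have lin: "Complex (H p (E t) \<bullet> e1) (H p (E t) \<bullet> e2) = a * cis (2 * pi * s * t) + b' * cis (- (2 * pi * s * t))" for t
    using s unfolding E_def a_def b'_def \<alpha>_def \<beta>_def A11_def A22_def A12_def A21_def
    by (auto simp: linear_add[OF linear_H] linear_cmul[OF linear_H] inner_add_left complex_eq_iff field_simps)
  have W0: "W p = 0" using p critical_iff by simp
  obtain d where d: "d > 0" "\<And>u. norm (u - p) < d \<Longrightarrow> norm (W u - H p (u - p)) \<le> g/16 * norm (u - p)"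
    using W_expansion[OF W0, of "g/16"] g by auto
  define K where "K = norm (H p p) + 1"
  have K: "K > 0" unfolding K_def by (smt (verit) norm_ge_zero)
  have "\<forall>\<^sub>F r in at_right 0. 0 < r \<and> r < Min {1, d/2, g / (16 * K)}"
    using eventually_at_right_real[of 0 "Min {1, d/2, g / (16 * K)}"] d g K by simp
  then have "\<forall>\<^sub>F r in at_right 0. \<forall>t.
      cmod (Complex (W (tangent_circle p e1 e2 r t) \<bullet> e1) (W (tangent_circle p e1 e2 r t) \<bullet> e2)
        - of_real (r ^ 1) * a * cis (2 * pi * s * t)) < r ^ 1 * cmod a"
  proof eventually_elim
    case (elim r)
    then have r: "0 < r" "r < 1" "r < d / 2" "r < g / (16 * K)" by auto
    show ?case
    proof
      fix t
      define c where "c = tangent_circle p e1 e2 r t"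
      have c: "c - p = (sqrt (1 - r\<^sup>2) - 1) *\<^sub>R p + r *\<^sub>R E t"
        by (simp add: c_def tangent_circle_def E_def algebra_simps)
      have r2: "r\<^sup>2 \<le> 1" using r by (simp add: power_le_one)
      have sq: "\<bar>sqrt (1 - r\<^sup>2) - 1\<bar> \<le> r\<^sup>2"
      proof -
        have "1 - r\<^sup>2 \<le> sqrt (1 - r\<^sup>2)" using r2 by (intro real_le_rsqrt) (auto simp: power2_eq_square mult_left_le)
        moreover have "sqrt (1 - r\<^sup>2) \<le> 1" using r2 by simp
        ultimately show ?thesis by auto
      qed
      have nE: "norm (E t) = 1"
      proof -
        have "e1 \<bullet> e1 = 1" "e2 \<bullet> e2 = 1" "e1 \<bullet> e2 = 0" using b by (auto simp: tangent_basis_def norm_eq_1)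
        then have "E t \<bullet> E t = 1" using sin_cos_squared_add[of "2 * pi * t"]
          by (simp add: E_def inner_add_left inner_add_right inner_commute power2_eq_square add.commute)
        then show ?thesis by (simp add: norm_eq_1)
      qed
      have rr: "r\<^sup>2 \<le> r" using r by (simp add: power2_eq_square)
      have nc: "norm (c - p) \<le> 2 * r"
        unfolding c using norm_triangle_ineq[of "(sqrt (1 - r\<^sup>2) - 1) *\<^sub>R p" "r *\<^sub>R E t"] sq rr pn nE r by simp
      then have "norm (W c - H p (c - p)) \<le> g/16 * norm (c - p)" using d(2) r by simp
      also have "\<dots> \<le> g/16 * (2 * r)" using nc g by (intro mult_left_mono) auto
      finally have e1': "norm (W c - H p (c - p)) \<le> g * r / 8" by simp
      have "H p (c - p) - r *\<^sub>R H p (E t) = (sqrt (1 - r\<^sup>2) - 1) *\<^sub>R H p p"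
        unfolding c by (simp add: linear_add[OF linear_H] linear_cmul[OF linear_H])
      then have "norm (H p (c - p) - r *\<^sub>R H p (E t)) \<le> r\<^sup>2 * K"
        using mult_mono[OF sq, of "norm (H p p)" K] by (simp add: K_def)
      also have "\<dots> \<le> g * r / 16"
      proof -
        have "r * K \<le> g / 16" using r(4) K by (simp add: field_simps)
        then have "r * (r * K) \<le> r * (g / 16)" using r by (intro mult_left_mono) auto
        then show ?thesis by (simp add: power2_eq_square mult_ac)
      qed
      finally have e2': "norm (H p (c - p) - r *\<^sub>R H p (E t)) \<le> g * r / 16" .
      define x where "x = W c - r *\<^sub>R H p (E t)"
      have nx: "norm x \<le> g * r / 8 + g * r / 16"
        using norm_triangle_ineq[of "W c - H p (c - p)" "H p (c - p) - r *\<^sub>R H p (E t)"] e1' e2'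
        by (simp add: x_def)
      have cx: "cmod (Complex (x \<bullet> e1) (x \<bullet> e2)) \<le> 2 * norm x"
      proof -
        have "cmod (Complex (x \<bullet> e1) (x \<bullet> e2)) \<le> \<bar>x \<bullet> e1\<bar> + \<bar>x \<bullet> e2\<bar>" using cmod_le[of "Complex (x \<bullet> e1) (x \<bullet> e2)"] by simp
        moreover have "\<bar>x \<bullet> e1\<bar> \<le> norm x" "\<bar>x \<bullet> e2\<bar> \<le> norm x"
          using Cauchy_Schwarz_ineq2[of x e1] Cauchy_Schwarz_ineq2[of x e2] b by (auto simp: tangent_basis_def)
        ultimately show ?thesis by linarith
      qed
      have "Complex (W c \<bullet> e1) (W c \<bullet> e2) - of_real r * a * cis (2 * pi * s * t)
        = Complex (x \<bullet> e1) (x \<bullet> e2) + of_real r * b' * cis (- (2 * pi * s * t))"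
      proof -
        have "Complex (W c \<bullet> e1) (W c \<bullet> e2) = Complex (x \<bullet> e1) (x \<bullet> e2) + of_real r * Complex (H p (E t) \<bullet> e1) (H p (E t) \<bullet> e2)"
          by (simp add: complex_eq_iff x_def inner_diff_left)
        then show ?thesis unfolding lin by (simp add: algebra_simps)
      qed
      then have "cmod (Complex (W c \<bullet> e1) (W c \<bullet> e2) - of_real r * a * cis (2 * pi * s * t))
        \<le> cmod (Complex (x \<bullet> e1) (x \<bullet> e2)) + r * cmod b'"
        using norm_triangle_ineq[of "Complex (x \<bullet> e1) (x \<bullet> e2)" "of_real r * b' * cis (- (2 * pi * s * t))"] r
        by (simp add: norm_mult)
      also have "\<dots> \<le> 2 * (g * r / 8 + g * r / 16) + r * cmod b'" using order_trans[OF cx mult_left_mono[OF nx, of 2]] by simp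
      also have "\<dots> < g * r + r * cmod b'" using g r by (simp add: field_simps)
      also have "\<dots> = r * cmod a" by (simp add: g_def algebra_simps)
      finally show "cmod (Complex (W (tangent_circle p e1 e2 r t) \<bullet> e1) (W (tangent_circle p e1 e2 r t) \<bullet> e2)
        - of_real (r ^ 1) * a * cis (2 * pi * s * t)) < r ^ 1 * cmod a" by (simp add: c_def)
    qed
  qed
  then show "\<exists>\<alpha> n. \<forall>\<^sub>F r in at_right 0. \<forall>t.
      cmod (Complex (W (tangent_circle p e1 e2 r t) \<bullet> e1) (W (tangent_circle p e1 e2 r t) \<bullet> e2)
        - of_real (r ^ n) * \<alpha> * cis (2 * pi * s * t)) < r ^ n * cmod \<alpha>" by blast
qed

lemma Q_basis:
  assumes p: "p \<in> critical_points f" and b: "tangent_basis p e1 e2"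
  shows "Q p (x *\<^sub>R e1 + y *\<^sub>R e2) = (H p e1 \<bullet> e1) * x^2 + (H p e2 \<bullet> e1 + H p e1 \<bullet> e2) * x * y + (H p e2 \<bullet> e2) * y^2"
proof -
  have "(x *\<^sub>R e1 + y *\<^sub>R e2) \<bullet> p = 0" using b by (simp add: tangent_basis_def inner_add_left)
  from critical_normal(3)[OF p this, symmetric] show ?thesis
    by (simp add: linear_add[OF linear_H] linear_cmul[OF linear_H] inner_add_left inner_add_right
        power2_eq_square algebra_simps)
qed

lemma definite_critical_point:
  assumes p: "p \<in> critical_points f" and fin: "finite (critical_points f)"
    and sg: "\<sigma> = 1 \<or> \<sigma> = (-1::real)"
    and def: "\<And>v. v \<bullet> p = 0 \<Longrightarrow> v \<noteq> 0 \<Longrightarrow> \<sigma> * Q p v > 0"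
  shows "has_ph_index (sphere_grad f) p 1"
    and "\<sigma> = 1 \<Longrightarrow> p \<in> stable_points f - unstable_points f"
    and "\<sigma> = -1 \<Longrightarrow> p \<in> unstable_points f - stable_points f"
proof -
  have pS: "p \<in> S2" using p by (simp add: critical_iff)
  show "has_ph_index (sphere_grad f) p 1"
  proof (rule has_ph_index_det[OF p eventually_sphere_grad_nonzero[OF fin pS]])
    fix e1 e2 assume b: "tangent_basis p e1 e2"
    have e: "e1 \<bullet> e1 = 1" "e2 \<bullet> e2 = 1" "e1 \<bullet> e2 = 0" using b by (auto simp: tangent_basis_def norm_eq_1)
    let ?A = "H p e1 \<bullet> e1" and ?B = "H p e2 \<bullet> e1" and ?C = "H p e1 \<bullet> e2" and ?E = "H p e2 \<bullet> e2"
    have pos: "\<sigma> * (?A * x^2 + (?B + ?C) * x * y + ?E * y^2) > 0" if "(x, y) \<noteq> (0, 0)" for x y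
      unfolding Q_basis[OF p b, symmetric]
    proof (rule def)
      show "(x *\<^sub>R e1 + y *\<^sub>R e2) \<bullet> p = 0" using b by (simp add: tangent_basis_def inner_add_left)
      have "(x *\<^sub>R e1 + y *\<^sub>R e2) \<bullet> e1 = x" "(x *\<^sub>R e1 + y *\<^sub>R e2) \<bullet> e2 = y"
        using e by (auto simp: inner_add_left inner_add_right inner_commute)
      then show "x *\<^sub>R e1 + y *\<^sub>R e2 \<noteq> 0" using that by auto
    qed
    have "(\<sigma> * ?A) * (\<sigma> * ?E) - (\<sigma> * ?B) * (\<sigma> * ?C) > 0"
    proof (rule definite_det_pos)
      show "\<sigma> * ?A * x^2 + (\<sigma> * ?B + \<sigma> * ?C) * x * y + \<sigma> * ?E * y^2 > 0" if "(x, y) \<noteq> (0, 0)" for x y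
        using pos[OF that] by (simp add: algebra_simps)
    qed
    then show "(1::int) * (?A * ?E - ?B * ?C) > 0" using sg by auto
  qed simp
  have st: "\<forall>\<^sub>F u in at p within S2. \<sigma> * (f u - f p) > 0"
    by (rule definite_critical_strict[OF p sg]) (rule def)
  have nb: "\<not> (\<forall>\<^sub>F u in at p within S2. \<sigma> * (f u - f p) \<le> 0)"
  proof
    assume "\<forall>\<^sub>F u in at p within S2. \<sigma> * (f u - f p) \<le> 0"
    with st have "\<forall>\<^sub>F u in at p within S2. False" by eventually_elim simp
    then show False using at_within_S2_nontrivial[OF pS] by simp
  qed
  {
    assume "\<sigma> = 1"
    then have "\<forall>\<^sub>F u in at p within S2. f p \<le> f u" using st by (auto elim!: eventually_mono)
    then show "p \<in> stable_points f - unstable_points f"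
      using p nb \<open>\<sigma> = 1\<close> by (simp add: stable_points_def unstable_points_def)
  }
  {
    assume "\<sigma> = -1"
    then have "\<forall>\<^sub>F u in at p within S2. f u \<le> f p" using st by (auto elim!: eventually_mono)
    then show "p \<in> unstable_points f - stable_points f"
      using p nb \<open>\<sigma> = -1\<close> by (simp add: stable_points_def unstable_points_def)
  }
qed

lemma saddle_type_if_indefinite:
  assumes p: "p \<in> critical_points f"
    and a: "a \<bullet> p = 0" "Q p a > 0" and b: "b \<bullet> p = 0" "Q p b < 0"
  shows "p \<in> saddle_type_points f"
  using p critical_not_extremum_if[OF p, of 1 a] critical_not_extremum_if[OF p, of "-1" b] a b
  by (simp add: saddle_type_points_def stable_points_def unstable_points_def)

text \<open>Since \<open>J\<close> is symmetric, an indefinite form has negative determinant: the point is nondegenerate of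
  index \<open>-1\<close>.\<close>

lemma indefinite_critical_point:
  assumes p: "p \<in> critical_points f" and fin: "finite (critical_points f)"
    and sym: "\<And>v w. J p v \<bullet> w = J p w \<bullet> v"
    and a: "a \<bullet> p = 0" "Q p a > 0" and b: "b \<bullet> p = 0" "Q p b < 0"
  shows "ordinary_saddle f p"
proof -
  have pS: "p \<in> S2" "norm p = 1" using p by (auto simp: critical_iff)
  have det: "(H p e1 \<bullet> e1) * (H p e2 \<bullet> e2) - (H p e2 \<bullet> e1) * (H p e1 \<bullet> e2) < 0 \<and> H p e2 \<bullet> e1 = H p e1 \<bullet> e2"
    if tb: "tangent_basis p e1 e2" for e1 e2
  proof -
    have o: "e1 \<bullet> p = 0" "e2 \<bullet> p = 0" "p \<bullet> e1 = 0" "p \<bullet> e2 = 0" "e1 \<bullet> e2 = 0" "e2 \<bullet> e1 = 0"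
      using tb by (auto simp: tangent_basis_def inner_commute)
    have s: "H p e2 \<bullet> e1 = H p e1 \<bullet> e2"
      using sym[of e1 e2] o by (simp add: H_def inner_diff_left)
    have "a = (a \<bullet> e1) *\<^sub>R e1 + (a \<bullet> e2) *\<^sub>R e2" "b = (b \<bullet> e1) *\<^sub>R e1 + (b \<bullet> e2) *\<^sub>R e2"
      using tangent_decompose[OF tb pS(2)] a b by auto
    then have "Q p ((a \<bullet> e1) *\<^sub>R e1 + (a \<bullet> e2) *\<^sub>R e2) > 0" "Q p ((b \<bullet> e1) *\<^sub>R e1 + (b \<bullet> e2) *\<^sub>R e2) < 0"
      using a(2) b(2) by auto
    then show ?thesis
      using indefinite_det_neg[of "H p e1 \<bullet> e1" "a \<bullet> e1" "H p e1 \<bullet> e2" "a \<bullet> e2" "H p e2 \<bullet> e2" "b \<bullet> e1" "b \<bullet> e2"]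
      unfolding Q_basis[OF p tb] s by (simp add: mult.assoc)
  qed
  have "has_ph_index (sphere_grad f) p (-1)"
  proof (rule has_ph_index_det[OF p eventually_sphere_grad_nonzero[OF fin pS(1)]])
    fix e1 e2 assume b: "tangent_basis p e1 e2"
    show "(-1::int) * ((H p e1 \<bullet> e1) * (H p e2 \<bullet> e2) - (H p e2 \<bullet> e1) * (H p e1 \<bullet> e2)) > 0"
      using conjunct1[OF det[OF b]] by simp
  qed simp
  moreover have "nondegenerate_critical f p"
    unfolding nondegenerate_critical_def
  proof (intro conjI exI allI impI)
    show "(sphere_grad f has_derivative H p) (at p within S2)" by (rule sphere_grad_deriv[OF pS(1)])
    fix v assume v: "v \<bullet> p = 0 \<and> v \<noteq> 0"
    show "H p v \<noteq> 0"
    proof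
      assume h0: "H p v = 0"
      obtain e1 e2 where tb: "tangent_basis p e1 e2" using tangent_basis_exists pS by blast
      let ?A = "H p e1 \<bullet> e1" and ?B = "H p e2 \<bullet> e1" and ?C = "H p e1 \<bullet> e2" and ?E = "H p e2 \<bullet> e2"
      define x y where "x = v \<bullet> e1" and "y = v \<bullet> e2"
      have vd: "v = x *\<^sub>R e1 + y *\<^sub>R e2"
        unfolding x_def y_def using tangent_decompose[OF tb pS(2)] v by blast
      have "H p v = x *\<^sub>R H p e1 + y *\<^sub>R H p e2"
        by (subst vd) (simp add: linear_add[OF linear_H] linear_cmul[OF linear_H])
      then have hz: "x *\<^sub>R H p e1 + y *\<^sub>R H p e2 = 0" using h0 by simp
      have "(x *\<^sub>R H p e1 + y *\<^sub>R H p e2) \<bullet> e1 = 0" "(x *\<^sub>R H p e1 + y *\<^sub>R H p e2) \<bullet> e2 = 0"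
        unfolding hz by simp_all
      then have z: "x * ?A + y * ?B = 0" "x * ?C + y * ?E = 0"
        by (simp_all add: inner_add_left)
      have "x * (?A * ?E - ?B * ?C) = (x * ?A + y * ?B) * ?E - ?B * (x * ?C + y * ?E)"
        "y * (?A * ?E - ?B * ?C) = ?A * (x * ?C + y * ?E) - ?C * (x * ?A + y * ?B)"
        by (simp_all add: algebra_simps)
      then have "x = 0" "y = 0" using z det[OF tb] by auto
      then show False using vd v by simp
    qed
  qed (rule p)
  ultimately show ?thesis unfolding ordinary_saddle_def by simp
qed
end

lemma has_ph_index_unique:
  assumes "has_ph_index V p k" "has_ph_index V p k'"
  shows "k = k'"
proof -
  have "norm p = 1" using assms by (simp add: has_ph_index_def)
  then obtain e1 e2 where "tangent_basis p e1 e2" using tangent_basis_exists by blast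
  then have b: "norm e1 = 1 \<and> norm e2 = 1 \<and> e1 \<bullet> e2 = 0 \<and> e1 \<bullet> p = 0 \<and> e2 \<bullet> p = 0"
    by (simp add: tangent_basis_def)
  have "\<forall>\<^sub>F r in at_right 0.
        winding_number
          (\<lambda>t. Complex (V (tangent_circle p e1 e2 r t) \<bullet> e1) (V (tangent_circle p e1 e2 r t) \<bullet> e2)) 0
        = of_int k" using assms(1) b unfolding has_ph_index_def by blast
  moreover have "\<forall>\<^sub>F r in at_right 0.
        winding_number
          (\<lambda>t. Complex (V (tangent_circle p e1 e2 r t) \<bullet> e1) (V (tangent_circle p e1 e2 r t) \<bullet> e2)) 0
        = of_int k'" using assms(2) b unfolding has_ph_index_def by blast
  ultimately have "\<forall>\<^sub>F r in at_right (0::real). k = k'" by eventually_elim simp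
  then show ?thesis by simp
qed

lemma ph_index_eq: "has_ph_index V p k \<Longrightarrow> ph_index V p = k"
  unfolding ph_index_def using has_ph_index_unique by (intro the_equality) blast+

section \<open>Horizontal and vertical coordinates\<close>

text \<open>Horizontal vectors are identified with complex numbers: the rotations and the powers \<open>w^m\<close> that
  govern the harmonics are then complex arithmetic.\<close>

definition wc :: "real^3 \<Rightarrow> complex" where "wc x = Complex (x $ 1) (x $ 2)"

definition hor :: "complex \<Rightarrow> real^3" where "hor c = vector [Re c, Im c, 0]"

abbreviation e\<^sub>3 :: "real^3" where "e\<^sub>3 \<equiv> axis 3 1"

lemma wc_hor [simp]: "wc (hor c) = c" by (simp add: wc_def hor_def vector_3)

lemma hor_3 [simp]: "hor c $ 3 = 0" by (simp add: hor_def vector_3)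

lemma wc_e3 [simp]: "wc e\<^sub>3 = 0" by (simp add: wc_def axis_def complex_eq_iff)

lemma e3_3 [simp]: "e\<^sub>3 $ 3 = 1" by (simp add: axis_def)

lemma bounded_linear_wc: "bounded_linear wc"
proof -
  have "linear wc" by (rule linearI) (simp_all add: wc_def complex_eq_iff)
  then show ?thesis by (simp add: linear_conv_bounded_linear)
qed

lemma bounded_linear_hor: "bounded_linear hor"
proof -
  have "linear hor" by (rule linearI) (simp_all add: hor_def vec_eq_iff forall_3 vector_3)
  then show ?thesis by (simp add: linear_conv_bounded_linear)
qed

lemmas wc_add [simp] = bounded_linear.linear[OF bounded_linear_wc, THEN linear_add]
lemmas wc_scale [simp] = bounded_linear.linear[OF bounded_linear_wc, THEN linear_cmul]
lemmas wc_diff [simp] = bounded_linear.linear[OF bounded_linear_wc, THEN linear_diff]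
lemmas wc_minus [simp] = bounded_linear.linear[OF bounded_linear_wc, THEN linear_neg]
lemmas wc_0 [simp] = bounded_linear.linear[OF bounded_linear_wc, THEN linear_0]
lemmas hor_0 [simp] = bounded_linear.linear[OF bounded_linear_hor, THEN linear_0]

lemma inner_wc: "x \<bullet> y = Re (cnj (wc x) * wc y) + x $ 3 * y $ 3"
  by (simp add: inner_vec_def sum_3 wc_def)

lemma inner_hor: "x \<bullet> hor c = Re (cnj c * wc x)" "hor c \<bullet> x = Re (cnj c * wc x)"
  by (simp_all add: inner_wc mult.commute)

lemma inner_e3: "x \<bullet> e\<^sub>3 = x $ 3" "e\<^sub>3 \<bullet> x = x $ 3"
  by (simp_all add: inner_wc)

lemma vec3_eq_iff: "x = y \<longleftrightarrow> wc x = wc y \<and> x $ 3 = (y $ 3 :: real)"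
  by (auto simp: vec_eq_iff forall_3 wc_def)

lemma S2_iff: "u \<in> S2 \<longleftrightarrow> (cmod (wc u))\<^sup>2 = 1 - (u $ 3)\<^sup>2"
proof -
  have "u \<in> S2 \<longleftrightarrow> u \<bullet> u = 1" by (simp add: norm_eq_1)
  moreover have "u \<bullet> u = (cmod (wc u))\<^sup>2 + (u $ 3)\<^sup>2"
    unfolding inner_wc cmod_power2 by (simp add: power2_eq_square)
  ultimately show ?thesis by (simp only: eq_diff_eq)
qed

lemma S2_third: assumes "u \<in> S2" shows "\<bar>u $ 3\<bar> \<le> 1" "wc u \<noteq> 0 \<Longrightarrow> \<bar>u $ 3\<bar> < 1" "wc u = 0 \<Longrightarrow> u \<in> poles"
proof -
  have e: "(cmod (wc u))\<^sup>2 = 1 - (u $ 3)\<^sup>2" by (rule S2_iff[THEN iffD1, OF assms])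
  then have "(u $ 3)\<^sup>2 \<le> 1" using zero_le_power2[of "cmod (wc u)"] by linarith
  then show "\<bar>u $ 3\<bar> \<le> 1" by (simp add: abs_square_le_1)
  show "\<bar>u $ 3\<bar> < 1" if "wc u \<noteq> 0"
  proof -
    have "(cmod (wc u))\<^sup>2 > 0" using that by simp
    then have "(u $ 3)\<^sup>2 < 1" using e by linarith
    then show ?thesis by (simp add: abs_square_less_1)
  qed
  show "u \<in> poles" if "wc u = 0"
  proof -
    have "(u $ 3)\<^sup>2 = 1" using e that by simp
    then have "u $ 3 = 1 \<or> u $ 3 = -1" by (simp add: power2_eq_1_iff)
    then show ?thesis using that by (auto simp: poles_def north_pole_def south_pole_def vec3_eq_iff)
  qed
qed

lemma poles_in_S2: "p \<in> poles \<Longrightarrow> p \<in> S2"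
  by (auto simp: poles_def north_pole_def south_pole_def norm_axis_1)

lemma poles_facts: assumes "p \<in> poles" shows "wc p = 0" "p $ 3 = 1 \<or> p $ 3 = -1" "p = p $ 3 *\<^sub>R e\<^sub>3"
  using assms by (auto simp: poles_def north_pole_def south_pole_def vec3_eq_iff)

text \<open>The points at height \<open>z\<close> whose \<open>m\<close>-fold longitude is the argument of \<open>c\<close>. Nodal meridians have
  \<open>c = \<plusminus>\<i>\<close>; the meridians on which \<open>w^m\<close> is real have \<open>c = \<plusminus>1\<close>.\<close>

definition fibre :: "nat \<Rightarrow> real \<Rightarrow> complex \<Rightarrow> (real^3) set"
  where "fibre m z c = {u \<in> S2. u $ 3 = z \<and> wc u ^ m = of_real (sqrt (1 - z\<^sup>2) ^ m) * c}"

text \<open>These are the \<open>m\<close>-th roots of a nonzero complex number.\<close>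

lemma fibre_card:
  assumes m: "1 \<le> m" and z: "\<bar>z\<bar> < 1" and c: "cmod c = 1"
  shows "finite (fibre m z c)" "card (fibre m z c) = m"
proof -
  have z2: "z\<^sup>2 < 1" using z by (simp add: abs_square_less_1)
  let ?a = "of_real (sqrt (1 - z\<^sup>2) ^ m) * c"
  have a0: "?a \<noteq> 0" using c z2 by auto
  have *: "fibre m z c = (\<lambda>w. hor w + z *\<^sub>R e\<^sub>3) ` {w. w ^ m = ?a}"
  proof (intro equalityI subsetI)
    fix u assume "u \<in> fibre m z c"
    then show "u \<in> (\<lambda>w. hor w + z *\<^sub>R e\<^sub>3) ` {w. w ^ m = ?a}"
      by (intro image_eqI[of _ _ "wc u"]) (auto simp: fibre_def vec3_eq_iff)
  next
    fix u assume "u \<in> (\<lambda>w. hor w + z *\<^sub>R e\<^sub>3) ` {w. w ^ m = ?a}"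
    then obtain w where w: "w ^ m = ?a" "u = hor w + z *\<^sub>R e\<^sub>3" by auto
    have "cmod w ^ m = cmod ?a" unfolding w(1)[symmetric] by (simp add: norm_power)
    also have "\<dots> = sqrt (1 - z\<^sup>2) ^ m" using c z2 by (simp add: norm_mult norm_power)
    finally have "cmod w ^ m = sqrt (1 - z\<^sup>2) ^ m" .
    then have "cmod w = sqrt (1 - z\<^sup>2)"
      by (rule power_eq_imp_eq_base) (use m z2 in auto)
    then have "(cmod w)\<^sup>2 = 1 - z\<^sup>2" using z2 by simp
    then show "u \<in> fibre m z c" using w unfolding fibre_def mem_Collect_eq S2_iff by simp
  qed
  have inj: "inj_on (\<lambda>w. hor w + z *\<^sub>R e\<^sub>3) A" for A
    by (rule inj_onI) (simp add: vec3_eq_iff)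
  have "finite {w. w ^ m = ?a}" using m by (intro finite_nth_roots) auto
  then show "finite (fibre m z c)" unfolding * by simp
  show "card (fibre m z c) = m" unfolding * card_image[OF inj]
    using m a0 by (intro card_nth_roots) auto
qed

lemma fibre_disjoint:
  assumes "u \<in> fibre m z c" "u \<in> fibre m z' c'" "\<bar>z\<bar> < 1"
  shows "z = z' \<and> c = c'"
proof -
  have zz: "z = z'" using assms by (simp add: fibre_def)
  have z2: "z\<^sup>2 < 1" using assms by (simp add: abs_square_less_1)
  have "of_real (sqrt (1 - z\<^sup>2) ^ m) * c = of_real (sqrt (1 - z\<^sup>2) ^ m) * c'"
    using assms zz by (simp add: fibre_def)
  then show ?thesis using zz z2 by auto
qed

lemma card_fibres:
  assumes m: "1 \<le> m" and A: "finite A" "\<And>z c. (z, c) \<in> A \<Longrightarrow> \<bar>z\<bar> < 1 \<and> cmod c = 1"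
  shows "finite (\<Union>(z, c)\<in>A. fibre m z c)" "card (\<Union>(z, c)\<in>A. fibre m z c) = m * card A"
proof -
  have fi: "\<And>i. i \<in> A \<Longrightarrow> finite (case i of (z, c) \<Rightarrow> fibre m z c)"
    using fibre_card(1)[OF m] A(2) by auto
  then show "finite (\<Union>(z, c)\<in>A. fibre m z c)" using A(1) by blast
  have "card (\<Union>i\<in>A. case i of (z, c) \<Rightarrow> fibre m z c) = (\<Sum>i\<in>A. card (case i of (z, c) \<Rightarrow> fibre m z c))"
  proof (rule card_UN_disjoint)
    show "\<forall>i\<in>A. \<forall>j\<in>A. i \<noteq> j \<longrightarrow> (case i of (z, c) \<Rightarrow> fibre m z c) \<inter> (case j of (z, c) \<Rightarrow> fibre m z c) = {}"
      using fibre_disjoint A(2) by (fastforce split: prod.splits)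
  qed (use A fi in auto)
  also have "\<dots> = (\<Sum>i\<in>A. m)"
    by (rule sum.cong) (use A(2) fibre_card(2)[OF m] in \<open>auto split: prod.splits\<close>)
  finally show "card (\<Union>(z, c)\<in>A. fibre m z c) = m * card A" by simp
qed

section \<open>Functions of a sectoral height and the third coordinate\<close>

text \<open>The sectoral polynomial \<open>Re (w^m)\<close>, equal to \<open>sin\<^sup>m \<theta> cos (m \<phi>)\<close> on the sphere.\<close>

definition Sh :: "nat \<Rightarrow> real^3 \<Rightarrow> real" where "Sh m x = Re (wc x ^ m)"

lemma Sh_has_derivative:
  "(Sh m has_derivative (\<lambda>h. Re (of_nat m * wc x ^ (m - 1) * wc h))) (at x)"
proof -
  have "((\<lambda>x. Re (wc x ^ m)) has_derivative (\<lambda>h. Re (of_nat m * wc h * wc x ^ (m - 1)))) (at x)"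
    by (intro has_derivative_Re has_derivative_power bounded_linear.has_derivative[OF bounded_linear_wc] has_derivative_ident)
  moreover have "Sh m = (\<lambda>x. Re (wc x ^ m))" by (auto simp: Sh_def)
  ultimately show ?thesis by (simp only: mult_ac)
qed

lemma poly_comp_has_derivative:
  "((\<lambda>x::real^3. poly q (x $ 3)) has_derivative (\<lambda>h. poly (pderiv q) (x $ 3) * h $ 3)) (at x)"
proof -
  have "((\<lambda>x::real^3. x $ 3) has_derivative (\<lambda>h. h $ 3)) (at x)"
    by (rule bounded_linear.has_derivative[OF bounded_linear_vec_nth has_derivative_ident])
  moreover have "(poly q has_derivative (\<lambda>h. poly (pderiv q) (x $ 3) * h)) (at (x $ 3))"
    using poly_DERIV[of q "x $ 3"] by (simp add: has_field_derivative_def)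
  ultimately show ?thesis using diff_chain_at[of "\<lambda>x::real^3. x $ 3"] by (fastforce simp: o_def)
qed

text \<open>The common form of the squared distance for all orders. For \<open>m \<ge> 2\<close> it is used with
  \<open>\<kappa> = C = 0\<close>; for \<open>m = 1\<close> the displaced centroid changes \<open>q\<close> by a constant and contributes the
  terms with \<open>\<kappa>\<close> and \<open>C\<close>.\<close>

locale zonal_body =
  fixes m :: nat and q :: "real poly" and \<epsilon> \<kappa> C :: real and f :: "real^3 \<Rightarrow> real"
  assumes m: "1 \<le> m"
    and f_eq: "\<And>u. u \<in> S2 \<Longrightarrow> f u = (1 + \<epsilon> * Sh m u * poly q (u $ 3))\<^sup>2 - \<kappa> * (Sh m u)\<^sup>2 + C"
begin

definition R where "R x = 1 + \<epsilon> * Sh m x * poly q (x $ 3)"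

text \<open>With \<open>F\<close> regarded as a function of \<open>s = Sh m x\<close> and \<open>z = x $ 3\<close>, the functions \<open>Fs\<close>, \<open>Fz\<close>,
  \<open>Fss\<close>, \<open>Fsz\<close>, \<open>Fzz\<close> are its partial derivatives.\<close>

definition Fs where "Fs x = 2 * R x * \<epsilon> * poly q (x $ 3) - 2 * \<kappa> * Sh m x"

definition Fz where "Fz x = 2 * R x * \<epsilon> * Sh m x * poly (pderiv q) (x $ 3)"

definition Fss where "Fss x = 2 * \<epsilon>\<^sup>2 * (poly q (x $ 3))\<^sup>2 - 2 * \<kappa>"

definition Fsz where "Fsz x = 2 * \<epsilon>\<^sup>2 * Sh m x * poly q (x $ 3) * poly (pderiv q) (x $ 3) + 2 * R x * \<epsilon> * poly (pderiv q) (x $ 3)"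

definition Fzz where "Fzz x = 2 * (\<epsilon> * Sh m x * poly (pderiv q) (x $ 3))\<^sup>2 + 2 * R x * \<epsilon> * Sh m x * poly (pderiv (pderiv q)) (x $ 3)"

definition F where "F x = (R x)\<^sup>2 - \<kappa> * (Sh m x)\<^sup>2 + C"

definition D where "D x = Fs x *\<^sub>R hor (cnj (of_nat m * wc x ^ (m - 1))) + Fz x *\<^sub>R e\<^sub>3"

definition dS where "dS x h = Re (of_nat m * wc x ^ (m - 1) * wc h)"

definition J where "J x h = (Fss x * dS x h + Fsz x * h $ 3) *\<^sub>R hor (cnj (of_nat m * wc x ^ (m - 1)))
   + Fs x *\<^sub>R hor (cnj (of_nat m * (of_nat (m - 1) * wc x ^ (m - 1 - 1) * wc h)))
   + (Fsz x * dS x h + Fzz x * h $ 3) *\<^sub>R e\<^sub>3"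

lemma dS_derivative: "(Sh m has_derivative dS x) (at x)"
  using Sh_has_derivative[of m x] by (simp add: dS_def[abs_def])

lemma R_derivative: "(R has_derivative (\<lambda>h. \<epsilon> * poly q (x $ 3) * dS x h + \<epsilon> * Sh m x * poly (pderiv q) (x $ 3) * h $ 3)) (at x)"
proof -
  have "((\<lambda>x. 1 + \<epsilon> * Sh m x * poly q (x $ 3)) has_derivative
    (\<lambda>h. 0 + (\<epsilon> * Sh m x * (poly (pderiv q) (x $ 3) * h $ 3) + \<epsilon> * dS x h * poly q (x $ 3)))) (at x)"
    by (intro has_derivative_add has_derivative_const has_derivative_mult has_derivative_mult_right
       dS_derivative poly_comp_has_derivative)
  moreover have "R = (\<lambda>x. 1 + \<epsilon> * Sh m x * poly q (x $ 3))" by (auto simp: R_def)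
  ultimately show ?thesis by (simp add: mult_ac add.commute)
qed

lemma inner_D: "h \<bullet> D x = Fs x * dS x h + Fz x * h $ 3"
  by (simp add: D_def inner_add_right inner_hor inner_e3 dS_def)

lemma F_derivative: "(F has_derivative (\<lambda>h. h \<bullet> D x)) (at x)"
proof -
  have "((\<lambda>x. (R x)\<^sup>2 - \<kappa> * (Sh m x)\<^sup>2 + C) has_derivative
    (\<lambda>h. of_nat 2 * (\<epsilon> * poly q (x $ 3) * dS x h + \<epsilon> * Sh m x * poly (pderiv q) (x $ 3) * h $ 3) * R x ^ (2 - 1)
       - \<kappa> * (of_nat 2 * dS x h * Sh m x ^ (2 - 1)) + 0)) (at x)"
    by (intro has_derivative_add has_derivative_diff has_derivative_const has_derivative_mult_right
       has_derivative_power dS_derivative R_derivative)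
  moreover have "F = (\<lambda>x. (R x)\<^sup>2 - \<kappa> * (Sh m x)\<^sup>2 + C)" by (auto simp: F_def)
  moreover have "(\<lambda>h. h \<bullet> D x) = (\<lambda>h. of_nat 2 * (\<epsilon> * poly q (x $ 3) * dS x h + \<epsilon> * Sh m x * poly (pderiv q) (x $ 3) * h $ 3) * R x ^ (2 - 1)
       - \<kappa> * (of_nat 2 * dS x h * Sh m x ^ (2 - 1)) + 0)"
    by (rule ext) (simp add: inner_D Fs_def Fz_def algebra_simps)
  ultimately show ?thesis by simp
qed

lemma Fs_derivative: "(Fs has_derivative (\<lambda>h. Fss x * dS x h + Fsz x * h $ 3)) (at x)"
proof -
  have "((\<lambda>x. 2 * R x * \<epsilon> * poly q (x $ 3) - 2 * \<kappa> * Sh m x) has_derivative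
    (\<lambda>h. 2 * R x * \<epsilon> * (poly (pderiv q) (x $ 3) * h $ 3) + 2 * (\<epsilon> * poly q (x $ 3) * dS x h + \<epsilon> * Sh m x * poly (pderiv q) (x $ 3) * h $ 3) * \<epsilon> * poly q (x $ 3)
      - 2 * \<kappa> * dS x h)) (at x)"
    by (intro has_derivative_diff has_derivative_mult has_derivative_mult_right has_derivative_mult_left
       dS_derivative R_derivative poly_comp_has_derivative)
  moreover have "Fs = (\<lambda>x. 2 * R x * \<epsilon> * poly q (x $ 3) - 2 * \<kappa> * Sh m x)" by (auto simp: Fs_def)
  moreover have "(\<lambda>h. Fss x * dS x h + Fsz x * h $ 3) = (\<lambda>h. 2 * R x * \<epsilon> * (poly (pderiv q) (x $ 3) * h $ 3) + 2 * (\<epsilon> * poly q (x $ 3) * dS x h + \<epsilon> * Sh m x * poly (pderiv q) (x $ 3) * h $ 3) * \<epsilon> * poly q (x $ 3)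
      - 2 * \<kappa> * dS x h)"
    by (rule ext) (simp add: Fss_def Fsz_def power2_eq_square algebra_simps)
  ultimately show ?thesis by simp
qed

lemma Fz_derivative: "(Fz has_derivative (\<lambda>h. Fsz x * dS x h + Fzz x * h $ 3)) (at x)"
proof -
  have "((\<lambda>x. 2 * R x * \<epsilon> * Sh m x * poly (pderiv q) (x $ 3)) has_derivative
    (\<lambda>h. 2 * R x * \<epsilon> * Sh m x * (poly (pderiv (pderiv q)) (x $ 3) * h $ 3) +
      (2 * R x * \<epsilon> * dS x h + 2 * (\<epsilon> * poly q (x $ 3) * dS x h + \<epsilon> * Sh m x * poly (pderiv q) (x $ 3) * h $ 3) * \<epsilon> * Sh m x)
       * poly (pderiv q) (x $ 3))) (at x)"
    by (intro has_derivative_diff has_derivative_mult has_derivative_mult_right has_derivative_mult_left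
       dS_derivative R_derivative poly_comp_has_derivative)
  moreover have "Fz = (\<lambda>x. 2 * R x * \<epsilon> * Sh m x * poly (pderiv q) (x $ 3))" by (auto simp: Fz_def)
  moreover have "(\<lambda>h. Fsz x * dS x h + Fzz x * h $ 3) = (\<lambda>h. 2 * R x * \<epsilon> * Sh m x * (poly (pderiv (pderiv q)) (x $ 3) * h $ 3) +
      (2 * R x * \<epsilon> * dS x h + 2 * (\<epsilon> * poly q (x $ 3) * dS x h + \<epsilon> * Sh m x * poly (pderiv q) (x $ 3) * h $ 3) * \<epsilon> * Sh m x)
       * poly (pderiv q) (x $ 3))"
    by (rule ext) (simp add: Fsz_def Fzz_def power2_eq_square algebra_simps)
  ultimately show ?thesis by simp
qed

lemma bounded_linear_hor_cnj: "bounded_linear (\<lambda>c. hor (cnj (of_nat m * c)))"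
  by (intro bounded_linear_compose[OF bounded_linear_hor] bounded_linear_compose[OF bounded_linear_cnj]
     bounded_linear_const_mult bounded_linear_ident)

lemma D_derivative: "(D has_derivative J x) (at x)"
proof -
  have w: "((\<lambda>x. wc x ^ (m - 1)) has_derivative (\<lambda>h. of_nat (m - 1) * wc h * wc x ^ (m - 1 - 1))) (at x)"
    by (intro has_derivative_power bounded_linear.has_derivative[OF bounded_linear_wc] has_derivative_ident)
  have "((\<lambda>x. Fs x *\<^sub>R hor (cnj (of_nat m * wc x ^ (m - 1))) + Fz x *\<^sub>R e\<^sub>3) has_derivative
    (\<lambda>h. (Fs x *\<^sub>R hor (cnj (of_nat m * (of_nat (m - 1) * wc h * wc x ^ (m - 1 - 1))))
      + (Fss x * dS x h + Fsz x * h $ 3) *\<^sub>R hor (cnj (of_nat m * wc x ^ (m - 1))))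
      + (Fsz x * dS x h + Fzz x * h $ 3) *\<^sub>R e\<^sub>3)) (at x)"
    by (intro has_derivative_add has_derivative_scaleR has_derivative_scaleR_left Fs_derivative Fz_derivative
        bounded_linear.has_derivative[OF bounded_linear_hor_cnj w])
  moreover have "D = (\<lambda>x. Fs x *\<^sub>R hor (cnj (of_nat m * wc x ^ (m - 1))) + Fz x *\<^sub>R e\<^sub>3)" by (auto simp: D_def)
  moreover have "J x = (\<lambda>h. (Fs x *\<^sub>R hor (cnj (of_nat m * (of_nat (m - 1) * wc h * wc x ^ (m - 1 - 1))))
      + (Fss x * dS x h + Fsz x * h $ 3) *\<^sub>R hor (cnj (of_nat m * wc x ^ (m - 1))))
      + (Fsz x * dS x h + Fzz x * h $ 3) *\<^sub>R e\<^sub>3)"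
    by (rule ext) (simp add: J_def mult_ac add_ac)
  ultimately show ?thesis by simp
qed

sublocale sphere_fun f F D J
  by unfold_locales (simp add: f_eq F_def R_def, rule F_derivative, rule D_derivative)

lemma J_inner: "J x h \<bullet> k = Fss x * dS x h * dS x k + Fsz x * (h $ 3 * dS x k + k $ 3 * dS x h)
   + Fs x * Re (of_nat m * (of_nat (m - 1) * wc x ^ (m - 1 - 1) * wc h) * wc k) + Fzz x * h $ 3 * k $ 3"
  unfolding J_def inner_add_left inner_scaleR_left inner_hor inner_e3 complex_cnj_cnj dS_def[symmetric]
  by (simp add: dS_def algebra_simps)

lemma J_sym: "J x h \<bullet> k = J x k \<bullet> h"
  unfolding J_inner by (simp add: mult_ac)

lemma wc_power: "wc x * wc x ^ (m - 1) = wc x ^ m"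
  using m by (cases m) auto

lemma dS_self: "dS x x = real m * Sh m x"
proof -
  have "of_nat m * wc x ^ (m - 1) * wc x = of_nat m * wc x ^ m" using wc_power[of x] by (simp add: mult_ac)
  then show ?thesis unfolding dS_def Sh_def by (simp only:) simp
qed

lemma D_radial: "D x \<bullet> x = Fs x * real m * Sh m x + Fz x * x $ 3"
  using inner_D[of x x] by (simp add: inner_commute dS_self)

lemma W_parts: "wc (W u) = Fs u *\<^sub>R cnj (of_nat m * wc u ^ (m - 1)) - (D u \<bullet> u) *\<^sub>R wc u"
  "W u $ 3 = Fz u - (D u \<bullet> u) * u $ 3"
  by (simp_all add: W_def D_def)

text \<open>The two conditions are the vanishing of the derivatives of \<open>f\<close> along the parallel and along the
  meridian.\<close>

lemma critical_nonpole_iff: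
  assumes u: "u \<in> S2" and w: "wc u \<noteq> 0"
  shows "u \<in> critical_points f \<longleftrightarrow>
    Fs u * Im (wc u ^ m) = 0 \<and> (1 - (u $ 3)\<^sup>2) * Fz u = real m * u $ 3 * Sh m u * Fs u"
proof -
  define l where "l = D u \<bullet> u"
  have l: "l = Fs u * real m * Sh m u + Fz u * u $ 3" unfolding l_def by (rule D_radial)
  have n: "(cmod (wc u))\<^sup>2 = 1 - (u $ 3)\<^sup>2" by (rule S2_iff[THEN iffD1, OF u])
  have nz: "1 - (u $ 3)\<^sup>2 \<noteq> 0" using w n by auto
  have cw: "cnj (wc u) * wc u = of_real (1 - (u $ 3)\<^sup>2)"
    using complex_norm_square[of "wc u"] n by (simp add: mult.commute)
  have crit: "u \<in> critical_points f \<longleftrightarrow> Fs u *\<^sub>R cnj (of_nat m * wc u ^ (m - 1)) = l *\<^sub>R wc u \<and> Fz u = l * u $ 3"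
    using u unfolding critical_iff vec3_eq_iff W_parts l_def[symmetric] by auto
  have "Fs u *\<^sub>R cnj (of_nat m * wc u ^ (m - 1)) = l *\<^sub>R wc u \<longleftrightarrow>
    cnj (wc u) * (Fs u *\<^sub>R cnj (of_nat m * wc u ^ (m - 1))) = cnj (wc u) * (l *\<^sub>R wc u)"
    unfolding mult_cancel_left using w by simp
  also have "cnj (wc u) * (Fs u *\<^sub>R cnj (of_nat m * wc u ^ (m - 1))) = of_real (Fs u * real m) * cnj (wc u ^ m)"
    unfolding wc_power[of u, symmetric] by (simp add: scaleR_conv_of_real)
  also have "cnj (wc u) * (l *\<^sub>R wc u) = of_real (l * (1 - (u $ 3)\<^sup>2))"
    using cw by (simp add: scaleR_conv_of_real)
  also have "of_real (Fs u * real m) * cnj (wc u ^ m) = of_real (l * (1 - (u $ 3)\<^sup>2)) \<longleftrightarrow>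
    Fs u * real m * Sh m u = l * (1 - (u $ 3)\<^sup>2) \<and> Fs u * real m * Im (wc u ^ m) = 0"
    unfolding complex_eq_iff Sh_def by (simp del: complex_cnj_power)
  finally have A: "Fs u *\<^sub>R cnj (of_nat m * wc u ^ (m - 1)) = l *\<^sub>R wc u \<longleftrightarrow>
    Fs u * real m * Sh m u = l * (1 - (u $ 3)\<^sup>2) \<and> Fs u * Im (wc u ^ m) = 0"
    using m by auto
  show ?thesis
  proof
    assume "u \<in> critical_points f"
    then have h: "Fs u * real m * Sh m u = l * (1 - (u $ 3)\<^sup>2)" "Fs u * Im (wc u ^ m) = 0" "Fz u = l * u $ 3"
      using crit A by auto
    have "(1 - (u $ 3)\<^sup>2) * Fz u = u $ 3 * (l * (1 - (u $ 3)\<^sup>2))" unfolding h(3) by simp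
    also have "\<dots> = real m * u $ 3 * Sh m u * Fs u" unfolding h(1)[symmetric] by simp
    finally show "Fs u * Im (wc u ^ m) = 0 \<and> (1 - (u $ 3)\<^sup>2) * Fz u = real m * u $ 3 * Sh m u * Fs u"
      using h by simp
  next
    assume h: "Fs u * Im (wc u ^ m) = 0 \<and> (1 - (u $ 3)\<^sup>2) * Fz u = real m * u $ 3 * Sh m u * Fs u"
    have "l * (1 - (u $ 3)\<^sup>2) = Fs u * real m * Sh m u * (1 - (u $ 3)\<^sup>2) + u $ 3 * ((1 - (u $ 3)\<^sup>2) * Fz u)"
      unfolding l by (simp add: algebra_simps)
    also have "\<dots> = Fs u * real m * Sh m u" unfolding h[THEN conjunct2]
      by (simp add: power2_eq_square algebra_simps)
    finally have e: "l * (1 - (u $ 3)\<^sup>2) = Fs u * real m * Sh m u" .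
    have "(1 - (u $ 3)\<^sup>2) * Fz u = (1 - (u $ 3)\<^sup>2) * (l * u $ 3)"
      using h e by (simp add: mult_ac)
    then have "Fz u = l * u $ 3" using nz by simp
    then show "u \<in> critical_points f" using crit A e h by simp
  qed
qed

text \<open>The parallel component is \<open>a\<close> and the meridian component is \<open>b\<close>, both in units of the radius of the
  parallel.\<close>

lemma tangent_vector:
  assumes u: "u \<in> S2" and w: "wc u \<noteq> 0" and v: "v \<bullet> u = 0"
  obtains a b where "wc v = wc u * Complex (b * u $ 3) a" "v $ 3 = - b * (1 - (u $ 3)\<^sup>2)" "v \<noteq> 0 \<Longrightarrow> a \<noteq> 0 \<or> b \<noteq> 0"
proof -
  have n: "(cmod (wc u))\<^sup>2 = 1 - (u $ 3)\<^sup>2" by (rule S2_iff[THEN iffD1, OF u])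
  have nz: "1 - (u $ 3)\<^sup>2 \<noteq> 0" using w n by auto
  define \<zeta> where "\<zeta> = wc v / wc u"
  have z: "wc v = wc u * \<zeta>" using w by (simp add: \<zeta>_def)
  define b where "b = - v $ 3 / (1 - (u $ 3)\<^sup>2)"
  have b: "v $ 3 = - b * (1 - (u $ 3)\<^sup>2)" using nz by (simp add: b_def)
  have "cnj (wc v) * wc u = cnj \<zeta> * of_real ((cmod (wc u))\<^sup>2)"
    unfolding z complex_norm_square by simp
  then have "Re (cnj (wc v) * wc u) = Re \<zeta> * (1 - (u $ 3)\<^sup>2)" unfolding n by simp
  then have "Re \<zeta> * (1 - (u $ 3)\<^sup>2) = b * u $ 3 * (1 - (u $ 3)\<^sup>2)"
    using v unfolding inner_wc b by (simp add: algebra_simps)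
  then have r: "Re \<zeta> = b * u $ 3" using nz by simp
  have "wc v = wc u * Complex (b * u $ 3) (Im \<zeta>)" unfolding z r[symmetric] by simp
  moreover have "Im \<zeta> \<noteq> 0 \<or> b \<noteq> 0" if "v \<noteq> 0"
  proof (rule ccontr)
    assume "\<not> ?thesis"
    then have "\<zeta> = 0" "v $ 3 = 0" using r b by (auto simp: complex_eq_iff)
    then show False using that z by (simp add: vec3_eq_iff)
  qed
  ultimately show ?thesis using that b by blast
qed

lemma Q_frame:
  assumes u: "u \<in> S2" and v: "wc v = wc u * \<zeta>" "v $ 3 = t"
  shows "Q u v = Fss u * (Re (of_nat m * wc u ^ m * \<zeta>))\<^sup>2 + 2 * Fsz u * t * Re (of_nat m * wc u ^ m * \<zeta>)
    + Fs u * Re (of_nat m * of_nat (m - 1) * wc u ^ m * \<zeta>\<^sup>2) + Fzz u * t\<^sup>2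
    - (Fs u * real m * Sh m u + Fz u * u $ 3) * ((1 - (u $ 3)\<^sup>2) * (cmod \<zeta>)\<^sup>2 + t\<^sup>2)"
proof -
  have n: "(cmod (wc u))\<^sup>2 = 1 - (u $ 3)\<^sup>2" by (rule S2_iff[THEN iffD1, OF u])
  have ds: "dS u v = Re (of_nat m * wc u ^ m * \<zeta>)"
    unfolding dS_def v(1) wc_power[of u, symmetric] by (simp add: mult_ac)
  define A :: complex where "A = of_nat (m - 1) * wc u ^ (m - 1 - 1)"
  have A: "A * wc u = of_nat (m - 1) * wc u ^ (m - 1)"
    unfolding A_def by (cases "m - 1") (auto simp: mult_ac)
  have "of_nat m * (A * wc v) * wc v = of_nat m * ((A * wc u) * wc u) * \<zeta>\<^sup>2"
    unfolding v(1) by (simp add: power2_eq_square mult_ac)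
  also have "(A * wc u) * wc u = of_nat (m - 1) * wc u ^ m"
    unfolding A wc_power[of u, symmetric] by (simp add: mult_ac)
  finally have e1: "of_nat m * (of_nat (m - 1) * wc u ^ (m - 1 - 1) * wc v) * wc v = of_nat m * of_nat (m - 1) * wc u ^ m * \<zeta>\<^sup>2"
    unfolding A_def by (simp only: mult.assoc)
  have e2: "v \<bullet> v = (1 - (u $ 3)\<^sup>2) * (cmod \<zeta>)\<^sup>2 + t\<^sup>2"
  proof -
    have "v \<bullet> v = (cmod (wc v))\<^sup>2 + (v $ 3)\<^sup>2"
      unfolding inner_wc cmod_power2 by (simp add: power2_eq_square)
    then show ?thesis unfolding v by (simp add: norm_mult power_mult_distrib n)
  qed
  have ring: "a * X * X + b * (t * X + t * X) + c * Y + d * t * t - l * n = a * X\<^sup>2 + 2 * b * t * X + c * Y + d * t\<^sup>2 - l * n"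
    for a b c d X Y l n :: real by (simp add: power2_eq_square algebra_simps)
  show ?thesis unfolding Q_def J_inner D_radial ds v(2) e1 e2 by (rule ring)
qed
end

section \<open>Critical points away from the poles\<close>

text \<open>At height \<open>z\<close> on a meridian where \<open>w^m\<close> is real, with \<open>s = \<plusminus>(1 - z\<^sup>2)^(m/2)\<close>, this is a nonzero
  multiple of the derivative of \<open>f\<close> along the meridian (fact \<open>E\<close> in the proof of
  \<open>extremum_point\<close>). For \<open>\<kappa> = 0\<close> its zeros are those of \<open>crit_poly m q\<close>.\<close>

definition crit_fun :: "nat \<Rightarrow> real poly \<Rightarrow> real \<Rightarrow> real \<Rightarrow> real \<Rightarrow> real \<Rightarrow> real"
  where "crit_fun m q \<epsilon> \<kappa> s z = (1 + \<epsilon> * s * poly q z) * \<epsilon> * poly (crit_poly m q) z + \<kappa> * real m * s * z"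

text \<open>The derivative of \<open>crit_fun\<close> in \<open>z\<close> along the meridian, where \<open>s' = - m z s / (1 - z\<^sup>2)\<close>,
  multiplied by \<open>1 - z\<^sup>2\<close>.\<close>

definition crit_fun_slope :: "nat \<Rightarrow> real poly \<Rightarrow> real \<Rightarrow> real \<Rightarrow> real \<Rightarrow> real \<Rightarrow> real"
  where "crit_fun_slope m q \<epsilon> \<kappa> s z =
    \<epsilon> * (\<epsilon> * s * (poly (crit_poly m q) z)\<^sup>2 + (1 - z\<^sup>2) * (1 + \<epsilon> * s * poly q z) * poly (pderiv (crit_poly m q)) z)
    + \<kappa> * real m * ((1 - z\<^sup>2) * s - real m * z\<^sup>2 * s)"

text \<open>The value of \<open>Re (w^m)\<close> at height \<open>z\<close> on a meridian where \<open>w^m\<close> is real of sign \<open>\<sigma>\<close>.\<close>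

definition parallel_height :: "nat \<Rightarrow> real \<Rightarrow> real \<Rightarrow> real"
  where "parallel_height m \<sigma> z = \<sigma> * sqrt (1 - z\<^sup>2) ^ m"

text \<open>The information about roots from which all critical points are read off. The set \<open>Z\<close> labels the
  heights of the extrema; \<open>b \<sigma> r\<close> is the height with label \<open>r\<close> on the meridians where \<open>w^m\<close> has sign
  \<open>\<sigma>\<close>, which depends on \<open>\<sigma>\<close> when \<open>\<kappa> \<noteq> 0\<close>. The sign \<open>\<eta> r\<close> is that of \<open>q\<close> there and decides between
  minima and maxima. Assumption \<open>off\<close> rules out critical points with \<open>Fs = 0\<close> at zeros of \<open>q'\<close>.\<close>

locale zonal_body_roots = zonal_body m q \<epsilon> \<kappa> C f for m q \<epsilon> \<kappa> C f +
  fixes d :: nat and Z :: "real set" and b :: "real \<Rightarrow> real \<Rightarrow> real" and \<eta> :: "real \<Rightarrow> real"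
  assumes eps: "0 < \<epsilon>" and kap: "2 \<le> m \<Longrightarrow> \<kappa> = 0"
    and Rpos: "\<And>u. u \<in> S2 \<Longrightarrow> 0 < 1 + \<epsilon> * Sh m u * poly q (u $ 3)"
    and q_roots: "finite {z. \<bar>z\<bar> \<le> 1 \<and> poly q z = 0}" "card {z. \<bar>z\<bar> \<le> 1 \<and> poly q z = 0} = d"
    and q_simple: "\<And>z. \<bar>z\<bar> \<le> 1 \<Longrightarrow> poly q z = 0 \<Longrightarrow> \<bar>z\<bar> < 1 \<and> poly (pderiv q) z \<noteq> 0"
    and off: "\<And>u. u \<in> S2 \<Longrightarrow> poly (pderiv q) (u $ 3) = 0 \<Longrightarrow>
      (1 + \<epsilon> * Sh m u * poly q (u $ 3)) * \<epsilon> * poly q (u $ 3) \<noteq> \<kappa> * Sh m u"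
    and Z: "finite Z" "card Z = d + 1"
    and b: "\<And>\<sigma>. \<sigma> \<in> {1, -1} \<Longrightarrow> bij_betw (b \<sigma>) Z {z. \<bar>z\<bar> < 1 \<and> crit_fun m q \<epsilon> \<kappa> (parallel_height m \<sigma> z) z = 0}"
    and chi: "\<And>r. r \<in> Z \<Longrightarrow> \<eta> r \<in> {1, -1}"
    and sgn_Fs: "\<And>r \<sigma> z s. r \<in> Z \<Longrightarrow> \<sigma> \<in> {1, -1} \<Longrightarrow> z = b \<sigma> r \<Longrightarrow> s = parallel_height m \<sigma> z \<Longrightarrow>
      sgn ((1 + \<epsilon> * s * poly q z) * \<epsilon> * poly q z - \<kappa> * s) = \<eta> r"
    and sgn_slope: "\<And>r \<sigma> z. r \<in> Z \<Longrightarrow> \<sigma> \<in> {1, -1} \<Longrightarrow> z = b \<sigma> r \<Longrightarrow>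
      sgn (crit_fun_slope m q \<epsilon> \<kappa> (parallel_height m \<sigma> z) z) = - \<eta> r"
begin

lemma R_pos: "u \<in> S2 \<Longrightarrow> R u > 0" using Rpos by (simp add: R_def)

definition saddle_index :: "(real \<times> complex) set"
  where "saddle_index = {z. \<bar>z\<bar> \<le> 1 \<and> poly q z = 0} \<times> {\<i>, - \<i>}"

text \<open>Pairs of a height and a constant \<open>c = \<plusminus>1\<close> for \<open>fibre\<close>: the minima for \<open>\<tau> = 1\<close>, the maxima for
  \<open>\<tau> = -1\<close>. The choice \<open>\<sigma> = - \<tau> \<eta> r\<close> is the one that gives \<open>Q\<close> the sign \<open>\<tau>\<close> in \<open>extremum_point\<close>.\<close>

definition extremum_index :: "real \<Rightarrow> (real \<times> complex) set"
  where "extremum_index \<tau> = (\<lambda>r. (b (- \<tau> * \<eta> r) r, of_real (- \<tau> * \<eta> r))) ` Z"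

lemma fibre_wc:
  assumes "u \<in> fibre m z c" "\<bar>z\<bar> < 1" "cmod c = 1"
  shows "u \<in> S2" "u $ 3 = z" "wc u \<noteq> 0" "wc u ^ m = of_real (sqrt (1 - z\<^sup>2) ^ m) * c" "sqrt (1 - z\<^sup>2) ^ m > 0"
proof -
  have z2: "z\<^sup>2 < 1" using assms by (simp add: abs_square_less_1)
  then show "sqrt (1 - z\<^sup>2) ^ m > 0" by simp
  moreover have "c \<noteq> 0" using assms(3) by auto
  ultimately have nz: "of_real (sqrt (1 - z\<^sup>2) ^ m) * c \<noteq> 0" using z2 by auto
  show w: "wc u ^ m = of_real (sqrt (1 - z\<^sup>2) ^ m) * c" "u \<in> S2" "u $ 3 = z"
    using assms by (auto simp: fibre_def)
  show "wc u \<noteq> 0"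
  proof
    assume "wc u = 0"
    then have "wc u ^ m = 0" using m by simp
    then show False using w(1) nz by simp
  qed
qed

text \<open>With parallel component \<open>a\<close> and meridian component \<open>b\<close> the Hessian form is
  \<open>- m\<^sup>2 s Fs a\<^sup>2 + 2 s T b\<^sup>2\<close>, where \<open>T\<close> is \<open>crit_fun_slope\<close>. Since \<open>Fs\<close> has sign \<open>\<eta> r\<close> and \<open>T\<close> has the
  opposite sign, the form is definite with the sign of \<open>- s \<eta> r\<close>.\<close>

lemma extremum_point:
  assumes r: "r \<in> Z" and sg: "\<sigma> \<in> {1, -1}" and u: "u \<in> fibre m (b \<sigma> r) (of_real \<sigma>)"
  shows "u \<in> critical_points f" and "\<And>v. v \<bullet> u = 0 \<Longrightarrow> v \<noteq> 0 \<Longrightarrow> (- \<sigma> * \<eta> r) * Q u v > 0"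
proof -
  define z where "z = b \<sigma> r"
  define s where "s = parallel_height m \<sigma> z"
  have z: "\<bar>z\<bar> < 1" "crit_fun m q \<epsilon> \<kappa> s z = 0"
    using b[OF sg] r unfolding bij_betw_def z_def s_def by auto
  have c1: "cmod (complex_of_real \<sigma>) = 1" using sg by auto
  note fw = fibre_wc[OF u[folded z_def] z(1) c1]
  have ws: "wc u ^ m = of_real s" using fw(4) by (simp add: s_def parallel_height_def mult.commute)
  have S: "Sh m u = s" "Im (wc u ^ m) = 0" by (simp_all add: Sh_def ws)
  have ss: "\<sigma> * s > 0" using fw(5) sg by (auto simp: s_def parallel_height_def)
  define N N' q0 q1 q2 where "N = poly (crit_poly m q) z" and "N' = poly (pderiv (crit_poly m q)) z"
    and "q0 = poly q z" and "q1 = poly (pderiv q) z" and "q2 = poly (pderiv (pderiv q)) z"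
  define RR where "RR = 1 + \<epsilon> * s * q0"
  have N: "N = (1 - z\<^sup>2) * q1 - real m * z * q0" by (simp add: N_def q0_def q1_def poly_crit_poly)
  have N': "N' = (1 - z\<^sup>2) * q2 - (real m + 2) * z * q1 - real m * q0"
    by (simp add: N'_def q0_def q1_def q2_def poly_pderiv_crit_poly)
  have T: "RR * \<epsilon> * N + \<kappa> * real m * s * z = 0"
    using z(2) by (simp add: crit_fun_def RR_def N_def q0_def)
  have ph: "R u = RR" "Fs u = 2 * RR * \<epsilon> * q0 - 2 * \<kappa> * s" "Fz u = 2 * RR * \<epsilon> * s * q1"
    "Fss u = 2 * \<epsilon>\<^sup>2 * q0\<^sup>2 - 2 * \<kappa>" "Fsz u = 2 * \<epsilon>\<^sup>2 * s * q0 * q1 + 2 * RR * \<epsilon> * q1"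
    "Fzz u = 2 * (\<epsilon> * s * q1)\<^sup>2 + 2 * RR * \<epsilon> * s * q2"
    by (simp_all add: R_def Fs_def Fz_def Fss_def Fsz_def Fzz_def S fw(2) RR_def q0_def q1_def q2_def)
  have E: "(1 - z\<^sup>2) * Fz u - real m * z * s * Fs u = 2 * s * (RR * \<epsilon> * N + \<kappa> * real m * s * z)"
    unfolding ph N by (simp add: algebra_simps)
  then have E0: "(1 - z\<^sup>2) * Fz u = real m * z * s * Fs u" unfolding T by simp
  show crit: "u \<in> critical_points f"
    unfolding critical_nonpole_iff[OF fw(1,3)] S fw(2) using E0 by simp
  define Tu where "Tu = crit_fun_slope m q \<epsilon> \<kappa> s z"
  have Tu: "Tu = \<epsilon> * (\<epsilon> * s * N\<^sup>2 + (1 - z\<^sup>2) * RR * N') + \<kappa> * real m * ((1 - z\<^sup>2) * s - real m * z\<^sup>2 * s)"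
    by (simp add: Tu_def crit_fun_slope_def N_def N'_def RR_def q0_def)
  have sF: "sgn (Fs u) = \<eta> r"
  proof -
    have "Fs u = 2 * ((1 + \<epsilon> * s * poly q z) * \<epsilon> * poly q z - \<kappa> * s)"
      by (simp add: ph RR_def q0_def algebra_simps)
    then have "sgn (Fs u) = sgn 2 * sgn ((1 + \<epsilon> * s * poly q z) * \<epsilon> * poly q z - \<kappa> * s)"
      by (simp only: sgn_mult)
    then show ?thesis unfolding sgn_Fs[OF r sg z_def s_def] by simp
  qed
  have sT: "sgn Tu = - \<eta> r" using sgn_slope[OF r sg z_def] by (simp add: Tu_def s_def)
  fix v assume v: "v \<bullet> u = 0" "v \<noteq> 0"
  obtain a' b' where ab: "wc v = wc u * Complex (b' * u $ 3) a'" "v $ 3 = - b' * (1 - (u $ 3)\<^sup>2)" "a' \<noteq> 0 \<or> b' \<noteq> 0"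
    using tangent_vector[OF fw(1,3) v(1)] v(2) by metis
  have re: "Re (of_nat m * wc u ^ m * Complex (b' * u $ 3) a') = real m * s * b' * z"
    unfolding ws fw(2) by simp
  have re2: "Re (of_nat m * of_nat (m - 1) * wc u ^ m * (Complex (b' * u $ 3) a')\<^sup>2)
     = real m * (real m - 1) * s * ((b' * z)\<^sup>2 - a'\<^sup>2)"
    unfolding ws fw(2) using m by (simp add: of_nat_diff Re_power2)
  have cm: "(cmod (Complex (b' * u $ 3) a'))\<^sup>2 = b'\<^sup>2 * z\<^sup>2 + a'\<^sup>2"
    unfolding cmod_power2 fw(2) by (simp add: power_mult_distrib)
  have "Q u v = Fss u * (real m * s * b' * z)\<^sup>2 + 2 * Fsz u * (- b' * (1 - z\<^sup>2)) * (real m * s * b' * z)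
    + Fs u * (real m * (real m - 1) * s * ((b' * z)\<^sup>2 - a'\<^sup>2)) + Fzz u * (- b' * (1 - z\<^sup>2))\<^sup>2
    - (Fs u * real m * s + Fz u * z) * ((1 - z\<^sup>2) * (b'\<^sup>2 * z\<^sup>2 + a'\<^sup>2) + (- b' * (1 - z\<^sup>2))\<^sup>2)"
    unfolding Q_frame[OF fw(1) ab(1,2)] re re2 cm S(1) unfolding fw(2) ..
  also have "\<dots> = - (real m)\<^sup>2 * s * Fs u * a'\<^sup>2 + 2 * s * Tu * b'\<^sup>2"
  proof -
    define M where "M = real m"
    have lam: "(Fs u * M * s + Fz u * z) * (1 - z\<^sup>2) = M * s * Fs u"
    proof -
      have "(Fs u * M * s + Fz u * z) * (1 - z\<^sup>2) = Fs u * M * s * (1 - z\<^sup>2) + z * ((1 - z\<^sup>2) * Fz u)"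
        by (simp add: algebra_simps)
      also have "\<dots> = M * s * Fs u" unfolding E0 M_def by (simp add: power2_eq_square algebra_simps)
      finally show ?thesis .
    qed
    have n: "(1 - z\<^sup>2) * (b'\<^sup>2 * z\<^sup>2 + a'\<^sup>2) + (- b' * (1 - z\<^sup>2))\<^sup>2 = (1 - z\<^sup>2) * (b'\<^sup>2 + a'\<^sup>2)"
      by (simp add: power2_eq_square algebra_simps)
    \<comment> \<open>The two sides agree up to a multiple of \<open>crit_fun\<close>, which vanishes at the point.\<close>
    have th: "Fss u * (M * s * z)\<^sup>2 - 2 * Fsz u * (1 - z\<^sup>2) * (M * s * z) + Fs u * M * (M - 1) * s * z\<^sup>2
       + Fzz u * (1 - z\<^sup>2)\<^sup>2 - M * s * Fs u = 2 * s * Tu"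
    proof -
      have "Fss u * (M * s * z)\<^sup>2 - 2 * Fsz u * (1 - z\<^sup>2) * (M * s * z) + Fs u * M * (M - 1) * s * z\<^sup>2
       + Fzz u * (1 - z\<^sup>2)\<^sup>2 - M * s * Fs u = 2 * s * Tu + 2 * z * s * (2 - M) * (RR * \<epsilon> * N + \<kappa> * M * s * z)"
        unfolding ph Tu N N' M_def[symmetric] by (simp add: power2_eq_square algebra_simps)
      then show ?thesis using T by (simp add: M_def)
    qed
    have "Fss u * (M * s * b' * z)\<^sup>2 + 2 * Fsz u * (- b' * (1 - z\<^sup>2)) * (M * s * b' * z)
    + Fs u * (M * (M - 1) * s * ((b' * z)\<^sup>2 - a'\<^sup>2)) + Fzz u * (- b' * (1 - z\<^sup>2))\<^sup>2
    - (Fs u * M * s + Fz u * z) * ((1 - z\<^sup>2) * (b'\<^sup>2 + a'\<^sup>2))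
     = b'\<^sup>2 * (Fss u * (M * s * z)\<^sup>2 - 2 * Fsz u * (1 - z\<^sup>2) * (M * s * z) + Fs u * M * (M - 1) * s * z\<^sup>2
       + Fzz u * (1 - z\<^sup>2)\<^sup>2 - (Fs u * M * s + Fz u * z) * (1 - z\<^sup>2))
      - a'\<^sup>2 * (Fs u * M * (M - 1) * s + (Fs u * M * s + Fz u * z) * (1 - z\<^sup>2))"
      by (simp add: power2_eq_square algebra_simps)
    also have "\<dots> = b'\<^sup>2 * (2 * s * Tu) - a'\<^sup>2 * (Fs u * M * (M - 1) * s + M * s * Fs u)"
      unfolding lam th ..
    also have "\<dots> = - M\<^sup>2 * s * Fs u * a'\<^sup>2 + 2 * s * Tu * b'\<^sup>2"
      by (simp add: power2_eq_square algebra_simps)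
    finally show ?thesis unfolding n M_def[symmetric] .
  qed
  finally have Qv: "Q u v = - (real m)\<^sup>2 * s * Fs u * a'\<^sup>2 + 2 * s * Tu * b'\<^sup>2" .
  have x1: "\<eta> r * Fs u > 0" "- \<eta> r * Tu > 0"
  proof -
    have "\<eta> r = 1 \<or> \<eta> r = -1" using chi[OF r] by auto
    then show "\<eta> r * Fs u > 0" "- \<eta> r * Tu > 0"
      using sF sT by (auto simp: sgn_if split: if_splits)
  qed
  have "(- \<sigma> * \<eta> r) * Q u v = (real m)\<^sup>2 * (\<sigma> * s) * (\<eta> r * Fs u) * a'\<^sup>2 + 2 * (\<sigma> * s) * (- \<eta> r * Tu) * b'\<^sup>2"
    unfolding Qv by (simp add: algebra_simps)
  also have "\<dots> > 0"
  proof -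
    have p: "(real m)\<^sup>2 * (\<sigma> * s) * (\<eta> r * Fs u) > 0" "2 * (\<sigma> * s) * (- \<eta> r * Tu) > 0"
      by (intro mult_pos_pos ss x1; use m in simp)+
    have pos: "A * a'\<^sup>2 + B * b'\<^sup>2 > 0" if "A > 0" "B > 0" for A B :: real
    proof (cases "a' = 0")
      case True
      then show ?thesis using ab(3) that by simp
    next
      case False
      then have "A * a'\<^sup>2 > 0" using that by simp
      moreover have "B * b'\<^sup>2 \<ge> 0" using that by simp
      ultimately show ?thesis by linarith
    qed
    show ?thesis using pos[OF p] .
  qed
  finally show "(- \<sigma> * \<eta> r) * Q u v > 0" .
qed

text \<open>At such a point \<open>f\<close> is to second order a constant plus \<open>2 \<epsilon> s q(z) - \<kappa> s\<^sup>2\<close>, where \<open>s\<close> varies along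
  the parallel and \<open>q(z)\<close> along the meridian. The mixed term makes the form \<open>- h + g y\<close> on vectors
  with parallel component 1, and \<open>g \<noteq> 0\<close>.\<close>

lemma saddle_point:
  assumes zc: "(z, c) \<in> saddle_index" and u: "u \<in> fibre m z c"
  shows "u \<in> critical_points f"
    and "\<exists>a1 a2. a1 \<bullet> u = 0 \<and> Q u a1 > 0 \<and> a2 \<bullet> u = 0 \<and> Q u a2 < 0"
proof -
  have z: "\<bar>z\<bar> < 1" "poly q z = 0" "poly (pderiv q) z \<noteq> 0" and c: "c = \<i> \<or> c = - \<i>"
    using zc q_simple by (auto simp: saddle_index_def)
  have c1: "cmod c = 1" using c by auto
  note fw = fibre_wc[OF u z(1) c1]
  have S: "Sh m u = 0" using c by (auto simp: Sh_def fw(4))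
  define t where "t = Im (wc u ^ m)"
  have "z\<^sup>2 < 1" using z(1) by (simp add: abs_square_less_1)
  then have t: "t \<noteq> 0" using c by (auto simp: t_def fw(4))
  have wt: "wc u ^ m = Complex 0 t" using S by (simp add: t_def Sh_def complex_eq_iff)
  have ph: "R u = 1" "Fs u = 0" "Fz u = 0" "Fss u = - 2 * \<kappa>" "Fsz u = 2 * \<epsilon> * poly (pderiv q) z" "Fzz u = 0"
    by (simp_all add: R_def Fs_def Fz_def Fss_def Fsz_def Fzz_def S fw(2) z(2))
  show "u \<in> critical_points f"
    unfolding critical_nonpole_iff[OF fw(1,3)] by (simp add: ph)
  have z2: "1 - z\<^sup>2 > 0" using z(1) by (simp add: abs_square_less_1)
  define h g where "h = 2 * \<kappa> * (real m * t)\<^sup>2" and "g = 4 * \<epsilon> * poly (pderiv q) z * (real m * t) * (1 - z\<^sup>2)"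
  have g: "g \<noteq> 0" using eps z(3) m t z2 by (auto simp: g_def)
  \<comment> \<open>Tangent vectors with parallel component 1 and meridian component \<open>y\<close>.\<close>
  define V where "V = (\<lambda>y. hor (wc u * Complex (y * z) 1) + (- y * (1 - z\<^sup>2)) *\<^sub>R e\<^sub>3)"
  have n: "(cmod (wc u))\<^sup>2 = 1 - (u $ 3)\<^sup>2" by (rule S2_iff[THEN iffD1, OF fw(1)])
  have V: "V y \<bullet> u = 0" "Q u (V y) = - h + g * y" for y
  proof -
    have "cnj (wc u * Complex (y * z) 1) * wc u = of_real ((cmod (wc u))\<^sup>2) * cnj (Complex (y * z) 1)"
      unfolding complex_norm_square by (simp add: mult_ac)
    then have "Re (cnj (wc u * Complex (y * z) 1) * wc u) = Re (of_real ((cmod (wc u))\<^sup>2) * cnj (Complex (y * z) 1))"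
      by (rule arg_cong)
    also have "\<dots> = (1 - z\<^sup>2) * (y * z)" unfolding n fw(2) by simp
    finally have "Re (cnj (wc u * Complex (y * z) 1) * wc u) = (1 - z\<^sup>2) * (y * z)" .
    then show "V y \<bullet> u = 0" unfolding V_def inner_wc by (simp add: fw(2))
    have v: "wc (V y) = wc u * Complex (y * z) 1" "V y $ 3 = - y * (1 - z\<^sup>2)" by (simp_all add: V_def)
    show "Q u (V y) = - h + g * y"
      unfolding Q_frame[OF fw(1) v] wt ph h_def g_def by (simp add: power2_eq_square algebra_simps)
  qed
  have "Q u (V ((h + 1) / g)) > 0" "Q u (V ((h - 1) / g)) < 0" unfolding V(2) using g by simp_all
  then show "\<exists>a1 a2. a1 \<bullet> u = 0 \<and> Q u a1 > 0 \<and> a2 \<bullet> u = 0 \<and> Q u a2 < 0" using V(1) by blast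
qed

text \<open>If \<open>w^m\<close> is real, the meridian equation is \<open>crit_fun = 0\<close>. Otherwise \<open>Fs = Fz = 0\<close>, that is
  \<open>s q' = 0\<close> and \<open>R \<epsilon> q = \<kappa> s\<close>; the case \<open>q' = 0\<close> is excluded by \<open>off\<close>, and \<open>s = 0\<close> forces \<open>q = 0\<close>.\<close>

lemma critical_nonpole_classified:
  assumes u: "u \<in> critical_points f" and w: "wc u \<noteq> 0"
  shows "(\<exists>(z, c)\<in>saddle_index. u \<in> fibre m z c) \<or>
    (\<exists>r\<in>Z. \<exists>\<sigma>\<in>{1, -1}. u \<in> fibre m (b \<sigma> r) (of_real \<sigma>))"
proof -
  have uS: "u \<in> S2" using u by (simp add: critical_iff)
  define z where "z = u $ 3"
  have z1: "\<bar>z\<bar> < 1" using S2_third(2)[OF uS w] by (simp add: z_def)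
  then have z2: "1 - z\<^sup>2 > 0" by (simp add: abs_square_less_1)
  have n: "(cmod (wc u))\<^sup>2 = 1 - z\<^sup>2" using S2_iff[THEN iffD1, OF uS] by (simp add: z_def)
  then have cw: "cmod (wc u) = sqrt (1 - z\<^sup>2)"
    by (metis norm_ge_zero real_sqrt_unique)
  then have cwm: "cmod (wc u ^ m) = sqrt (1 - z\<^sup>2) ^ m" by (simp add: norm_power)
  have pos: "sqrt (1 - z\<^sup>2) ^ m > 0" using z2 by simp
  have cr: "Fs u * Im (wc u ^ m) = 0" "(1 - z\<^sup>2) * Fz u = real m * z * Sh m u * Fs u"
    using u critical_nonpole_iff[OF uS w] by (auto simp: z_def)
  show ?thesis
  proof (cases "Im (wc u ^ m) = 0")
    case False
    then have Fs0: "Fs u = 0" using cr by simp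
    then have "Fz u = 0" using cr z2 by simp
    then have "Sh m u = 0 \<or> poly (pderiv q) z = 0" using R_pos[OF uS] eps by (simp add: Fz_def z_def)
    moreover have "poly (pderiv q) z \<noteq> 0"
    proof
      assume "poly (pderiv q) z = 0"
      moreover have "Fs u = 2 * ((1 + \<epsilon> * Sh m u * poly q (u $ 3)) * \<epsilon> * poly q (u $ 3) - \<kappa> * Sh m u)"
        by (simp add: Fs_def R_def algebra_simps)
      ultimately show False using off[OF uS] Fs0 by (simp add: z_def)
    qed
    ultimately have S: "Sh m u = 0" by simp
    then have q0: "poly q z = 0" using Fs0 R_pos[OF uS] eps by (simp add: Fs_def z_def)
    have wI: "wc u ^ m = of_real (Im (wc u ^ m)) * \<i>" using S by (simp add: Sh_def complex_eq_iff)
    have aI: "\<bar>Im (wc u ^ m)\<bar> = sqrt (1 - z\<^sup>2) ^ m" using cwm by (subst (asm) wI) (simp add: norm_mult)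
    define c where "c = of_real (sgn (Im (wc u ^ m))) * \<i>"
    have "Im (wc u ^ m) = sqrt (1 - z\<^sup>2) ^ m * sgn (Im (wc u ^ m))"
      unfolding aI[symmetric] by (simp add: abs_mult_sgn)
    then have "wc u ^ m = of_real (sqrt (1 - z\<^sup>2) ^ m) * c"
      unfolding c_def
    by (subst wI) (simp only: mult.assoc[symmetric] of_real_mult[symmetric])
    then have "u \<in> fibre m z c" using uS by (simp add: fibre_def z_def)
    moreover have "(z, c) \<in> saddle_index" using q0 z1 False by (auto simp: saddle_index_def c_def sgn_if)
    ultimately show ?thesis by blast
  next
    case True
    define s where "s = Sh m u"
    have ws: "wc u ^ m = of_real s" using True by (simp add: s_def Sh_def complex_eq_iff)
    have as: "\<bar>s\<bar> = sqrt (1 - z\<^sup>2) ^ m" using cwm unfolding ws by simp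
    define \<sigma> where "\<sigma> = sgn s"
    have s0: "s \<noteq> 0" using pos unfolding as[symmetric] by simp
    then have sg: "\<sigma> \<in> {1, -1}" by (auto simp: \<sigma>_def sgn_if)
    have s: "s = parallel_height m \<sigma> z" unfolding parallel_height_def \<sigma>_def as[symmetric]
      by (simp add: mult.commute abs_mult_sgn)
    have "2 * s * crit_fun m q \<epsilon> \<kappa> s z = (1 - z\<^sup>2) * Fz u - real m * z * s * Fs u"
      unfolding crit_fun_def Fz_def Fs_def R_def s_def[symmetric] z_def[symmetric] poly_crit_poly
      by (simp add: algebra_simps)
    also have "\<dots> = 0" using cr(2) by (simp add: s_def)
    finally have "crit_fun m q \<epsilon> \<kappa> s z = 0" using s0 by simp
    then have "z \<in> b \<sigma> ` Z" using b[OF sg] z1 unfolding bij_betw_def s by auto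
    then obtain r where r: "r \<in> Z" "z = b \<sigma> r" by blast
    have "wc u ^ m = of_real (sqrt (1 - z\<^sup>2) ^ m) * of_real \<sigma>"
      unfolding ws s parallel_height_def by simp
    then have "u \<in> fibre m (b \<sigma> r) (of_real \<sigma>)" using uS r by (simp add: fibre_def z_def)
    then show ?thesis using r sg by blast
  qed
qed
end

section \<open>Projection of a hemisphere as a smooth chart\<close>

lemma Ck_on_cong:
  assumes "open W" "\<And>x. x \<in> W \<Longrightarrow> f x = g x" "Ck_on k W f"
  shows "Ck_on k W g"
  using assms(2,3)
proof (induction k arbitrary: f g)
  case 0
  then show ?case using continuous_on_cong[of W W f g] by simp
next
  case (Suc k)
  have d: "(g has_derivative frechet_derivative f (at x)) (at x)" if "x \<in> W" for x
  proof -
    have "(f has_derivative frechet_derivative f (at x)) (at x)"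
      using Suc.prems(2) that by (simp add: frechet_derivative_works)
    then show ?thesis
      by (rule has_derivative_transform_within_open[OF _ assms(1) that]) (use Suc.prems(1) in auto)
  qed
  show ?case unfolding Ck_on.simps
  proof (intro conjI ballI allI)
    show "g differentiable at x" if "x \<in> W" for x using d[OF that] by (auto simp: differentiable_def)
    fix v
    show "Ck_on k W (\<lambda>x. frechet_derivative g (at x) v)"
    proof (rule Suc.IH[of "\<lambda>x. frechet_derivative f (at x) v"])
      show "frechet_derivative f (at x) v = frechet_derivative g (at x) v" if "x \<in> W" for x
        using frechet_derivative_at[OF d[OF that]] by simp
      show "Ck_on k W (\<lambda>x. frechet_derivative f (at x) v)" using Suc.prems(2) by simp
    qed
  qed
qed

text \<open>Iterated differentiability is stated with \<open>frechet_derivative\<close>; this rule permits any derivative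
  that is known explicitly.\<close>

lemma Ck_on_SucI:
  assumes "open W" "\<And>x. x \<in> W \<Longrightarrow> (f has_derivative f' x) (at x)" "\<And>v. Ck_on k W (\<lambda>x. f' x v)"
  shows "Ck_on (Suc k) W f"
  unfolding Ck_on.simps
proof (intro conjI ballI allI)
  show "f differentiable at x" if "x \<in> W" for x using assms(2)[OF that] by (auto simp: differentiable_def)
  show "Ck_on k W (\<lambda>x. frechet_derivative f (at x) v)" for v
  proof (rule Ck_on_cong[OF assms(1) _ assms(3)])
    show "f' x v = frechet_derivative f (at x) v" if "x \<in> W" for x
      using frechet_derivative_at[OF assms(2)[OF that]] by simp
  qed
qed

lemma Ck_on_SucD:
  assumes "Ck_on (Suc k) W f" "x \<in> W"
  shows "(f has_derivative frechet_derivative f (at x)) (at x)"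
  using assms by (simp add: frechet_derivative_works)

lemma Ck_on_lower: "Ck_on (Suc k) W f \<Longrightarrow> Ck_on k W f"
proof (induction k arbitrary: f)
  case 0
  then have "f differentiable_on W"
    by (auto simp: differentiable_on_def intro: differentiable_at_withinI)
  then show ?case by (simp add: differentiable_imp_continuous_on)
next
  case (Suc k)
  then show ?case by simp
qed

lemma Ck_on_const: "open W \<Longrightarrow> Ck_on k W (\<lambda>x. c)"
proof (induction k arbitrary: c)
  case (Suc k)
  then show ?case by (intro Ck_on_SucI[where f' = "\<lambda>x v. 0"]) auto
qed simp

lemma Ck_on_bounded_linear: "open W \<Longrightarrow> bounded_linear f \<Longrightarrow> Ck_on k W f"
proof (cases k)
  case 0
  assume "bounded_linear f"
  then show ?thesis using 0 by (simp add: linear_continuous_on)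
next
  case (Suc n)
  assume W: "open W" and f: "bounded_linear f"
  show ?thesis unfolding Suc
    by (rule Ck_on_SucI[OF W bounded_linear_imp_has_derivative[OF f] Ck_on_const[OF W]])
qed

lemma Ck_on_compose_bounded_linear:
  assumes "open W" "bounded_linear L"
  shows "Ck_on k W f \<Longrightarrow> Ck_on k W (\<lambda>x. L (f x))"
proof (induction k arbitrary: f)
  case 0
  then show ?case using linear_continuous_on[OF assms(2)] continuous_on_compose2[of UNIV L W f] by simp
next
  case (Suc k)
  show ?case
  proof (rule Ck_on_SucI[OF assms(1)])
    show "((\<lambda>x. L (f x)) has_derivative (\<lambda>v. L (frechet_derivative f (at x) v))) (at x)" if "x \<in> W" for x
      by (rule bounded_linear.has_derivative[OF assms(2) Ck_on_SucD[OF Suc.prems that]])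
    show "Ck_on k W (\<lambda>x. L (frechet_derivative f (at x) v))" for v
      using Suc by simp
  qed
qed

lemma Ck_on_add:
  assumes "open W"
  shows "Ck_on k W f \<Longrightarrow> Ck_on k W g \<Longrightarrow> Ck_on k W (\<lambda>x. f x + g x)"
proof (induction k arbitrary: f g)
  case 0
  then show ?case by (simp add: continuous_on_add)
next
  case (Suc k)
  show ?case
  proof (rule Ck_on_SucI[OF assms])
    show "((\<lambda>x. f x + g x) has_derivative (\<lambda>v. frechet_derivative f (at x) v + frechet_derivative g (at x) v)) (at x)"
      if "x \<in> W" for x
      by (intro has_derivative_add Ck_on_SucD[OF Suc.prems(1) that] Ck_on_SucD[OF Suc.prems(2) that])
    show "Ck_on k W (\<lambda>x. frechet_derivative f (at x) v + frechet_derivative g (at x) v)" for v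
      using Suc by simp
  qed
qed

lemma Ck_on_mult:
  fixes f g :: "'a::real_normed_vector \<Rightarrow> real"
  assumes "open W"
  shows "Ck_on k W f \<Longrightarrow> Ck_on k W g \<Longrightarrow> Ck_on k W (\<lambda>x. f x * g x)"
proof (induction k arbitrary: f g)
  case 0
  then show ?case by (simp add: continuous_on_mult)
next
  case (Suc k)
  show ?case
  proof (rule Ck_on_SucI[OF assms])
    show "((\<lambda>x. f x * g x) has_derivative (\<lambda>v. f x * frechet_derivative g (at x) v + frechet_derivative f (at x) v * g x)) (at x)"
      if "x \<in> W" for x
      by (intro has_derivative_mult Ck_on_SucD[OF Suc.prems(1) that] Ck_on_SucD[OF Suc.prems(2) that])
    show "Ck_on k W (\<lambda>x. f x * frechet_derivative g (at x) v + frechet_derivative f (at x) v * g x)" for v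
    proof (rule Ck_on_add[OF assms])
      show "Ck_on k W (\<lambda>x. f x * frechet_derivative g (at x) v)"
        by (rule Suc.IH[OF Ck_on_lower[OF Suc.prems(1)]]) (use Suc.prems(2) in simp)
      show "Ck_on k W (\<lambda>x. frechet_derivative f (at x) v * g x)"
        by (rule Suc.IH[OF _ Ck_on_lower[OF Suc.prems(2)]]) (use Suc.prems(1) in simp)
    qed
  qed
qed

text \<open>Both statements are proved together, because the derivative of each of the two functions is a
  polynomial expression in the coordinates and the two functions.\<close>

lemma hemisphere_height_smooth:
  "Ck_on k (ball 0 1) (\<lambda>w::complex. sqrt (1 - (cmod w)\<^sup>2)) \<and>
   Ck_on k (ball 0 1) (\<lambda>w::complex. inverse (sqrt (1 - (cmod w)\<^sup>2)))"
proof (induction k)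
  case 0
  have "1 - (cmod w)\<^sup>2 > 0" if "w \<in> ball 0 1" for w :: complex
    using that by (simp add: power_less_one_iff abs_square_less_1)
  then have "\<forall>w\<in>ball 0 1. sqrt (1 - (cmod w)\<^sup>2) \<noteq> 0" by force
  then show ?case by (auto intro!: continuous_intros)
next
  case (Suc k)
  let ?h = "\<lambda>w::complex. sqrt (1 - (cmod w)\<^sup>2)"
  have dp: "?h w > 0" if "w \<in> ball 0 1" for w :: complex
    using that by (simp add: power_less_one_iff abs_square_less_1)
  have dn: "((\<lambda>w::complex. 1 - (cmod w)\<^sup>2) has_derivative (\<lambda>v. - (2 * (w \<bullet> v)))) (at w)" for w
  proof -
    have "((\<lambda>w::complex. 1 - w \<bullet> w) has_derivative (\<lambda>v. 0 - (w \<bullet> v + v \<bullet> w))) (at w)"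
      by (intro has_derivative_diff has_derivative_const has_derivative_inner has_derivative_ident)
    then show ?thesis by (simp add: power2_norm_eq_inner inner_commute)
  qed
  have dh: "(?h has_derivative (\<lambda>v. - (w \<bullet> v) * inverse (?h w))) (at w)" if w: "w \<in> ball 0 1" for w
  proof -
    have "((\<lambda>x. sqrt x) has_derivative (*) (inverse (?h w) / 2)) (at (1 - (cmod w)\<^sup>2))"
      using DERIV_real_sqrt[of "1 - (cmod w)\<^sup>2"] dp[OF w] by (simp add: has_field_derivative_def)
    from diff_chain_at[OF dn this] show ?thesis by (simp add: o_def mult_ac)
  qed
  have dg: "((\<lambda>w. inverse (?h w)) has_derivative (\<lambda>v. (w \<bullet> v) * (inverse (?h w) * (inverse (?h w) * inverse (?h w))))) (at w)"
    if w: "w \<in> ball 0 1" for w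
  proof -
    have "((\<lambda>w. inverse (?h w)) has_derivative (\<lambda>v. - (inverse (?h w) * (- (w \<bullet> v) * inverse (?h w)) * inverse (?h w)))) (at w)"
      by (rule Deriv.has_derivative_inverse[OF _ dh[OF w]]) (use dp[OF w] in simp)
    then show ?thesis by (simp add: mult_ac)
  qed
  have lin: "Ck_on k (ball 0 1) (\<lambda>w::complex. w \<bullet> v)" for v
    by (rule Ck_on_bounded_linear) (auto intro: bounded_linear_inner_left)
  have lin': "Ck_on k (ball 0 1) (\<lambda>w::complex. - (w \<bullet> v))" for v
    using lin[of "-v"] by simp
  show ?case
  proof
    show "Ck_on (Suc k) (ball 0 1) ?h"
    proof (rule Ck_on_SucI[OF open_ball dh])
      show "Ck_on k (ball 0 1) (\<lambda>w. - (w \<bullet> v) * inverse (?h w))" for v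
        by (rule Ck_on_mult[OF open_ball lin' Suc[THEN conjunct2]])
    qed
    show "Ck_on (Suc k) (ball 0 1) (\<lambda>w. inverse (?h w))"
    proof (rule Ck_on_SucI[OF open_ball dg])
      show "Ck_on k (ball 0 1) (\<lambda>w. (w \<bullet> v) * (inverse (?h w) * (inverse (?h w) * inverse (?h w))))" for v
        by (intro Ck_on_mult open_ball lin Suc[THEN conjunct2])
    qed
  qed
qed

text \<open>Vertical projection, with the graph of \<open>\<plusminus>sqrt (1 - |w|\<^sup>2)\<close> over the unit disc as its inverse.\<close>

lemma hemisphere_chart:
  assumes s: "s = 1 \<or> s = (-1::real)"
  defines "V \<equiv> {u \<in> S2. 0 < s * u $ 3}"
  shows "complex_chart V wc"
  unfolding complex_chart_def
proof (intro conjI exI)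
  have "open {u::real^3. 0 < s * u $ 3}" by (intro open_Collect_less continuous_intros)
  then have "openin (top_of_set S2) (S2 \<inter> {u. 0 < s * u $ 3})" by (rule openin_open_Int)
  moreover have "S2 \<inter> {u. 0 < s * u $ 3} = V" unfolding V_def by blast
  ultimately show "openin (top_of_set S2) V" by simp
  show "open (UNIV :: (real^3) set)" by simp
  show "V \<subseteq> UNIV" by simp
  show "smooth_on UNIV wc" unfolding smooth_on_def
    using Ck_on_bounded_linear[OF open_UNIV bounded_linear_wc] by blast
  show "open (ball (0::complex) 1)" by simp
  define g where "g = (\<lambda>w. hor w + (s * sqrt (1 - (cmod w)\<^sup>2)) *\<^sub>R e\<^sub>3)"
  show sm: "smooth_on (ball 0 1) g"
    unfolding smooth_on_def g_def
  proof
    fix k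
    have "bounded_linear (\<lambda>t::real. (s * t) *\<^sub>R e\<^sub>3)"
      using bounded_linear_compose[OF bounded_linear_scaleR_left[of e\<^sub>3] bounded_linear_mult_right[of s]]
      by simp
    then have "Ck_on k (ball 0 1) (\<lambda>w::complex. (s * sqrt (1 - (cmod w)\<^sup>2)) *\<^sub>R e\<^sub>3)"
      by (rule Ck_on_compose_bounded_linear[OF open_ball _ hemisphere_height_smooth[THEN conjunct1]])
    then show "Ck_on k (ball 0 1) (\<lambda>w. hor w + (s * sqrt (1 - (cmod w)\<^sup>2)) *\<^sub>R e\<^sub>3)"
      by (intro Ck_on_add Ck_on_bounded_linear[OF _ bounded_linear_hor]) auto
  qed
  show "homeomorphism V (ball 0 1) wc g"
    unfolding homeomorphism_def
  proof (intro conjI)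
    have g: "g w \<in> V" if "w \<in> ball 0 1" for w
    proof -
      have p: "1 - (cmod w)\<^sup>2 > 0" using that by (simp add: abs_square_less_1)
      have "s * s = 1" using s by auto
      then have "(cmod (wc (g w)))\<^sup>2 = 1 - (g w $ 3)\<^sup>2"
        using p by (simp add: g_def power_mult_distrib power2_eq_square[of s])
      then have "g w \<in> S2" by (rule S2_iff[THEN iffD2])
      moreover have "0 < s * g w $ 3" using p \<open>s * s = 1\<close> by (simp add: g_def mult.assoc[symmetric])
      ultimately show ?thesis by (simp add: V_def)
    qed
    have inv: "g (wc u) = u" if "u \<in> V" for u
    proof -
      have u: "u \<in> S2" "0 < s * u $ 3" using that by (auto simp: V_def)
      have n: "(cmod (wc u))\<^sup>2 = 1 - (u $ 3)\<^sup>2" by (rule S2_iff[THEN iffD1, OF u(1)])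
      have "s * sqrt (1 - (cmod (wc u))\<^sup>2) = s * \<bar>u $ 3\<bar>" unfolding n by simp
      also have "\<dots> = u $ 3" using u(2) s by auto
      finally show ?thesis by (simp add: g_def vec3_eq_iff)
    qed
    have b: "wc u \<in> ball 0 1" if "u \<in> V" for u
    proof -
      have u: "u \<in> S2" "u $ 3 \<noteq> 0" using that by (auto simp: V_def)
      have "(cmod (wc u))\<^sup>2 < 1" unfolding S2_iff[THEN iffD1, OF u(1)] using u(2) by simp
      then show ?thesis by (simp add: abs_square_less_1)
    qed
    show "\<forall>x\<in>V. g (wc x) = x" using inv by blast
    show "\<forall>y\<in>ball 0 1. wc (g y) = y" by (simp add: g_def)
    show "wc ` V = ball 0 1"
    proof (intro equalityI subsetI)
      fix w assume "w \<in> wc ` V" then show "w \<in> ball 0 1" using b by blast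
    next
      fix w :: complex assume w: "w \<in> ball 0 1"
      have "w = wc (g w)" by (simp add: g_def)
      then show "w \<in> wc ` V" using g[OF w] by blast
    qed
    show "g ` ball 0 1 = V"
    proof (intro equalityI subsetI)
      fix u assume "u \<in> g ` ball 0 1" then show "u \<in> V" using g by blast
    next
      fix u assume u: "u \<in> V"
      show "u \<in> g ` ball 0 1" by (rule image_eqI[where x = "wc u" and f = g, OF inv[OF u, symmetric] b[OF u]])
    qed
    show "continuous_on V wc" by (rule linear_continuous_on[OF bounded_linear_wc])
    have "Ck_on 0 (ball 0 1) g" using sm unfolding smooth_on_def by blast
    then show "continuous_on (ball 0 1) g" by simp
  qed
qed

section \<open>The poles\<close>

lemma poly_bounded_Icc: "\<exists>K. \<forall>z\<in>{-1..1}. \<bar>poly p z\<bar> \<le> (K::real)"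
proof -
  have "compact (poly p ` {-1..1})" by (intro compact_continuous_image continuous_intros compact_Icc)
  from compact_imp_bounded[OF this] show ?thesis unfolding bounded_iff by simp
qed

context zonal_body_roots begin

lemma q_pole: "p \<in> poles \<Longrightarrow> poly q (p $ 3) \<noteq> 0"
  using poles_facts(2)[of p] q_simple[of "p $ 3"] by auto

lemma pole_values:
  assumes "p \<in> poles"
  shows "Sh m p = 0" "R p = 1" "Fs p = 2 * \<epsilon> * poly q (p $ 3)" "Fz p = 0"
proof -
  show S: "Sh m p = 0" using poles_facts(1)[OF assms] m by (simp add: Sh_def)
  then show "R p = 1" by (simp add: R_def)
  then show "Fs p = 2 * \<epsilon> * poly q (p $ 3)" "Fz p = 0" using S by (simp_all add: Fs_def Fz_def)
qed

text \<open>For \<open>m = 1\<close> the function is \<open>2 \<epsilon> q Re w\<close> to first order, with nonzero horizontal gradient.\<close>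

lemma pole_regular:
  assumes "p \<in> poles" "m = 1"
  shows "p \<notin> critical_points f"
proof
  assume "p \<in> critical_points f"
  then have "wc (W p) = 0" by (simp add: critical_iff)
  then have "Fs p = 0" using W_parts(1)[of p] assms(2) poles_facts(1)[OF assms(1)]
    by (simp add: complex_eq_iff)
  then show False using pole_values[OF assms(1)] q_pole[OF assms(1)] eps by simp
qed

lemma D_pole: "p \<in> poles \<Longrightarrow> 2 \<le> m \<Longrightarrow> D p = 0"
  using pole_values[of p] poles_facts(1)[of p] by (simp add: D_def power_0_left)

lemma pole_critical: "p \<in> poles \<Longrightarrow> 2 \<le> m \<Longrightarrow> p \<in> critical_points f"
  using D_pole poles_in_S2 by (simp add: critical_iff W_def)

lemma Q_pole:
  assumes p: "p \<in> poles" "2 \<le> m" and v: "v $ 3 = 0"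
  shows "Q p v = Fs p * Re (of_nat m * (of_nat (m - 1) * 0 ^ (m - 2) * wc v) * wc v)"
proof -
  have d0: "dS p v = 0" using poles_facts(1)[OF p(1)] p(2) by (simp add: dS_def)
  have "m - 1 - 1 = m - 2" by simp
  then show ?thesis unfolding Q_def J_inner D_pole[OF p] d0 v poles_facts(1)[OF p(1)] by simp
qed

lemma inner_pole: "p \<in> poles \<Longrightarrow> v \<bullet> p = 0 \<longleftrightarrow> v $ 3 = 0"
  using poles_facts[of p] by (auto simp: inner_wc)

lemma pole_ordinary_saddle:
  assumes p: "p \<in> poles" and m2: "m = 2" and fin: "finite (critical_points f)"
  shows "ordinary_saddle f p"
proof -
  have c: "p \<in> critical_points f" using pole_critical p m2 by simp
  have g: "Fs p \<noteq> 0" using pole_values(3)[OF p] q_pole[OF p] eps by simp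
  have q1: "Q p (hor 1) = 2 * Fs p" "Q p (hor \<i>) = - 2 * Fs p"
    using Q_pole[OF p, of "hor 1"] Q_pole[OF p, of "hor \<i>"] m2 by simp_all
  have t: "hor 1 \<bullet> p = 0" "hor \<i> \<bullet> p = 0" using inner_pole[OF p] by simp_all
  show ?thesis
  proof (cases "Fs p > 0")
    case True
    show ?thesis
      by (rule indefinite_critical_point[OF c fin J_sym t(1) _ t(2)]) (use q1 True in auto)
  next
    case False
    then have "Fs p < 0" using g by simp
    then show ?thesis
      by (intro indefinite_critical_point[OF c fin J_sym t(2) _ t(1)]) (use q1 in auto)
  qed
qed

text \<open>For \<open>m \<ge> 3\<close> the second derivatives of \<open>w^m\<close> vanish at the pole.\<close>

lemma pole_degenerate:
  assumes p: "p \<in> poles" and m3: "3 \<le> m"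
  shows "degenerate_critical f p"
  unfolding degenerate_critical_def
proof (intro conjI exI)
  show "p \<in> critical_points f" using pole_critical p m3 by simp
  show "(sphere_grad f has_derivative H p) (at p within S2)" by (rule sphere_grad_deriv[OF poles_in_S2[OF p]])
  show "hor 1 \<bullet> p = 0" using inner_pole[OF p] by simp
  show "hor 1 \<noteq> 0" by (simp add: vec3_eq_iff)
  have d0: "dS p (hor 1) = 0" using poles_facts(1)[OF p] m3 by (simp add: dS_def power_0_left)
  have "m - 1 - 1 \<noteq> 0" using m3 by simp
  then have w0: "wc p ^ (m - 1 - 1) = 0" using poles_facts(1)[OF p] by (simp add: power_0_left)
  have "J p (hor 1) = 0" unfolding J_def d0 w0 by simp
  then show "H p (hor 1) = 0" using D_pole[OF p] m3 by (simp add: H_def)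
qed

lemma Sh_bound: "\<bar>Sh m u\<bar> \<le> cmod (wc u) ^ m"
  unfolding Sh_def using abs_Re_le_cmod[of "wc u ^ m"] by (simp add: norm_power)

lemma f_at: assumes "2 \<le> m" "u \<in> S2" shows "f u = (R u)\<^sup>2 + C"
  using f_eq[OF assms(2)] kap[OF assms(1)] by (simp add: R_def)

text \<open>Directions \<open>\<omega>\<close> with \<open>\<omega>^m = 1\<close> and with \<open>\<omega>^m = -1\<close> both occur, and \<open>f\<close> increases along one kind
  and decreases along the other. This argument does not use second derivatives, so it covers all
  \<open>m \<ge> 2\<close>.\<close>

lemma pole_saddle_type:
  assumes p: "p \<in> poles" and m2: "2 \<le> m"
  shows "p \<in> saddle_type_points f"
proof -
  have pS: "p \<in> S2" by (rule poles_in_S2[OF p])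
  have key: "\<not> (\<forall>\<^sub>F u in at p within S2. \<tau> * (f u - f p) \<le> 0)" if tau: "\<tau> = 1 \<or> \<tau> = (-1::real)" for \<tau>
  proof
    assume ev: "\<forall>\<^sub>F u in at p within S2. \<tau> * (f u - f p) \<le> 0"
    define \<sigma> where "\<sigma> = \<tau> * sgn (poly q (p $ 3))"
    have sg: "\<sigma> = 1 \<or> \<sigma> = -1" using q_pole[OF p] tau by (auto simp: \<sigma>_def sgn_if)
    \<comment> \<open>The horizontal direction along which \<open>\<tau> q Re (w^m)\<close> is positive.\<close>
    obtain \<omega> where om: "\<omega> ^ m = complex_of_real \<sigma>" "cmod \<omega> = 1"
    proof (cases "\<sigma> = 1")
      case True then show ?thesis using that[of 1] by simp
    next
      case False
      then have "\<sigma> = -1" using sg by simp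
      moreover have "cis (pi / m) ^ m = -1" using m by (simp add: Complex.DeMoivre)
      ultimately show ?thesis using that[of "cis (pi / m)"] by simp
    qed
    define cc where "cc = (\<lambda>t. hor (of_real t * \<omega>) + (sqrt (1 - t\<^sup>2) * p $ 3) *\<^sub>R e\<^sub>3)"
    have p3: "(p $ 3)\<^sup>2 = 1" using poles_facts(2)[OF p] by auto
    have ccS: "cc t \<in> S2" if "0 < t" "t < 1" for t
    proof (rule S2_iff[THEN iffD2])
      have "t\<^sup>2 \<le> 1" using that by (simp add: power_le_one)
      then show "(cmod (wc (cc t)))\<^sup>2 = 1 - (cc t $ 3)\<^sup>2"
        using om(2) p3 by (simp add: cc_def norm_mult power_mult_distrib)
    qed
    have Scc: "Sh m (cc t) = t ^ m * \<sigma>" for t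
      by (simp add: Sh_def cc_def power_mult_distrib om(1))
    have evt: "\<forall>\<^sub>F t in at_right (0::real). 0 < t \<and> t < 1" using eventually_at_right_real[of 0 1] by simp
    have "((\<lambda>t. hor (of_real t * \<omega>) + (sqrt (1 - t\<^sup>2) * p $ 3) *\<^sub>R e\<^sub>3) \<longlongrightarrow> hor (of_real 0 * \<omega>) + (sqrt (1 - 0\<^sup>2) * p $ 3) *\<^sub>R e\<^sub>3) (at_right 0)"
      by (intro tendsto_intros bounded_linear.tendsto[OF bounded_linear_hor])
    then have tcc: "(cc \<longlongrightarrow> p) (at_right 0)"
      unfolding cc_def using poles_facts(3)[OF p] by simp
    have "((\<lambda>t. poly q (cc t $ 3)) \<longlongrightarrow> poly q (p $ 3)) (at_right 0)"
      by (intro tendsto_poly tendsto_vec_nth tcc)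
    then have ts: "((\<lambda>t. sgn (poly q (p $ 3)) * poly q (cc t $ 3)) \<longlongrightarrow> sgn (poly q (p $ 3)) * poly q (p $ 3)) (at_right 0)"
      by (intro tendsto_mult tendsto_const)
    have "sgn (poly q (p $ 3)) * poly q (p $ 3) > 0"
      using q_pole[OF p] by (simp add: sgn_mult_self_eq mult_sgn_abs sgn_if)
    then have "\<forall>\<^sub>F t in at_right 0. sgn (poly q (p $ 3)) * poly q (cc t $ 3) > 0"
      by (rule order_tendstoD(1)[OF ts])
    with evt have pos: "\<forall>\<^sub>F t in at_right 0. 0 < t \<and> t < 1 \<and> \<tau> * (f (cc t) - f p) > 0"
    proof eventually_elim
      case (elim t)
      then have u: "cc t \<in> S2" using ccS by blast
      define X where "X = \<epsilon> * Sh m (cc t) * poly q (cc t $ 3)"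
      have "\<tau> * X = \<epsilon> * t ^ m * (sgn (poly q (p $ 3)) * poly q (cc t $ 3))"
        using tau by (auto simp: X_def Scc \<sigma>_def)
      then have X: "\<tau> * X > 0" using elim eps by simp
      have "1 + X > 0" using Rpos[OF u] by (simp add: X_def)
      then have "(\<tau> * X) * (2 + X) > 0" using X by simp
      moreover have "f (cc t) - f p = X * (2 + X)"
        unfolding f_at[OF m2 u] f_at[OF m2 pS] pole_values(2)[OF p]
        by (simp add: R_def X_def power2_eq_square algebra_simps)
      ultimately show ?case using elim by (simp add: mult.assoc)
    qed
    have "filterlim cc (at p within S2) (at_right 0)"
      unfolding filterlim_at
    proof
      show "\<forall>\<^sub>F t in at_right 0. cc t \<in> S2 \<and> cc t \<noteq> p"
        using pos by eventually_elim (use ccS in auto)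
    qed (rule tcc)
    from eventually_compose_filterlim[OF ev this]
    have "\<forall>\<^sub>F t in at_right 0. \<tau> * (f (cc t) - f p) \<le> 0" .
    with pos have "\<forall>\<^sub>F t in at_right (0::real). False" by eventually_elim simp
    then show False by simp
  qed
  show ?thesis using pole_critical[OF p m2] key[of 1] key[of "-1"]
    by (simp add: saddle_type_points_def stable_points_def unstable_points_def)
qed

text \<open>In the chart \<open>w\<close> the function is a constant plus \<open>2 \<epsilon> q(z) Re (w^m) + O(|w|^(2m))\<close>, and \<open>q(z)\<close> differs
  from its value at the pole by \<open>O(|z - s|) = O(|w|\<^sup>2)\<close>.\<close>

lemma pole_monkey:
  assumes p: "p \<in> poles" and m3: "3 \<le> m"
  shows "monkey_saddle m f p"
  unfolding monkey_saddle_def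
proof (intro conjI exI)
  define s where "s = p $ 3"
  have s: "s = 1 \<or> s = -1" using poles_facts(2)[OF p] by (simp add: s_def)
  have pS: "p \<in> S2" by (rule poles_in_S2[OF p])
  have m2: "2 \<le> m" using m3 by simp
  show "3 \<le> m" by (rule m3)
  show "degenerate_critical f p" by (rule pole_degenerate[OF p m3])
  show "complex_chart {u \<in> S2. 0 < s * u $ 3} wc" by (rule hemisphere_chart[OF s])
  have ss: "s * s = 1" using s by auto
  show "p \<in> {u \<in> S2. 0 < s * u $ 3}" using pS ss by (simp add: s_def)
  show "wc p = 0" by (rule poles_facts(1)[OF p])
  define a where "a = 2 * \<epsilon> * poly q s"
  show "a \<noteq> 0" using eps q_pole[OF p] by (simp add: a_def s_def)
  have "poly (q - [:poly q s:]) s = 0" by simp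
  then have "[:- s, 1:] dvd q - [:poly q s:]" by (simp only: poly_eq_0_iff_dvd)
  then obtain k where k: "q - [:poly q s:] = [:- s, 1:] * k" by (rule dvdE)
  have qk: "poly q z - poly q s = (z - s) * poly k z" for z
  proof -
    have "poly q z - poly q s = poly (q - [:poly q s:]) z" by simp
    also have "\<dots> = (z - s) * poly k z" unfolding k poly_mult by simp
    finally show ?thesis .
  qed
  obtain K where K: "\<And>z. z \<in> {-1..1} \<Longrightarrow> \<bar>poly k z\<bar> \<le> K"
    using poly_bounded_Icc[of k] by blast
  obtain M where M: "\<And>z. z \<in> {-1..1} \<Longrightarrow> \<bar>poly q z\<bar> \<le> M"
    using poly_bounded_Icc[of q] by blast
  have M0: "0 \<le> M" "0 \<le> K" using M[of 0] K[of 0] by auto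
  have "\<forall>\<^sub>F u in at p within S2. 0 < s * u $ 3"
  proof -
    have "((\<lambda>u. s * u $ 3) \<longlongrightarrow> s * p $ 3) (at p within S2)" by (intro tendsto_intros)
    then show ?thesis using order_tendstoD(1)[of "\<lambda>u. s * u $ 3" "s * p $ 3" _ 0] ss by (simp add: s_def)
  qed
  moreover have "\<forall>\<^sub>F u in at p within S2. u \<in> S2" by (simp add: eventually_at_filter)
  ultimately have "\<forall>\<^sub>F u in at p within S2. norm (f u - f p - a * Re (wc u ^ m)) \<le>
     (2 * \<epsilon> * K + \<epsilon>\<^sup>2 * M\<^sup>2) * norm (norm (wc u) ^ (m + 1))"
  proof eventually_elim
    case (elim u)
    define z r where "z = u $ 3" and "r = cmod (wc u)"
    have z: "\<bar>z\<bar> \<le> 1" using S2_third(1) elim by (simp add: z_def)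
    then have zI: "z \<in> {-1..1}" by auto
    have n: "r\<^sup>2 = 1 - z\<^sup>2" using S2_iff[THEN iffD1] elim by (simp add: z_def r_def)
    have r: "0 \<le> r" "r \<le> 1"
    proof -
      show "0 \<le> r" by (simp add: r_def)
      have "r\<^sup>2 \<le> 1" unfolding n by simp
      then show "r \<le> 1" by (simp add: abs_square_le_1 r_def)
    qed
    have S: "\<bar>Sh m u\<bar> \<le> r ^ m" using Sh_bound by (simp add: r_def)
    have zs: "\<bar>z - s\<bar> \<le> r"
    proof -
      have sz: "s * z > 0" using elim by (simp add: z_def)
      have "\<bar>z - s\<bar> = 1 - \<bar>z\<bar>" using s sz z by auto
      also have "\<dots> \<le> 1 - z\<^sup>2" using z mult_left_le[of "\<bar>z\<bar>" "\<bar>z\<bar>"] by (simp add: power2_eq_square)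
      also have "\<dots> = r * r" unfolding n[symmetric] by (simp add: power2_eq_square)
      also have "\<dots> \<le> r" using r by (simp add: mult_left_le)
      finally show ?thesis .
    qed
    have fp: "f p = 1 + C" using f_at[OF m2 pS] pole_values(2)[OF p] by simp
    have fu: "f u = (1 + \<epsilon> * Sh m u * poly q z)\<^sup>2 + C" using f_at[OF m2, of u] elim by (simp add: R_def z_def)
    have "f u - f p - a * Re (wc u ^ m) = 2 * \<epsilon> * Sh m u * (poly q z - poly q s) + \<epsilon>\<^sup>2 * (Sh m u)\<^sup>2 * (poly q z)\<^sup>2"
      unfolding fp fu by (simp add: a_def Sh_def[symmetric] power2_eq_square algebra_simps)
    also have "\<bar>\<dots>\<bar> \<le> \<bar>2 * \<epsilon> * Sh m u * (poly q z - poly q s)\<bar> + \<bar>\<epsilon>\<^sup>2 * (Sh m u)\<^sup>2 * (poly q z)\<^sup>2\<bar>"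
      by (rule abs_triangle_ineq)
    also have "\<bar>2 * \<epsilon> * Sh m u * (poly q z - poly q s)\<bar> \<le> 2 * \<epsilon> * (r ^ m * (r * K))"
    proof -
      have "\<bar>poly q z - poly q s\<bar> \<le> r * K"
        unfolding qk abs_mult using zs K[OF zI] r M0 by (intro mult_mono) auto
      then have "\<bar>Sh m u\<bar> * \<bar>poly q z - poly q s\<bar> \<le> r ^ m * (r * K)" using S r M0 by (intro mult_mono) auto
      then show ?thesis using eps by (simp add: abs_mult mult.assoc)
    qed
    also have "\<bar>\<epsilon>\<^sup>2 * (Sh m u)\<^sup>2 * (poly q z)\<^sup>2\<bar> \<le> \<epsilon>\<^sup>2 * (r ^ (m + 1) * M\<^sup>2)"
    proof -
      have "(Sh m u)\<^sup>2 \<le> (r ^ m)\<^sup>2" using S r by (intro abs_le_square_iff[THEN iffD1]) auto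
      also have "\<dots> = r ^ (2 * m)" by (simp add: power_mult[symmetric] mult.commute)
      also have "\<dots> \<le> r ^ (m + 1)" using r m by (intro power_decreasing) auto
      finally have A: "(Sh m u)\<^sup>2 \<le> r ^ (m + 1)" .
      have "(poly q z)\<^sup>2 \<le> M\<^sup>2" using M[OF zI] M0 by (intro abs_le_square_iff[THEN iffD1]) auto
      then have "(Sh m u)\<^sup>2 * (poly q z)\<^sup>2 \<le> r ^ (m + 1) * M\<^sup>2" using A r by (intro mult_mono) auto
      then show ?thesis by (simp add: mult.assoc mult_left_mono)
    qed
    finally have "\<bar>f u - f p - a * Re (wc u ^ m)\<bar> \<le> 2 * \<epsilon> * (r ^ m * (r * K)) + \<epsilon>\<^sup>2 * (r ^ (m + 1) * M\<^sup>2)" by simp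
    also have "\<dots> = (2 * \<epsilon> * K + \<epsilon>\<^sup>2 * M\<^sup>2) * r ^ (m + 1)" by (simp add: algebra_simps)
    finally show ?case using r by (simp add: r_def)
  qed
  then show "(\<lambda>u. f u - f p - a * Re (wc u ^ m)) \<in> O[at p within S2](\<lambda>u. norm (wc u) ^ (m + 1))"
    by (rule bigoI)
qed
end

section \<open>The index at the poles\<close>

lemma complex_of_inner:
  "Complex (Re (cnj y * a)) (Re (cnj y * (a * \<i>))) = cnj a * y"
  "Complex (Re (cnj y * a)) (Re (cnj y * (a * - \<i>))) = a * cnj y"
  by (rule complex_eqI; simp; simp add: mult.commute)+

context zonal_body_roots begin

lemma D_radial_factor: "D u \<bullet> u = Sh m u * (Fs u * real m + 2 * R u * \<epsilon> * poly (pderiv q) (u $ 3) * u $ 3)"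
  unfolding D_radial Fz_def by (simp add: algebra_simps)

text \<open>The gradient of \<open>Re (w^m)\<close> is \<open>m cnj (w^(m - 1))\<close>, which turns \<open>m - 1\<close> times backwards along a circle.
  Removing the radial part of the gradient changes it only by terms of order \<open>|w|^(m + 1)\<close>.\<close>

lemma pole_index:
  assumes p: "p \<in> poles" and m2: "2 \<le> m" and fin: "finite (critical_points f)"
  shows "has_ph_index (sphere_grad f) p (1 - int m)"
proof (rule has_ph_index_near_power[OF poles_in_S2[OF p] eventually_sphere_grad_nonzero[OF fin poles_in_S2[OF p]]])
  fix e1 e2 assume tb: "tangent_basis p e1 e2"
  have e3: "e1 $ 3 = 0" "e2 $ 3 = 0" using tb inner_pole[OF p] by (auto simp: tangent_basis_def)
  have pn: "norm p = 1" using poles_in_S2[OF p] by simp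
  define a where "a = wc e1"
  define c where "c = cnj a * wc e2"
  have "e1 \<bullet> e1 = 1" "e2 \<bullet> e2 = 1" "e1 \<bullet> e2 = 0" using tb by (auto simp: tangent_basis_def norm_eq_1)
  then have i: "Re (cnj a * a) = 1" "Re (cnj (wc e2) * wc e2) = 1" "Re c = 0"
    using e3 by (auto simp: inner_wc a_def c_def)
  have na: "cmod a = 1" "cmod (wc e2) = 1"
    using i(1,2) by (auto simp: cmod_def power2_eq_square)
  have aa: "a * cnj a = 1" using complex_norm_square[of a] na by simp
  have "cmod c = 1" using na by (simp add: c_def norm_mult)
  then have cI: "c = \<i> \<or> c = - \<i>" using i(3) by (auto simp: cmod_def complex_eq_iff)
  have e2: "wc e2 = a * c" unfolding c_def using aa by (simp add: mult.assoc[symmetric])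
  \<comment> \<open>The tangent basis is either positively oriented in the horizontal plane (\<open>c = \<i>\<close>) or negatively
    (\<open>c = -\<i>\<close>); the leading coefficient of the gradient depends on this, the exponent does not.\<close>
  define \<alpha> where "\<alpha> = of_real (Fs p * real m) * (if c = \<i> then cnj a ^ m else a ^ m)"
  define \<mu> where "\<mu> = \<bar>Fs p\<bar> * real m"
  have al: "cmod \<alpha> = \<mu>" using na by (simp add: \<alpha>_def \<mu>_def norm_mult norm_power abs_mult)
  have F0: "Fs p \<noteq> 0" using pole_values(3)[OF p] q_pole[OF p] eps by simp
  then have mu: "\<mu> > 0" using m by (simp add: \<mu>_def)
  \<comment> \<open>By \<open>D_radial_factor\<close> the radial part of \<open>D\<close> is \<open>Sh m u\<close> times this bounded factor.\<close>
  define L where "L = (\<lambda>u. Fs u * real m + 2 * R u * \<epsilon> * poly (pderiv q) (u $ 3) * u $ 3)"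
  define B where "B = \<bar>L p\<bar> + 1"
  have cF: "isCont Fs p" by (rule has_derivative_continuous[OF Fs_derivative])
  have cR: "isCont R p" by (rule has_derivative_continuous[OF R_derivative])
  have cp: "isCont (\<lambda>u::real^3. poly (pderiv q) (u $ 3)) p"
    by (rule has_derivative_continuous[OF poly_comp_has_derivative])
  have cL: "isCont L p" unfolding L_def by (intro continuous_intros cF cR cp)
  have "\<bar>Fs p\<bar> / 4 > 0" using F0 by simp
  with cF have "\<exists>d>0. \<forall>u. dist u p < d \<longrightarrow> dist (Fs u) (Fs p) < \<bar>Fs p\<bar> / 4"
    unfolding continuous_at_eps_delta by blast
  then obtain d1 where d1: "d1 > 0" "\<forall>u. norm (u - p) < d1 \<longrightarrow> \<bar>Fs u - Fs p\<bar> < \<bar>Fs p\<bar> / 4"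
    unfolding dist_norm real_norm_def by blast
  have "\<exists>d>0. \<forall>u. dist u p < d \<longrightarrow> dist (L u) (L p) < 1"
    using cL zero_less_one unfolding continuous_at_eps_delta by blast
  then obtain d2 where d2: "d2 > 0" "\<forall>u. norm (u - p) < d2 \<longrightarrow> \<bar>L u - L p\<bar> < 1"
    unfolding dist_norm real_norm_def by blast
  have B: "B > 0" by (simp add: B_def)
  define r0 where "r0 = Min {1, d1/2, d2/2, \<mu> / (4 * B)}"
  have r0: "r0 > 0" using d1 d2 mu B by (simp add: r0_def)
  have "\<forall>\<^sub>F r in at_right 0. 0 < r \<and> r < r0" using eventually_at_right_real[OF r0] by simp
  then have "\<forall>\<^sub>F r in at_right 0. \<forall>t.
      cmod (Complex (W (tangent_circle p e1 e2 r t) \<bullet> e1) (W (tangent_circle p e1 e2 r t) \<bullet> e2)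
        - of_real (r ^ (m - 1)) * \<alpha> * cis (2 * pi * (1 - int m) * t)) < r ^ (m - 1) * cmod \<alpha>"
  proof eventually_elim
    case (elim r)
    then have r: "0 < r" "r < 1" "2 * r < d1" "2 * r < d2" "r < \<mu> / (4 * B)" by (auto simp: r0_def)
    show ?case
    proof
      fix t
      define u where "u = tangent_circle p e1 e2 r t"
      define w where "w = wc u"
      define \<tau> where "\<tau> = 2 * pi * t"
      have uS: "u \<in> S2" unfolding u_def using r by (intro tangent_circle_in_sphere[OF pn tb]) auto
      have cs: "of_real (cos \<tau>) + of_real (sin \<tau>) * c = (if c = \<i> then cis \<tau> else cis (- \<tau>))"
        using cI by (auto simp: complex_eq_iff)
      have w: "w = of_real r * a * (if c = \<i> then cis \<tau> else cis (- \<tau>))"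
        unfolding cs[symmetric] w_def u_def tangent_circle_def wc_add wc_scale poles_facts(1)[OF p] e2
          a_def[symmetric] \<tau>_def[symmetric]
        by (simp add: scaleR_conv_of_real algebra_simps)
      have nw: "cmod w = r" unfolding w using na r by (simp add: norm_mult)
      have up: "norm (u - p) \<le> 2 * r"
      proof -
        have "u $ 3 = sqrt (1 - r\<^sup>2) * p $ 3" using e3 by (simp add: u_def tangent_circle_def)
        then have "u - p = hor w + ((sqrt (1 - r\<^sup>2) - 1) * p $ 3) *\<^sub>R e\<^sub>3"
          by (simp add: vec3_eq_iff w_def poles_facts(1)[OF p] algebra_simps)
        then have "norm (u - p) \<le> norm (hor w) + norm (((sqrt (1 - r\<^sup>2) - 1) * p $ 3) *\<^sub>R e\<^sub>3)"
          by (simp only: norm_triangle_ineq)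
        moreover have "norm (hor w) = r"
        proof -
          have "(norm (hor w))\<^sup>2 = (cmod w)\<^sup>2" unfolding power2_norm_eq_inner[of "hor w"] inner_wc cmod_power2
            by (simp add: power2_eq_square)
          then have "(norm (hor w))\<^sup>2 = r\<^sup>2" unfolding nw .
          then show ?thesis by (rule power2_eq_imp_eq) (use r in auto)
        qed
        moreover have "norm (((sqrt (1 - r\<^sup>2) - 1) * p $ 3) *\<^sub>R e\<^sub>3) \<le> r"
        proof -
          have r2: "r\<^sup>2 \<le> 1" "r * r \<le> r" using r mult_left_le[of r r] by (simp_all add: power_le_one)
          have "1 - r\<^sup>2 \<le> sqrt (1 - r\<^sup>2)" using r2 by (intro real_le_rsqrt) (auto simp: power2_eq_square mult_left_le)
          moreover have "sqrt (1 - r\<^sup>2) \<le> 1" using r2 by simp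
          ultimately have "\<bar>sqrt (1 - r\<^sup>2) - 1\<bar> \<le> r" using r2 by (simp add: power2_eq_square abs_le_iff)
          moreover have "\<bar>p $ 3\<bar> = 1" using poles_facts(2)[OF p] by auto
          ultimately show ?thesis by (simp add: norm_axis_1 abs_mult del: real_sqrt_le_1_iff)
        qed
        ultimately show ?thesis by linarith
      qed
      have Fd: "\<bar>Fs u - Fs p\<bar> < \<bar>Fs p\<bar> / 4" using d1(2)[rule_format, of u] up r by simp
      have Lu: "\<bar>L u\<bar> \<le> B" using d2(2)[rule_format, of u] up r by (simp add: B_def)
      define Y where "Y = of_real (Fs p * real m) * cnj (w ^ (m - 1))"
      have Wd: "wc (W u) - Y = of_real ((Fs u - Fs p) * real m) * cnj (w ^ (m - 1)) - of_real (Sh m u * L u) * w"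
        unfolding W_parts(1) Y_def D_radial_factor L_def w_def[symmetric]
        by (simp add: scaleR_conv_of_real algebra_simps)
      have rm: "r ^ m = r ^ (m - 1) * r" using m by (cases m) auto
      have "cmod (wc (W u) - Y) \<le> \<bar>Fs u - Fs p\<bar> * real m * r ^ (m - 1) + \<bar>Sh m u\<bar> * \<bar>L u\<bar> * r"
        unfolding Wd using norm_triangle_ineq4[of "of_real ((Fs u - Fs p) * real m) * cnj (w ^ (m - 1))" "of_real (Sh m u * L u) * w"]
        by (simp add: norm_mult norm_power nw abs_mult del: of_real_diff)
      also have "\<bar>Fs u - Fs p\<bar> * real m * r ^ (m - 1) \<le> \<mu> / 4 * r ^ (m - 1)"
      proof -
        have "\<bar>Fs u - Fs p\<bar> * real m \<le> \<bar>Fs p\<bar> / 4 * real m" using Fd by (intro mult_right_mono) auto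
        then have "\<bar>Fs u - Fs p\<bar> * real m \<le> \<mu> / 4" by (simp add: \<mu>_def)
        then show ?thesis using r by (intro mult_right_mono) auto
      qed
      also have "\<bar>Sh m u\<bar> * \<bar>L u\<bar> * r \<le> r ^ m * B * r"
        using Sh_bound[of u] Lu r by (intro mult_mono) (auto simp: nw[unfolded w_def])
      also have "r ^ m * B * r \<le> \<mu> / 4 * r ^ (m - 1)"
      proof -
        have "r * B \<le> \<mu> / 4" using r(5) B by (simp add: field_simps)
        moreover have "r * (r * B) \<le> 1 * (r * B)" using r B by (intro mult_right_mono) auto
        ultimately have "r * (r * B) \<le> \<mu> / 4" by simp
        then have "r ^ (m - 1) * (r * (r * B)) \<le> r ^ (m - 1) * (\<mu> / 4)" using r by (intro mult_left_mono) auto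
        then show ?thesis unfolding rm by (simp add: mult_ac)
      qed
      finally have "cmod (wc (W u) - Y) \<le> \<mu> / 4 * r ^ (m - 1) + \<mu> / 4 * r ^ (m - 1)" by simp
      also have "\<dots> < \<mu> * r ^ (m - 1)" using mu r by (simp add: field_simps)
      finally have main: "cmod (wc (W u) - Y) < r ^ (m - 1) * cmod \<alpha>" unfolding al by (simp add: mult.commute)
      have am: "cnj a * cnj a ^ (m - 1) = cnj a ^ m" "a * a ^ (m - 1) = a ^ m"
        unfolding power_Suc[symmetric] using m by simp_all
      have ck: "2 * pi * (1 - int m) * t = - (real (m - 1) * \<tau>)"
      proof -
        have e: "real_of_int (1 - int m) = - real (m - 1)"
          unfolding of_nat_diff[OF m] of_int_diff of_int_of_nat_eq by simp
        have "x * - k * t = - (k * (x * t))" for x k :: real by simp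
        then show ?thesis unfolding \<tau>_def e .
      qed
      show "cmod (Complex (W (tangent_circle p e1 e2 r t) \<bullet> e1) (W (tangent_circle p e1 e2 r t) \<bullet> e2)
        - of_real (r ^ (m - 1)) * \<alpha> * cis (2 * pi * (1 - int m) * t)) < r ^ (m - 1) * cmod \<alpha>"
        unfolding u_def[symmetric]
      proof (cases "c = \<i>")
        case True
        have "Complex (W u \<bullet> e1) (W u \<bullet> e2) = cnj a * wc (W u)"
          unfolding inner_wc e3 e2 True a_def[symmetric] mult_zero_right add_0_right by (rule complex_of_inner)
        moreover have "of_real (r ^ (m - 1)) * \<alpha> * cis (2 * pi * (1 - int m) * t) = cnj a * Y"
          unfolding Y_def \<alpha>_def w ck using True
          by (simp add: power_mult_distrib Complex.DeMoivre cis_cnj am(1)[symmetric])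
        ultimately have "Complex (W u \<bullet> e1) (W u \<bullet> e2) - of_real (r ^ (m - 1)) * \<alpha> * cis (2 * pi * (1 - int m) * t)
          = cnj a * (wc (W u) - Y)" by (simp add: algebra_simps)
        then show "cmod (Complex (W u \<bullet> e1) (W u \<bullet> e2) - of_real (r ^ (m - 1)) * \<alpha> * cis (2 * pi * (1 - int m) * t)) < r ^ (m - 1) * cmod \<alpha>"
          using main na by (simp add: norm_mult)
      next
        case False
        then have c: "c = - \<i>" using cI by simp
        have "Complex (W u \<bullet> e1) (W u \<bullet> e2) = a * cnj (wc (W u))"
          unfolding inner_wc e3 e2 c a_def[symmetric] mult_zero_right add_0_right by (rule complex_of_inner)
        moreover have "of_real (r ^ (m - 1)) * \<alpha> * cis (2 * pi * (1 - int m) * t) = a * cnj Y"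
          unfolding Y_def \<alpha>_def w ck using False
          by (simp add: power_mult_distrib Complex.DeMoivre am(2)[symmetric])
        ultimately have "Complex (W u \<bullet> e1) (W u \<bullet> e2) - of_real (r ^ (m - 1)) * \<alpha> * cis (2 * pi * (1 - int m) * t)
          = a * cnj (wc (W u) - Y)" by (simp add: algebra_simps)
        then show "cmod (Complex (W u \<bullet> e1) (W u \<bullet> e2) - of_real (r ^ (m - 1)) * \<alpha> * cis (2 * pi * (1 - int m) * t)) < r ^ (m - 1) * cmod \<alpha>"
          using main na by (simp only: norm_mult complex_mod_cnj mult_1)
      qed
    qed
  qed
  then show "\<exists>\<alpha> n. \<forall>\<^sub>F r in at_right 0. \<forall>t.
      cmod (Complex (W (tangent_circle p e1 e2 r t) \<bullet> e1) (W (tangent_circle p e1 e2 r t) \<bullet> e2)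
        - of_real (r ^ n) * \<alpha> * cis (2 * pi * (1 - int m) * t)) < r ^ n * cmod \<alpha>" by blast
qed

end

section \<open>The list of critical points\<close>

context zonal_body_roots begin

definition extrema :: "real \<Rightarrow> (real^3) set"
  where "extrema \<tau> = (\<Union>(z, c)\<in>extremum_index \<tau>. fibre m z c)"

definition saddles :: "(real^3) set"
  where "saddles = (\<Union>(z, c)\<in>saddle_index. fibre m z c)"

lemma extremum_index_facts:
  assumes tau: "\<tau> \<in> {1, -1}"
  shows "finite (extremum_index \<tau>)" "card (extremum_index \<tau>) = d + 1"
    and "\<And>z c. (z, c) \<in> extremum_index \<tau> \<Longrightarrow> \<bar>z\<bar> < 1 \<and> cmod c = 1"
proof -
  show "finite (extremum_index \<tau>)" using Z by (simp add: extremum_index_def)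
  have sg: "- \<tau> * \<eta> r \<in> {1, -1}" if "r \<in> Z" for r using chi[OF that] tau by auto
  have "inj_on (\<lambda>r. (b (- \<tau> * \<eta> r) r, complex_of_real (- \<tau> * \<eta> r))) Z"
  proof (rule inj_onI)
    fix r r' assume r: "r \<in> Z" "r' \<in> Z"
      "(b (- \<tau> * \<eta> r) r, complex_of_real (- \<tau> * \<eta> r)) = (b (- \<tau> * \<eta> r') r', complex_of_real (- \<tau> * \<eta> r'))"
    then have e2: "- \<tau> * \<eta> r = - \<tau> * \<eta> r'" by (simp only: prod.inject of_real_eq_iff)
    have "b (- \<tau> * \<eta> r) r = b (- \<tau> * \<eta> r') r'" using r(3) by (simp only: prod.inject)
    from inj_onD[OF bij_betw_imp_inj_on[OF b[OF sg[OF r(1)]]] this[folded e2] r(1,2)]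
    show "r = r'" .
  qed
  then show "card (extremum_index \<tau>) = d + 1"
    unfolding extremum_index_def using Z by (simp only: card_image)
  show "\<bar>z\<bar> < 1 \<and> cmod c = 1" if zc: "(z, c) \<in> extremum_index \<tau>" for z c
  proof -
    obtain r where r: "r \<in> Z" "z = b (- \<tau> * \<eta> r) r" "c = of_real (- \<tau> * \<eta> r)"
      using zc unfolding extremum_index_def image_iff prod.inject by blast
    have "z \<in> b (- \<tau> * \<eta> r) ` Z" using r by blast
    then have "\<bar>z\<bar> < 1" using b[OF sg[OF r(1)]] by (auto simp: bij_betw_def)
    moreover have "cmod c = 1" using sg[OF r(1)] unfolding r(3) norm_of_real by auto
    ultimately show ?thesis by simp
  qed
qed

lemma saddle_index_facts:
  shows "finite saddle_index" "card saddle_index = d * 2"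
    and "\<And>z c. (z, c) \<in> saddle_index \<Longrightarrow> \<bar>z\<bar> < 1 \<and> cmod c = 1"
proof -
  show "finite saddle_index" using q_roots by (simp add: saddle_index_def)
  have "card {\<i>, - \<i>} = 2" by (simp add: complex_eq_iff)
  then show "card saddle_index = d * 2" unfolding saddle_index_def card_cartesian_product q_roots(2) by simp
  show "\<bar>z\<bar> < 1 \<and> cmod c = 1" if "(z, c) \<in> saddle_index" for z c
    using that q_simple by (auto simp: saddle_index_def)
qed

lemma extrema_critical:
  assumes tau: "\<tau> \<in> {1, -1}" and u: "u \<in> extrema \<tau>"
  shows "u \<in> critical_points f" and "\<And>v. v \<bullet> u = 0 \<Longrightarrow> v \<noteq> 0 \<Longrightarrow> \<tau> * Q u v > 0"
proof -
  obtain r where r: "r \<in> Z" "u \<in> fibre m (b (- \<tau> * \<eta> r) r) (of_real (- \<tau> * \<eta> r))"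
    using u unfolding extrema_def extremum_index_def by blast
  have e: "\<eta> r * \<eta> r = 1" using chi[OF r(1)] by auto
  have sg: "- \<tau> * \<eta> r \<in> {1, -1}" using chi[OF r(1)] tau by auto
  have t: "- (- \<tau> * \<eta> r) * \<eta> r = \<tau>" using e by (simp add: mult.assoc)
  show "u \<in> critical_points f" by (rule extremum_point(1)[OF r(1) sg r(2)])
  show "\<tau> * Q u v > 0" if "v \<bullet> u = 0" "v \<noteq> 0" for v
    using extremum_point(2)[OF r(1) sg r(2) that] unfolding t .
qed

text \<open>Away from the poles this is \<open>critical_nonpole_classified\<close>, with the points on the real meridians
  regrouped by the sign of the Hessian instead of the sign of \<open>w^m\<close>.\<close>

lemma critical_points_eq:
  "critical_points f = extrema 1 \<union> extrema (-1) \<union> saddles \<union> (if 2 \<le> m then poles else {})"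
proof (intro equalityI subsetI)
  fix u assume u: "u \<in> critical_points f"
  show "u \<in> extrema 1 \<union> extrema (-1) \<union> saddles \<union> (if 2 \<le> m then poles else {})"
  proof (cases "wc u = 0")
    case True
    then have "u \<in> poles" using S2_third(3) u by (simp add: critical_iff)
    moreover have "2 \<le> m"
    proof (rule ccontr)
      assume "\<not> 2 \<le> m"
      then have "m = 1" using m by simp
      then show False using pole_regular[OF \<open>u \<in> poles\<close>] u by simp
    qed
    ultimately show ?thesis by simp
  next
    case False
    from critical_nonpole_classified[OF u this] show ?thesis
    proof
      assume "\<exists>(z, c)\<in>saddle_index. u \<in> fibre m z c"
      then show ?thesis unfolding saddles_def by blast
    next
      assume "\<exists>r\<in>Z. \<exists>\<sigma>\<in>{1, -1}. u \<in> fibre m (b \<sigma> r) (of_real \<sigma>)"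
      then obtain r \<sigma> where r: "r \<in> Z" "\<sigma> \<in> {1, -1}" "u \<in> fibre m (b \<sigma> r) (of_real \<sigma>)" by blast
      define \<tau> where "\<tau> = - \<sigma> * \<eta> r"
      have e: "\<eta> r * \<eta> r = 1" using chi[OF r(1)] by auto
      have s: "\<sigma> = - \<tau> * \<eta> r" unfolding \<tau>_def using e by (simp add: mult.assoc)
      have "u \<in> extrema \<tau>" unfolding extrema_def extremum_index_def using r(1,3) s by auto
      moreover have "\<tau> = 1 \<or> \<tau> = -1" using r(2) chi[OF r(1)] by (auto simp: \<tau>_def)
      ultimately show ?thesis by auto
    qed
  qed
next
  fix u assume "u \<in> extrema 1 \<union> extrema (-1) \<union> saddles \<union> (if 2 \<le> m then poles else {})"
  then consider "u \<in> extrema 1" | "u \<in> extrema (-1)" | "u \<in> saddles" | "u \<in> poles" "2 \<le> m"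
    by (auto split: if_splits)
  then show "u \<in> critical_points f"
  proof cases
    case 1 then show ?thesis using extrema_critical(1)[of 1] by simp
  next
    case 2 then show ?thesis using extrema_critical(1)[of "-1"] by simp
  next
    case 3 then show ?thesis using saddle_point(1) unfolding saddles_def by blast
  next
    case 4 then show ?thesis by (rule pole_critical)
  qed
qed

text \<open>There are \<open>d + 1\<close> heights, each with the \<open>m\<close> points of one fibre.\<close>

lemma card_extrema: "\<tau> \<in> {1, -1} \<Longrightarrow> finite (extrema \<tau>) \<and> card (extrema \<tau>) = m * (d + 1)"
  using card_fibres[OF m extremum_index_facts(1,3)] extremum_index_facts(2) unfolding extrema_def by auto

text \<open>There are \<open>d\<close> heights, each with the \<open>m\<close> points of two fibres, for \<open>c = \<i>\<close> and \<open>c = -\<i>\<close>.\<close>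

lemma card_saddles: "finite saddles" "card saddles = 2 * m * d"
  using card_fibres[OF m saddle_index_facts(1,3)] saddle_index_facts(2) unfolding saddles_def by auto

lemma finite_critical: "finite (critical_points f)"
  unfolding critical_points_eq using card_extrema[of 1] card_extrema[of "-1"] card_saddles
  by (auto simp: poles_def)

lemma minima_type:
  assumes "u \<in> extrema 1" shows "has_ph_index (sphere_grad f) u 1" "u \<in> stable_points f - unstable_points f"
  using definite_critical_point[OF extrema_critical(1) finite_critical, of 1 u 1] extrema_critical(2)[of 1 u] assms
  by auto

lemma maxima_type:
  assumes "u \<in> extrema (-1)" shows "has_ph_index (sphere_grad f) u 1" "u \<in> unstable_points f - stable_points f"
  using definite_critical_point[OF extrema_critical(1) finite_critical, of "-1" u "-1"] extrema_critical(2)[of "-1" u] assms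
  by auto

lemma saddles_type:
  assumes "u \<in> saddles" shows "ordinary_saddle f u" "u \<in> saddle_type_points f" "u \<notin> poles"
proof -
  obtain z c where zc: "(z, c) \<in> saddle_index" "u \<in> fibre m z c" using assms unfolding saddles_def by auto
  obtain a1 a2 where a: "a1 \<bullet> u = 0" "Q u a1 > 0" "a2 \<bullet> u = 0" "Q u a2 < 0"
    using saddle_point(2)[OF zc] by blast
  show "ordinary_saddle f u"
    by (rule indefinite_critical_point[OF saddle_point(1)[OF zc] finite_critical J_sym a])
  show "u \<in> saddle_type_points f"
    by (rule saddle_type_if_indefinite[OF saddle_point(1)[OF zc] a])
  have "wc u \<noteq> 0" using fibre_wc(3)[OF zc(2)] saddle_index_facts(3)[OF zc(1)] by blast
  then show "u \<notin> poles" using poles_facts(1) by blast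
qed

theorem equilibria:
  shows "stable_points f = extrema 1" "unstable_points f = extrema (-1)"
    "saddle_type_points f - poles = saddles"
proof -
  have sub: "stable_points f \<subseteq> critical_points f" "unstable_points f \<subseteq> critical_points f"
    "saddle_type_points f \<subseteq> critical_points f"
    by (auto simp: stable_points_def unstable_points_def saddle_type_points_def)
  have dj: "saddle_type_points f \<inter> (stable_points f \<union> unstable_points f) = {}"
    by (auto simp: saddle_type_points_def)
  have cl: "u \<in> extrema 1 \<or> u \<in> extrema (-1) \<or> u \<in> saddles \<or> u \<in> poles \<and> u \<in> saddle_type_points f"
    if "u \<in> critical_points f" for u
    using that pole_saddle_type[of u] unfolding critical_points_eq by (auto split: if_splits)
  show "stable_points f = extrema 1"
    using sub dj cl minima_type(2) maxima_type(2) saddles_type(2) by blast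
  show "unstable_points f = extrema (-1)"
    using sub dj cl minima_type(2) maxima_type(2) saddles_type(2) by blast
  show "saddle_type_points f - poles = saddles"
    using sub dj cl minima_type(2) maxima_type(2) saddles_type by blast
qed
end

section \<open>Symmetries of the body and its centroid\<close>

text \<open>De Moivre's formula turns \<open>sin\<^sup>m \<theta> cos (m \<phi>)\<close> into \<open>Re (w^m)\<close>, which has no singularity at the
  poles.\<close>

lemma real_harmonic_eq:
  assumes "u \<in> S2"
  shows "real_harmonic l m u = Sh m u * poly ((pderiv ^^ m) (legendre_poly l)) (u $ 3)"
proof -
  have z: "\<bar>u $ 3\<bar> \<le> 1" by (rule S2_third(1)[OF assms])
  then have c: "cos (colatitude u) = u $ 3" by (simp add: colatitude_def abs_le_iff)
  have n: "sqrt (1 - (u $ 3)\<^sup>2) = cmod (wc u)"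
    unfolding S2_iff[THEN iffD1, OF assms, symmetric] by simp
  have "wc u = rcis (cmod (wc u)) (Arg (wc u))" by (simp add: rcis_cmod_Arg)
  then have "wc u ^ m = rcis (cmod (wc u) ^ m) (real m * Arg (wc u))" by (metis DeMoivre2)
  then have "Sh m u = cmod (wc u) ^ m * cos (real m * Arg (wc u))" by (simp add: Sh_def)
  moreover have "longitude u = Arg (wc u)" by (simp add: longitude_def wc_def)
  ultimately show ?thesis unfolding real_harmonic_def c assoc_legendre_def n by simp
qed

lemma continuous_real_harmonic: "continuous_on S2 (real_harmonic l m)"
proof -
  have "continuous_on S2 (\<lambda>u::real^3. Sh m u * poly ((pderiv ^^ m) (legendre_poly l)) (u $ 3))"
    unfolding Sh_def by (intro continuous_intros linear_continuous_on[OF bounded_linear_wc])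
  then show ?thesis by (rule continuous_on_eq) (simp only: real_harmonic_eq)
qed

lemma compact_radial_body:
  assumes "continuous_on S2 g" "\<And>u. u \<in> S2 \<Longrightarrow> 0 < 1 + \<epsilon> * g u"
  shows "compact (radial_body g \<epsilon>)"
proof -
  let ?h = "\<lambda>y::real \<times> (real^3). (fst y * (1 + \<epsilon> * g (snd y))) *\<^sub>R snd y"
  have eq: "radial_body g \<epsilon> = ?h ` ({0..1} \<times> S2)"
  proof (intro equalityI subsetI)
    fix x assume "x \<in> radial_body g \<epsilon>"
    then obtain t u where tu: "x = t *\<^sub>R u" "u \<in> S2" "0 \<le> t" "t \<le> 1 + \<epsilon> * g u"
      unfolding radial_body_def by blast
    have "x = ?h (t / (1 + \<epsilon> * g u), u)" using assms(2)[OF tu(2)] tu(1) by simp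
    moreover have "(t / (1 + \<epsilon> * g u), u) \<in> {0..1} \<times> S2" using tu assms(2)[OF tu(2)] by simp
    ultimately show "x \<in> ?h ` ({0..1} \<times> S2)" by (rule image_eqI)
  next
    fix x assume "x \<in> ?h ` ({0..1} \<times> S2)"
    then obtain s u where su: "s \<in> {0..1}" "u \<in> S2" "x = (s * (1 + \<epsilon> * g u)) *\<^sub>R u" by auto
    have "0 \<le> s * (1 + \<epsilon> * g u)" "s * (1 + \<epsilon> * g u) \<le> 1 + \<epsilon> * g u"
      using su(1) assms(2)[OF su(2)] by (auto intro: mult_left_le_one_le)
    then show "x \<in> radial_body g \<epsilon>" unfolding radial_body_def using su by blast
  qed
  have "continuous_on ({0..1} \<times> S2) (\<lambda>y. g (snd y))"
    by (rule continuous_on_compose2[OF assms(1) continuous_on_snd[OF continuous_on_id]]) auto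
  then have "continuous_on ({0..1} \<times> S2) ?h" by (intro continuous_intros)
  then show ?thesis unfolding eq by (intro compact_continuous_image compact_Times) auto
qed

lemma absolutely_integrable_id_compact:
  fixes B :: "(real^'n) set"
  assumes "compact B"
  shows "(\<lambda>x. x) absolutely_integrable_on B"
proof -
  obtain a where a: "B \<subseteq> cbox (- a) a" using bounded_subset_cbox_symmetric[OF compact_imp_bounded[OF assms]] by blast
  have "(\<lambda>x. x) absolutely_integrable_on cbox (- a) a"
    by (rule absolutely_integrable_continuous) (rule continuous_on_id)
  moreover have "B \<in> sets lebesgue" using assms by (simp add: lmeasurable_compact fmeasurableD)
  ultimately show ?thesis using a by (rule set_integrable_subset)
qed

lemma integral_orthogonal_invariant:
  fixes f :: "real^'m::{finite,wellorder} \<Rightarrow> real^'n"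
  assumes T: "orthogonal_transformation T" and TS: "T ` S = S" and f: "f absolutely_integrable_on S"
  shows "(\<lambda>x. f (T x)) absolutely_integrable_on S" "integral S (\<lambda>x. f (T x)) = integral S f"
proof -
  have lin: "linear T" using T by (rule orthogonal_transformation_linear)
  have det: "\<bar>det (matrix T)\<bar> = 1" using T by simp
  have "f absolutely_integrable_on (T ` S) \<and> integral (T ` S) f = integral S f" using f TS by simp
  then have "(\<lambda>x. \<bar>det (matrix T)\<bar> *\<^sub>R f (T x)) absolutely_integrable_on S \<and>
    integral S (\<lambda>x. \<bar>det (matrix T)\<bar> *\<^sub>R f (T x)) = integral S f"
    using has_absolute_integral_change_of_variables_linear[OF lin, where f = f and S = S and b = "integral S f"] by blast
  then show "(\<lambda>x. f (T x)) absolutely_integrable_on S" "integral S (\<lambda>x. f (T x)) = integral S f"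
    unfolding det by simp_all
qed

text \<open>Orthogonal maps preserve volume and commute with integration.\<close>

lemma centroid_invariant:
  fixes T :: "real^3 \<Rightarrow> real^3"
  assumes T: "orthogonal_transformation T" and B: "compact B" and TB: "T ` B = B"
  shows "T (centroid B) = centroid B"
proof -
  have lin: "linear T" using T by (rule orthogonal_transformation_linear)
  then have bl: "bounded_linear T" by (simp add: linear_conv_bounded_linear)
  note ai = absolutely_integrable_id_compact[OF B]
  have int: "(\<lambda>x. x) integrable_on B" using ai by (rule set_lebesgue_integral_eq_integral(1))
  have "T (integral B (\<lambda>x. x)) = integral B (\<lambda>x. T x)"
    using integral_linear[OF int bl] by (simp add: o_def)
  also have "\<dots> = integral B (\<lambda>x. x)" using integral_orthogonal_invariant(2)[OF T TB ai] .
  finally show ?thesis by (simp add: centroid_def linear_cmul[OF lin])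
qed

lemma radial_body_invariant:
  assumes T: "orthogonal_transformation T" and g: "\<And>u. u \<in> S2 \<Longrightarrow> g (T u) = g u"
  shows "T ` radial_body g \<epsilon> = radial_body g \<epsilon>"
proof -
  have lin: "linear T" using T by (rule orthogonal_transformation_linear)
  have nT: "norm (T x) = norm x" for x using T by (rule orthogonal_transformation_norm)
  show ?thesis
  proof (intro equalityI subsetI)
    fix y assume "y \<in> T ` radial_body g \<epsilon>"
    then obtain t u where "y = T (t *\<^sub>R u)" "u \<in> S2" "0 \<le> t" "t \<le> 1 + \<epsilon> * g u" unfolding radial_body_def by blast
    then have "y = t *\<^sub>R T u" "T u \<in> S2" "0 \<le> t" "t \<le> 1 + \<epsilon> * g (T u)"
      using g nT by (auto simp: linear_cmul[OF lin])
    then show "y \<in> radial_body g \<epsilon>" unfolding radial_body_def by blast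
  next
    fix y assume "y \<in> radial_body g \<epsilon>"
    then obtain t u where y: "y = t *\<^sub>R u" "u \<in> S2" "0 \<le> t" "t \<le> 1 + \<epsilon> * g u" unfolding radial_body_def by blast
    obtain v where v: "u = T v" using orthogonal_transformation_surj[OF T] by blast
    then have vS: "v \<in> S2" using y(2) nT[of v] by simp
    have "y = T (t *\<^sub>R v)" by (simp add: y(1) v linear_cmul[OF lin])
    moreover have "t *\<^sub>R v \<in> radial_body g \<epsilon>" unfolding radial_body_def using vS y(3,4) g[OF vS] v by auto
    ultimately show "y \<in> T ` radial_body g \<epsilon>" by blast
  qed
qed

lemma norm_wc: "(norm x)\<^sup>2 = (cmod (wc x))\<^sup>2 + (x $ 3)\<^sup>2"
  unfolding power2_norm_eq_inner[of x] inner_wc cmod_power2 by (simp add: power2_eq_square)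

text \<open>Rotation about the vertical axis by the argument of \<open>a\<close>, combined for \<open>s = -1\<close> with the reflection in the
  horizontal plane.\<close>

definition rotoreflect :: "complex \<Rightarrow> real \<Rightarrow> real^3 \<Rightarrow> real^3"
  where "rotoreflect a s x = hor (a * wc x) + (s * x $ 3) *\<^sub>R e\<^sub>3"

definition conj_reflect :: "real^3 \<Rightarrow> real^3"
  where "conj_reflect x = hor (cnj (wc x)) + (x $ 3) *\<^sub>R e\<^sub>3"

lemma orthogonal_if_norm:
  fixes T :: "real^3 \<Rightarrow> real^3"
  assumes "linear T" "\<And>x. (cmod (wc (T x)))\<^sup>2 + (T x $ 3)\<^sup>2 = (cmod (wc x))\<^sup>2 + (x $ 3)\<^sup>2"
  shows "orthogonal_transformation T"
proof -
  have "norm (T x) = norm x" for x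
    by (rule power2_eq_imp_eq) (use assms(2)[of x] in \<open>simp_all add: norm_wc\<close>)
  then show ?thesis using assms(1) by (simp add: orthogonal_transformation)
qed

lemma orthogonal_rotoreflect:
  assumes "cmod a = 1" "s = 1 \<or> s = -1"
  shows "orthogonal_transformation (rotoreflect a s)"
proof (rule orthogonal_if_norm)
  show "linear (rotoreflect a s)"
    by (rule linearI) (simp_all add: rotoreflect_def vec3_eq_iff algebra_simps)
  show "(cmod (wc (rotoreflect a s x)))\<^sup>2 + (rotoreflect a s x $ 3)\<^sup>2 = (cmod (wc x))\<^sup>2 + (x $ 3)\<^sup>2" for x
    using assms by (auto simp: rotoreflect_def norm_mult power_mult_distrib)
qed

lemma orthogonal_conj_reflect: "orthogonal_transformation conj_reflect"
proof (rule orthogonal_if_norm)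
  show "linear conj_reflect"
    by (rule linearI) (simp_all add: conj_reflect_def vec3_eq_iff)
qed (simp add: conj_reflect_def)

lemma pderiv_iter_even:
  fixes p :: "real poly"
  assumes "pcompose p [:0, -1:] = p"
  shows "pcompose ((pderiv ^^ k) p) [:0, -1:] = Polynomial.smult ((-1) ^ k) ((pderiv ^^ k) p)"
proof (induction k)
  case (Suc k)
  have "pderiv (pcompose ((pderiv ^^ k) p) [:0, -1:]) = pcompose (pderiv ((pderiv ^^ k) p)) [:0, -1:] * pderiv [:0, -1:]"
    by (rule pderiv_pcompose)
  also have "pderiv [:0, -1::real:] = [:-1:]" by (simp add: pderiv_pCons)
  finally have "Polynomial.smult ((-1) ^ k) (pderiv ((pderiv ^^ k) p)) = - pcompose (pderiv ((pderiv ^^ k) p)) [:0, -1:]"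
    unfolding Suc by (simp add: pderiv_smult)
  then show ?case by (simp add: minus_equation_iff)
qed (use assms in simp)

lemma legendre_deriv_parity:
  "poly ((pderiv ^^ m) (legendre_poly l)) (- x) = (-1) ^ (l + m) * poly ((pderiv ^^ m) (legendre_poly l)) x"
proof -
  let ?f = "[:-1, 0, 1:] ^ l :: real poly"
  have b: "pcompose [:-1, 0, 1:] [:0, -1:] = ([:-1, 0, 1:] :: real poly)" by (simp add: pcompose_pCons)
  have "pcompose ?f [:0, -1:] = ?f"
    by (induction l) (simp_all only: power_0 power_Suc pcompose_1 pcompose_mult b)
  from pderiv_iter_even[OF this, of "m + l"]
  have "poly (pcompose ((pderiv ^^ (m + l)) ?f) [:0, -1:]) x = poly (Polynomial.smult ((-1) ^ (m + l)) ((pderiv ^^ (m + l)) ?f)) x"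
    by (rule arg_cong)
  then have "poly ((pderiv ^^ (m + l)) ?f) (- x) = (-1) ^ (m + l) * poly ((pderiv ^^ (m + l)) ?f) x"
    by (simp only: poly_pcompose poly_smult poly_pCons poly_0 mult_zero_right add_0_right add_0_left mult_minus1_right mult_1_right)
  moreover have "(pderiv ^^ m) (legendre_poly l) = Polynomial.smult (1 / (2 ^ l * fact l)) ((pderiv ^^ (m + l)) ?f)"
    unfolding legendre_poly_def pderiv_iter_smult funpow_add by simp
  ultimately show ?thesis by (simp add: add.commute)
qed

lemma harmonic_conj_reflect: "u \<in> S2 \<Longrightarrow> real_harmonic l m (conj_reflect u) = real_harmonic l m u"
  using orthogonal_transformation_norm[OF orthogonal_conj_reflect, of u]
  by (simp add: real_harmonic_eq Sh_def) (simp add: conj_reflect_def complex_cnj_power[symmetric] del: complex_cnj_power)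

text \<open>The reflection \<open>z \<mapsto> -z\<close> multiplies the harmonic by \<open>(-1)^(l + m)\<close>; the rotation by
  \<open>\<pi> (l - m) / m\<close> multiplies \<open>w^m\<close> by the same sign.\<close>

lemma harmonic_rotoreflect:
  assumes m: "1 \<le> m" "m \<le> l" and u: "u \<in> S2"
  shows "real_harmonic l m (rotoreflect (cis (pi * real (l - m) / real m)) (-1) u) = real_harmonic l m u"
proof -
  let ?T = "rotoreflect (cis (pi * real (l - m) / real m)) (-1)"
  have "?T u \<in> S2" using u orthogonal_transformation_norm[OF orthogonal_rotoreflect, of "cis (pi * real (l - m) / real m)" "-1" u] by simp
  moreover have "cis (pi * real (l - m) / real m) ^ m = (-1) ^ (l - m)"
  proof -
    have "cis (pi * real (l - m) / real m) ^ m = cis (real (l - m) * pi)" using m by (simp add: Complex.DeMoivre mult.commute)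
    also have "\<dots> = (-1) ^ (l - m)" by (simp add: Complex.DeMoivre[symmetric])
    finally show ?thesis .
  qed
  then have "Sh m (?T u) = (-1) ^ (l - m) * Sh m u"
    by (cases "even (l - m)") (simp_all add: Sh_def rotoreflect_def power_mult_distrib)
  moreover have "(-1::real) ^ (l + m) = (-1) ^ (l - m)" using m(2) by (simp add: minus_one_power_iff)
  moreover have "(-1::real) ^ (l - m) * (-1) ^ (l - m) = 1" by (simp add: power_mult_distrib[symmetric])
  moreover have "?T u $ 3 = - u $ 3" by (simp add: rotoreflect_def)
  ultimately show ?thesis using u by (simp add: real_harmonic_eq legendre_deriv_parity)
qed

lemma harmonic_rotate:
  assumes m: "1 \<le> m" and u: "u \<in> S2"
  shows "real_harmonic l m (rotoreflect (cis (2 * pi / real m)) 1 u) = real_harmonic l m u"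
proof -
  let ?T = "rotoreflect (cis (2 * pi / real m)) 1"
  have "?T u \<in> S2" using u orthogonal_transformation_norm[OF orthogonal_rotoreflect, of "cis (2 * pi / real m)" 1 u] by simp
  moreover have "cis (2 * pi / real m) ^ m = 1" using m by (simp add: Complex.DeMoivre)
  then have "Sh m (?T u) = Sh m u" by (simp add: Sh_def rotoreflect_def power_mult_distrib)
  moreover have "?T u $ 3 = u $ 3" by (simp add: rotoreflect_def)
  ultimately show ?thesis using u by (simp add: real_harmonic_eq)
qed

text \<open>The rotoreflection removes the vertical component and the reflection in the plane of longitude 0 the
  second one. For \<open>m \<ge> 2\<close> the rotation by \<open>2 \<pi> / m\<close> is not the identity and fixes only the vertical axis.\<close>

lemma centroid_symmetry:
  assumes m: "1 \<le> m" "m \<le> l" and pos: "\<And>u. u \<in> S2 \<Longrightarrow> 0 < 1 + \<epsilon> * real_harmonic l m u"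
  defines "c \<equiv> centroid (radial_body (real_harmonic l m) \<epsilon>)"
  shows "c $ 3 = 0" "Im (wc c) = 0" "2 \<le> m \<Longrightarrow> c = 0"
proof -
  note cpt = compact_radial_body[OF continuous_real_harmonic pos]
  have inv: "T c = c" if "orthogonal_transformation T" "\<And>u. u \<in> S2 \<Longrightarrow> real_harmonic l m (T u) = real_harmonic l m u" for T
    unfolding c_def by (rule centroid_invariant[OF that(1) cpt radial_body_invariant[OF that(1)]]) (use that(2) in auto)
  have "rotoreflect (cis (pi * real (l - m) / real m)) (-1) c = c"
    by (rule inv[OF orthogonal_rotoreflect harmonic_rotoreflect[OF m]]) auto
  then have "rotoreflect (cis (pi * real (l - m) / real m)) (-1) c $ 3 = c $ 3" by simp
  then show c3: "c $ 3 = 0" by (simp add: rotoreflect_def)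
  have "conj_reflect c = c" by (rule inv[OF orthogonal_conj_reflect harmonic_conj_reflect])
  then have "wc (conj_reflect c) = wc c" by simp
  then have "cnj (wc c) = wc c" by (simp add: conj_reflect_def)
  then show "Im (wc c) = 0" by (simp add: complex_eq_iff)
  show "c = 0" if m2: "2 \<le> m"
  proof -
    have "rotoreflect (cis (2 * pi / real m)) 1 c = c"
      by (rule inv[OF orthogonal_rotoreflect harmonic_rotate[OF m(1)]]) auto
    then have "wc (rotoreflect (cis (2 * pi / real m)) 1 c) = wc c" by simp
    then have "cis (2 * pi / real m) * wc c = wc c" by (simp add: rotoreflect_def)
    then have "cis (2 * pi / real m) = 1 \<or> wc c = 0" by auto
    moreover have "cis (2 * pi / real m) \<noteq> 1"
    proof
      assume "cis (2 * pi / real m) = 1"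
      then have "cos (2 * pi / real m) = 1" by (simp add: complex_eq_iff)
      moreover have "cos (2 * pi / real m) < cos 0"
        using m2 by (intro cos_monotone_0_pi) (auto simp: field_simps)
      ultimately show False by simp
    qed
    ultimately show ?thesis using c3 by (simp add: vec3_eq_iff)
  qed
qed

section \<open>First moments of spherical harmonics\<close>

text \<open>The origin is removed because the harmonics are extended to be constant along rays.\<close>

definition punctured_ball :: "(real^3) set" where "punctured_ball = cball 0 1 - {0}"

definition cos_colat :: "real^3 \<Rightarrow> real" where "cos_colat x = x $ 3 / norm x"

lemma punctured_ball_lmeasurable: "punctured_ball \<in> lmeasurable"
  unfolding punctured_ball_def by (intro fmeasurable_Diff) auto

lemma punctured_ball_D: "x \<in> punctured_ball \<Longrightarrow> x \<noteq> 0 \<and> 0 < norm x \<and> norm x \<le> 1"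
  by (auto simp: punctured_ball_def)

lemma absolutely_integrable_bounded_continuous:
  fixes f :: "real^3 \<Rightarrow> 'b::euclidean_space"
  assumes "continuous_on punctured_ball f" "\<And>x. x \<in> punctured_ball \<Longrightarrow> norm (f x) \<le> K"
  shows "f absolutely_integrable_on punctured_ball"
proof (rule measurable_bounded_by_integrable_imp_absolutely_integrable)
  have S: "punctured_ball \<in> sets lebesgue" using punctured_ball_lmeasurable by blast
  then show "f \<in> borel_measurable (lebesgue_on punctured_ball)"
    by (rule continuous_imp_measurable_on_sets_lebesgue[OF assms(1)])
  show "punctured_ball \<in> sets lebesgue" by (rule S)
  show "(\<lambda>x. K) integrable_on punctured_ball" by (rule integrable_on_const[OF punctured_ball_lmeasurable])
qed (rule assms(2))

lemma integral_orthogonal_invariant_real: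
  fixes f :: "real^3 \<Rightarrow> real"
  assumes T: "orthogonal_transformation T" and TS: "T ` S = S" and f: "f absolutely_integrable_on S"
  shows "(\<lambda>x. f (T x)) integrable_on S" "integral S (\<lambda>x. f (T x)) = integral S f"
proof -
  let ?F = "\<lambda>x. f x *\<^sub>R e\<^sub>3"
  have bl: "bounded_linear (\<lambda>t::real. t *\<^sub>R e\<^sub>3)" by (rule bounded_linear_scaleR_left)
  have F: "?F absolutely_integrable_on S" using absolutely_integrable_linear[OF f bl] by (simp add: o_def)
  note inv = integral_orthogonal_invariant[OF T TS F]
  have i1: "(\<lambda>x. ?F (T x)) integrable_on S" using inv(1) by (rule set_lebesgue_integral_eq_integral(1))
  then have "(\<lambda>x. ?F (T x) $ 3) integrable_on S" using integrable_linear[OF i1 bounded_linear_vec_nth[of 3]] by (simp add: o_def)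
  then show i2: "(\<lambda>x. f (T x)) integrable_on S" by simp
  have fi: "f integrable_on S" using f by (rule set_lebesgue_integral_eq_integral(1))
  have "integral S (\<lambda>x. f (T x)) *\<^sub>R e\<^sub>3 = integral S f *\<^sub>R e\<^sub>3"
    using integral_linear[OF i2 bl] integral_linear[OF fi bl] inv(2) by (simp add: o_def)
  then show "integral S (\<lambda>x. f (T x)) = integral S f" by (simp add: vec3_eq_iff)
qed

lemma punctured_ball_invariant:
  assumes "orthogonal_transformation T" shows "T ` punctured_ball = punctured_ball"
proof -
  have n: "norm (T x) = norm x" for x using assms by (rule orthogonal_transformation_norm)
  have iff: "T x \<in> punctured_ball \<longleftrightarrow> x \<in> punctured_ball" for x
  proof -
    have z: "T x = 0 \<longleftrightarrow> x = 0" using n[of x] by (metis norm_eq_zero)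
    show ?thesis unfolding punctured_ball_def Diff_iff mem_cball_0 n singleton_iff z ..
  qed
  show ?thesis
  proof (intro equalityI subsetI)
    fix y assume "y \<in> punctured_ball"
    moreover obtain x where "y = T x" using orthogonal_transformation_surj[OF assms] by blast
    ultimately show "y \<in> T ` punctured_ball" using iff by blast
  qed (use iff in blast)
qed

lemma cos_colat_bound: "x \<in> punctured_ball \<Longrightarrow> cos_colat x \<in> {-1..1}"
  using component_le_norm_cart[of x 3] punctured_ball_D[of x]
  by (auto simp: cos_colat_def field_simps abs_le_iff)

lemma continuous_on_cos_colat: "continuous_on punctured_ball (\<lambda>x. poly p (cos_colat x))"
  unfolding cos_colat_def by (intro continuous_intros) (auto simp: punctured_ball_def)

definition meridian_rotation :: "real \<Rightarrow> real^3 \<Rightarrow> real^3"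
  where "meridian_rotation t x = vector [x $ 1 * cos t + x $ 3 * sin t, x $ 2, x $ 3 * cos t - x $ 1 * sin t]"

lemma norm3: "(norm (x::real^3))\<^sup>2 = (x $ 1)\<^sup>2 + (x $ 2)\<^sup>2 + (x $ 3)\<^sup>2"
  unfolding power2_norm_eq_inner[of x] inner_vec_def by (simp add: sum_3 power2_eq_square)

lemma orthogonal_meridian_rotation: "orthogonal_transformation (meridian_rotation t)"
proof -
  have "linear (meridian_rotation t)"
    by (rule linearI) (simp_all add: meridian_rotation_def vec_eq_iff forall_3 vector_3 algebra_simps)
  moreover have "norm (meridian_rotation t x) = norm x" for x
  proof (rule power2_eq_imp_eq)
    have e: "(a * c + b * s)\<^sup>2 + (b * c - a * s)\<^sup>2 = (a\<^sup>2 + b\<^sup>2) * (s\<^sup>2 + c\<^sup>2)" for a b c s :: real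
      by (simp add: power2_eq_square algebra_simps)
    show "(norm (meridian_rotation t x))\<^sup>2 = (norm x)\<^sup>2"
      using e[of "x $ 1" "cos t" "x $ 3" "sin t"] unfolding norm3 meridian_rotation_def vector_3 by simp
  qed auto
  ultimately show ?thesis by (simp add: orthogonal_transformation)
qed

text \<open>The integrand is the derivative at \<open>t = 0\<close> of \<open>x\<^sub>1 p(x\<^sub>3/|x|)\<close> along the rotations in the plane of the
  first and third axis. Rotations preserve the integral over the ball, so the derivative of the integral
  is 0; this replaces integration by parts on the sphere.\<close>

lemma integral_meridian_derivative:
  fixes p :: "real poly"
  shows "integral punctured_ball (\<lambda>x. x $ 3 * poly p (cos_colat x) - (x $ 1)\<^sup>2 / norm x * poly (pderiv p) (cos_colat x)) = 0"
proof -
  obtain K0 where K0: "\<forall>z\<in>{-1..1}. \<bar>poly p z\<bar> \<le> K0" using poly_bounded_Icc by blast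
  obtain K1 where K1: "\<forall>z\<in>{-1..1}. \<bar>poly (pderiv p) z\<bar> \<le> K1" using poly_bounded_Icc by blast
  define f where "f = (\<lambda>x::real^3. x $ 1 * poly p (cos_colat x))"
  define f' where "f' = (\<lambda>x::real^3. x $ 3 * poly p (cos_colat x) - (x $ 1)\<^sup>2 / norm x * poly (pderiv p) (cos_colat x))"
  have xb: "\<bar>x $ i\<bar> \<le> 1" if "x \<in> punctured_ball" for x :: "real^3" and i
    using component_le_norm_cart[of x i] punctured_ball_D[OF that] by linarith
  have fb: "norm (f x) \<le> K0" if "x \<in> punctured_ball" for x
  proof -
    have "\<bar>x $ 1\<bar> * \<bar>poly p (cos_colat x)\<bar> \<le> 1 * K0"
      using xb[OF that, of 1] K0 cos_colat_bound[OF that] by (intro mult_mono) auto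
    then show ?thesis by (simp add: f_def abs_mult)
  qed
  have f'b: "\<bar>f' x\<bar> \<le> K0 + K1" if x: "x \<in> punctured_ball" for x
  proof -
    have "\<bar>x $ 3\<bar> * \<bar>poly p (cos_colat x)\<bar> \<le> 1 * K0"
      using xb[OF x, of 3] K0 cos_colat_bound[OF x] by (intro mult_mono) auto
    moreover have "\<bar>(x $ 1)\<^sup>2 / norm x\<bar> * \<bar>poly (pderiv p) (cos_colat x)\<bar> \<le> 1 * K1"
    proof (intro mult_mono)
      have "(x $ 1)\<^sup>2 \<le> (norm x)\<^sup>2" using component_le_norm_cart[of x 1] by (simp add: abs_le_square_iff[symmetric])
      also have "\<dots> \<le> norm x" using punctured_ball_D[OF x] by (simp add: power2_eq_square mult_left_le)
      finally show "\<bar>(x $ 1)\<^sup>2 / norm x\<bar> \<le> 1" using punctured_ball_D[OF x] by (simp add: divide_le_eq)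
    qed (use K1 cos_colat_bound[OF x] in auto)
    ultimately show ?thesis unfolding f'_def
      using abs_triangle_ineq4[of "x $ 3 * poly p (cos_colat x)" "(x $ 1)\<^sup>2 / norm x * poly (pderiv p) (cos_colat x)"]
      by (simp only: abs_mult)
  qed
  have fai: "f absolutely_integrable_on punctured_ball"
  proof (rule absolutely_integrable_bounded_continuous[OF _ fb])
    show "continuous_on punctured_ball f" unfolding f_def by (intro continuous_intros continuous_on_cos_colat)
  qed
  note rot = integral_orthogonal_invariant_real[OF orthogonal_meridian_rotation punctured_ball_invariant[OF orthogonal_meridian_rotation] fai]
  have fi: "f integrable_on punctured_ball" using fai by (rule set_lebesgue_integral_eq_integral(1))
  have nr: "norm (meridian_rotation t x) = norm x" for t x
    by (rule orthogonal_transformation_norm[OF orthogonal_meridian_rotation])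
  have rS: "meridian_rotation t x \<in> punctured_ball" if "x \<in> punctured_ball" for t x
    using punctured_ball_invariant[OF orthogonal_meridian_rotation[of t]] that by blast
  have df: "((\<lambda>t. f (meridian_rotation t x)) has_real_derivative f' (meridian_rotation t x)) (at t)"
    if x: "x \<in> punctured_ball" for x t
  proof -
    let ?a = "\<lambda>t. x $ 1 * cos t + x $ 3 * sin t" and ?b = "\<lambda>t. x $ 3 * cos t - x $ 1 * sin t"
    have da: "(?a has_real_derivative ?b t) (at t)" by (auto intro!: derivative_eq_intros)
    have db: "((\<lambda>t. ?b t / norm x) has_real_derivative - ?a t / norm x) (at t)"
      using punctured_ball_D[OF x] by (auto intro!: derivative_eq_intros simp: field_simps)
    have dp: "((\<lambda>t. poly p (?b t / norm x)) has_real_derivative poly (pderiv p) (?b t / norm x) * (- ?a t / norm x)) (at t)"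
      by (rule DERIV_chain2[OF poly_DERIV db])
    have "((\<lambda>t. ?a t * poly p (?b t / norm x)) has_real_derivative
      ?b t * poly p (?b t / norm x) - (?a t)\<^sup>2 / norm x * poly (pderiv p) (?b t / norm x)) (at t)"
    proof -
      have e: "b * P - a\<^sup>2 / n * P' = b * P + P' * (- a / n) * a" for a b P P' n :: real
        by (simp add: power2_eq_square)
      show ?thesis unfolding e by (rule DERIV_mult[OF da dp])
    qed
    moreover have "f (meridian_rotation t x) = ?a t * poly p (?b t / norm x)" for t
      unfolding f_def cos_colat_def nr by (simp add: meridian_rotation_def vector_3)
    moreover have "f' (meridian_rotation t x) = ?b t * poly p (?b t / norm x) - (?a t)\<^sup>2 / norm x * poly (pderiv p) (?b t / norm x)"
      unfolding f'_def cos_colat_def nr by (simp add: meridian_rotation_def vector_3)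
    ultimately show ?thesis by simp
  qed
  define h where "h = (\<lambda>n x. real (Suc n) * (f (meridian_rotation (1 / real (Suc n)) x) - f x))"
  have hi: "h n integrable_on punctured_ball" for n
    unfolding h_def by (intro integrable_on_mult_right integrable_diff rot(1) fi)
  have h0: "integral punctured_ball (h n) = 0" for n
    unfolding h_def using rot fi by (simp add: integral_diff)
  have id0: "meridian_rotation 0 x = x" for x by (simp add: meridian_rotation_def vec_eq_iff forall_3 vector_3)
  have hb: "norm (h n x) \<le> K0 + K1" if x: "x \<in> punctured_ball" for n x
  proof -
    have pos: "0 < 1 / real (Suc n)" by simp
    obtain z where "f (meridian_rotation (1 / real (Suc n)) x) - f (meridian_rotation 0 x)
      = (1 / real (Suc n) - 0) * f' (meridian_rotation z x)"
      using MVT2[OF pos, of "\<lambda>t. f (meridian_rotation t x)" "\<lambda>t. f' (meridian_rotation t x)"] df[OF x] by blast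
    then have "h n x = f' (meridian_rotation z x)" unfolding h_def id0 by simp
    then show ?thesis using f'b[OF rS[OF x]] by simp
  qed
  have hl: "(\<lambda>n. h n x) \<longlonglongrightarrow> f' x" if x: "x \<in> punctured_ball" for x
  proof -
    have "((\<lambda>t. (f (meridian_rotation (0 + t) x) - f (meridian_rotation 0 x)) / t) \<longlongrightarrow> f' (meridian_rotation 0 x)) (at 0)"
      using df[OF x, of 0] unfolding DERIV_def .
    then have lim: "((\<lambda>t. (f (meridian_rotation t x) - f x) / t) \<longlongrightarrow> f' x) (at 0)" unfolding id0 by simp
    have "filterlim (\<lambda>n. 1 / real (Suc n)) (at 0) sequentially"
      unfolding filterlim_at
    proof
      show "(\<lambda>n. 1 / real (Suc n)) \<longlonglongrightarrow> 0" using LIMSEQ_inverse_real_of_nat by (simp add: inverse_eq_divide)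
    qed simp
    from filterlim_compose[OF lim this] show ?thesis by (simp add: h_def mult.commute)
  qed
  have "(\<lambda>n. integral punctured_ball (h n)) \<longlonglongrightarrow> integral punctured_ball f'"
    by (rule dominated_convergence(2)[OF hi integrable_on_const[OF punctured_ball_lmeasurable] hb hl])
  then have "integral punctured_ball f' = 0" unfolding h0 by (simp add: LIMSEQ_const_iff)
  then show ?thesis unfolding f'_def .
qed

text \<open>Rotation by a right angle about the vertical axis exchanges \<open>x\<^sub>1\<^sup>2\<close> and \<open>x\<^sub>2\<^sup>2\<close>, whose sum is
  \<open>|x|\<^sup>2 (1 - cos\<^sup>2 \<theta>)\<close>.\<close>

lemma integral_equatorial_square:
  "(\<lambda>x. (x $ 1)\<^sup>2 / norm x * poly a (cos_colat x)) integrable_on punctured_ball"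
  "(\<lambda>x. norm x * ((1 - (cos_colat x)\<^sup>2) * poly a (cos_colat x))) integrable_on punctured_ball"
  "integral punctured_ball (\<lambda>x. (x $ 1)\<^sup>2 / norm x * poly a (cos_colat x))
    = (1/2) * integral punctured_ball (\<lambda>x. norm x * ((1 - (cos_colat x)\<^sup>2) * poly a (cos_colat x)))"
proof -
  obtain K where K: "\<forall>z\<in>{-1..1}. \<bar>poly a z\<bar> \<le> K" using poly_bounded_Icc by blast
  define f where "f = (\<lambda>x::real^3. (x $ 1)\<^sup>2 / norm x * poly a (cos_colat x))"
  have fai: "f absolutely_integrable_on punctured_ball"
  proof (rule absolutely_integrable_bounded_continuous)
    show "continuous_on punctured_ball f" unfolding f_def
      by (intro continuous_intros continuous_on_cos_colat) (auto simp: punctured_ball_def)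
    fix x assume x: "x \<in> punctured_ball"
    have "\<bar>(x $ 1)\<^sup>2 / norm x\<bar> * \<bar>poly a (cos_colat x)\<bar> \<le> 1 * K"
    proof (intro mult_mono)
      have "(x $ 1)\<^sup>2 \<le> (norm x)\<^sup>2" using component_le_norm_cart[of x 1] by (simp add: abs_le_square_iff[symmetric])
      also have "\<dots> \<le> norm x" using punctured_ball_D[OF x] by (simp add: power2_eq_square mult_left_le)
      finally show "\<bar>(x $ 1)\<^sup>2 / norm x\<bar> \<le> 1" using punctured_ball_D[OF x] by (simp add: divide_le_eq)
    qed (use K cos_colat_bound[OF x] in auto)
    then show "norm (f x) \<le> K" by (simp add: f_def abs_mult)
  qed
  then show fi: "(\<lambda>x. (x $ 1)\<^sup>2 / norm x * poly a (cos_colat x)) integrable_on punctured_ball"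
    unfolding f_def by (rule set_lebesgue_integral_eq_integral(1))
  define T where "T = rotoreflect \<i> 1"
  have oT: "orthogonal_transformation T" unfolding T_def by (rule orthogonal_rotoreflect) auto
  have T1: "T x $ 1 = - x $ 2" "T x $ 3 = x $ 3" for x
    by (auto simp: T_def rotoreflect_def hor_def wc_def vector_3 axis_def)
  have cT: "cos_colat (T x) = cos_colat x" "norm (T x) = norm x" for x
    using orthogonal_transformation_norm[OF oT, of x] T1 by (simp_all add: cos_colat_def)
  note inv = integral_orthogonal_invariant_real[OF oT punctured_ball_invariant[OF oT] fai]
  have fT: "f (T x) = (x $ 2)\<^sup>2 / norm x * poly a (cos_colat x)" for x
    unfolding f_def cT T1 by simp
  have sum: "f x + f (T x) = norm x * ((1 - (cos_colat x)\<^sup>2) * poly a (cos_colat x))" if x: "x \<in> punctured_ball" for x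
  proof -
    have n: "norm x > 0" using punctured_ball_D[OF x] by simp
    have "(x $ 1)\<^sup>2 + (x $ 2)\<^sup>2 = (norm x)\<^sup>2 * (1 - (cos_colat x)\<^sup>2)"
    proof -
      have "(norm x)\<^sup>2 * (cos_colat x)\<^sup>2 = (x $ 3)\<^sup>2" using n by (simp add: cos_colat_def power_divide)
      then show ?thesis using norm3[of x] by (simp add: right_diff_distrib)
    qed
    then have A: "((x $ 1)\<^sup>2 + (x $ 2)\<^sup>2) / norm x = norm x * (1 - (cos_colat x)\<^sup>2)"
      using n by (simp add: power2_eq_square)
    have "f x + f (T x) = ((x $ 1)\<^sup>2 + (x $ 2)\<^sup>2) / norm x * poly a (cos_colat x)"
      unfolding fT unfolding f_def by (simp add: add_divide_distrib distrib_right)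
    then show ?thesis unfolding A by simp
  qed
  have fi': "f integrable_on punctured_ball" using fi f_def by simp
  have si: "(\<lambda>x. f x + f (T x)) integrable_on punctured_ball" by (intro integrable_add fi' inv(1))
  show "(\<lambda>x. norm x * ((1 - (cos_colat x)\<^sup>2) * poly a (cos_colat x))) integrable_on punctured_ball"
    by (rule integrable_eq[OF si sum])
  have "integral punctured_ball (\<lambda>x. norm x * ((1 - (cos_colat x)\<^sup>2) * poly a (cos_colat x)))
    = integral punctured_ball (\<lambda>x. f x + f (T x))"
    by (rule integral_cong) (simp only: sum)
  also have "\<dots> = integral punctured_ball f + integral punctured_ball f"
    using integral_add[OF fi' inv(1)] inv(2) by simp
  finally show "integral punctured_ball (\<lambda>x. (x $ 1)\<^sup>2 / norm x * poly a (cos_colat x))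
    = (1/2) * integral punctured_ball (\<lambda>x. norm x * ((1 - (cos_colat x)\<^sup>2) * poly a (cos_colat x)))"
    unfolding f_def by simp
qed

text \<open>Orthogonality of harmonics of the different degrees \<open>l\<close> and 1. The identity
  \<open>integral_meridian_derivative\<close> is applied to \<open>\<phi> = l (l + 1) P - 2 z P'\<close>, chosen such that Legendre's
  equation reduces it to \<open>l (l + 1) - 2\<close> times the wanted integral, and \<open>l (l + 1) > 2\<close>.\<close>

lemma first_moment_of_harmonic:
  assumes l: "2 \<le> l"
  shows "integral punctured_ball (\<lambda>x. (x $ 1)\<^sup>2 / norm x * poly (pderiv (legendre_poly l)) (cos_colat x)) = 0"
proof -
  define P where "P = legendre_poly l"
  define \<Lambda> where "\<Lambda> = real l * (real l + 1)"
  define \<phi> where "\<phi> = Polynomial.smult \<Lambda> P - Polynomial.smult 2 ([:0, 1:] * pderiv P)"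
  define A where "A = (\<lambda>x. (x $ 1)\<^sup>2 / norm x * poly (pderiv \<phi>) (cos_colat x))"
  define B where "B = (\<lambda>x. norm x * ((1 - (cos_colat x)\<^sup>2) * poly (pderiv \<phi>) (cos_colat x)))"
  define E where "E = (\<lambda>x. norm x * ((1 - (cos_colat x)\<^sup>2) * poly (pderiv P) (cos_colat x)))"
  have x3: "x $ 3 = norm x * cos_colat x" if "x \<in> punctured_ball" for x
    using punctured_ball_D[OF that] by (simp add: cos_colat_def)
  have id: "(1 - z\<^sup>2) * poly (pderiv \<phi>) z - 2 * z * poly \<phi> z = (\<Lambda> - 2) * ((1 - z\<^sup>2) * poly (pderiv P) z)" for z
  proof -
    have ode: "(1 - z\<^sup>2) * poly (pderiv (pderiv P)) z = 2 * z * poly (pderiv P) z - \<Lambda> * poly P z"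
      using legendre_ode[of l z] l by (simp add: P_def \<Lambda>_def)
    have d: "poly (pderiv \<phi>) z = \<Lambda> * poly (pderiv P) z - 2 * (poly (pderiv P) z + z * poly (pderiv (pderiv P)) z)"
      unfolding \<phi>_def pderiv_diff pderiv_smult pderiv_mult by (simp add: pderiv_pCons)
    have e: "poly \<phi> z = \<Lambda> * poly P z - 2 * z * poly (pderiv P) z" by (simp add: \<phi>_def)
    have "(1 - z\<^sup>2) * poly (pderiv \<phi>) z - 2 * z * poly \<phi> z = \<Lambda> * (1 - z\<^sup>2) * poly (pderiv P) z - 2 * (1 - z\<^sup>2) * poly (pderiv P) z
      - 2 * z * ((1 - z\<^sup>2) * poly (pderiv (pderiv P)) z) - 2 * z * (\<Lambda> * poly P z - 2 * z * poly (pderiv P) z)"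
      unfolding d e by (simp add: algebra_simps)
    also have "\<dots> = (\<Lambda> - 2) * ((1 - z\<^sup>2) * poly (pderiv P) z)"
      unfolding ode by (simp add: algebra_simps power2_eq_square)
    finally show ?thesis .
  qed
  note iA = integral_equatorial_square[of "pderiv \<phi>", folded A_def B_def]
  note iE = integral_equatorial_square[of "pderiv P", folded E_def]
  have eq: "x $ 3 * poly \<phi> (cos_colat x) - A x = (1/2) * B x - A x - ((\<Lambda> - 2) / 2) * E x" if "x \<in> punctured_ball" for x
  proof -
    have "norm x * ((1 - (cos_colat x)\<^sup>2) * poly (pderiv \<phi>) (cos_colat x) - 2 * cos_colat x * poly \<phi> (cos_colat x))
      = norm x * ((\<Lambda> - 2) * ((1 - (cos_colat x)\<^sup>2) * poly (pderiv P) (cos_colat x)))" unfolding id ..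
    moreover have "n * c * F - A' = (1/2) * (n * B') - A' - (L / 2) * (n * E')"
      if "n * (B' - 2 * c * F) = n * (L * E')" for n c F A' B' L E' :: real
      using that by (simp add: right_diff_distrib) (simp add: mult_ac)
    ultimately show ?thesis unfolding B_def E_def x3[OF that] by blast
  qed
  have "0 = integral punctured_ball (\<lambda>x. x $ 3 * poly \<phi> (cos_colat x) - A x)"
    using integral_meridian_derivative[of \<phi>] unfolding A_def by simp
  also have "\<dots> = integral punctured_ball (\<lambda>x. (1/2) * B x - A x - ((\<Lambda> - 2) / 2) * E x)"
    by (rule integral_cong) (rule eq)
  also have "\<dots> = (1/2) * integral punctured_ball B - integral punctured_ball A - ((\<Lambda> - 2) / 2) * integral punctured_ball E"
    using iA(1,2) iE(2) by (simp add: integral_diff integrable_diff integrable_on_mult_right)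
  also have "\<dots> = - ((\<Lambda> - 2) / 2) * integral punctured_ball E" unfolding iA(3) by simp
  finally have "(\<Lambda> - 2) * integral punctured_ball E = 0" by simp
  moreover have "\<Lambda> > 2"
  proof -
    have "2 * 3 \<le> real l * (real l + 1)" using l by (intro mult_mono) auto
    then show ?thesis by (simp add: \<Lambda>_def)
  qed
  ultimately have "integral punctured_ball E = 0" by simp
  then show ?thesis using iE(3) by (simp add: P_def)
qed

section \<open>The centroid for order one\<close>

text \<open>The derivative of \<open>x \<mapsto> r(x) x\<close> is \<open>r\<close> times the identity plus the rank-one map \<open>h \<mapsto> (d h) x\<close>. The latter
  contributes only through \<open>d x\<close>, which is 0 when \<open>r\<close> is constant along rays.\<close>

lemma det_scaling_plus_radial:
  fixes x :: "real^3"
  assumes lin: "linear d" and dx: "d x = 0"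
  shows "det (matrix (\<lambda>h. r *\<^sub>R h + d h *\<^sub>R x)) = r ^ 3"
proof -
  have "x = x $ 1 *\<^sub>R axis 1 1 + x $ 2 *\<^sub>R axis 2 1 + x $ 3 *\<^sub>R axis 3 1"
    by (simp add: vec_eq_iff axis_def forall_3)
  then have "d x = d (x $ 1 *\<^sub>R axis 1 1 + x $ 2 *\<^sub>R axis 2 1 + x $ 3 *\<^sub>R axis 3 1)"
    by (rule arg_cong)
  also have "\<dots> = x $ 1 * d (axis 1 1) + x $ 2 * d (axis 2 1) + x $ 3 * d (axis 3 1)"
    by (simp add: linear_add[OF lin] linear_cmul[OF lin])
  finally have "d x = x $ 1 * d (axis 1 1) + x $ 2 * d (axis 2 1) + x $ 3 * d (axis 3 1)" .
  then have s: "x $ 1 * d (axis 1 1) + x $ 2 * d (axis 2 1) + x $ 3 * d (axis 3 1) = 0"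
    using dx by simp
  define a b c where "a = d (axis 1 1)" and "b = d (axis 2 1)" and "c = d (axis 3 1)"
  have "det (matrix (\<lambda>h. r *\<^sub>R h + d h *\<^sub>R x)) = r ^ 3 + r\<^sup>2 * (x $ 1 * a + x $ 2 * b + x $ 3 * c)"
    unfolding det_3 matrix_def a_def b_def c_def
    by (simp add: axis_def power2_eq_square power3_eq_cube algebra_simps)
  then show ?thesis using s by (simp add: a_def b_def c_def)
qed

lemma homogeneous_derivative_radial:
  fixes g :: "real^3 \<Rightarrow> real"
  assumes d: "(g has_derivative d) (at x)" and hom: "\<And>t. t > 0 \<Longrightarrow> g (t *\<^sub>R x) = g x"
  shows "d x = 0"
proof -
  have "((\<lambda>t. t *\<^sub>R x) has_derivative (\<lambda>h. h *\<^sub>R x)) (at 1)" by (auto intro!: derivative_eq_intros)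
  moreover have "(g has_derivative d) (at (1 *\<^sub>R x))" using d by simp
  ultimately have "((\<lambda>t. g (t *\<^sub>R x)) has_derivative (\<lambda>h. d (h *\<^sub>R x))) (at 1)"
    using diff_chain_at[of "\<lambda>t. t *\<^sub>R x"] by (fastforce simp: o_def)
  then have A: "((\<lambda>t::real. g x) has_derivative (\<lambda>h. d (h *\<^sub>R x))) (at 1)"
    by (rule has_derivative_transform_within_open[of _ _ _ _ "{0<..}"]) (auto simp: hom)
  have "(\<lambda>h. d (h *\<^sub>R x)) = (\<lambda>h. 0)" by (rule has_derivative_unique[OF A has_derivative_const])
  then have "d (1 *\<^sub>R x) = 0" by metis
  then show ?thesis by simp
qed

text \<open>The harmonic of order 1, extended to be constant along rays.\<close>

definition radial_ext :: "real poly \<Rightarrow> real^3 \<Rightarrow> real"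
  where "radial_ext q x = x $ 1 / norm x * poly q (cos_colat x)"

lemma radial_ext_differentiable:
  assumes "x \<noteq> 0" shows "\<exists>d. (radial_ext q has_derivative d) (at x)"
proof -
  have n: "((\<lambda>x::real^3. norm x) has_derivative (\<lambda>h. h \<bullet> sgn x)) (at x)" by (rule has_derivative_norm[OF assms])
  have c: "((\<lambda>x::real^3. x $ i) has_derivative (\<lambda>h. h $ i)) (at x)" for i
    by (rule bounded_linear.has_derivative[OF bounded_linear_vec_nth has_derivative_ident])
  have nx: "norm x \<noteq> 0" using assms by simp
  have dz: "\<exists>d. (cos_colat has_derivative d) (at x)"
    using has_derivative_divide'[OF c[of 3] n nx] unfolding cos_colat_def[abs_def] by blast
  then obtain dz where dz: "(cos_colat has_derivative dz) (at x)" by blast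
  have "(poly q has_derivative (\<lambda>h. poly (pderiv q) (cos_colat x) * h)) (at (cos_colat x))"
    using poly_DERIV[of q "cos_colat x"] by (simp add: has_field_derivative_def)
  from diff_chain_at[OF dz this]
  have dq: "((\<lambda>x. poly q (cos_colat x)) has_derivative (\<lambda>h. poly (pderiv q) (cos_colat x) * dz h)) (at x)"
    by (simp add: o_def)
  show ?thesis using has_derivative_mult[OF has_derivative_divide'[OF c[of 1] n nx] dq]
    unfolding radial_ext_def[abs_def] by blast
qed

lemma radial_ext_homogeneous: "t > 0 \<Longrightarrow> radial_ext q (t *\<^sub>R x) = radial_ext q x"
  by (simp add: radial_ext_def cos_colat_def)

lemma radial_ext_continuous: "continuous_on punctured_ball (radial_ext q)"
  unfolding radial_ext_def[abs_def]
  by (intro continuous_intros continuous_on_cos_colat) (auto simp: punctured_ball_def)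

lemma radial_ext_bounded: "\<exists>K. 0 < K \<and> (\<forall>x\<in>punctured_ball. \<bar>radial_ext q x\<bar> \<le> K)"
proof -
  obtain K where K: "\<forall>z\<in>{-1..1}. \<bar>poly q z\<bar> \<le> K" using poly_bounded_Icc by blast
  have "\<bar>radial_ext q x\<bar> \<le> \<bar>K\<bar> + 1" if x: "x \<in> punctured_ball" for x
  proof -
    have "\<bar>x $ 1 / norm x\<bar> \<le> 1" using component_le_norm_cart[of x 1] punctured_ball_D[OF x] by (simp add: divide_le_eq)
    then have "\<bar>x $ 1 / norm x\<bar> * \<bar>poly q (cos_colat x)\<bar> \<le> 1 * K"
      using K cos_colat_bound[OF x] by (intro mult_mono) auto
    then show ?thesis by (simp add: radial_ext_def abs_mult)
  qed
  then show ?thesis by (intro exI[of _ "\<bar>K\<bar> + 1"]) auto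
qed

lemma radial_ext_sphere: "u \<in> S2 \<Longrightarrow> radial_ext q u = Sh 1 u * poly q (u $ 3)"
  by (simp add: radial_ext_def Sh_def wc_def cos_colat_def)

text \<open>Change of variables along the radial map \<open>x \<mapsto> R(x) x\<close> from the ball to the body, with Jacobian
  determinant \<open>R\<^sup>3\<close>.\<close>

lemma radial_body_integral:
  assumes g: "\<And>u. u \<in> S2 \<Longrightarrow> g u = radial_ext q u" and gc: "continuous_on S2 g"
    and pos: "\<And>u. u \<in> S2 \<Longrightarrow> 0 < 1 + \<epsilon> * g u"
  shows "integral (radial_body g \<epsilon>) (\<lambda>x. x) $ 1 = integral punctured_ball (\<lambda>x. (1 + \<epsilon> * radial_ext q x) ^ 4 * x $ 1)"
proof -
  define R where "R = (\<lambda>x. 1 + \<epsilon> * radial_ext q x)"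
  define T where "T = (\<lambda>x. R x *\<^sub>R x)"
  have RS: "R x = 1 + \<epsilon> * g (x /\<^sub>R norm x)" "R x > 0" if "x \<noteq> 0" for x
  proof -
    have u: "x /\<^sub>R norm x \<in> S2" using that by simp
    have "radial_ext q (x /\<^sub>R norm x) = radial_ext q x" using radial_ext_homogeneous[of "inverse (norm x)" q x] that by simp
    then show "R x = 1 + \<epsilon> * g (x /\<^sub>R norm x)" using g[OF u] by (simp add: R_def)
    then show "R x > 0" using pos[OF u] by simp
  qed
  have Rhom: "R (t *\<^sub>R x) = R x" if "t > 0" for t x unfolding R_def radial_ext_homogeneous[OF that] ..
  have TS: "T ` punctured_ball = radial_body g \<epsilon> - {0}"
  proof (intro equalityI subsetI)
    fix y assume "y \<in> T ` punctured_ball"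
    then obtain x where x: "x \<in> punctured_ball" "y = R x *\<^sub>R x" unfolding T_def by blast
    note x0 = punctured_ball_D[OF x(1)]
    have "y = (R x * norm x) *\<^sub>R (x /\<^sub>R norm x)" using x0 x(2) by simp
    moreover have "x /\<^sub>R norm x \<in> S2" using x0 by simp
    moreover have "0 \<le> R x * norm x" using RS(2)[of x] x0 by simp
    moreover have "R x * norm x \<le> R x" using RS(2)[of x] x0 by (simp add: mult_left_le)
    then have "R x * norm x \<le> 1 + \<epsilon> * g (x /\<^sub>R norm x)" using RS(1)[of x] x0 by simp
    ultimately have "y \<in> radial_body g \<epsilon>" unfolding radial_body_def by blast
    moreover have "y \<noteq> 0" using x(2) RS(2)[of x] x0 by simp
    ultimately show "y \<in> radial_body g \<epsilon> - {0}" by simp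
  next
    fix y assume "y \<in> radial_body g \<epsilon> - {0}"
    then obtain t u where tu: "y = t *\<^sub>R u" "u \<in> S2" "0 \<le> t" "t \<le> 1 + \<epsilon> * g u" "y \<noteq> 0" unfolding radial_body_def by blast
    have t: "t > 0" using tu(1,3,5) by (cases "t = 0") auto
    have u0: "u \<noteq> 0" "norm u = 1" using tu(2) by auto
    have Ru: "R u = 1 + \<epsilon> * g u" "R u > 0" using RS[OF u0(1)] u0 by simp_all
    define x where "x = (t / R u) *\<^sub>R u"
    have tR: "t / R u > 0" using t Ru by simp
    have "T x = y" unfolding T_def x_def Rhom[OF tR] using tu(1) Ru(2) by simp
    moreover have "x \<in> punctured_ball" unfolding punctured_ball_def x_def using tR u0 tu(4) Ru t by (simp add: divide_le_eq)
    ultimately show "y \<in> T ` punctured_ball" by blast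
  qed
  have inj: "inj_on T punctured_ball"
  proof (rule inj_onI)
    fix x y assume xy: "x \<in> punctured_ball" "y \<in> punctured_ball" "T x = T y"
    have p: "R x > 0" "R y > 0" using RS(2) punctured_ball_D xy by auto
    have e: "y = (R x / R y) *\<^sub>R x"
    proof -
      have "R y *\<^sub>R y = R x *\<^sub>R x" using xy(3) by (simp add: T_def)
      then have "inverse (R y) *\<^sub>R (R y *\<^sub>R y) = inverse (R y) *\<^sub>R (R x *\<^sub>R x)" by simp
      then show ?thesis using p by (simp add: divide_inverse mult.commute)
    qed
    have "R y = R x" using Rhom[of "R x / R y" x] p e by simp
    then show "x = y" using e p by simp
  qed
  have "\<exists>d. (radial_ext q has_derivative d) (at x)" if "x \<in> punctured_ball" for x
    using radial_ext_differentiable punctured_ball_D[OF that] by blast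
  then obtain d where d: "\<And>x. x \<in> punctured_ball \<Longrightarrow> (radial_ext q has_derivative d x) (at x)" by metis
  define T' where "T' = (\<lambda>x h. R x *\<^sub>R h + (\<epsilon> * d x h) *\<^sub>R x)"
  have dT: "(T has_derivative T' x) (at x within punctured_ball)" if x: "x \<in> punctured_ball" for x
  proof -
    have "(R has_derivative (\<lambda>h. 0 + \<epsilon> * d x h)) (at x)"
      unfolding R_def by (intro has_derivative_add has_derivative_const has_derivative_mult_right d[OF x])
    from has_derivative_scaleR[OF this has_derivative_ident]
    have "(T has_derivative T' x) (at x)" unfolding T_def T'_def by simp
    then show ?thesis by (rule has_derivative_at_withinI)
  qed
  have det: "\<bar>det (matrix (T' x))\<bar> = R x ^ 3" if x: "x \<in> punctured_ball" for x
  proof -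
    have "linear (\<lambda>h. \<epsilon> * d x h)"
      using linear_compose[OF has_derivative_linear[OF d[OF x]], of "\<lambda>t. \<epsilon> * t"] by (simp add: o_def linear_times)
    moreover have "\<epsilon> * d x x = 0" using homogeneous_derivative_radial[OF d[OF x] radial_ext_homogeneous] by simp
    ultimately have "det (matrix (T' x)) = R x ^ 3" unfolding T'_def by (rule det_scaling_plus_radial)
    then show ?thesis using RS(2)[of x] punctured_ball_D[OF x] by simp
  qed
  have cB: "compact (radial_body g \<epsilon>)" by (rule compact_radial_body[OF gc pos])
  note ai = absolutely_integrable_id_compact[OF cB]
  have S: "punctured_ball \<in> sets lebesgue" using punctured_ball_lmeasurable by blast
  have "(radial_body g \<epsilon> - {0}) \<in> sets lebesgue" using cB by (intro sets.Diff) (auto simp: lmeasurable_compact fmeasurableD)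
  then have ai0: "(\<lambda>x. x) absolutely_integrable_on (radial_body g \<epsilon> - {0})"
    by (rule set_integrable_subset[OF ai]) auto
  have "integral (radial_body g \<epsilon>) (\<lambda>x. x) = integral (radial_body g \<epsilon> - {0}) (\<lambda>x. x)"
    by (rule integral_spike_set) (auto intro: negligible_subset[OF negligible_sing[of 0]])
  also have "\<dots> = integral punctured_ball (\<lambda>x. \<bar>det (matrix (T' x))\<bar> *\<^sub>R T x)"
    using integral_change_of_variables[OF S dT inj, of "\<lambda>x. x"] ai0 unfolding TS by blast
  also have "\<dots> = integral punctured_ball (\<lambda>x. R x ^ 4 *\<^sub>R x)"
    by (rule integral_cong) (simp add: det T_def power3_eq_cube power4_eq_xxxx)
  finally have eq: "integral (radial_body g \<epsilon>) (\<lambda>x. x) = integral punctured_ball (\<lambda>x. R x ^ 4 *\<^sub>R x)" .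
  obtain K where K: "0 < K" "\<forall>x\<in>punctured_ball. \<bar>radial_ext q x\<bar> \<le> K" using radial_ext_bounded by blast
  have "(\<lambda>x. R x ^ 4 *\<^sub>R x) absolutely_integrable_on punctured_ball"
  proof (rule absolutely_integrable_bounded_continuous)
    show "continuous_on punctured_ball (\<lambda>x. R x ^ 4 *\<^sub>R x)"
      unfolding R_def by (intro continuous_intros radial_ext_continuous)
    fix x assume x: "x \<in> punctured_ball"
    have "\<bar>\<epsilon> * radial_ext q x\<bar> \<le> \<bar>\<epsilon>\<bar> * K" using K x by (simp add: abs_mult mult_left_mono)
    then have "\<bar>R x\<bar> \<le> 1 + \<bar>\<epsilon>\<bar> * K" unfolding R_def by linarith
    then have "\<bar>R x\<bar> ^ 4 * norm x \<le> (1 + \<bar>\<epsilon>\<bar> * K) ^ 4 * 1"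
      using punctured_ball_D[OF x] by (intro mult_mono power_mono) auto
    then show "norm (R x ^ 4 *\<^sub>R x) \<le> (1 + \<bar>\<epsilon>\<bar> * K) ^ 4" by (simp add: power_abs)
  qed
  then have "(\<lambda>x. R x ^ 4 *\<^sub>R x) integrable_on punctured_ball" by (rule set_lebesgue_integral_eq_integral(1))
  from integral_linear[OF this bounded_linear_vec_nth[of 1]]
  show ?thesis unfolding eq by (simp add: o_def R_def)
qed

text \<open>In \<open>(1 + \<epsilon> g)^4 x\<^sub>1\<close> the term of order 0 integrates to 0 by symmetry and the term of order 1 by
  \<open>first_moment_of_harmonic\<close>; the volume is bounded below by that of the ball of radius \<open>1/2\<close>.\<close>

lemma centroid_shift_second_order:
  assumes l: "2 \<le> l"
  obtains K \<epsilon>0 where "0 < K" "0 < \<epsilon>0"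
    "\<And>\<epsilon> u. 0 < \<epsilon> \<Longrightarrow> \<epsilon> < \<epsilon>0 \<Longrightarrow> u \<in> S2 \<Longrightarrow> 1 / 2 \<le> 1 + \<epsilon> * real_harmonic l 1 u"
    "\<And>\<epsilon>. 0 < \<epsilon> \<Longrightarrow> \<epsilon> < \<epsilon>0 \<Longrightarrow> \<bar>Re (wc (centroid (radial_body (real_harmonic l 1) \<epsilon>)))\<bar> \<le> K * \<epsilon>\<^sup>2"
proof -
  define q where "q = pderiv (legendre_poly l)"
  define g where "g = radial_ext q"
  define h where "h = real_harmonic l 1"
  have hg: "h u = radial_ext q u" if "u \<in> S2" for u
    using real_harmonic_eq[OF that, of l 1] radial_ext_sphere[OF that, of q] by (simp add: h_def q_def)
  obtain \<Gamma> where G: "0 < \<Gamma>" "\<forall>x\<in>punctured_ball. \<bar>g x\<bar> \<le> \<Gamma>" using radial_ext_bounded unfolding g_def by blast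
  have hb: "\<bar>h u\<bar> \<le> \<Gamma>" if "u \<in> S2" for u
  proof -
    have "u \<in> punctured_ball" using that by (auto simp: punctured_ball_def)
    then show ?thesis using G hg[OF that] by (simp add: g_def)
  qed
  define \<epsilon>0 where "\<epsilon>0 = min 1 (1 / (2 * \<Gamma>))"
  have e0: "\<epsilon>0 > 0" using G by (simp add: \<epsilon>0_def)
  have half: "1 / 2 \<le> 1 + \<epsilon> * h u" if "0 < \<epsilon>" "\<epsilon> < \<epsilon>0" "u \<in> S2" for \<epsilon> u
  proof -
    have "\<epsilon> * \<Gamma> \<le> 1 / 2" using that(1,2) G by (simp add: \<epsilon>0_def field_simps)
    moreover have "\<bar>\<epsilon> * h u\<bar> \<le> \<epsilon> * \<Gamma>" using hb[OF that(3)] that(1) by (simp add: abs_mult mult_left_mono)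
    ultimately show ?thesis by linarith
  qed
  define V where "V = measure lebesgue (punctured_ball)"
  define v where "v = measure lebesgue (ball (0::real^3) (1/2))"
  have v: "v > 0" unfolding v_def using content_ball_pos[of "1/2" "0::real^3"] by simp
  \<comment> \<open>Bounds the terms of order at least 2 of \<open>(1 + \<epsilon> g)^4\<close> after division by \<open>\<epsilon>\<^sup>2\<close>, for \<open>\<epsilon> \<le> 1\<close>.\<close>
  define K1 where "K1 = 6 * \<Gamma>\<^sup>2 + 4 * \<Gamma> ^ 3 + \<Gamma> ^ 4"
  define K where "K = K1 * V / v + 1"
  have V: "V \<ge> 0" by (simp add: V_def)
  have K1: "K1 \<ge> 0" using G by (simp add: K1_def)
  have K: "K > 0" using K1 V v by (simp add: K_def add_nonneg_pos)
  have abx: "\<bar>x $ 1\<bar> \<le> 1" if "x \<in> punctured_ball" for x :: "real^3"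
    using component_le_norm_cart[of x 1] punctured_ball_D[OF that] by linarith
  have gi: "(\<lambda>x. p x * x $ 1) absolutely_integrable_on punctured_ball"
    if c: "continuous_on punctured_ball p" and b: "\<And>x. x \<in> punctured_ball \<Longrightarrow> \<bar>p x\<bar> \<le> B" for p :: "real^3 \<Rightarrow> real" and B
  proof (rule absolutely_integrable_bounded_continuous)
    show "continuous_on punctured_ball (\<lambda>x. p x * x $ 1)" by (intro continuous_intros c)
    show "norm (p x * x $ 1) \<le> B" if "x \<in> punctured_ball" for x
      using mult_mono[OF b[OF that] abx[OF that]] b[OF that] by (simp add: abs_mult)
  qed
  have main: "\<bar>Re (wc (centroid (radial_body h \<epsilon>)))\<bar> \<le> K * \<epsilon>\<^sup>2" if e: "0 < \<epsilon>" "\<epsilon> < \<epsilon>0" for \<epsilon>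
  proof -
    have e1: "\<epsilon> \<le> 1" using e by (simp add: \<epsilon>0_def)
    have pos: "0 < 1 + \<epsilon> * h u" if "u \<in> S2" for u using half[OF e that] by linarith
    have hc: "continuous_on S2 h" unfolding h_def by (rule continuous_real_harmonic)
    define \<rho> where "\<rho> = (\<lambda>x. 6 * (g x)\<^sup>2 + 4 * \<epsilon> * (g x) ^ 3 + \<epsilon>\<^sup>2 * (g x) ^ 4)"
    have rb: "\<bar>\<rho> x\<bar> \<le> K1" if x: "x \<in> punctured_ball" for x
    proof -
      have gx: "\<bar>g x\<bar> \<le> \<Gamma>" using G x by blast
      have pw: "\<bar>g x\<bar> ^ n \<le> \<Gamma> ^ n" for n using gx by (intro power_mono) auto
      have "\<bar>\<rho> x\<bar> \<le> \<bar>6 * (g x)\<^sup>2\<bar> + \<bar>4 * \<epsilon> * (g x) ^ 3\<bar> + \<bar>\<epsilon>\<^sup>2 * (g x) ^ 4\<bar>"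
        unfolding \<rho>_def by linarith
      also have "\<dots> = 6 * \<bar>g x\<bar>\<^sup>2 + \<epsilon> * (4 * \<bar>g x\<bar> ^ 3) + \<epsilon>\<^sup>2 * \<bar>g x\<bar> ^ 4"
        using e by (simp add: abs_mult power_abs)
      also have "\<dots> \<le> 6 * \<Gamma>\<^sup>2 + 1 * (4 * \<Gamma> ^ 3) + 1 * \<Gamma> ^ 4"
      proof (intro add_mono)
        show "6 * \<bar>g x\<bar>\<^sup>2 \<le> 6 * \<Gamma>\<^sup>2" by (rule mult_left_mono[OF pw]) simp
        show "\<epsilon> * (4 * \<bar>g x\<bar> ^ 3) \<le> 1 * (4 * \<Gamma> ^ 3)"
          by (rule mult_mono[OF e1 mult_left_mono[OF pw]]) (use e in auto)
        show "\<epsilon>\<^sup>2 * \<bar>g x\<bar> ^ 4 \<le> 1 * \<Gamma> ^ 4"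
          by (rule mult_mono[OF _ pw]) (use e e1 in \<open>auto simp: power_le_one\<close>)
      qed
      finally show ?thesis by (simp add: K1_def)
    qed
    have gc: "continuous_on punctured_ball g" unfolding g_def by (rule radial_ext_continuous)
    have rc: "continuous_on punctured_ball \<rho>" unfolding \<rho>_def by (intro continuous_intros gc)
    have i1: "(\<lambda>x. 1 * x $ 1) absolutely_integrable_on punctured_ball"
      by (rule gi[of "\<lambda>x. 1" 1]) auto
    have i2: "(\<lambda>x. g x * x $ 1) absolutely_integrable_on punctured_ball" using gi[OF gc] G by blast
    have i3: "(\<lambda>x. \<rho> x * x $ 1) absolutely_integrable_on punctured_ball" using gi[OF rc rb] .
    note ii = i1[THEN set_lebesgue_integral_eq_integral(1)] i2[THEN set_lebesgue_integral_eq_integral(1)]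
      i3[THEN set_lebesgue_integral_eq_integral(1)]
    have I1: "integral punctured_ball (\<lambda>x. 1 * x $ 1) = 0"
    proof -
      have o: "orthogonal_transformation (rotoreflect (-1) 1)" by (rule orthogonal_rotoreflect) auto
      have r: "rotoreflect (-1) 1 x $ 1 = - x $ 1" for x
        by (simp add: rotoreflect_def hor_def wc_def vector_3 axis_def)
      from integral_orthogonal_invariant_real(2)[OF o punctured_ball_invariant[OF o] i1]
      show ?thesis unfolding r by simp
    qed
    have I2: "integral punctured_ball (\<lambda>x. g x * x $ 1) = 0"
    proof -
      have "(\<lambda>x. g x * x $ 1) = (\<lambda>x. (x $ 1)\<^sup>2 / norm x * poly (pderiv (legendre_poly l)) (cos_colat x))"
        by (simp add: g_def radial_ext_def q_def power2_eq_square fun_eq_iff)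
      then show ?thesis using first_moment_of_harmonic[OF l] by simp
    qed
    have I3: "\<bar>integral punctured_ball (\<lambda>x. \<rho> x * x $ 1)\<bar> \<le> K1 * V"
    proof -
      have "norm (integral punctured_ball (\<lambda>x. \<rho> x * x $ 1)) \<le> integral punctured_ball (\<lambda>x. K1)"
      proof (rule Henstock_Kurzweil_Integration.integral_norm_bound_integral[OF ii(3) integrable_on_const[OF punctured_ball_lmeasurable]])
        show "norm (\<rho> x * x $ 1) \<le> K1" if "x \<in> punctured_ball" for x
          using mult_mono[OF rb[OF that] abx[OF that]] K1 by (simp add: abs_mult)
      qed
      also have "integral punctured_ball (\<lambda>x. K1) = integral punctured_ball (\<lambda>x. K1 * 1)" by simp
      also have "\<dots> = K1 * V" unfolding V_def lmeasure_integral[OF punctured_ball_lmeasurable] by (rule integral_mult_right)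
      finally show ?thesis by simp
    qed
    have "integral (radial_body h \<epsilon>) (\<lambda>x. x) $ 1 = integral punctured_ball (\<lambda>x. (1 + \<epsilon> * g x) ^ 4 * x $ 1)"
      unfolding g_def by (rule radial_body_integral[OF hg hc pos])
    also have "\<dots> = integral punctured_ball (\<lambda>x. (1 * x $ 1 + (4 * \<epsilon>) * (g x * x $ 1)) + \<epsilon>\<^sup>2 * (\<rho> x * x $ 1))"
      by (rule integral_cong) (simp add: \<rho>_def power2_eq_square power3_eq_cube power4_eq_xxxx algebra_simps)
    also have "\<dots> = (integral punctured_ball (\<lambda>x. 1 * x $ 1) + (4 * \<epsilon>) * integral punctured_ball (\<lambda>x. g x * x $ 1))
       + \<epsilon>\<^sup>2 * integral punctured_ball (\<lambda>x. \<rho> x * x $ 1)"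
      using ii by (simp only: integral_add integrable_add integrable_on_mult_right integral_mult_right)
    finally have M: "integral (radial_body h \<epsilon>) (\<lambda>x. x) $ 1 = \<epsilon>\<^sup>2 * integral punctured_ball (\<lambda>x. \<rho> x * x $ 1)"
      unfolding I1 I2 by simp
    have mB: "v \<le> measure lebesgue (radial_body h \<epsilon>)" unfolding v_def
    proof (rule measure_mono_fmeasurable)
      show "radial_body h \<epsilon> \<in> lmeasurable" by (rule lmeasurable_compact[OF compact_radial_body[OF hc pos]])
      show "ball (0::real^3) (1/2) \<subseteq> radial_body h \<epsilon>"
      proof
        fix x :: "real^3" assume x: "x \<in> ball 0 (1/2)"
        obtain u where u: "u \<in> S2" "x = norm x *\<^sub>R u"
        proof (cases "x = 0")
          case True then show ?thesis using that[of "axis 1 1"] by (simp add: norm_axis_1)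
        next
          case False then show ?thesis using that[of "x /\<^sub>R norm x"] by simp
        qed
        have "norm x \<le> 1 + \<epsilon> * h u" using half[OF e u(1)] x by simp
        then show "x \<in> radial_body h \<epsilon>" unfolding radial_body_def using u norm_ge_zero[of x] by blast
      qed
    qed simp
    have "Re (wc (centroid (radial_body h \<epsilon>))) = integral (radial_body h \<epsilon>) (\<lambda>x. x) $ 1 / measure lebesgue (radial_body h \<epsilon>)"
      by (simp add: wc_def centroid_def divide_inverse mult.commute)
    then have "\<bar>Re (wc (centroid (radial_body h \<epsilon>)))\<bar> = \<epsilon>\<^sup>2 * \<bar>integral punctured_ball (\<lambda>x. \<rho> x * x $ 1)\<bar> / measure lebesgue (radial_body h \<epsilon>)"
      unfolding M by (simp add: abs_mult)
    also have "\<dots> \<le> \<epsilon>\<^sup>2 * (K1 * V) / v"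
      using I3 mB v K1 V by (intro frac_le mult_left_mono mult_nonneg_nonneg) auto
    also have "\<dots> = (K1 * V / v) * \<epsilon>\<^sup>2" by simp
    also have "\<dots> \<le> K * \<epsilon>\<^sup>2" by (intro mult_right_mono) (auto simp: K_def)
    finally show ?thesis .
  qed
  show ?thesis by (rule that[OF K e0]) (use half main in \<open>auto simp: h_def\<close>)
qed

section \<open>Orders at least two\<close>

text \<open>Transfers the positivity of the radius from the sphere to the auxiliary functions of the height.\<close>

lemma parallel_height_attained:
  assumes "\<sigma> \<in> {1, -1}" "\<bar>z\<bar> \<le> 1" "1 \<le> m"
  shows "\<exists>u\<in>S2. u $ 3 = z \<and> Sh m u = parallel_height m \<sigma> z"
proof -
  have z2: "0 \<le> 1 - z\<^sup>2" using assms(2) by (simp add: abs_square_le_1)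
  obtain \<omega> where om: "\<omega> ^ m = complex_of_real \<sigma>" "cmod \<omega> = 1"
  proof (cases "\<sigma> = 1")
    case True then show ?thesis using that[of 1] by simp
  next
    case False
    then have "\<sigma> = -1" using assms(1) by simp
    moreover have "cis (pi / m) ^ m = -1" using assms(3) by (simp add: Complex.DeMoivre)
    ultimately show ?thesis using that[of "cis (pi / m)"] by simp
  qed
  define u where "u = hor (of_real (sqrt (1 - z\<^sup>2)) * \<omega>) + z *\<^sub>R e\<^sub>3"
  have "u \<in> S2"
    by (rule S2_iff[THEN iffD2]) (use om(2) z2 in \<open>simp add: u_def norm_mult power_mult_distrib\<close>)
  moreover have "Sh m u = Re (of_real (sqrt (1 - z\<^sup>2) ^ m) * complex_of_real \<sigma>)"
    by (simp add: Sh_def u_def power_mult_distrib om(1))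
  then have "Sh m u = parallel_height m \<sigma> z" unfolding parallel_height_def by (simp add: mult.commute)
  moreover have "u $ 3 = z" by (simp add: u_def)
  ultimately show ?thesis by blast
qed

lemma centroid_dist2_expand:
  assumes m: "1 \<le> m" "m \<le> l" and pos: "\<And>u. u \<in> S2 \<Longrightarrow> 0 < 1 + \<epsilon> * real_harmonic l m u" and u: "u \<in> S2"
  defines "c \<equiv> Re (wc (centroid (radial_body (real_harmonic l m) \<epsilon>)))"
  shows "centroid_dist2 (real_harmonic l m) \<epsilon> u
    = (1 + \<epsilon> * (Sh m u * poly ((pderiv ^^ m) (legendre_poly l)) (u $ 3)))\<^sup>2
      - 2 * (1 + \<epsilon> * (Sh m u * poly ((pderiv ^^ m) (legendre_poly l)) (u $ 3))) * (c * Sh 1 u) + c\<^sup>2"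
proof -
  define C where "C = centroid (radial_body (real_harmonic l m) \<epsilon>)"
  define r where "r = 1 + \<epsilon> * real_harmonic l m u"
  have C: "C $ 3 = 0" "wc C = of_real c"
    using centroid_symmetry(1,2)[OF m pos] unfolding C_def c_def by (simp_all add: complex_eq_iff)
  have uu: "u \<bullet> u = 1" using u by (simp add: norm_eq_1)
  have uC: "u \<bullet> C = c * Sh 1 u" by (simp add: inner_wc C Sh_def mult.commute)
  have CC: "C \<bullet> C = c\<^sup>2" by (simp add: inner_wc C power2_eq_square)
  have "(norm (r *\<^sub>R u - C))\<^sup>2 = r\<^sup>2 - 2 * r * (c * Sh 1 u) + c\<^sup>2"
    unfolding power2_norm_eq_inner using uu uC CC
    by (simp add: inner_diff_left inner_diff_right inner_commute power2_eq_square algebra_simps)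
  then show ?thesis unfolding centroid_dist2_def C_def[symmetric] r_def real_harmonic_eq[OF u] .
qed

definition harmonic_factor :: "nat \<Rightarrow> nat \<Rightarrow> real poly"
  where "harmonic_factor l m = (pderiv ^^ m) (legendre_poly l)"

lemma harmonic_factor_facts:
  assumes m: "1 \<le> m" "m \<le> l"
  defines "q \<equiv> harmonic_factor l m"
  shows "finite {z. poly q z = 0}" "card {z. poly q z = 0} = l - m" "\<And>z. poly q z = 0 \<Longrightarrow> \<bar>z\<bar> < 1"
    "\<And>z. poly q z = 0 \<Longrightarrow> poly (pderiv q) z \<noteq> 0"
    "card {z \<in> {-1<..<1}. poly (crit_poly m q) z = 0} = l - m + 1"
    "\<And>z. z \<in> {-1<..<1} \<Longrightarrow> poly (crit_poly m q) z = 0 \<Longrightarrow> poly (pderiv (crit_poly m q)) z * poly q z < 0"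
proof -
  note L = legendre_deriv_roots[OF m(2), folded harmonic_factor_def, folded q_def]
  show fin: "finite {z. poly q z = 0}" using L(1) by (rule poly_roots_finite)
  show "card {z. poly q z = 0} = l - m" by (rule L(3))
  show "\<bar>z\<bar> < 1" if "poly q z = 0" for z using L(4) that by (auto simp: abs_less_iff)
  have cd: "card {z. poly q z = 0} = degree q" using L(2,3) by simp
  show "poly (pderiv q) z \<noteq> 0" if "poly q z = 0" for z
    by (rule simple_root_if_card_roots_eq_degree[OF fin cd _ _ L(1)]) (use that in auto)
  have z: "\<And>x. x \<in> {z. poly q z = 0} \<Longrightarrow> poly q x = 0" by simp
  show "card {z \<in> {-1<..<1}. poly (crit_poly m q) z = 0} = l - m + 1"
    using crit_poly_roots(1)[OF m(1) fin cd z L(4,1)] L(2) by simp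
  show "poly (pderiv (crit_poly m q)) z * poly q z < 0" if "z \<in> {-1<..<1}" "poly (crit_poly m q) z = 0" for z
    by (rule crit_poly_roots(2)[OF m(1) fin cd z L(4,1) that])
qed

text \<open>The centroid is the origin, so that \<open>\<kappa> = 0\<close> and \<open>crit_fun\<close> is \<open>crit_poly\<close> times the positive factor
  \<open>\<epsilon> (1 + \<epsilon> s q)\<close>: the heights are the same on all meridians.\<close>

lemma zonal_body_roots_higher_order:
  assumes m: "2 \<le> m" "m \<le> l" and e: "0 < \<epsilon>" and pos: "\<And>u. u \<in> S2 \<Longrightarrow> 0 < 1 + \<epsilon> * real_harmonic l m u"
  defines "q \<equiv> harmonic_factor l m"
  shows "zonal_body_roots m q \<epsilon> 0 0 (centroid_dist2 (real_harmonic l m) \<epsilon>) (l - m)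
    {z \<in> {-1<..<1}. poly (crit_poly m q) z = 0} (\<lambda>\<sigma> r. r) (\<lambda>r. sgn (poly q r))"
proof -
  have m1: "1 \<le> m" using m by simp
  note H = harmonic_factor_facts[OF m1 m(2), folded q_def]
  have pos': "0 < 1 + \<epsilon> * Sh m u * poly q (u $ 3)" if "u \<in> S2" for u
    using pos[OF that] real_harmonic_eq[OF that, of l m] by (simp add: q_def harmonic_factor_def mult.assoc)
  have R: "0 < 1 + \<epsilon> * parallel_height m \<sigma> z * poly q z" if sz: "\<sigma> \<in> {1, -1}" "\<bar>z\<bar> \<le> 1" for \<sigma> z
  proof -
    obtain u where "u \<in> S2" "u $ 3 = z" "Sh m u = parallel_height m \<sigma> z"
      using parallel_height_attained[OF sz m1] by blast
    then show ?thesis using pos'[of u] by simp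
  qed
  have q0: "poly q z \<noteq> 0" if "z \<in> {-1<..<1}" "poly (crit_poly m q) z = 0" for z
    using H(6)[OF that] by auto
  show ?thesis
  proof (unfold_locales)
    show "1 \<le> m" by (rule m1)
    have c0: "centroid (radial_body (real_harmonic l m) \<epsilon>) = 0"
      by (rule centroid_symmetry(3)[OF m1 m(2) pos m(1)])
    show "centroid_dist2 (real_harmonic l m) \<epsilon> u = (1 + \<epsilon> * Sh m u * poly q (u $ 3))\<^sup>2 - 0 * (Sh m u)\<^sup>2 + 0"
      if "u \<in> S2" for u
      using centroid_dist2_expand[OF m1 m(2) pos that] unfolding c0
      by (simp add: q_def harmonic_factor_def mult.assoc)
    show "0 < \<epsilon>" by (rule e)
    show "(0::real) = 0" ..
    show "0 < 1 + \<epsilon> * Sh m u * poly q (u $ 3)" if "u \<in> S2" for u by (rule pos'[OF that])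
    have eq: "{z. \<bar>z\<bar> \<le> 1 \<and> poly q z = 0} = {z. poly q z = 0}" using H(3) by force
    show "finite {z. \<bar>z\<bar> \<le> 1 \<and> poly q z = 0}" "card {z. \<bar>z\<bar> \<le> 1 \<and> poly q z = 0} = l - m"
      unfolding eq by (rule H)+
    show "\<bar>z\<bar> < 1 \<and> poly (pderiv q) z \<noteq> 0" if "\<bar>z\<bar> \<le> 1" "poly q z = 0" for z using H(3,4) that by blast
    show "(1 + \<epsilon> * Sh m u * poly q (u $ 3)) * \<epsilon> * poly q (u $ 3) \<noteq> 0 * Sh m u"
      if "u \<in> S2" "poly (pderiv q) (u $ 3) = 0" for u
    proof -
      have "poly q (u $ 3) \<noteq> 0" using H(4) that(2) by blast
      then show ?thesis using pos'[OF that(1)] e by simp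
    qed
    show "card {z \<in> {-1<..<1}. poly (crit_poly m q) z = 0} = l - m + 1" by (rule H(5))
    then show "finite {z \<in> {-1<..<1}. poly (crit_poly m q) z = 0}" by (intro card_ge_0_finite) simp
    show "bij_betw (\<lambda>r. r) {z \<in> {-1<..<1}. poly (crit_poly m q) z = 0}
       {z. \<bar>z\<bar> < 1 \<and> crit_fun m q \<epsilon> 0 (parallel_height m \<sigma> z) z = 0}" if s: "\<sigma> \<in> {1, -1}" for \<sigma>
    proof -
      have "crit_fun m q \<epsilon> 0 (parallel_height m \<sigma> z) z = 0 \<longleftrightarrow> poly (crit_poly m q) z = 0" if "\<bar>z\<bar> < 1" for z
        using R[OF s, of z] that e by (simp add: crit_fun_def)
      then have "{z. \<bar>z\<bar> < 1 \<and> crit_fun m q \<epsilon> 0 (parallel_height m \<sigma> z) z = 0} = {z \<in> {-1<..<1}. poly (crit_poly m q) z = 0}"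
        by (auto simp: abs_less_iff)
      then show ?thesis by (simp add: bij_betw_def)
    qed
    show "sgn (poly q r) \<in> {1, -1}" if "r \<in> {z \<in> {-1<..<1}. poly (crit_poly m q) z = 0}" for r
      using q0 that by (auto simp: sgn_if)
    show "sgn ((1 + \<epsilon> * s * poly q z) * \<epsilon> * poly q z - 0 * s) = sgn (poly q r)"
      if "r \<in> {z \<in> {-1<..<1}. poly (crit_poly m q) z = 0}" "\<sigma> \<in> {1, -1}" "z = r" "s = parallel_height m \<sigma> z" for r \<sigma> z s
    proof -
      have "\<bar>r\<bar> \<le> 1" using that(1) by (auto simp: abs_le_iff)
      then have "0 < 1 + \<epsilon> * s * poly q z" using R[OF that(2), of r] that(3,4) by simp
      then show ?thesis using e that(3) by (simp add: sgn_mult)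
    qed
    show "sgn (crit_fun_slope m q \<epsilon> 0 (parallel_height m \<sigma> z) z) = - sgn (poly q r)"
      if r: "r \<in> {z \<in> {-1<..<1}. poly (crit_poly m q) z = 0}" and s: "\<sigma> \<in> {1, -1}" and z: "z = r" for r \<sigma> z
    proof -
      have r1: "\<bar>r\<bar> < 1" "poly (crit_poly m q) r = 0" using r by auto
      have p: "0 < 1 + \<epsilon> * parallel_height m \<sigma> r * poly q r" using R[OF s, of r] r1 by simp
      have u: "0 < 1 - r\<^sup>2" using r1(1) by (simp add: abs_square_less_1)
      define X where "X = \<epsilon> * ((1 - r\<^sup>2) * (1 + \<epsilon> * parallel_height m \<sigma> r * poly q r))"
      have eq: "crit_fun_slope m q \<epsilon> 0 (parallel_height m \<sigma> z) z = X * poly (pderiv (crit_poly m q)) r"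
        unfolding z crit_fun_slope_def r1(2) X_def by simp
      have "0 < X" unfolding X_def using e u p by (intro mult_pos_pos)
      moreover have "sgn (poly (pderiv (crit_poly m q)) r) = - sgn (poly q r)"
        using H(6)[of r] r by (auto simp: mult_less_0_iff sgn_if)
      ultimately show ?thesis unfolding eq by (simp add: sgn_mult)
    qed
  qed
qed

section \<open>Order one\<close>

lemma crit_poly_shift:
  "poly (crit_poly 1 (q - [:a:])) z = poly (crit_poly 1 q) z + a * z"
  "poly (pderiv (crit_poly 1 (q - [:a:]))) z = poly (pderiv (crit_poly 1 q)) z + a"
  by (simp_all add: poly_crit_poly poly_pderiv_crit_poly pderiv_diff pderiv_pCons algebra_simps)

lemma parallel_height_bound: "\<sigma> \<in> {1, -1} \<Longrightarrow> \<bar>z\<bar> \<le> 1 \<Longrightarrow> \<bar>parallel_height 1 \<sigma> z\<bar> \<le> 1"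
proof -
  assume a: "\<sigma> \<in> {1, -1}" "\<bar>z\<bar> \<le> 1"
  have "0 \<le> 1 - z\<^sup>2" using a(2) by (simp add: abs_square_le_1)
  then have "\<bar>sqrt (1 - z\<^sup>2)\<bar> \<le> 1" by simp
  then show ?thesis using a(1) by (auto simp: parallel_height_def)
qed

text \<open>Identifies \<open>crit_fun_slope\<close> with the derivative along the meridian, to which \<open>simple_roots_stable\<close>
  applies. Division by \<open>\<epsilon>\<close> makes \<open>crit_fun\<close> converge to \<open>crit_poly\<close> when \<open>\<epsilon>\<close> and \<open>\<kappa>/\<epsilon>\<close> tend to 0.\<close>

lemma crit_fun_deriv:
  assumes z: "\<bar>z\<bar> < 1" and e: "\<epsilon> \<noteq> 0"
  shows "((\<lambda>z. crit_fun 1 q \<epsilon> \<kappa> (parallel_height 1 \<sigma> z) z / \<epsilon>) has_real_derivative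
    crit_fun_slope 1 q \<epsilon> \<kappa> (parallel_height 1 \<sigma> z) z / (\<epsilon> * (1 - z\<^sup>2))) (at z)"
proof -
  define s where "s = parallel_height 1 \<sigma>"
  have u: "0 < 1 - z\<^sup>2" using z by (simp add: abs_square_less_1)
  have "((\<lambda>z. \<sigma> * sqrt (1 - z\<^sup>2)) has_real_derivative \<sigma> * ((0 - 2 * z) * (inverse (sqrt (1 - z\<^sup>2)) / 2))) (at z)"
    using u by (auto intro!: derivative_eq_intros)
  moreover have "\<sigma> * ((0 - 2 * z) * (inverse (sqrt (1 - z\<^sup>2)) / 2)) = - z * s z / (1 - z\<^sup>2)"
  proof -
    have "inverse (sqrt (1 - z\<^sup>2)) = sqrt (1 - z\<^sup>2) / (1 - z\<^sup>2)"
      using u real_sqrt_mult_self[of "1 - z\<^sup>2"] by (simp add: field_simps)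
    moreover have "\<sigma> * ((0 - 2 * z) * (w / v / 2)) = - z * (\<sigma> * w) / v" for w v :: real
      by (cases "v = 0") (simp_all add: field_simps)
    ultimately show ?thesis unfolding s_def parallel_height_def by (simp only: power_one_right)
  qed
  ultimately have ds: "(s has_real_derivative - z * s z / (1 - z\<^sup>2)) (at z)"
    by (simp add: s_def parallel_height_def[abs_def])
  let ?N = "poly (crit_poly 1 q)" and ?N' = "poly (pderiv (crit_poly 1 q))" and ?q = "poly q" and ?q' = "poly (pderiv q)"
  have "((\<lambda>z. 1 + \<epsilon> * s z * ?q z) has_real_derivative \<epsilon> * (- z * s z / (1 - z\<^sup>2)) * ?q z + ?q' z * (\<epsilon> * s z)) (at z)"
    using DERIV_add[OF DERIV_const DERIV_mult[OF DERIV_cmult[OF ds, of \<epsilon>] poly_DERIV[of q z]]] by (simp only: add_0_left)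
  note B = DERIV_mult[OF DERIV_cmult_right[OF this, of \<epsilon>] poly_DERIV[of "crit_poly 1 q" z]]
  note C = DERIV_mult[OF DERIV_cmult[OF ds, of "\<kappa> * real 1"] DERIV_ident]
  have "((\<lambda>z. ((1 + \<epsilon> * s z * ?q z) * \<epsilon> * ?N z + \<kappa> * real 1 * s z * z) / \<epsilon>) has_real_derivative
    (((\<epsilon> * (- z * s z / (1 - z\<^sup>2)) * ?q z + ?q' z * (\<epsilon> * s z)) * \<epsilon> * ?N z + ?N' z * ((1 + \<epsilon> * s z * ?q z) * \<epsilon>))
     + (\<kappa> * real 1 * (- z * s z / (1 - z\<^sup>2)) * z + 1 * (\<kappa> * real 1 * s z))) / \<epsilon>) (at z)"
    by (rule DERIV_cdivide[OF DERIV_add[OF B C]])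
  moreover have "(((\<epsilon> * (- z * s z / (1 - z\<^sup>2)) * ?q z + ?q' z * (\<epsilon> * s z)) * \<epsilon> * ?N z + ?N' z * ((1 + \<epsilon> * s z * ?q z) * \<epsilon>))
     + (\<kappa> * real 1 * (- z * s z / (1 - z\<^sup>2)) * z + 1 * (\<kappa> * real 1 * s z))) / \<epsilon>
     = crit_fun_slope 1 q \<epsilon> \<kappa> (s z) z / (\<epsilon> * (1 - z\<^sup>2))"
  proof -
    define v where "v = 1 - z\<^sup>2"
    have v: "v \<noteq> 0" using u v_def by simp
    have N: "?N z = v * ?q' z - z * ?q z" by (simp add: poly_crit_poly v_def)
    have "((\<epsilon> * (- z * s z / v) * ?q z + ?q' z * (\<epsilon> * s z)) * \<epsilon> * ?N z + ?N' z * ((1 + \<epsilon> * s z * ?q z) * \<epsilon>)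
     + (\<kappa> * real 1 * (- z * s z / v) * z + \<kappa> * real 1 * s z)) * v
     = \<epsilon> * (\<epsilon> * s z * (v * ?q' z - z * ?q z) * ?N z + v * (1 + \<epsilon> * s z * ?q z) * ?N' z) + \<kappa> * (v * s z - z * z * s z)"
      using v by (simp add: field_simps)
    also have "\<dots> = crit_fun_slope 1 q \<epsilon> \<kappa> (s z) z"
      unfolding crit_fun_slope_def N[symmetric] v_def[symmetric] by (simp add: power2_eq_square mult_ac)
    finally show ?thesis unfolding v_def[symmetric] using v e by (simp add: field_simps)
  qed
  ultimately show ?thesis unfolding crit_fun_def s_def[symmetric] by simp
qed

text \<open>The centroid is \<open>c\<close> times the first axis with \<open>|c| \<le> K \<epsilon>\<^sup>2\<close>. Completing the square replaces \<open>q\<close> by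
  \<open>q - c/\<epsilon>\<close> and gives \<open>\<kappa> = c\<^sup>2\<close>. Both are perturbations that vanish with \<open>\<epsilon>\<close>, so the simple roots of \<open>q\<close>
  and of \<open>crit_poly 1 q\<close> persist.\<close>

lemma zonal_body_roots_first_order:
  assumes l: "2 \<le> l"
  obtains \<delta> where "0 < \<delta>"
    "\<And>\<epsilon>. 0 < \<epsilon> \<Longrightarrow> \<epsilon> < \<delta> \<Longrightarrow> \<exists>q \<kappa> C Z b \<eta>. zonal_body_roots 1 q \<epsilon> \<kappa> C (centroid_dist2 (real_harmonic l 1) \<epsilon>) (l - 1) Z b \<eta>"
proof -
  define q where "q = harmonic_factor l 1"
  have l1: "1 \<le> l" using l by simp
  note H = harmonic_factor_facts[OF order_refl l1, folded q_def]
  define N N' where "N = poly (crit_poly 1 q)" and "N' = poly (pderiv (crit_poly 1 q))"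
  define Z where "Z = {z \<in> {-1<..<1}. N z = 0}"
  have cardZ: "card Z = l - 1 + 1" unfolding Z_def N_def by (rule H(5))
  have finZ: "finite Z" using cardZ by (intro card_ge_0_finite) simp
  have sgnZ: "N' r * poly q r < 0" if "r \<in> Z" for r using H(6) that by (auto simp: Z_def N_def N'_def)
  obtain K \<epsilon>0 where K: "0 < K" and e0: "0 < \<epsilon>0"
    and pos: "\<And>\<epsilon> u. 0 < \<epsilon> \<Longrightarrow> \<epsilon> < \<epsilon>0 \<Longrightarrow> u \<in> S2 \<Longrightarrow> 1 / 2 \<le> 1 + \<epsilon> * real_harmonic l 1 u"
    and shift: "\<And>\<epsilon>. 0 < \<epsilon> \<Longrightarrow> \<epsilon> < \<epsilon>0 \<Longrightarrow> \<bar>Re (wc (centroid (radial_body (real_harmonic l 1) \<epsilon>)))\<bar> \<le> K * \<epsilon>\<^sup>2"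
  proof (rule centroid_shift_second_order[OF l])
    fix K \<epsilon>0 :: real
    assume "0 < K" "0 < \<epsilon>0"
      "\<And>\<epsilon> u. 0 < \<epsilon> \<Longrightarrow> \<epsilon> < \<epsilon>0 \<Longrightarrow> u \<in> S2 \<Longrightarrow> 1 / 2 \<le> 1 + \<epsilon> * real_harmonic l 1 u"
      "\<And>\<epsilon>. 0 < \<epsilon> \<Longrightarrow> \<epsilon> < \<epsilon>0 \<Longrightarrow> \<bar>Re (wc (centroid (radial_body (real_harmonic l 1) \<epsilon>)))\<bar> \<le> K * \<epsilon>\<^sup>2"
    then show thesis by (rule that)
  qed
  obtain M where M: "0 < M" "\<And>z. \<bar>z\<bar> \<le> 1 \<Longrightarrow> \<bar>poly q z\<bar> \<le> M" "\<And>z. \<bar>z\<bar> \<le> 1 \<Longrightarrow> \<bar>N z\<bar> \<le> M" "\<And>z. \<bar>z\<bar> \<le> 1 \<Longrightarrow> \<bar>N' z\<bar> \<le> M"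
  proof -
    obtain a where a: "\<forall>z\<in>{-1..1}. \<bar>poly q z\<bar> \<le> a" using poly_bounded_Icc[of q] ..
    obtain b where b: "\<forall>z\<in>{-1..1}. \<bar>N z\<bar> \<le> b" unfolding N_def using poly_bounded_Icc[of "crit_poly 1 q"] ..
    obtain c where c: "\<forall>z\<in>{-1..1}. \<bar>N' z\<bar> \<le> c" unfolding N'_def using poly_bounded_Icc[of "pderiv (crit_poly 1 q)"] ..
    show ?thesis
    proof (rule that)
      show "0 < \<bar>a\<bar> + \<bar>b\<bar> + \<bar>c\<bar> + 1" by linarith
      fix z :: real assume "\<bar>z\<bar> \<le> 1"
      then have z: "z \<in> {-1..1}" by (simp add: abs_le_iff)
      show "\<bar>poly q z\<bar> \<le> \<bar>a\<bar> + \<bar>b\<bar> + \<bar>c\<bar> + 1" using bspec[OF a z] by linarith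
      show "\<bar>N z\<bar> \<le> \<bar>a\<bar> + \<bar>b\<bar> + \<bar>c\<bar> + 1" using bspec[OF b z] by linarith
      show "\<bar>N' z\<bar> \<le> \<bar>a\<bar> + \<bar>b\<bar> + \<bar>c\<bar> + 1" using bspec[OF c z] by linarith
    qed
  qed
  \<comment> \<open>A common lower bound for \<open>|q|\<close> at the roots of \<open>N\<close> and of \<open>q'\<close>: there the terms with \<open>\<kappa>\<close> must be
    dominated by those with \<open>q\<close>.\<close>
  obtain \<mu> where mu: "0 < \<mu>" "\<And>r. r \<in> Z \<Longrightarrow> \<mu> \<le> \<bar>poly q r\<bar>" "\<And>z. \<bar>z\<bar> \<le> 1 \<Longrightarrow> poly (pderiv q) z = 0 \<Longrightarrow> \<mu> \<le> \<bar>poly q z\<bar>"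
  proof -
    define A where "A = Z \<union> {z \<in> {-1..1}. poly (pderiv q) z = 0}"
    have "closed {z. poly (pderiv q) z = 0}" by (intro closed_Collect_eq continuous_intros)
    then have "compact ({-1..1} \<inter> {z. poly (pderiv q) z = 0})" by (intro compact_Int_closed) auto
    moreover have "{-1..1} \<inter> {z. poly (pderiv q) z = 0} = {z \<in> {-1..1}. poly (pderiv q) z = 0}" by auto
    ultimately have "compact {z \<in> {-1..1}. poly (pderiv q) z = 0}" by (simp only:)
    then have "compact A" unfolding A_def by (rule compact_Un[OF finite_imp_compact[OF finZ]])
    moreover have "A \<noteq> {}" using cardZ by (auto simp: A_def)
    moreover have "continuous_on A (\<lambda>z. \<bar>poly q z\<bar>)" by (intro continuous_intros)
    ultimately obtain z0 where z0: "z0 \<in> A" "\<forall>z\<in>A. \<bar>poly q z0\<bar> \<le> \<bar>poly q z\<bar>"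
      using continuous_attains_inf[of A "\<lambda>z. \<bar>poly q z\<bar>"] by blast
    have q0: "poly q z0 \<noteq> 0"
    proof
      assume 0: "poly q z0 = 0"
      then have "poly (pderiv q) z0 \<noteq> 0" by (rule H(4))
      then have "z0 \<in> Z" using z0(1) by (simp add: A_def)
      from sgnZ[OF this] 0 show False by simp
    qed
    show ?thesis
    proof (rule that)
      show "0 < \<bar>poly q z0\<bar>" using q0 by simp
      show "\<bar>poly q z0\<bar> \<le> \<bar>poly q r\<bar>" if "r \<in> Z" for r using z0(2) that by (simp add: A_def)
      show "\<bar>poly q z0\<bar> \<le> \<bar>poly q z\<bar>" if "\<bar>z\<bar> \<le> 1" "poly (pderiv q) z = 0" for z
        using z0(2) that by (simp add: A_def abs_le_iff)
    qed
  qed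
  have "uniformly_continuous_on {-1..1} (poly q)"
    by (intro compact_uniformly_continuous continuous_intros) auto
  then have "\<exists>d>0. \<forall>x\<in>{-1..1}. \<forall>y\<in>{-1..1}. dist y x < d \<longrightarrow> dist (poly q y) (poly q x) < \<mu> / 4"
    using mu(1) unfolding uniformly_continuous_on_def by (elim allE[where x = "\<mu> / 4"]) simp
  then obtain \<eta>0 where eta: "0 < \<eta>0" "\<And>x y. x \<in> {-1..1} \<Longrightarrow> y \<in> {-1..1} \<Longrightarrow> dist y x < \<eta>0 \<Longrightarrow> dist (poly q y) (poly q x) < \<mu> / 4"
    by blast
  have endN: "N 1 \<noteq> 0" "N (-1) \<noteq> 0" using H(3)[of 1] H(3)[of "-1"] by (auto simp: N_def poly_crit_poly)
  have simpleN: "N' z \<noteq> 0" if "z \<in> {-1<..<1}" "N z = 0" for z using sgnZ[of z] that by (auto simp: Z_def)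
  obtain \<delta>1 a0 where d1: "0 < \<delta>1" "0 < a0" "a0 < 1" and stab: "\<And>F F'. continuous_on {-1..1} F \<and> (\<forall>z\<in>{-1..1}. \<bar>F z - N z\<bar> < \<delta>1) \<and>
      (\<forall>z. \<bar>z\<bar> \<le> 1 - a0 \<longrightarrow> (F has_real_derivative F' z) (at z) \<and> \<bar>F' z - N' z\<bar> < \<delta>1) \<Longrightarrow>
      (\<exists>\<phi>. bij_betw \<phi> Z {z \<in> {-1..1}. F z = 0} \<and>
        (\<forall>r\<in>Z. \<bar>\<phi> r\<bar> < 1 \<and> \<bar>\<phi> r - r\<bar> < \<eta>0 \<and> sgn (F' (\<phi> r)) = sgn (N' r)))"
  proof -
    have "continuous_on {-1..1} N" "continuous_on {-1..1} N'" unfolding N_def N'_def by (intro continuous_intros)+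
    note S = simple_roots_stable[OF this finZ[unfolded Z_def] endN _ simpleN eta(1), folded Z_def]
    have dN: "(N has_real_derivative N' z) (at z)" for z unfolding N_def N'_def by (rule poly_DERIV)
    have "\<exists>d>0. \<exists>a>0. a < 1 \<and> (\<forall>F F'. continuous_on {-1..1} F \<and> (\<forall>z\<in>{-1..1}. \<bar>F z - N z\<bar> < d) \<and>
      (\<forall>z. \<bar>z\<bar> \<le> 1 - a \<longrightarrow> (F has_real_derivative F' z) (at z) \<and> \<bar>F' z - N' z\<bar> < d) \<longrightarrow>
      (\<exists>\<phi>. bij_betw \<phi> Z {z \<in> {-1..1}. F z = 0} \<and>
        (\<forall>r\<in>Z. \<bar>\<phi> r\<bar> < 1 \<and> \<bar>\<phi> r - r\<bar> < \<eta>0 \<and> sgn (F' (\<phi> r)) = sgn (N' r))))"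
      by (rule S[OF dN])
    then obtain d a where "0 < d" "0 < a" "a < 1" and
      st: "\<forall>F F'. continuous_on {-1..1} F \<and> (\<forall>z\<in>{-1..1}. \<bar>F z - N z\<bar> < d) \<and>
      (\<forall>z. \<bar>z\<bar> \<le> 1 - a \<longrightarrow> (F has_real_derivative F' z) (at z) \<and> \<bar>F' z - N' z\<bar> < d) \<longrightarrow>
      (\<exists>\<phi>. bij_betw \<phi> Z {z \<in> {-1..1}. F z = 0} \<and>
        (\<forall>r\<in>Z. \<bar>\<phi> r\<bar> < 1 \<and> \<bar>\<phi> r - r\<bar> < \<eta>0 \<and> sgn (F' (\<phi> r)) = sgn (N' r)))"
      by (elim exE conjE)
    show ?thesis by (rule that[OF \<open>0 < d\<close> \<open>0 < a\<close> \<open>a < 1\<close> st[rule_format]])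
  qed
  have endq: "poly q 1 \<noteq> 0" "poly q (-1) \<noteq> 0" using H(3)[of 1] H(3)[of "-1"] by auto
  define Zq where "Zq = {z \<in> {-1<..<1}. poly q z = 0}"
  have Zq: "Zq = {z. poly q z = 0}" unfolding Zq_def using H(3) by (auto simp: abs_less_iff)
  obtain \<delta>2 a2 where d2: "0 < \<delta>2" and stabq: "\<And>F F'. continuous_on {-1..1} F \<and> (\<forall>z\<in>{-1..1}. \<bar>F z - poly q z\<bar> < \<delta>2) \<and>
      (\<forall>z. \<bar>z\<bar> \<le> 1 - a2 \<longrightarrow> (F has_real_derivative F' z) (at z) \<and> \<bar>F' z - poly (pderiv q) z\<bar> < \<delta>2) \<Longrightarrow>
      (\<exists>\<phi>. bij_betw \<phi> Zq {z \<in> {-1..1}. F z = 0} \<and>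
        (\<forall>r\<in>Zq. \<bar>\<phi> r\<bar> < 1 \<and> \<bar>\<phi> r - r\<bar> < 1 \<and> sgn (F' (\<phi> r)) = sgn (poly (pderiv q) r)))"
  proof -
    have c: "continuous_on {-1..1} (poly q)" "continuous_on {-1..1} (poly (pderiv q))" by (intro continuous_intros)+
    have f: "finite {z \<in> {-1<..<1}. poly q z = 0}" using H(1) Zq unfolding Zq_def by simp
    have "\<exists>d>0. \<exists>a>0. a < 1 \<and> (\<forall>F F'. continuous_on {-1..1} F \<and> (\<forall>z\<in>{-1..1}. \<bar>F z - poly q z\<bar> < d) \<and>
      (\<forall>z. \<bar>z\<bar> \<le> 1 - a \<longrightarrow> (F has_real_derivative F' z) (at z) \<and> \<bar>F' z - poly (pderiv q) z\<bar> < d) \<longrightarrow>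
      (\<exists>\<phi>. bij_betw \<phi> Zq {z \<in> {-1..1}. F z = 0} \<and>
        (\<forall>r\<in>Zq. \<bar>\<phi> r\<bar> < 1 \<and> \<bar>\<phi> r - r\<bar> < 1 \<and> sgn (F' (\<phi> r)) = sgn (poly (pderiv q) r))))"
      by (rule simple_roots_stable[OF c f endq poly_DERIV H(4) zero_less_one, folded Zq_def])
    then obtain d a where "0 < d" and
      st: "\<forall>F F'. continuous_on {-1..1} F \<and> (\<forall>z\<in>{-1..1}. \<bar>F z - poly q z\<bar> < d) \<and>
      (\<forall>z. \<bar>z\<bar> \<le> 1 - a \<longrightarrow> (F has_real_derivative F' z) (at z) \<and> \<bar>F' z - poly (pderiv q) z\<bar> < d) \<longrightarrow>
      (\<exists>\<phi>. bij_betw \<phi> Zq {z \<in> {-1..1}. F z = 0} \<and>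
        (\<forall>r\<in>Zq. \<bar>\<phi> r\<bar> < 1 \<and> \<bar>\<phi> r - r\<bar> < 1 \<and> sgn (F' (\<phi> r)) = sgn (poly (pderiv q) r)))"
      by (elim exE conjE)
    show ?thesis by (rule that[OF \<open>0 < d\<close> st[rule_format]])
  qed
  \<comment> \<open>With this constant \<open>F\<close> and \<open>F'\<close> below differ from \<open>N\<close> and \<open>N'\<close> by at most \<open>\<epsilon> B\<close>.\<close>
  define B where "B = (M + K)\<^sup>2 + K + K\<^sup>2 + (M + K)\<^sup>2 / a0 + K\<^sup>2 / a0"
  have B: "0 < B" using M(1) K d1 unfolding B_def by (intro add_pos_nonneg add_nonneg_nonneg) auto
  \<comment> \<open>In this order, the bounds make the estimate of \<open>c\<close> available, \<open>\<epsilon>\<close> at most 1, the perturbations of \<open>N\<close> and of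
    \<open>q\<close> small enough for the stability of roots, \<open>c/\<epsilon>\<close> small against \<open>\<mu>\<close>, the radius at least \<open>1/2\<close>,
    and \<open>\<kappa>\<close> small against \<open>\<epsilon> \<mu>\<close>.\<close>
  define \<delta> where "\<delta> = Min {\<epsilon>0, 1, \<delta>1 / (2 * B), \<delta>2 / (2 * K), \<mu> / (8 * K), 1 / (2 * (M + K)), \<mu> / (8 * K\<^sup>2)}"
  have dpos: "\<delta> > 0" unfolding \<delta>_def using e0 d1(1) d2 B K mu(1) M(1)
    by (subst Min_gr_iff) auto
  show ?thesis
  proof (rule that[OF dpos])
    fix \<epsilon> :: real assume e: "0 < \<epsilon>" "\<epsilon> < \<delta>"
    have eb: "\<epsilon> < \<epsilon>0" "\<epsilon> < 1" "\<epsilon> < \<delta>1 / (2 * B)" "\<epsilon> < \<delta>2 / (2 * K)" "\<epsilon> < \<mu> / (8 * K)" "\<epsilon> < 1 / (2 * (M + K))" "\<epsilon> < \<mu> / (8 * K\<^sup>2)"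
      using e(2) unfolding \<delta>_def by (simp_all only: Min_gr_iff finite.intros ball_simps insert_not_empty not_False_eq_True)
    have scale: "\<epsilon> * X < y / n" if "0 < X" "0 < n" "\<epsilon> < y / (n * X)" for X y n :: real
      using that by (simp add: field_simps)
    have eB: "\<epsilon> * B < \<delta>1" "\<epsilon> * K < \<delta>2" "\<epsilon> * K < \<mu> / 4" "\<epsilon> * (M + K) \<le> 1 / 2" "\<epsilon> * K\<^sup>2 < \<mu> / 4"
      using scale[OF B _ eb(3)] scale[OF K _ eb(4)] scale[OF K _ eb(5)] scale[OF add_pos_pos[OF M(1) K] _ eb(6)]
        scale[OF zero_less_power[OF K] _ eb(7)] d1(1) d2 mu(1) by linarith+
    define c where "c = Re (wc (centroid (radial_body (real_harmonic l 1) \<epsilon>)))"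
    define a where "a = c / \<epsilon>"
    define \<kappa> where "\<kappa> = c\<^sup>2"
    define qs where "qs = q - [:a:]"
    have cb: "\<bar>c\<bar> \<le> K * \<epsilon>\<^sup>2" unfolding c_def by (rule shift[OF e(1) eb(1)])
    then have ab: "\<bar>a\<bar> \<le> \<epsilon> * K" using e by (simp add: a_def power2_eq_square field_simps)
    have eK: "\<epsilon> * K \<le> K" using e eb(2) K by simp
    have aK: "\<bar>a\<bar> \<le> K" using ab eK by linarith
    have kb: "\<kappa> / \<epsilon> \<le> \<epsilon> * K\<^sup>2"
    proof -
      have "\<kappa> \<le> (K * \<epsilon>\<^sup>2)\<^sup>2" unfolding \<kappa>_def using cb K by (intro abs_le_square_iff[THEN iffD1]) auto
      also have "\<dots> = \<epsilon> * \<epsilon> * (K\<^sup>2 * (\<epsilon> * \<epsilon>))" by (simp add: power2_eq_square mult_ac)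
      also have "\<dots> \<le> \<epsilon> * \<epsilon> * (K\<^sup>2 * 1)" using e eb(2) K by (intro mult_left_mono) (auto simp: mult_le_one)
      finally show ?thesis using e by (simp add: field_simps)
    qed
    have k0: "0 \<le> \<kappa>" by (simp add: \<kappa>_def)
    have qsb: "\<bar>poly qs z\<bar> \<le> M + K" if "\<bar>z\<bar> \<le> 1" for z using M(2)[OF that] aK by (simp add: qs_def)
    have Rs: "\<bar>\<epsilon> * s * poly qs z\<bar> \<le> \<epsilon> * (M + K)" if "\<bar>s\<bar> \<le> 1" "\<bar>z\<bar> \<le> 1" for s z
    proof -
      have "\<bar>s\<bar> * \<bar>poly qs z\<bar> \<le> 1 * (M + K)" using that qsb[OF that(2)] by (intro mult_mono) auto
      then show ?thesis using e by (simp add: abs_mult mult.assoc)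
    qed
    have Rhalf: "1 / 2 \<le> 1 + \<epsilon> * s * poly qs z" if "\<bar>s\<bar> \<le> 1" "\<bar>z\<bar> \<le> 1" for s z
      using Rs[OF that] eB(4) by linarith
    define F where "F = (\<lambda>\<sigma> z. crit_fun 1 qs \<epsilon> \<kappa> (parallel_height 1 \<sigma> z) z / \<epsilon>)"
    define F' where "F' = (\<lambda>\<sigma> z. crit_fun_slope 1 qs \<epsilon> \<kappa> (parallel_height 1 \<sigma> z) z / (\<epsilon> * (1 - z\<^sup>2)))"
    have az: "\<bar>N z + a * z\<bar> \<le> M + K" "\<bar>N' z + a\<bar> \<le> M + K" if "\<bar>z\<bar> \<le> 1" for z
    proof -
      have "\<bar>a * z\<bar> \<le> K * 1" unfolding abs_mult using aK that K by (intro mult_mono) auto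
      then show "\<bar>N z + a * z\<bar> \<le> M + K" using M(3)[OF that] by linarith
      show "\<bar>N' z + a\<bar> \<le> M + K" using M(4)[OF that] aK by linarith
    qed
    have Fdiff: "\<bar>F \<sigma> z - N z\<bar> < \<delta>1" if sg: "\<sigma> \<in> {1, -1}" and z: "z \<in> {-1..1}" for \<sigma> z
    proof -
      define s where "s = parallel_height 1 \<sigma> z"
      have z1: "\<bar>z\<bar> \<le> 1" using z by auto
      have s: "\<bar>s\<bar> \<le> 1" unfolding s_def by (rule parallel_height_bound[OF sg z1])
      have "F \<sigma> z - N z = \<epsilon> * s * poly qs z * (N z + a * z) + a * z + \<kappa> / \<epsilon> * (s * z)"
        unfolding F_def crit_fun_def s_def[symmetric] qs_def crit_poly_shift N_def[symmetric]
        using e by (simp add: field_simps)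
      then have "\<bar>F \<sigma> z - N z\<bar> \<le> \<bar>\<epsilon> * s * poly qs z\<bar> * \<bar>N z + a * z\<bar> + \<bar>a\<bar> * \<bar>z\<bar> + \<bar>\<kappa> / \<epsilon>\<bar> * (\<bar>s\<bar> * \<bar>z\<bar>)"
        unfolding abs_mult[symmetric] by linarith
      also have "\<bar>\<epsilon> * s * poly qs z\<bar> * \<bar>N z + a * z\<bar> \<le> (\<epsilon> * (M + K)) * (M + K)"
        using Rs[OF s z1] az(1)[OF z1] e M(1) K by (intro mult_mono) auto
      also have "\<bar>a\<bar> * \<bar>z\<bar> \<le> (\<epsilon> * K) * 1" using ab z1 e K by (intro mult_mono) auto
      also have "\<bar>\<kappa> / \<epsilon>\<bar> * (\<bar>s\<bar> * \<bar>z\<bar>) \<le> (\<epsilon> * K\<^sup>2) * (1 * 1)"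
        using kb k0 e s z1 by (intro mult_mono) auto
      finally have "\<bar>F \<sigma> z - N z\<bar> \<le> \<epsilon> * ((M + K)\<^sup>2 + K + K\<^sup>2)" by (simp add: power2_eq_square algebra_simps)
      also have "\<dots> \<le> \<epsilon> * B" using e d1 unfolding B_def by (intro mult_left_mono) auto
      finally show ?thesis using eB(1) by linarith
    qed
    have F'diff: "\<bar>F' \<sigma> z - N' z\<bar> < \<delta>1" if sg: "\<sigma> \<in> {1, -1}" and z: "\<bar>z\<bar> \<le> 1 - a0" for \<sigma> z
    proof -
      define s where "s = parallel_height 1 \<sigma> z"
      define v where "v = 1 - z\<^sup>2"
      have z1: "\<bar>z\<bar> \<le> 1" using z d1 by linarith
      have s: "\<bar>s\<bar> \<le> 1" unfolding s_def by (rule parallel_height_bound[OF sg z1])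
      have v: "a0 \<le> v" "v \<le> 1"
      proof -
        have "\<bar>z\<bar>\<^sup>2 \<le> (1 - a0)\<^sup>2" using z by (intro power_mono) auto
        also have "\<dots> \<le> (1 - a0) * 1" unfolding power2_eq_square using d1 by (intro mult_left_mono) auto
        finally show "a0 \<le> v" by (simp add: v_def)
        show "v \<le> 1" by (simp add: v_def)
      qed
      have v0: "0 < v" using v d1 by linarith
      have iv: "1 / v \<le> 1 / a0" using v d1 by (simp add: frac_le)
      define n where "n = N z + a * z"
      have pp: "(\<epsilon> * (M + K)) * (M + K) = \<epsilon> * (M + K)\<^sup>2" by (simp only: power2_eq_square mult.assoc)
      have "F' \<sigma> z = (\<epsilon> * (\<epsilon> * s * n\<^sup>2 + v * (1 + \<epsilon> * s * poly qs z) * (N' z + a)) + \<kappa> * (v * s - z\<^sup>2 * s)) / (\<epsilon> * v)"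
        unfolding F'_def crit_fun_slope_def s_def[symmetric] qs_def crit_poly_shift N_def[symmetric] N'_def[symmetric] v_def[symmetric] n_def[symmetric]
        by simp
      also have "\<dots> = \<epsilon> * (s * n\<^sup>2 * (1 / v)) + (1 + \<epsilon> * s * poly qs z) * (N' z + a) + \<kappa> / \<epsilon> * (s * (v - z\<^sup>2) * (1 / v))"
        using e v0 by (simp add: field_simps)
      finally have dF: "F' \<sigma> z - N' z = \<epsilon> * (s * n\<^sup>2 * (1 / v)) + \<epsilon> * s * poly qs z * (N' z + a) + a + \<kappa> / \<epsilon> * (s * (v - z\<^sup>2) * (1 / v))"
        by (simp add: algebra_simps)
      then have "\<bar>F' \<sigma> z - N' z\<bar> \<le> \<epsilon> * (\<bar>s\<bar> * n\<^sup>2 * (1 / v)) + \<bar>\<epsilon> * s * poly qs z\<bar> * \<bar>N' z + a\<bar> + \<bar>a\<bar> + \<bar>\<kappa> / \<epsilon>\<bar> * (\<bar>s\<bar> * \<bar>v - z\<^sup>2\<bar> * (1 / v))"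
      proof -
        have tri: "\<bar>x + y + w + t\<bar> \<le> \<bar>x\<bar> + \<bar>y\<bar> + \<bar>w\<bar> + \<bar>t\<bar>" for x y w t :: real by linarith
        have e1: "\<bar>\<epsilon> * (s * n\<^sup>2 * (1 / v))\<bar> = \<epsilon> * (\<bar>s\<bar> * n\<^sup>2 * (1 / v))" using e v0 by (simp add: abs_mult)
        have e2: "\<bar>\<kappa> / \<epsilon> * (s * (v - z\<^sup>2) * (1 / v))\<bar> = \<bar>\<kappa> / \<epsilon>\<bar> * (\<bar>s\<bar> * \<bar>v - z\<^sup>2\<bar> * (1 / v))"
          using v0 by (simp add: abs_mult)
        have e3: "\<bar>\<epsilon> * s * poly qs z * (N' z + a)\<bar> = \<bar>\<epsilon> * s * poly qs z\<bar> * \<bar>N' z + a\<bar>" by (simp only: abs_mult)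
        show ?thesis unfolding dF e1[symmetric] e2[symmetric] e3[symmetric] by (rule tri)
      qed
      also have "\<epsilon> * (\<bar>s\<bar> * n\<^sup>2 * (1 / v)) \<le> \<epsilon> * (1 * (M + K)\<^sup>2 * (1 / a0))"
      proof -
        have "n\<^sup>2 \<le> (M + K)\<^sup>2" using az(1)[OF z1] M(1) K unfolding n_def by (intro abs_le_square_iff[THEN iffD1]) auto
        then show ?thesis using s iv v0 e by (intro mult_left_mono mult_mono) auto
      qed
      also have "\<bar>\<epsilon> * s * poly qs z\<bar> * \<bar>N' z + a\<bar> \<le> (\<epsilon> * (M + K)) * (M + K)"
        using Rs[OF s z1] az(2)[OF z1] e M(1) K by (intro mult_mono) auto
      also have "\<bar>a\<bar> \<le> \<epsilon> * K" by (rule ab)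
      also have "\<bar>\<kappa> / \<epsilon>\<bar> * (\<bar>s\<bar> * \<bar>v - z\<^sup>2\<bar> * (1 / v)) \<le> (\<epsilon> * K\<^sup>2) * (1 * 1 * (1 / a0))"
      proof -
        have "\<bar>v - z\<^sup>2\<bar> \<le> 1" using v v0 zero_le_power2[of z] by (auto simp: v_def abs_le_iff)
        then show ?thesis using kb k0 e s iv v0 by (intro mult_mono) auto
      qed
      finally have "\<bar>F' \<sigma> z - N' z\<bar> \<le> \<epsilon> * ((M + K)\<^sup>2 + K + (M + K)\<^sup>2 / a0 + K\<^sup>2 / a0)"
        unfolding pp by (simp add: distrib_left add_ac)
      also have "\<dots> \<le> \<epsilon> * B" using e unfolding B_def by (intro mult_left_mono) auto
      finally show ?thesis using eB(1) by linarith
    qed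
    have Fc: "continuous_on {-1..1} (F \<sigma>)" for \<sigma>
      unfolding F_def crit_fun_def parallel_height_def by (intro continuous_intros) (use e in auto)
    have "\<exists>\<phi>. bij_betw \<phi> Z {z \<in> {-1..1}. F \<sigma> z = 0} \<and>
        (\<forall>r\<in>Z. \<bar>\<phi> r\<bar> < 1 \<and> \<bar>\<phi> r - r\<bar> < \<eta>0 \<and> sgn (F' \<sigma> (\<phi> r)) = sgn (N' r))" if sg: "\<sigma> \<in> {1, -1}" for \<sigma>
    proof (rule stab, intro conjI ballI allI impI)
      show "continuous_on {-1..1} (F \<sigma>)" by (rule Fc)
      show "\<bar>F \<sigma> z - N z\<bar> < \<delta>1" if "z \<in> {-1..1}" for z by (rule Fdiff[OF sg that])
      show "(F \<sigma> has_real_derivative F' \<sigma> z) (at z)" if "\<bar>z\<bar> \<le> 1 - a0" for z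
      proof -
        have "\<bar>z\<bar> < 1" "\<epsilon> \<noteq> 0" using that d1 e by auto
        then show ?thesis unfolding F_def F'_def by (rule crit_fun_deriv)
      qed
      show "\<bar>F' \<sigma> z - N' z\<bar> < \<delta>1" if "\<bar>z\<bar> \<le> 1 - a0" for z by (rule F'diff[OF sg that])
    qed
    then have "\<forall>\<sigma>\<in>{1,-1}. \<exists>\<phi>. bij_betw \<phi> Z {z \<in> {-1..1}. F \<sigma> z = 0} \<and>
        (\<forall>r\<in>Z. \<bar>\<phi> r\<bar> < 1 \<and> \<bar>\<phi> r - r\<bar> < \<eta>0 \<and> sgn (F' \<sigma> (\<phi> r)) = sgn (N' r))" by blast
    from bchoice[OF this] obtain b where b: "\<forall>\<sigma>\<in>{1,-1}. bij_betw (b \<sigma>) Z {z \<in> {-1..1}. F \<sigma> z = 0} \<and>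
        (\<forall>r\<in>Z. \<bar>b \<sigma> r\<bar> < 1 \<and> \<bar>b \<sigma> r - r\<bar> < \<eta>0 \<and> sgn (F' \<sigma> (b \<sigma> r)) = sgn (N' r))" ..
    have "\<exists>\<phi>. bij_betw \<phi> Zq {z \<in> {-1..1}. poly qs z = 0} \<and>
        (\<forall>r\<in>Zq. \<bar>\<phi> r\<bar> < 1 \<and> \<bar>\<phi> r - r\<bar> < 1 \<and> sgn (poly (pderiv qs) (\<phi> r)) = sgn (poly (pderiv q) r))"
    proof (rule stabq, intro conjI ballI allI impI)
      show "continuous_on {-1..1} (poly qs)" by (intro continuous_intros)
      show "\<bar>poly qs z - poly q z\<bar> < \<delta>2" for z using ab eB(2) by (simp add: qs_def)
      show "(poly qs has_real_derivative poly (pderiv qs) z) (at z)" for z by (rule poly_DERIV)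
      show "\<bar>poly (pderiv qs) z - poly (pderiv q) z\<bar> < \<delta>2" for z using d2 by (simp add: qs_def pderiv_diff pderiv_pCons)
    qed
    then obtain \<phi> where phi: "bij_betw \<phi> Zq {z \<in> {-1..1}. poly qs z = 0}"
      "\<forall>r\<in>Zq. \<bar>\<phi> r\<bar> < 1 \<and> \<bar>\<phi> r - r\<bar> < 1 \<and> sgn (poly (pderiv qs) (\<phi> r)) = sgn (poly (pderiv q) r)" by blast
    have qseq: "{z. \<bar>z\<bar> \<le> 1 \<and> poly qs z = 0} = {z \<in> {-1..1}. poly qs z = 0}" by (auto simp: abs_le_iff)
    have near: "sgn (poly qs (b \<sigma> r)) = sgn (poly q r) \<and> \<mu> / 2 \<le> \<bar>poly qs (b \<sigma> r)\<bar>" if "\<sigma> \<in> {1, -1}" "r \<in> Z" for \<sigma> r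
    proof -
      have "\<bar>b \<sigma> r\<bar> < 1" "\<bar>b \<sigma> r - r\<bar> < \<eta>0" using b that by blast+
      then have "\<bar>poly q (b \<sigma> r) - poly q r\<bar> < \<mu> / 4"
        using eta(2)[of r "b \<sigma> r"] that(2) by (auto simp: Z_def dist_real_def abs_less_iff)
      moreover have "poly qs (b \<sigma> r) = poly q (b \<sigma> r) - a" by (simp add: qs_def)
      ultimately have "\<bar>poly qs (b \<sigma> r) - poly q r\<bar> < \<mu> / 2" using ab eB(3) by linarith
      moreover have "\<mu> \<le> \<bar>poly q r\<bar>" by (rule mu(2)[OF that(2)])
      ultimately have "(0 < poly q r \<and> \<mu> / 2 \<le> poly qs (b \<sigma> r)) \<or> (poly q r < 0 \<and> poly qs (b \<sigma> r) \<le> - \<mu> / 2)"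
        using mu(1) by linarith
      then show ?thesis using mu(1) by (elim disjE) (auto simp: sgn_if)
    qed
    have ksmall: "\<kappa> * \<bar>s\<bar> < (1 + \<epsilon> * s * poly qs z) * \<epsilon> * \<bar>poly qs z\<bar>" if "\<bar>s\<bar> \<le> 1" "\<bar>z\<bar> \<le> 1" "\<mu> / 2 \<le> \<bar>poly qs z\<bar>" for s z
    proof -
      have "\<kappa> * \<bar>s\<bar> \<le> \<kappa> * 1" using that(1) k0 by (intro mult_left_mono) auto
      also have "\<dots> \<le> \<epsilon> * (\<epsilon> * K\<^sup>2)" using kb e by (simp add: field_simps)
      also have "\<dots> < \<epsilon> * (\<mu> / 4)" using eB(5) e by (intro mult_strict_left_mono) auto
      also have "\<dots> = (1 / 2) * \<epsilon> * (\<mu> / 2)" by simp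
      also have "\<dots> \<le> (1 + \<epsilon> * s * poly qs z) * \<epsilon> * \<bar>poly qs z\<bar>"
        using Rhalf[OF that(1,2)] e that(3) mu(1) by (intro mult_mono) auto
      finally show ?thesis .
    qed
    have "zonal_body_roots 1 qs \<epsilon> \<kappa> (c\<^sup>2) (centroid_dist2 (real_harmonic l 1) \<epsilon>) (l - 1) Z b (\<lambda>r. sgn (poly q r))"
    proof (unfold_locales)
      have pos': "0 < 1 + \<epsilon> * real_harmonic l 1 u" if "u \<in> S2" for u using pos[OF e(1) eb(1) that] by linarith
      have Sh1: "\<bar>Sh 1 u\<bar> \<le> 1" "\<bar>u $ 3\<bar> \<le> 1" if "u \<in> S2" for u
      proof -
        show "\<bar>u $ 3\<bar> \<le> 1" by (rule S2_third(1)[OF that])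
        have "\<bar>u $ 1\<bar> \<le> 1" using component_le_norm_cart[of u 1] that by simp
        then show "\<bar>Sh 1 u\<bar> \<le> 1" by (simp add: Sh_def wc_def)
      qed
      show "(1::nat) \<le> 1" ..
      show "centroid_dist2 (real_harmonic l 1) \<epsilon> u = (1 + \<epsilon> * Sh 1 u * poly qs (u $ 3))\<^sup>2 - \<kappa> * (Sh 1 u)\<^sup>2 + c\<^sup>2"
        if u: "u \<in> S2" for u
      proof -
        have "\<epsilon> * Sh 1 u * poly qs (u $ 3) = \<epsilon> * (Sh 1 u * poly q (u $ 3)) - c * Sh 1 u"
          using e by (simp add: qs_def a_def field_simps)
        moreover have "centroid_dist2 (real_harmonic l 1) \<epsilon> u = (1 + \<epsilon> * (Sh 1 u * poly q (u $ 3)))\<^sup>2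
          - 2 * (1 + \<epsilon> * (Sh 1 u * poly q (u $ 3))) * (c * Sh 1 u) + c\<^sup>2"
          using centroid_dist2_expand[OF order_refl l1 pos' u] by (simp add: c_def q_def harmonic_factor_def)
        moreover have "(1 + X)\<^sup>2 - 2 * (1 + X) * Y + c\<^sup>2 = (1 + (X - Y))\<^sup>2 - Y\<^sup>2 + c\<^sup>2" for X Y :: real
          by (simp add: power2_eq_square algebra_simps)
        ultimately show ?thesis by (simp add: \<kappa>_def power_mult_distrib)
      qed
      show "0 < \<epsilon>" by (rule e(1))
      show "\<kappa> = 0" if "(2::nat) \<le> 1" using that by simp
      show "0 < 1 + \<epsilon> * Sh 1 u * poly qs (u $ 3)" if "u \<in> S2" for u using Rhalf[OF Sh1[OF that]] by linarith
      show "finite {z. \<bar>z\<bar> \<le> 1 \<and> poly qs z = 0}" unfolding qseq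
        using bij_betw_finite[OF phi(1)] H(1) Zq by simp
      show "card {z. \<bar>z\<bar> \<le> 1 \<and> poly qs z = 0} = l - 1" unfolding qseq
        using bij_betw_same_card[OF phi(1)] H(2) Zq by simp
      show "\<bar>z\<bar> < 1 \<and> poly (pderiv qs) z \<noteq> 0" if "\<bar>z\<bar> \<le> 1" "poly qs z = 0" for z
      proof -
        have "z \<in> \<phi> ` Zq" using phi(1) that qseq by (auto simp: bij_betw_def)
        then obtain r where r: "r \<in> Zq" "z = \<phi> r" by blast
        then have "\<bar>z\<bar> < 1" "sgn (poly (pderiv qs) z) = sgn (poly (pderiv q) r)" using phi(2) by blast+
        moreover have "poly (pderiv q) r \<noteq> 0" using H(4) r(1) Zq by blast
        ultimately show ?thesis by (auto simp: sgn_if split: if_splits)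
      qed
      show "(1 + \<epsilon> * Sh 1 u * poly qs (u $ 3)) * \<epsilon> * poly qs (u $ 3) \<noteq> \<kappa> * Sh 1 u"
        if u: "u \<in> S2" and d: "poly (pderiv qs) (u $ 3) = 0" for u
      proof
        assume eq: "(1 + \<epsilon> * Sh 1 u * poly qs (u $ 3)) * \<epsilon> * poly qs (u $ 3) = \<kappa> * Sh 1 u"
        have "poly (pderiv q) (u $ 3) = 0" using d by (simp add: qs_def pderiv_diff pderiv_pCons)
        then have "\<mu> \<le> \<bar>poly q (u $ 3)\<bar>" by (rule mu(3)[OF Sh1(2)[OF u]])
        moreover have "poly qs (u $ 3) = poly q (u $ 3) - a" by (simp add: qs_def)
        ultimately have "\<mu> / 2 \<le> \<bar>poly qs (u $ 3)\<bar>" using ab eB(3) mu(1) by linarith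
        from ksmall[OF Sh1[OF u] this] Rhalf[OF Sh1[OF u]] arg_cong[OF eq, of abs]
        show False using e k0 by (simp add: abs_mult)
      qed
      show "finite Z" by (rule finZ)
      show "card Z = l - 1 + 1" by (rule cardZ)
      show "bij_betw (b \<sigma>) Z {z. \<bar>z\<bar> < 1 \<and> crit_fun 1 qs \<epsilon> \<kappa> (parallel_height 1 \<sigma> z) z = 0}" if sg: "\<sigma> \<in> {1, -1}" for \<sigma>
      proof -
        have bb: "bij_betw (b \<sigma>) Z {z \<in> {-1..1}. F \<sigma> z = 0}" "\<forall>r\<in>Z. \<bar>b \<sigma> r\<bar> < 1" using b sg by blast+
        have "{z. \<bar>z\<bar> < 1 \<and> crit_fun 1 qs \<epsilon> \<kappa> (parallel_height 1 \<sigma> z) z = 0} = {z \<in> {-1..1}. F \<sigma> z = 0}"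
        proof (intro equalityI subsetI)
          fix z assume "z \<in> {z. \<bar>z\<bar> < 1 \<and> crit_fun 1 qs \<epsilon> \<kappa> (parallel_height 1 \<sigma> z) z = 0}"
          then show "z \<in> {z \<in> {-1..1}. F \<sigma> z = 0}" by (auto simp: F_def)
        next
          fix z assume z: "z \<in> {z \<in> {-1..1}. F \<sigma> z = 0}"
          then have "z \<in> b \<sigma> ` Z" using bb(1) by (auto simp: bij_betw_def)
          then have "\<bar>z\<bar> < 1" using bb(2) by blast
          then show "z \<in> {z. \<bar>z\<bar> < 1 \<and> crit_fun 1 qs \<epsilon> \<kappa> (parallel_height 1 \<sigma> z) z = 0}" using z e by (simp add: F_def)
        qed
        then show ?thesis using bb(1) by simp
      qed
      show "sgn (poly q r) \<in> {1, -1}" if "r \<in> Z" for r using sgnZ[OF that] by (auto simp: sgn_if)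
      show "sgn ((1 + \<epsilon> * s * poly qs z) * \<epsilon> * poly qs z - \<kappa> * s) = sgn (poly q r)"
        if r: "r \<in> Z" and sg: "\<sigma> \<in> {1, -1}" and z: "z = b \<sigma> r" and s: "s = parallel_height 1 \<sigma> z" for r \<sigma> z s
      proof -
        have "\<bar>z\<bar> < 1" using b sg r z by blast
        then have z1: "\<bar>z\<bar> \<le> 1" by simp
        have s1: "\<bar>s\<bar> \<le> 1" unfolding s by (rule parallel_height_bound[OF sg z1])
        have n: "sgn (poly qs z) = sgn (poly q r)" "\<mu> / 2 \<le> \<bar>poly qs z\<bar>" using near[OF sg r] z by auto
        define X where "X = (1 + \<epsilon> * s * poly qs z) * \<epsilon>"
        have X: "0 < X" unfolding X_def using Rhalf[OF s1 z1] e by (intro mult_pos_pos) auto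
        have "\<kappa> * \<bar>s\<bar> < X * \<bar>poly qs z\<bar>" unfolding X_def by (rule ksmall[OF s1 z1 n(2)])
        then have "\<bar>\<kappa> * s\<bar> < \<bar>X * poly qs z\<bar>" using k0 X by (simp add: abs_mult)
        then have "sgn (X * poly qs z - \<kappa> * s) = sgn (X * poly qs z)" by (auto simp: sgn_if)
        also have "\<dots> = sgn (poly q r)" using X n(1) by (simp add: sgn_mult)
        finally show ?thesis unfolding X_def .
      qed
      show "sgn (crit_fun_slope 1 qs \<epsilon> \<kappa> (parallel_height 1 \<sigma> z) z) = - sgn (poly q r)"
        if r: "r \<in> Z" and sg: "\<sigma> \<in> {1, -1}" and z: "z = b \<sigma> r" for r \<sigma> z
      proof -
        have z1: "\<bar>z\<bar> < 1" "sgn (F' \<sigma> z) = sgn (N' r)" using b sg r z by blast+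
        have "0 < \<epsilon> * (1 - z\<^sup>2)" using e z1(1) by (simp add: abs_square_less_1)
        then have "sgn (crit_fun_slope 1 qs \<epsilon> \<kappa> (parallel_height 1 \<sigma> z) z) = sgn (F' \<sigma> z)"
          unfolding F'_def by (simp add: sgn_divide)
        also have "\<dots> = - sgn (poly q r)" unfolding z1(2) using sgnZ[OF r] by (auto simp: sgn_if mult_less_0_iff)
        finally show ?thesis .
      qed
    qed
    then show "\<exists>q \<kappa> C Z b \<eta>. zonal_body_roots 1 q \<epsilon> \<kappa> C (centroid_dist2 (real_harmonic l 1) \<epsilon>) (l - 1) Z b \<eta>" by blast
  qed
qed

section \<open>Counting equilibria and indices\<close>

lemma ph_index_sum:
  assumes "\<And>u. u \<in> A \<Longrightarrow> has_ph_index V u k"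
  shows "(\<Sum>u\<in>A. ph_index V u) = int (card A) * k"
  using ph_index_eq[OF assms] by simp

text \<open>Both cases supply an instance of \<open>zonal_body_roots\<close> with \<open>d = l - m\<close>; the counts and the sums of
  indices are then read off from its list of critical points.\<close>

theorem theorem1:
  fixes l m :: nat
  assumes "2 \<le> l" and "1 \<le> m" and "m \<le> l"
  shows "\<exists>\<delta>>0. \<forall>\<epsilon>.
    (2 \<le> m \<and> \<epsilon> \<in> convex_range (real_harmonic l m)) \<or> (m = 1 \<and> 0 < \<epsilon> \<and> \<epsilon> < \<delta>) \<longrightarrow>
    (let \<rho> = centroid_dist2 (real_harmonic l m) \<epsilon>;
         S = stable_points \<rho>;
         U = unstable_points \<rho>;
         A = saddle_type_points \<rho> - poles;
         ind = ph_index (sphere_grad \<rho>)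
     in card S = m * (l - m + 1) \<and> card U = m * (l - m + 1) \<and>
        finite A \<and> card A = 2 * m * (l - m) \<and> (\<forall>u\<in>A. ordinary_saddle \<rho> u) \<and>
        (2 \<le> m \<longrightarrow> poles \<subseteq> saddle_type_points \<rho> \<and>
          (\<forall>p\<in>poles. has_ph_index (sphere_grad \<rho>) p (1 - int m) \<and>
            (m = 2 \<longrightarrow> ordinary_saddle \<rho> p) \<and> (3 \<le> m \<longrightarrow> monkey_saddle m \<rho> p))) \<and>
        (m = 1 \<longrightarrow> poles \<inter> critical_points \<rho> = {}) \<and>
        (\<forall>u\<in>S \<union> U. has_ph_index (sphere_grad \<rho>) u 1) \<and>
        (\<Sum>u\<in>S \<union> U. ind u) = 2 * int m * (int l - int m + 1) \<and>
        (\<Sum>u\<in>A. ind u) = - (2 * int m * (int l - int m)) \<and>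
        (\<Sum>u\<in>critical_points \<rho> \<inter> poles. ind u) = 2 * (1 - int m) \<and>
        (\<Sum>u\<in>critical_points \<rho>. ind u) = 2 \<and>
        2 * int m * (int l - int m + 1) - 2 * int m * (int l - int m) + 2 * (1 - int m) = 2 \<and>
        euler_characteristic (top_of_set S2) = 2)"
proof -
  \<comment> \<open>The bound for order 1 is a witness for every \<open>m\<close>, since \<open>\<delta>\<close> restricts \<open>\<epsilon>\<close> only for \<open>m = 1\<close>.\<close>
  have "\<exists>\<delta>>0. m = 1 \<longrightarrow> (\<forall>\<epsilon>. 0 < \<epsilon> \<longrightarrow> \<epsilon> < \<delta> \<longrightarrow>
    (\<exists>q \<kappa> C Z b \<eta>. zonal_body_roots 1 q \<epsilon> \<kappa> C (centroid_dist2 (real_harmonic l 1) \<epsilon>) (l - 1) Z b \<eta>))"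
    by (rule zonal_body_roots_first_order[OF assms(1)]) blast
  then obtain \<delta> :: real where \<delta>: "0 < \<delta>" "m = 1 \<longrightarrow> (\<forall>\<epsilon>. 0 < \<epsilon> \<longrightarrow> \<epsilon> < \<delta> \<longrightarrow>
    (\<exists>q \<kappa> C Z b \<eta>. zonal_body_roots 1 q \<epsilon> \<kappa> C (centroid_dist2 (real_harmonic l 1) \<epsilon>) (l - 1) Z b \<eta>))"
    by blast
  show ?thesis
  proof (intro exI[of _ \<delta>] conjI allI impI \<delta>(1), goal_cases)
    case (1 \<epsilon>)
    define \<rho> where "\<rho> = centroid_dist2 (real_harmonic l m) \<epsilon>"
    have "\<exists>q \<kappa> C Z b \<eta>. zonal_body_roots m q \<epsilon> \<kappa> C \<rho> (l - m) Z b \<eta>"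
      using 1
    proof
      assume "m = 1 \<and> 0 < \<epsilon> \<and> \<epsilon> < \<delta>"
      then show ?thesis using \<delta>(2) unfolding \<rho>_def by simp
    next
      assume c: "2 \<le> m \<and> \<epsilon> \<in> convex_range (real_harmonic l m)"
      then have "0 < \<epsilon>" "\<And>u. u \<in> S2 \<Longrightarrow> 0 < 1 + \<epsilon> * real_harmonic l m u"
        by (simp_all add: convex_range_def)
      from zonal_body_roots_higher_order[OF _ assms(3) this] c show ?thesis unfolding \<rho>_def by blast
    qed
    then obtain q \<kappa> C Z b \<eta> where zbr: "zonal_body_roots m q \<epsilon> \<kappa> C \<rho> (l - m) Z b \<eta>" by blast
    define E1 E2 A where "E1 = zonal_body_roots.extrema m Z b \<eta> 1" and "E2 = zonal_body_roots.extrema m Z b \<eta> (- 1)"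
      and "A = zonal_body_roots.saddles m q"
    note zr = zonal_body_roots.equilibria[OF zbr, folded E1_def E2_def A_def]
    have cards: "finite E1" "card E1 = m * (l - m + 1)" "finite E2" "card E2 = m * (l - m + 1)"
      "finite A" "card A = 2 * m * (l - m)"
      using zonal_body_roots.card_extrema[OF zbr, of 1] zonal_body_roots.card_extrema[OF zbr, of "-1"]
        zonal_body_roots.card_saddles[OF zbr] unfolding E1_def E2_def A_def by simp_all
    have ext: "has_ph_index (sphere_grad \<rho>) u 1" if "u \<in> E1 \<union> E2" for u
      using zonal_body_roots.minima_type(1)[OF zbr, of u] zonal_body_roots.maxima_type(1)[OF zbr, of u] that
      unfolding E1_def E2_def by blast
    have disj: "E1 \<inter> E2 = {}"
      using zonal_body_roots.minima_type(2)[OF zbr] zonal_body_roots.maxima_type(2)[OF zbr]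
      unfolding E1_def E2_def by blast
    have sad: "ordinary_saddle \<rho> u" "u \<in> saddle_type_points \<rho>" "u \<notin> poles" if "u \<in> A" for u
      by (rule zonal_body_roots.saddles_type[OF zbr that[unfolded A_def]])+
    have fin: "finite (critical_points \<rho>)" by (rule zonal_body_roots.finite_critical[OF zbr])
    have zb: "zonal_body m q \<epsilon> \<kappa> C \<rho>" by (rule zonal_body_roots.axioms(1)[OF zbr])
    have pole: "p \<in> saddle_type_points \<rho>" "has_ph_index (sphere_grad \<rho>) p (1 - int m)"
        "m = 2 \<longrightarrow> ordinary_saddle \<rho> p" "3 \<le> m \<longrightarrow> monkey_saddle m \<rho> p" if "2 \<le> m" "p \<in> poles" for p
      using zonal_body_roots.pole_saddle_type[OF zbr that(2,1)] zonal_body_roots.pole_index[OF zbr that(2,1) fin]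
        zonal_body_roots.pole_ordinary_saddle[OF zbr that(2) _ fin] zonal_body_roots.pole_monkey[OF zbr that(2)]
      by blast+
    have reg: "poles \<inter> critical_points \<rho> = {}" if "m = 1"
      using zonal_body_roots.pole_regular[OF zbr _ that] by blast
    have lm: "int (l - m) = int l - int m" using assms(3) by (rule of_nat_diff)
    have "(\<Sum>u\<in>E1 \<union> E2. ph_index (sphere_grad \<rho>) u) = int (card (E1 \<union> E2)) * 1"
      by (rule ph_index_sum) (rule ext)
    also have "\<dots> = 2 * int m * (int l - int m + 1)"
      unfolding card_Un_disjoint[OF cards(1,3) disj] cards(2,4) of_nat_add of_nat_mult lm of_nat_1
      by (simp add: algebra_simps)
    finally have si: "(\<Sum>u\<in>E1 \<union> E2. ph_index (sphere_grad \<rho>) u) = 2 * int m * (int l - int m + 1)" .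
    have "has_ph_index (sphere_grad \<rho>) u (- 1)" if "u \<in> A" for u
      using sad(1)[OF that] by (simp add: ordinary_saddle_def)
    then have sA: "(\<Sum>u\<in>A. ph_index (sphere_grad \<rho>) u) = - (2 * int m * (int l - int m))"
      using ph_index_sum[of A "sphere_grad \<rho>" "- 1"] unfolding cards(6) of_nat_mult lm by simp
    have two: "card poles = 2"
      by (simp add: poles_def north_pole_def south_pole_def axis_def vec_eq_iff exI[of _ 3])
    have sp: "(\<Sum>u\<in>critical_points \<rho> \<inter> poles. ph_index (sphere_grad \<rho>) u) = 2 * (1 - int m)"
    proof (cases "m = 1")
      case True then show ?thesis using reg by (simp add: Int_commute)
    next
      case False
      then have m2: "2 \<le> m" using assms(2) by simp
      then have "critical_points \<rho> \<inter> poles = poles" using pole(1) by (auto simp: saddle_type_points_def)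
      then show ?thesis using ph_index_sum[of poles, OF pole(2)[OF m2]] two by simp
    qed
    \<comment> \<open>The total index is the sum over extrema, saddles off the poles, and critical poles.\<close>
    have dec: "critical_points \<rho> = (E1 \<union> E2) \<union> (A \<union> (critical_points \<rho> \<inter> poles))"
      unfolding zr[symmetric] by (auto simp: saddle_type_points_def stable_points_def unstable_points_def)
    have d1: "A \<inter> (critical_points \<rho> \<inter> poles) = {}" using sad(3) by blast
    have d2: "(E1 \<union> E2) \<inter> (A \<union> (critical_points \<rho> \<inter> poles)) = {}"
    proof -
      have "u \<in> saddle_type_points \<rho>" if "u \<in> critical_points \<rho> \<inter> poles" for u
        using pole(1)[of u] reg that assms(2) by (cases "m = 1") auto
      then show ?thesis using sad(2) unfolding zr(1,2)[symmetric] by (auto simp: saddle_type_points_def)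
    qed
    have fp: "finite (critical_points \<rho> \<inter> poles)" using fin by simp
    have "(\<Sum>u\<in>critical_points \<rho>. ph_index (sphere_grad \<rho>) u)
      = 2 * int m * (int l - int m + 1) + (- (2 * int m * (int l - int m)) + 2 * (1 - int m))"
      by (subst dec) (use cards fp d1 d2 si sA sp in \<open>simp add: sum.union_disjoint\<close>)
    then have sum: "(\<Sum>u\<in>critical_points \<rho>. ph_index (sphere_grad \<rho>) u) = 2" by (simp add: algebra_simps)
    have arith: "2 * int m * (int l - int m + 1) - 2 * int m * (int l - int m) + 2 * (1 - int m) = 2"
      by (simp add: algebra_simps)
    show ?case
      unfolding \<rho>_def[symmetric] Let_def zr
      using cards(2,4,5,6) sad(1) pole reg ext si sA sp sum arith euler_characteristic_S2 by blast
  qed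
qed

end
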